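(* Let $\mathcal C$ be an extensive category and $\mathcal E$ a locally connected Grothendieck topos. The category $\mathsf{FC}(\mathcal C,\mathcal E)$ of finite-coproduct-preserving functors $\mathcal C\to\mathcal E$ (and natural transformations) is equivalent to the functor category $[\mathcal{UF}_{\mathcal C},\mathcal E]$, via an equivalence whose two directions are given as follows. A functor $A\in\mathsf{FC}(\mathcal C,\mathcal E)$ is sent to $\tilde A\colon\mathcal{UF}_{\mathcal C}\to\mathcal E$ with $$\tilde A(X,\mathcal U)\cong\bigcap_{U\in\mathcal U}AU\subseteq AX$$ (and action on morphisms induced by that of $A$); and a functor $B\colon\mathcal{UF}_{\mathcal C}\to\mathcal E$ is sent to $\int B\colon\mathcal C\to\mathcal E$ with $$\Big(\int B\Big)Y=\sum_{\mathcal V\in\beta Y}B(Y,\mathcal V),$$ where for $f\colon Y\to Z$ the map $(\int B)f$ sends the $\mathcal V$-summand to the $f_!(\mathcal V)$-summand via $B([f])$.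
   Context: A category $\mathcal C$ with finite coproducts is extensive if for all $A,B\in\mathcal C$ the functor $+\colon\mathcal C/A\times\mathcal C/B\to\mathcal C/(A+B)$ is an equivalence of categories. In such a category, coproduct coprojections are monic, and pullbacks along them exist and are again coproduct coprojections. A Grothendieck topos $\mathcal E$ is a locally small category equivalent to sheaves on a small site. It is locally connected if the left adjoint $\Delta\colon\mathbf{Set}\to\mathcal E$ (sending $X$ to $\sum_{x\in X}1$) of $\Gamma=\mathcal E(1,-)\colon\mathcal E\to\mathbf{Set}$ has a further left adjoint $\pi_0\colon\mathcal E\to\mathbf{Set}$. $\mathrm{Sum}_{\mathcal C}(X)$ is the poset of isomorphism classes of coproduct coprojections with codomain $X$; it is a Boolean algebra, and for $f\colon X\to Y$ pullback gives a Boolean algebra homomorphism $f^{-1}\colon\mathrm{Sum}_{\mathcal C}(Y)\to\mathrm{Sum}_{\mathcal C}(X)$. An ultrafilter on $X\in\mathcal C$ is an ultrafilter of the Boolean algebra $\mathrm{Sum}_{\mathcal C}(X)$; $\beta X$ is the set of these. For $f\colon X\to Y$ and $\mathcal U\in\beta X$, $f_!(\mathcal U)=\{V\in\mathrm{Sum}_{\mathcal C}(Y):f^{-1}(V)\in\mathcal U\}\in\beta Y$. The category $\mathcal{UF}_{\mathcal C}$ has as objects pairs $(X,\mathcal U)$ with $X\in\mathcal C$, $\mathcal U\in\beta X$. A map $f\colon U\to Y$ defined on the domain of some $U\rightarrowtail X$ in $\mathcal U$ (a partial map $X\rightharpoonup Y$) is continuous $(X,\mathcal U)\rightharpoonup(Y,\mathcal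 V)$ if for all $V\in\mathrm{Sum}_{\mathcal C}(Y)$: $V\in\mathcal V$ iff the composite $f^{-1}(V)\rightarrowtail U\rightarrowtail X$ is in $\mathcal U$. Two partial maps defined on $U$, $U'$ are $=_{\mathcal U}$-equivalent if their restrictions to some $W\subseteq U\cap U'$ in $\mathcal U$ coincide. Morphisms $(X,\mathcal U)\to(Y,\mathcal V)$ are $=_{\mathcal U}$-equivalence classes $[f]$ of partial continuous maps defined on the domain of some element of $\mathcal U$. A finite-coproduct-preserving $A\colon\mathcal C\to\mathcal E$ sends coproduct coprojections to monomorphisms, so each $U\rightarrowtail X$ in $\mathcal U$ yields a subobject $AU\subseteq AX$; the intersection is taken in the subobject lattice of $AX$. For a morphism represented by a continuous $f\colon U\to Y$, the map $\tilde A([f])\colon\tilde A(X,\mathcal U)\to\tilde A(Y,\mathcal V)$ is the factorisation of $\tilde A(X,\mathcal U)\subseteq AU\xrightarrow{Af}AY$ through $\tilde A(Y,\mathcal V)\subseteq AY$. *)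

theory Defs
  imports "HOL-Library.Equipollence" "HOL-Library.FuncSet"
begin

section \<open>Categories, functors, natural transformations\<close>

record ('o, 'a) cat =
  Obj :: "'o set"
  Arr :: "'a set"
  src :: "'a \<Rightarrow> 'o"
  tgt :: "'a \<Rightarrow> 'o"
  ident :: "'o \<Rightarrow> 'a"
  compo :: "'a \<Rightarrow> 'a \<Rightarrow> 'a" (infixl "\<cdot>\<index>" 70)

definition hom :: "('o, 'a) cat \<Rightarrow> 'o \<Rightarrow> 'o \<Rightarrow> 'a set" where
  "hom C x y = {f \<in> Arr C. src C f = x \<and> tgt C f = y}"

definition category :: "('o, 'a) cat \<Rightarrow> bool" where
  "category C \<longleftrightarrow>
     (\<forall>f\<in>Arr C. src C f \<in> Obj C \<and> tgt C f \<in> Obj C) \<and>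
     (\<forall>x\<in>Obj C. ident C x \<in> hom C x x) \<and>
     (\<forall>f\<in>Arr C. \<forall>g\<in>Arr C. tgt C f = src C g \<longrightarrow>
        g \<cdot>\<^bsub>C\<^esub> f \<in> hom C (src C f) (tgt C g)) \<and>
     (\<forall>f\<in>Arr C. f \<cdot>\<^bsub>C\<^esub> ident C (src C f) = f \<and> ident C (tgt C f) \<cdot>\<^bsub>C\<^esub> f = f) \<and>
     (\<forall>f\<in>Arr C. \<forall>g\<in>Arr C. \<forall>h\<in>Arr C. tgt C f = src C g \<and> tgt C g = src C h \<longrightarrow>
        (h \<cdot>\<^bsub>C\<^esub> g) \<cdot>\<^bsub>C\<^esub> f = h \<cdot>\<^bsub>C\<^esub> (g \<cdot>\<^bsub>C\<^esub> f))"

text \<open>Functors and natural transformations are extensional functions (value \<^const>\<open>undefined\<close>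
  off the objects and arrows), so that equality in HOL is equality of functors.\<close>

record ('o, 'a, 'p, 'b) fctr =
  fobj :: "'o \<Rightarrow> 'p"
  fmap :: "'a \<Rightarrow> 'b"

definition is_functor ::
  "('o, 'a) cat \<Rightarrow> ('p, 'b) cat \<Rightarrow> ('o, 'a, 'p, 'b) fctr \<Rightarrow> bool" where
  "is_functor A B F \<longleftrightarrow> category A \<and> category B \<and>
     fobj F \<in> Obj A \<rightarrow>\<^sub>E Obj B \<and>
     fmap F \<in> Arr A \<rightarrow>\<^sub>E Arr B \<and>
     (\<forall>f\<in>Arr A. fmap F f \<in> hom B (fobj F (src A f)) (fobj F (tgt A f))) \<and>
     (\<forall>x\<in>Obj A. fmap F (ident A x) = ident B (fobj F x)) \<and>
     (\<forall>f\<in>Arr A. \<forall>g\<in>Arr A. tgt A f = src A g \<longrightarrow>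
        fmap F (g \<cdot>\<^bsub>A\<^esub> f) = fmap F g \<cdot>\<^bsub>B\<^esub> fmap F f)"

definition id_functor :: "('o, 'a) cat \<Rightarrow> ('o, 'a, 'o, 'a) fctr" where
  "id_functor A = \<lparr> fobj = restrict (\<lambda>x. x) (Obj A), fmap = restrict (\<lambda>f. f) (Arr A) \<rparr>"

definition comp_functor ::
  "('o, 'a) cat \<Rightarrow> ('p, 'b, 'q, 'c) fctr \<Rightarrow> ('o, 'a, 'p, 'b) fctr \<Rightarrow> ('o, 'a, 'q, 'c) fctr" where
  "comp_functor A G F =
     \<lparr> fobj = restrict (\<lambda>x. fobj G (fobj F x)) (Obj A),
       fmap = restrict (\<lambda>f. fmap G (fmap F f)) (Arr A) \<rparr>"

type_synonym ('o, 'a, 'p, 'b) nt =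
  "('o, 'a, 'p, 'b) fctr \<times> ('o \<Rightarrow> 'b) \<times> ('o, 'a, 'p, 'b) fctr"

definition nat_trans ::
  "('o, 'a) cat \<Rightarrow> ('p, 'b) cat \<Rightarrow> ('o, 'a, 'p, 'b) fctr \<Rightarrow> ('o, 'a, 'p, 'b) fctr \<Rightarrow> ('o \<Rightarrow> 'b) \<Rightarrow> bool"
  where
  "nat_trans A B F G \<tau> \<longleftrightarrow> \<tau> \<in> extensional (Obj A) \<and>
     (\<forall>x\<in>Obj A. \<tau> x \<in> hom B (fobj F x) (fobj G x)) \<and>
     (\<forall>f\<in>Arr A. \<tau> (tgt A f) \<cdot>\<^bsub>B\<^esub> fmap F f = fmap G f \<cdot>\<^bsub>B\<^esub> \<tau> (src A f))"

definition functor_cat ::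
  "('o, 'a) cat \<Rightarrow> ('p, 'b) cat \<Rightarrow>
   (('o, 'a, 'p, 'b) fctr, ('o, 'a, 'p, 'b) nt) cat" where
  "functor_cat A B =
     \<lparr> Obj = {F. is_functor A B F},
       Arr = {(F, \<tau>, G). is_functor A B F \<and> is_functor A B G \<and> nat_trans A B F G \<tau>},
       src = (\<lambda>(F, \<tau>, G). F),
       tgt = (\<lambda>(F, \<tau>, G). G),
       ident = (\<lambda>F. (F, restrict (\<lambda>x. ident B (fobj F x)) (Obj A), F)),
       compo = (\<lambda>(G, \<sigma>, H) (F, \<tau>, _). (F, restrict (\<lambda>x. \<sigma> x \<cdot>\<^bsub>B\<^esub> \<tau> x) (Obj A), H)) \<rparr>"

definition full_subcat :: "('o, 'a) cat \<Rightarrow> ('o \<Rightarrow> bool) \<Rightarrow> ('o, 'a) cat" where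
  "full_subcat C P =
     C \<lparr> Obj := {x \<in> Obj C. P x}, Arr := {f \<in> Arr C. P (src C f) \<and> P (tgt C f)} \<rparr>"

definition op_cat :: "('o, 'a) cat \<Rightarrow> ('o, 'a) cat" where
  "op_cat C =
     \<lparr> Obj = Obj C, Arr = Arr C, src = tgt C, tgt = src C, ident = ident C,
       compo = (\<lambda>g f. f \<cdot>\<^bsub>C\<^esub> g) \<rparr>"

definition prod_cat :: "('o, 'a) cat \<Rightarrow> ('p, 'b) cat \<Rightarrow> ('o \<times> 'p, 'a \<times> 'b) cat" where
  "prod_cat C D =
     \<lparr> Obj = Obj C \<times> Obj D, Arr = Arr C \<times> Arr D,
       src = map_prod (src C) (src D), tgt = map_prod (tgt C) (tgt D),
       ident = map_prod (ident C) (ident D),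
       compo = (\<lambda>(g, g') (f, f'). (g \<cdot>\<^bsub>C\<^esub> f, g' \<cdot>\<^bsub>D\<^esub> f')) \<rparr>"

definition slice_cat :: "('o, 'a) cat \<Rightarrow> 'o \<Rightarrow> ('a, 'a \<times> 'a \<times> 'a) cat" where
  "slice_cat C x =
     \<lparr> Obj = {f \<in> Arr C. tgt C f = x},
       Arr = {(f, h, g). f \<in> Arr C \<and> g \<in> Arr C \<and> tgt C f = x \<and> tgt C g = x \<and>
                h \<in> hom C (src C f) (src C g) \<and> g \<cdot>\<^bsub>C\<^esub> h = f},
       src = (\<lambda>(f, h, g). f),
       tgt = (\<lambda>(f, h, g). g),
       ident = (\<lambda>f. (f, ident C (src C f), f)),
       compo = (\<lambda>(_, k, e) (f, h, _). (f, k \<cdot>\<^bsub>C\<^esub> h, e)) \<rparr>"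

definition is_iso :: "('o, 'a) cat \<Rightarrow> 'a \<Rightarrow> bool" where
  "is_iso C f \<longleftrightarrow> f \<in> Arr C \<and>
     (\<exists>g\<in>hom C (tgt C f) (src C f).
        g \<cdot>\<^bsub>C\<^esub> f = ident C (src C f) \<and> f \<cdot>\<^bsub>C\<^esub> g = ident C (tgt C f))"

definition naturally_isomorphic ::
  "('o, 'a) cat \<Rightarrow> ('p, 'b) cat \<Rightarrow> ('o, 'a, 'p, 'b) fctr \<Rightarrow> ('o, 'a, 'p, 'b) fctr \<Rightarrow> bool" where
  "naturally_isomorphic A B F G \<longleftrightarrow>
     (\<exists>\<tau>. nat_trans A B F G \<tau> \<and> (\<forall>x\<in>Obj A. is_iso B (\<tau> x)))"

definition equivalence ::
  "('o, 'a) cat \<Rightarrow> ('p, 'b) cat \<Rightarrow> ('o, 'a, 'p, 'b) fctr \<Rightarrow> ('p, 'b, 'o, 'a) fctr \<Rightarrow> bool" where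
  "equivalence A B F G \<longleftrightarrow> is_functor A B F \<and> is_functor B A G \<and>
     naturally_isomorphic A A (id_functor A) (comp_functor A G F) \<and>
     naturally_isomorphic B B (comp_functor B F G) (id_functor B)"

definition adjunction ::
  "('o, 'a) cat \<Rightarrow> ('p, 'b) cat \<Rightarrow> ('o, 'a, 'p, 'b) fctr \<Rightarrow> ('p, 'b, 'o, 'a) fctr \<Rightarrow> bool" where
  "adjunction A B F G \<longleftrightarrow> is_functor A B F \<and> is_functor B A G \<and>
     (\<exists>\<phi>. (\<forall>a\<in>Obj A. \<forall>b\<in>Obj B.
              bij_betw (\<phi> a b) (hom B (fobj F a) b) (hom A a (fobj G b))) \<and>
           (\<forall>k\<in>Arr A. \<forall>h\<in>Arr B. \<forall>f\<in>hom B (fobj F (tgt A k)) (src B h).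
              \<phi> (src A k) (tgt B h) (h \<cdot>\<^bsub>B\<^esub> (f \<cdot>\<^bsub>B\<^esub> fmap F k)) =
              fmap G h \<cdot>\<^bsub>A\<^esub> (\<phi> (tgt A k) (src B h) f \<cdot>\<^bsub>A\<^esub> k)))"


section \<open>Limits and colimits\<close>

definition is_initial :: "('o, 'a) cat \<Rightarrow> 'o \<Rightarrow> bool" where
  "is_initial C z \<longleftrightarrow> z \<in> Obj C \<and> (\<forall>x\<in>Obj C. \<exists>!f. f \<in> hom C z x)"

definition is_terminal :: "('o, 'a) cat \<Rightarrow> 'o \<Rightarrow> bool" where
  "is_terminal C t \<longleftrightarrow> t \<in> Obj C \<and> (\<forall>x\<in>Obj C. \<exists>!f. f \<in> hom C x t)"

definition is_coproduct ::
  "('o, 'a) cat \<Rightarrow> 'i set \<Rightarrow> ('i \<Rightarrow> 'o) \<Rightarrow> 'o \<Rightarrow> ('i \<Rightarrow> 'a) \<Rightarrow> bool" where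
  "is_coproduct C I D s inc \<longleftrightarrow> s \<in> Obj C \<and> (\<forall>i\<in>I. D i \<in> Obj C \<and> inc i \<in> hom C (D i) s) \<and>
     (\<forall>z\<in>Obj C. \<forall>f. (\<forall>i\<in>I. f i \<in> hom C (D i) z) \<longrightarrow>
        (\<exists>!h. h \<in> hom C s z \<and> (\<forall>i\<in>I. h \<cdot>\<^bsub>C\<^esub> inc i = f i)))"

definition is_binary_coproduct ::
  "('o, 'a) cat \<Rightarrow> 'o \<Rightarrow> 'o \<Rightarrow> 'o \<Rightarrow> 'a \<Rightarrow> 'a \<Rightarrow> bool" where
  "is_binary_coproduct C x y s i j \<longleftrightarrow>
     x \<in> Obj C \<and> y \<in> Obj C \<and> s \<in> Obj C \<and> i \<in> hom C x s \<and> j \<in> hom C y s \<and>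
     (\<forall>z\<in>Obj C. \<forall>f\<in>hom C x z. \<forall>g\<in>hom C y z.
        \<exists>!h. h \<in> hom C s z \<and> h \<cdot>\<^bsub>C\<^esub> i = f \<and> h \<cdot>\<^bsub>C\<^esub> j = g)"

definition is_pullback :: "('o, 'a) cat \<Rightarrow> 'a \<Rightarrow> 'a \<Rightarrow> 'a \<Rightarrow> 'a \<Rightarrow> bool" where
  "is_pullback C p q f g \<longleftrightarrow>
     p \<in> Arr C \<and> q \<in> Arr C \<and> f \<in> Arr C \<and> g \<in> Arr C \<and> src C p = src C q \<and>
     tgt C p = src C f \<and> tgt C q = src C g \<and> tgt C f = tgt C g \<and> f \<cdot>\<^bsub>C\<^esub> p = g \<cdot>\<^bsub>C\<^esub> q \<and>
     (\<forall>z\<in>Obj C. \<forall>r\<in>hom C z (src C f). \<forall>s\<in>hom C z (src C g). f \<cdot>\<^bsub>C\<^esub> r = g \<cdot>\<^bsub>C\<^esub> s \<longrightarrow>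
        (\<exists>!h. h \<in> hom C z (src C p) \<and> p \<cdot>\<^bsub>C\<^esub> h = r \<and> q \<cdot>\<^bsub>C\<^esub> h = s))"

definition is_mono :: "('o, 'a) cat \<Rightarrow> 'a \<Rightarrow> bool" where
  "is_mono C m \<longleftrightarrow> m \<in> Arr C \<and>
     (\<forall>z\<in>Obj C. \<forall>f\<in>hom C z (src C m). \<forall>g\<in>hom C z (src C m).
        m \<cdot>\<^bsub>C\<^esub> f = m \<cdot>\<^bsub>C\<^esub> g \<longrightarrow> f = g)"

definition factors_through :: "('o, 'a) cat \<Rightarrow> 'a \<Rightarrow> 'a \<Rightarrow> bool" where
  "factors_through C f g \<longleftrightarrow> (\<exists>h\<in>hom C (src C f) (src C g). g \<cdot>\<^bsub>C\<^esub> h = f)"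

text \<open>The meet of the subobjects (represented by) \<open>S\<close> in the subobject lattice of \<open>x\<close>.\<close>

definition is_intersection :: "('o, 'a) cat \<Rightarrow> 'o \<Rightarrow> 'a set \<Rightarrow> 'a \<Rightarrow> bool" where
  "is_intersection C x S m \<longleftrightarrow>
     is_mono C m \<and> tgt C m = x \<and> (\<forall>s\<in>S. factors_through C m s) \<and>
     (\<forall>n. is_mono C n \<and> tgt C n = x \<and> (\<forall>s\<in>S. factors_through C n s) \<longrightarrow> factors_through C n m)"

definition preserves_finite_coproducts ::
  "('o, 'a) cat \<Rightarrow> ('p, 'b) cat \<Rightarrow> ('o, 'a, 'p, 'b) fctr \<Rightarrow> bool" where
  "preserves_finite_coproducts C D F \<longleftrightarrow>
     (\<forall>z. is_initial C z \<longrightarrow> is_initial D (fobj F z)) \<and>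
     (\<forall>x y s i j. is_binary_coproduct C x y s i j \<longrightarrow>
        is_binary_coproduct D (fobj F x) (fobj F y) (fobj F s) (fmap F i) (fmap F j))"

definition FC ::
  "('o, 'a) cat \<Rightarrow> ('p, 'b) cat \<Rightarrow>
   (('o, 'a, 'p, 'b) fctr, ('o, 'a, 'p, 'b) nt) cat" where
  "FC C E = full_subcat (functor_cat C E) (preserves_finite_coproducts C E)"


section \<open>Extensive categories\<close>

text \<open>A choice of binary coproducts: \<open>S x y\<close> with coprojections \<open>l x y\<close> and \<open>r x y\<close>.\<close>

definition binary_coproduct_choice ::
  "('o, 'a) cat \<Rightarrow> ('o \<Rightarrow> 'o \<Rightarrow> 'o) \<Rightarrow> ('o \<Rightarrow> 'o \<Rightarrow> 'a) \<Rightarrow> ('o \<Rightarrow> 'o \<Rightarrow> 'a) \<Rightarrow> bool" where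
  "binary_coproduct_choice C S l r \<longleftrightarrow>
     (\<forall>x\<in>Obj C. \<forall>y\<in>Obj C. is_binary_coproduct C x y (S x y) (l x y) (r x y))"

definition sum_arr ::
  "('o, 'a) cat \<Rightarrow> ('o \<Rightarrow> 'o \<Rightarrow> 'o) \<Rightarrow> ('o \<Rightarrow> 'o \<Rightarrow> 'a) \<Rightarrow> ('o \<Rightarrow> 'o \<Rightarrow> 'a) \<Rightarrow> 'a \<Rightarrow> 'a \<Rightarrow> 'a" where
  "sum_arr C S l r f g =
     (THE h. h \<in> hom C (S (src C f) (src C g)) (S (tgt C f) (tgt C g)) \<and>
        h \<cdot>\<^bsub>C\<^esub> l (src C f) (src C g) = l (tgt C f) (tgt C g) \<cdot>\<^bsub>C\<^esub> f \<and>
        h \<cdot>\<^bsub>C\<^esub> r (src C f) (src C g) = r (tgt C f) (tgt C g) \<cdot>\<^bsub>C\<^esub> g)"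

definition sum_functor ::
  "('o, 'a) cat \<Rightarrow> ('o \<Rightarrow> 'o \<Rightarrow> 'o) \<Rightarrow> ('o \<Rightarrow> 'o \<Rightarrow> 'a) \<Rightarrow> ('o \<Rightarrow> 'o \<Rightarrow> 'a) \<Rightarrow> 'o \<Rightarrow> 'o \<Rightarrow>
   ('a \<times> 'a, ('a \<times> 'a \<times> 'a) \<times> ('a \<times> 'a \<times> 'a), 'a, 'a \<times> 'a \<times> 'a) fctr" where
  "sum_functor C S l r a b =
     \<lparr> fobj = restrict (\<lambda>(f, g). sum_arr C S l r f g)
                (Obj (prod_cat (slice_cat C a) (slice_cat C b))),
       fmap = restrict (\<lambda>((f, h, f'), (g, k, g')).
                  (sum_arr C S l r f g, sum_arr C S l r h k, sum_arr C S l r f' g'))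
                (Arr (prod_cat (slice_cat C a) (slice_cat C b))) \<rparr>"

definition extensive :: "('o, 'a) cat \<Rightarrow> bool" where
  "extensive C \<longleftrightarrow> category C \<and> (\<exists>z. is_initial C z) \<and>
     (\<exists>S l r. binary_coproduct_choice C S l r \<and>
        (\<forall>a\<in>Obj C. \<forall>b\<in>Obj C. \<exists>G.
           equivalence (prod_cat (slice_cat C a) (slice_cat C b)) (slice_cat C (S a b))
             (sum_functor C S l r a b) G))"


section \<open>Small sets and the category of sets\<close>

text \<open>Smallness is relative to a type \<open>'u\<close> playing the role of a Grothendieck universe: a set, of
  elements of any type, is small if its cardinality is strictly below that of \<open>'u\<close>. The universe
  of hereditarily finite sets is allowed, as in SGA 4.\<close>

definition small :: "'u itself \<Rightarrow> 'x set \<Rightarrow> bool" where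
  "small U X \<longleftrightarrow> X \<prec> (UNIV :: 'u set)"

definition universe :: "'u itself \<Rightarrow> bool" where
  "universe U \<longleftrightarrow> infinite (UNIV :: 'u set) \<and>
     (\<forall>X :: 'u set. small U X \<longrightarrow> small U (Pow X)) \<and>
     (\<forall>(I :: 'u set) (X :: 'u \<Rightarrow> 'u set).
        small U I \<and> (\<forall>i\<in>I. small U (X i)) \<longrightarrow> small U (\<Union>i\<in>I. X i))"

type_synonym 'u set_arr = "'u set \<times> ('u \<Rightarrow> 'u) \<times> 'u set"

definition set_cat :: "'u itself \<Rightarrow> ('u set, 'u set_arr) cat" where
  "set_cat U =
     \<lparr> Obj = {X. small U X},
       Arr = {(X, f, Y). small U X \<and> small U Y \<and> f \<in> X \<rightarrow>\<^sub>E Y},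
       src = (\<lambda>(X, f, Y). X),
       tgt = (\<lambda>(X, f, Y). Y),
       ident = (\<lambda>X. (X, restrict (\<lambda>x. x) X, X)),
       compo = (\<lambda>(_, g, Z) (X, f, _). (X, compose X g f, Z)) \<rparr>"

definition app :: "'u set_arr \<Rightarrow> 'u \<Rightarrow> 'u" where
  "app = (\<lambda>(X, f, Y). f)"

definition locally_small :: "'u itself \<Rightarrow> ('o, 'a) cat \<Rightarrow> bool" where
  "locally_small U C \<longleftrightarrow> (\<forall>x\<in>Obj C. \<forall>y\<in>Obj C. small U (hom C x y))"


section \<open>Locally connected Grothendieck toposes\<close>

definition is_sieve :: "('o, 'a) cat \<Rightarrow> 'o \<Rightarrow> 'a set \<Rightarrow> bool" where
  "is_sieve J c R \<longleftrightarrow> R \<subseteq> {f \<in> Arr J. tgt J f = c} \<and>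
     (\<forall>f\<in>R. \<forall>g\<in>Arr J. tgt J g = src J f \<longrightarrow> f \<cdot>\<^bsub>J\<^esub> g \<in> R)"

definition pull_sieve :: "('o, 'a) cat \<Rightarrow> 'a \<Rightarrow> 'a set \<Rightarrow> 'a set" where
  "pull_sieve J g R = {h \<in> Arr J. tgt J h = src J g \<and> g \<cdot>\<^bsub>J\<^esub> h \<in> R}"

definition grothendieck_topology :: "('o, 'a) cat \<Rightarrow> ('o \<Rightarrow> 'a set set) \<Rightarrow> bool" where
  "grothendieck_topology J T \<longleftrightarrow>
     (\<forall>c\<in>Obj J. \<forall>R\<in>T c. is_sieve J c R) \<and>
     (\<forall>c\<in>Obj J. {f \<in> Arr J. tgt J f = c} \<in> T c) \<and>
     (\<forall>c\<in>Obj J. \<forall>R\<in>T c. \<forall>g\<in>Arr J. tgt J g = c \<longrightarrow> pull_sieve J g R \<in> T (src J g)) \<and>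
     (\<forall>c\<in>Obj J. \<forall>R\<in>T c. \<forall>Q. is_sieve J c Q \<and> (\<forall>g\<in>R. pull_sieve J g Q \<in> T (src J g)) \<longrightarrow>
        Q \<in> T c)"

definition is_sheaf ::
  "('o, 'a) cat \<Rightarrow> ('o \<Rightarrow> 'a set set) \<Rightarrow>
   ('o, 'a, 'u set, 'u set_arr) fctr \<Rightarrow> bool" where
  "is_sheaf J T P \<longleftrightarrow>
     (\<forall>c\<in>Obj J. \<forall>R\<in>T c. \<forall>x.
        (\<forall>f\<in>R. x f \<in> fobj P (src J f)) \<and>
        (\<forall>f\<in>R. \<forall>g\<in>Arr J. tgt J g = src J f \<longrightarrow> app (fmap P g) (x f) = x (f \<cdot>\<^bsub>J\<^esub> g)) \<longrightarrow>
        (\<exists>!a. a \<in> fobj P c \<and> (\<forall>f\<in>R. app (fmap P f) a = x f)))"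

definition sheaf_cat ::
  "'u itself \<Rightarrow> ('o, 'a) cat \<Rightarrow> ('o \<Rightarrow> 'a set set) \<Rightarrow>
   (('o, 'a, 'u set, 'u set_arr) fctr, ('o, 'a, 'u set, 'u set_arr) nt) cat" where
  "sheaf_cat U J T = full_subcat (functor_cat (op_cat J) (set_cat U)) (is_sheaf J T)"

text \<open>Every small category is isomorphic to one whose objects and arrows are elements of \<open>'u\<close>.\<close>

definition grothendieck_topos :: "'u itself \<Rightarrow> ('o, 'a) cat \<Rightarrow> bool" where
  "grothendieck_topos U E \<longleftrightarrow> category E \<and> locally_small U E \<and>
     (\<exists>(J :: ('u, 'u) cat) T.
        category J \<and> small U (Obj J) \<and> small U (Arr J) \<and> grothendieck_topology J T \<and>
        (\<exists>F G. equivalence E (sheaf_cat U J T) F G))"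

text \<open>The hom-sets of \<open>E\<close> do not consist of elements of \<open>'u\<close>, so \<open>\<Gamma> = E(1,-)\<close> is a functor to
  the category of small subsets of \<open>'u\<close> only up to natural bijections \<open>e\<close>.\<close>

definition is_global_sections ::
  "'u itself \<Rightarrow> ('o, 'a) cat \<Rightarrow> ('o, 'a, 'u set, 'u set_arr) fctr \<Rightarrow> bool" where
  "is_global_sections U E \<Gamma> \<longleftrightarrow> is_functor E (set_cat U) \<Gamma> \<and>
     (\<exists>t e. is_terminal E t \<and>
        (\<forall>y\<in>Obj E. bij_betw (e y) (fobj \<Gamma> y) (hom E t y)) \<and>
        (\<forall>g\<in>Arr E. \<forall>s\<in>fobj \<Gamma> (src E g).
           e (tgt E g) (app (fmap \<Gamma> g) s) = g \<cdot>\<^bsub>E\<^esub> e (src E g) s))"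

definition locally_connected :: "'u itself \<Rightarrow> ('o, 'a) cat \<Rightarrow> bool" where
  "locally_connected U E \<longleftrightarrow>
     (\<exists>\<Gamma> \<Delta> \<pi>\<^sub>0. is_global_sections U E \<Gamma> \<and>
        adjunction (set_cat U) E \<Delta> \<Gamma> \<and> adjunction E (set_cat U) \<pi>\<^sub>0 \<Delta>)"


section \<open>Summands and ultrafilters\<close>

definition coprojection :: "('o, 'a) cat \<Rightarrow> 'o \<Rightarrow> 'a \<Rightarrow> bool" where
  "coprojection C X m \<longleftrightarrow> (\<exists>n. is_binary_coproduct C (src C m) (src C n) X m n)"

definition sum_class :: "('o, 'a) cat \<Rightarrow> 'o \<Rightarrow> 'a \<Rightarrow> 'a set" where
  "sum_class C X m =
     {n. coprojection C X n \<and> (\<exists>h\<in>hom C (src C n) (src C m). is_iso C h \<and> m \<cdot>\<^bsub>C\<^esub> h = n)}"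

definition summands :: "('o, 'a) cat \<Rightarrow> 'o \<Rightarrow> 'a set set" where
  "summands C X = sum_class C X ` {m. coprojection C X m}"

definition sum_le :: "('o, 'a) cat \<Rightarrow> 'a set \<Rightarrow> 'a set \<Rightarrow> bool" where
  "sum_le C P Q \<longleftrightarrow> (\<exists>m\<in>P. \<exists>n\<in>Q. factors_through C m n)"

definition proper_filter :: "'p set \<Rightarrow> ('p \<Rightarrow> 'p \<Rightarrow> bool) \<Rightarrow> 'p set \<Rightarrow> bool" where
  "proper_filter P le F \<longleftrightarrow> F \<subseteq> P \<and> F \<noteq> {} \<and> F \<noteq> P \<and>
     (\<forall>a\<in>F. \<forall>b\<in>P. le a b \<longrightarrow> b \<in> F) \<and>
     (\<forall>a\<in>F. \<forall>b\<in>F. \<exists>c\<in>F. le c a \<and> le c b)"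

definition ultrafilter_on :: "'p set \<Rightarrow> ('p \<Rightarrow> 'p \<Rightarrow> bool) \<Rightarrow> 'p set \<Rightarrow> bool" where
  "ultrafilter_on P le F \<longleftrightarrow> proper_filter P le F \<and>
     (\<forall>G. proper_filter P le G \<and> F \<subseteq> G \<longrightarrow> G = F)"

definition beta :: "('o, 'a) cat \<Rightarrow> 'o \<Rightarrow> 'a set set set" where
  "beta C X = {\<U>. ultrafilter_on (summands C X) (sum_le C) \<U>}"

text \<open>For \<open>V\<close> an isomorphism class of coprojections into the target of \<open>f\<close>, the set of all
  pullbacks of its members along \<open>f\<close> is again an isomorphism class.\<close>

definition pull :: "('o, 'a) cat \<Rightarrow> 'a \<Rightarrow> 'a set \<Rightarrow> 'a set" where
  "pull C f V = {p. \<exists>v\<in>V. \<exists>q. is_pullback C p q f v}"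

definition pushforward :: "('o, 'a) cat \<Rightarrow> 'a \<Rightarrow> 'a set set \<Rightarrow> 'a set set" where
  "pushforward C f \<U> = {V \<in> summands C (tgt C f). pull C f V \<in> \<U>}"

text \<open>The class of the composites \<open>P \<rightarrowtail> src u \<rightarrowtail> X\<close>, for \<open>P\<close> in \<open>summands C (src C u)\<close>.\<close>

definition compose_class :: "('o, 'a) cat \<Rightarrow> 'o \<Rightarrow> 'a \<Rightarrow> 'a set \<Rightarrow> 'a set" where
  "compose_class C X u P = (\<Union>p\<in>P. sum_class C X (u \<cdot>\<^bsub>C\<^esub> p))"


section \<open>The category of ultrafilters\<close>

type_synonym ('o, 'a) uf_obj = "'o \<times> 'a set set"

type_synonym ('o, 'a) uf_arr = "('o, 'a) uf_obj \<times> ('a \<times> 'a) set \<times> ('o, 'a) uf_obj"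

text \<open>A partial map from \<open>X\<close> to \<open>Y\<close> is a pair \<open>(u, f)\<close> of a coprojection \<open>u : U \<rightarrowtail> X\<close> and
  \<open>f : U \<rightarrow> Y\<close>.\<close>

definition continuous_partial ::
  "('o, 'a) cat \<Rightarrow> ('o, 'a) uf_obj \<Rightarrow> ('o, 'a) uf_obj \<Rightarrow> 'a \<times> 'a \<Rightarrow> bool" where
  "continuous_partial C = (\<lambda>(X, \<U>) (Y, \<V>) (u, f).
     coprojection C X u \<and> sum_class C X u \<in> \<U> \<and> f \<in> hom C (src C u) Y \<and>
     (\<forall>V\<in>summands C Y. V \<in> \<V> \<longleftrightarrow> compose_class C X u (pull C f V) \<in> \<U>))"

definition uf_eq ::
  "('o, 'a) cat \<Rightarrow> ('o, 'a) uf_obj \<Rightarrow> 'a \<times> 'a \<Rightarrow> 'a \<times> 'a \<Rightarrow> bool" where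
  "uf_eq C = (\<lambda>(X, \<U>) (u, f) (u', f').
     \<exists>w. coprojection C X w \<and> sum_class C X w \<in> \<U> \<and>
       (\<exists>h\<in>hom C (src C w) (src C u). \<exists>h'\<in>hom C (src C w) (src C u').
          u \<cdot>\<^bsub>C\<^esub> h = w \<and> u' \<cdot>\<^bsub>C\<^esub> h' = w \<and> f \<cdot>\<^bsub>C\<^esub> h = f' \<cdot>\<^bsub>C\<^esub> h'))"

definition uf_class ::
  "('o, 'a) cat \<Rightarrow> ('o, 'a) uf_obj \<Rightarrow> ('o, 'a) uf_obj \<Rightarrow> 'a \<times> 'a \<Rightarrow> ('a \<times> 'a) set" where
  "uf_class C x y g = {g'. continuous_partial C x y g' \<and> uf_eq C x g g'}"

definition uf_arr ::
  "('o, 'a) cat \<Rightarrow> ('o, 'a) uf_obj \<Rightarrow> ('o, 'a) uf_obj \<Rightarrow> 'a \<times> 'a \<Rightarrow>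
   ('o, 'a) uf_arr" where
  "uf_arr C x y g = (x, uf_class C x y g, y)"

text \<open>Classes of \<open>(u, f)\<close> and \<open>(v, g)\<close> compose to the class of the partial map defined on the
  pullback \<open>f\<^sup>-\<^sup>1(v)\<close>.\<close>

definition UF ::
  "('o, 'a) cat \<Rightarrow>
   (('o, 'a) uf_obj, ('o, 'a) uf_arr) cat" where
  "UF C =
     \<lparr> Obj = {(X, \<U>). X \<in> Obj C \<and> \<U> \<in> beta C X},
       Arr = {uf_arr C (X, \<U>) (Y, \<V>) g | X \<U> Y \<V> g.
                X \<in> Obj C \<and> \<U> \<in> beta C X \<and> Y \<in> Obj C \<and> \<V> \<in> beta C Y \<and>
                continuous_partial C (X, \<U>) (Y, \<V>) g},
       src = (\<lambda>(x, a, y). x),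
       tgt = (\<lambda>(x, a, y). y),
       ident = (\<lambda>x. uf_arr C x x (ident C (fst x), ident C (fst x))),
       compo = (\<lambda>(_, b, z) (x, a, _).
         (x, \<Union>{uf_class C x z (u \<cdot>\<^bsub>C\<^esub> p, g \<cdot>\<^bsub>C\<^esub> q) | u f v g p q.
                 (u, f) \<in> a \<and> (v, g) \<in> b \<and> is_pullback C p q f v}, z)) \<rparr>"


section \<open>The two constructions\<close>

text \<open>\<open>B\<close> is \<open>\<tilde>A\<close>, with \<open>\<iota> (X, \<U>)\<close> its inclusion into \<open>A X\<close>; the arrow \<open>k\<close> is the inclusion of
  \<open>\<tilde>A (X, \<U>)\<close> into \<open>A U\<close>.\<close>

definition is_tilde ::
  "('o, 'a) cat \<Rightarrow> ('p, 'b) cat \<Rightarrow> ('o, 'a, 'p, 'b) fctr \<Rightarrow>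
   (('o, 'a) uf_obj, ('o, 'a) uf_arr, 'p, 'b) fctr \<Rightarrow>
   (('o, 'a) uf_obj \<Rightarrow> 'b) \<Rightarrow> bool" where
  "is_tilde C E A B \<iota> \<longleftrightarrow> is_functor (UF C) E B \<and>
     (\<forall>(X, \<U>)\<in>Obj (UF C).
        src E (\<iota> (X, \<U>)) = fobj B (X, \<U>) \<and>
        is_intersection E (fobj A X)
          {fmap A u | u. coprojection C X u \<and> sum_class C X u \<in> \<U>} (\<iota> (X, \<U>))) \<and>
     (\<forall>x\<in>Obj (UF C). \<forall>y\<in>Obj (UF C). \<forall>u f. continuous_partial C x y (u, f) \<longrightarrow>
        (\<exists>k\<in>hom E (fobj B x) (fobj A (src C u)).
           fmap A u \<cdot>\<^bsub>E\<^esub> k = \<iota> x \<and>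
           \<iota> y \<cdot>\<^bsub>E\<^esub> fmap B (uf_arr C x y (u, f)) = fmap A f \<cdot>\<^bsub>E\<^esub> k))"

definition is_tilde_functor ::
  "('o, 'a) cat \<Rightarrow> ('p, 'b) cat \<Rightarrow>
   (('o, 'a, 'p, 'b) fctr, ('o, 'a, 'p, 'b) nt,
    (('o, 'a) uf_obj, ('o, 'a) uf_arr, 'p, 'b) fctr, (('o, 'a) uf_obj, ('o, 'a) uf_arr, 'p, 'b) nt) fctr \<Rightarrow>
   bool" where
  "is_tilde_functor C E \<Phi> \<longleftrightarrow> is_functor (FC C E) (functor_cat (UF C) E) \<Phi> \<and>
     (\<exists>\<iota>. (\<forall>A\<in>Obj (FC C E). is_tilde C E A (fobj \<Phi> A) (\<iota> A)) \<and>
          (\<forall>A A' \<alpha> \<sigma>. (A, \<alpha>, A') \<in> Arr (FC C E) \<and>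
             fmap \<Phi> (A, \<alpha>, A') = (fobj \<Phi> A, \<sigma>, fobj \<Phi> A') \<longrightarrow>
             (\<forall>(X, \<U>)\<in>Obj (UF C).
                \<iota> A' (X, \<U>) \<cdot>\<^bsub>E\<^esub> \<sigma> (X, \<U>) = \<alpha> X \<cdot>\<^bsub>E\<^esub> \<iota> A (X, \<U>))))"

text \<open>\<open>A\<close> is \<open>\<integral>B\<close>, with \<open>\<kappa> Y \<V>\<close> the coprojection of \<open>A Y\<close> at \<open>\<V>\<close>. A total map \<open>f\<close> is the
  partial map with domain inclusion the identity.\<close>

definition is_integral ::
  "('o, 'a) cat \<Rightarrow> ('p, 'b) cat \<Rightarrow>
   (('o, 'a) uf_obj, ('o, 'a) uf_arr, 'p, 'b) fctr \<Rightarrow>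
   ('o, 'a, 'p, 'b) fctr \<Rightarrow> ('o \<Rightarrow> 'a set set \<Rightarrow> 'b) \<Rightarrow> bool" where
  "is_integral C E B A \<kappa> \<longleftrightarrow> is_functor C E A \<and>
     (\<forall>Y\<in>Obj C. is_coproduct E (beta C Y) (\<lambda>\<V>. fobj B (Y, \<V>)) (fobj A Y) (\<kappa> Y)) \<and>
     (\<forall>Y\<in>Obj C. \<forall>Z\<in>Obj C. \<forall>f\<in>hom C Y Z. \<forall>\<V>\<in>beta C Y.
        fmap A f \<cdot>\<^bsub>E\<^esub> \<kappa> Y \<V> =
        \<kappa> Z (pushforward C f \<V>) \<cdot>\<^bsub>E\<^esub>
          fmap B (uf_arr C (Y, \<V>) (Z, pushforward C f \<V>) (ident C Y, f)))"

definition is_integral_functor ::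
  "('o, 'a) cat \<Rightarrow> ('p, 'b) cat \<Rightarrow>
   ((('o, 'a) uf_obj, ('o, 'a) uf_arr, 'p, 'b) fctr, (('o, 'a) uf_obj, ('o, 'a) uf_arr, 'p, 'b) nt,
    ('o, 'a, 'p, 'b) fctr, ('o, 'a, 'p, 'b) nt) fctr \<Rightarrow>
   bool" where
  "is_integral_functor C E \<Psi> \<longleftrightarrow> is_functor (functor_cat (UF C) E) (FC C E) \<Psi> \<and>
     (\<exists>\<kappa>. (\<forall>B\<in>Obj (functor_cat (UF C) E). is_integral C E B (fobj \<Psi> B) (\<kappa> B)) \<and>
          (\<forall>B B' \<beta> \<sigma>. (B, \<beta>, B') \<in> Arr (functor_cat (UF C) E) \<and>
             fmap \<Psi> (B, \<beta>, B') = (fobj \<Psi> B, \<sigma>, fobj \<Psi> B') \<longrightarrow>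
             (\<forall>Y\<in>Obj C. \<forall>\<V>\<in>beta C Y.
                \<sigma> Y \<cdot>\<^bsub>E\<^esub> \<kappa> B Y \<V> = \<kappa> B' Y \<V> \<cdot>\<^bsub>E\<^esub> \<beta> (Y, \<V>))))"

end

theory Submission
  imports Defs
begin

text \<open>In a locally connected topos, pulling back the unit \<open>AX \<rightarrow> \<Delta>(\<pi>\<^sub>0(AX))\<close> along the points of
  \<open>\<pi>\<^sub>0(AX)\<close> writes \<open>AX\<close> as a coproduct of pieces, each of which factors through one of any
  two complementary summands of \<open>AX\<close>. So each non-initial piece determines an ultrafilter on \<open>X\<close>, namely the summands
  \<open>U\<close> for which it factors through \<open>AU\<close>. By infinitary disjointness and stability of coproducts in a topos, the
  pieces with ultrafilter \<open>\<U>\<close> add up to the intersection of the \<open>AU\<close> for \<open>U\<close> in \<open>\<U>\<close>, and thus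
  \<open>AX\<close> is the coproduct of the \<open>\<tilde>A(X, \<U>)\<close> over all ultrafilters \<open>\<U>\<close> on \<open>X\<close>. Conversely, a summand
  \<open>U\<close> in \<open>\<U>\<close> with the restricted ultrafilter is isomorphic to \<open>(X, \<U>)\<close>, and an ultrafilter contains
  exactly one of two complementary summands, so \<open>\<integral>B\<close> preserves finite coproducts and has \<open>B\<close> as its
  \<open>\<tilde>A\<close>. Hence the triples \<open>(A, B, \<iota>)\<close>, where \<open>\<iota>\<close> exhibits \<open>AX\<close> as the coproduct of the \<open>B(X, \<U>)\<close>
  compatibly with arrows, form a span of fully faithful functors surjective on objects.\<close>

section \<open>Categories, coproducts, functors\<close>

text \<open>Preserving finite coproducts says nothing about infinite ones, so the obstacle is that
  the intersections might not exhaust \<open>AX\<close>: for sheaves on the Cantor space, with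
  \<open>A\<close> the identity and \<open>X\<close> terminal, every intersection is initial. Local
  connectedness removes it by cutting \<open>AX\<close> into pieces that no binary coproduct divides
  further. The other property drawn from the topos is that small coproducts are stable, disjoint and
  have monic coprojections; it is proved for sheaves by an explicit construction and carried along
  an equivalence. Intersections are never assumed to exist in \<open>E\<close>: each one arises as a
  sum of pieces. Sums over ultrafilters require \<open>beta C X\<close> to be small, which the bound
  on \<open>summands C X\<close> provides through a power set. The span form is chosen because the
  inclusion of an intersection and the coprojection of a sum are the same arrow \<iota>: one
  relation \<open>represents\<close> serves both constructions, objects are chosen once, arrows are
  then forced, and functor laws, naturality and inverse laws follow from uniqueness.\<close>

locale cat =
  fixes C :: "('o, 'a) cat" (structure)
  assumes category: "category C"
begin

lemma in_hom [simp]: "f \<in> hom C x y \<longleftrightarrow> f \<in> Arr C \<and> src C f = x \<and> tgt C f = y"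
  by (simp add: hom_def)

lemma src_Obj [simp]: "f \<in> Arr C \<Longrightarrow> src C f \<in> Obj C"
  and tgt_Obj [simp]: "f \<in> Arr C \<Longrightarrow> tgt C f \<in> Obj C"
  using category by (auto simp: category_def)

lemma ident_Arr [simp]:
  assumes "x \<in> Obj C"
  shows "ident C x \<in> Arr C" "src C (ident C x) = x" "tgt C (ident C x) = x"
  using assms category by (auto simp: category_def)

lemma comp_Arr [simp]:
  assumes "f \<in> Arr C" "g \<in> Arr C" "tgt C f = src C g"
  shows "g \<cdot> f \<in> Arr C" "src C (g \<cdot> f) = src C f" "tgt C (g \<cdot> f) = tgt C g"
  using assms category by (auto simp: category_def)

lemma comp_ident [simp]:
  "f \<in> Arr C \<Longrightarrow> src C f = x \<Longrightarrow> f \<cdot> ident C x = f"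
  "f \<in> Arr C \<Longrightarrow> tgt C f = x \<Longrightarrow> ident C x \<cdot> f = f"
  using category by (auto simp: category_def)

lemma assoc [simp]:
  "f \<in> Arr C \<Longrightarrow> g \<in> Arr C \<Longrightarrow> h \<in> Arr C \<Longrightarrow> tgt C f = src C g \<Longrightarrow> tgt C g = src C h \<Longrightarrow>
    (h \<cdot> g) \<cdot> f = h \<cdot> (g \<cdot> f)"
  using category by (auto simp: category_def)

text \<open>With composites associated to the right, an equation between composites rewrites only at the
  right end of a longer composite; this form rewrites in the middle.\<close>

lemma ext2:
  assumes "g \<cdot> f = k" "f \<in> Arr C" "g \<in> Arr C" "tgt C f = src C g" "x \<in> Arr C" "tgt C x = src C f"
  shows "g \<cdot> (f \<cdot> x) = k \<cdot> x"
  using assms by (metis assoc)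

lemma mono_cancel:
  "is_mono C m \<Longrightarrow> f \<in> Arr C \<Longrightarrow> g \<in> Arr C \<Longrightarrow> src C f = src C g \<Longrightarrow>
    tgt C f = src C m \<Longrightarrow> tgt C g = src C m \<Longrightarrow> m \<cdot> f = m \<cdot> g \<Longrightarrow> f = g"
  unfolding is_mono_def by (metis in_hom src_Obj)

lemma is_monoI:
  assumes "m \<in> Arr C"
    and "\<And>f g. f \<in> Arr C \<Longrightarrow> g \<in> Arr C \<Longrightarrow> src C f = src C g \<Longrightarrow> tgt C f = src C m \<Longrightarrow>
      tgt C g = src C m \<Longrightarrow> m \<cdot> f = m \<cdot> g \<Longrightarrow> f = g"
  shows "is_mono C m"
  unfolding is_mono_def using assms by auto

lemma initial_arr:
  assumes "is_initial C z" "x \<in> Obj C"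
  obtains f where "f \<in> Arr C" "src C f = z" "tgt C f = x"
  using assms unfolding is_initial_def by auto

lemma initial_Obj: "is_initial C z \<Longrightarrow> z \<in> Obj C"
  by (simp add: is_initial_def)

lemma initial_eq:
  assumes "is_initial C (src C f)" "f \<in> Arr C" "g \<in> Arr C" "src C g = src C f" "tgt C f = tgt C g"
  shows "f = g"
  using assms unfolding is_initial_def by (metis in_hom tgt_Obj)

section \<open>Coproducts of families\<close>

lemma coproductI:
  assumes "s \<in> Obj C" "\<And>i. i \<in> I \<Longrightarrow> D i \<in> Obj C"
    and "\<And>i. i \<in> I \<Longrightarrow> inc i \<in> hom C (D i) s"
    and "\<And>z f. z \<in> Obj C \<Longrightarrow> (\<And>i. i \<in> I \<Longrightarrow> f i \<in> hom C (D i) z) \<Longrightarrow>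
      \<exists>h\<in>hom C s z. \<forall>i\<in>I. h \<cdot> inc i = f i"
    and "\<And>z h k. h \<in> hom C s z \<Longrightarrow> k \<in> hom C s z \<Longrightarrow>
      (\<And>i. i \<in> I \<Longrightarrow> h \<cdot> inc i = k \<cdot> inc i) \<Longrightarrow> h = k"
  shows "is_coproduct C I D s inc"
proof -
  have "\<exists>!h. h \<in> hom C s z \<and> (\<forall>i\<in>I. h \<cdot> inc i = f i)"
    if "z \<in> Obj C" "\<forall>i\<in>I. f i \<in> hom C (D i) z" for z f
  proof -
    have "\<And>i. i \<in> I \<Longrightarrow> f i \<in> hom C (D i) z" using that(2) by blast
    from assms(4)[OF that(1) this] obtain h where "h \<in> hom C s z" "\<forall>i\<in>I. h \<cdot> inc i = f i" by blast
    then show ?thesis using assms(5)[of _ z] by metis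
  qed
  then show ?thesis unfolding is_coproduct_def using assms(1-3) by blast
qed

lemma coproductD:
  assumes "is_coproduct C I D s inc"
  shows "s \<in> Obj C" "i \<in> I \<Longrightarrow> D i \<in> Obj C" "i \<in> I \<Longrightarrow> inc i \<in> Arr C"
    "i \<in> I \<Longrightarrow> src C (inc i) = D i" "i \<in> I \<Longrightarrow> tgt C (inc i) = s"
  using assms unfolding is_coproduct_def by auto

lemma coproduct_ex1:
  assumes "is_coproduct C I D s inc" "z \<in> Obj C" "\<forall>i\<in>I. f i \<in> hom C (D i) z"
  shows "\<exists>!h. h \<in> hom C s z \<and> (\<forall>i\<in>I. h \<cdot> inc i = f i)"
  using assms unfolding is_coproduct_def by blast

lemma coproduct_ex:
  assumes "is_coproduct C I D s inc" "z \<in> Obj C" "\<And>i. i \<in> I \<Longrightarrow> f i \<in> hom C (D i) z"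
  obtains h where "h \<in> Arr C" "src C h = s" "tgt C h = z" "\<And>i. i \<in> I \<Longrightarrow> h \<cdot> inc i = f i"
proof -
  have "\<forall>i\<in>I. f i \<in> hom C (D i) z" using assms(3) by blast
  from coproduct_ex1[OF assms(1,2) this] show ?thesis using that by auto
qed

lemma coproduct_eq:
  assumes "is_coproduct C I D s inc" "h \<in> Arr C" "k \<in> Arr C" "src C h = s" "src C k = s"
    "tgt C h = tgt C k" "\<And>i. i \<in> I \<Longrightarrow> h \<cdot> inc i = k \<cdot> inc i"
  shows "h = k"
proof -
  have "\<forall>i\<in>I. k \<cdot> inc i \<in> hom C (D i) (tgt C k)"
    using assms(3,5) coproductD[OF assms(1)] by auto
  note coproduct_ex1[OF assms(1) tgt_Obj[OF assms(3)] this]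
  moreover have "h \<in> hom C s (tgt C k)" "k \<in> hom C s (tgt C k)" using assms by auto
  ultimately show ?thesis using assms(7) by blast
qed

text \<open>Indexing by the booleans turns every fact about families, in particular uniqueness,
  stability and disjointness, into a fact about binary coproducts.\<close>

lemma binary_coproduct_iff:
  "is_binary_coproduct C x y s i j \<longleftrightarrow>
    is_coproduct C UNIV (\<lambda>b. if b then x else y) s (\<lambda>b. if b then i else j)" (is "?L \<longleftrightarrow> ?R")
proof
  assume L: ?L
  show ?R
    unfolding is_coproduct_def
  proof (intro conjI ballI allI impI)
    fix z f assume "z \<in> Obj C" "\<forall>b\<in>UNIV. f b \<in> hom C (if b then x else y) z"
    then have "z \<in> Obj C" "f True \<in> hom C x z" "f False \<in> hom C y z" by (metis UNIV_I)+
    then have "\<exists>!h. h \<in> hom C s z \<and> h \<cdot> i = f True \<and> h \<cdot> j = f False"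
      using L unfolding is_binary_coproduct_def by blast
    then show "\<exists>!h. h \<in> hom C s z \<and> (\<forall>b\<in>UNIV. h \<cdot> (if b then i else j) = f b)"
      by (simp add: all_bool_eq) 
  qed (use L in \<open>auto simp: is_binary_coproduct_def\<close>)
next
  assume R: ?R
  note d = coproductD(1)[OF R] coproductD(2-5)[OF R, of True, simplified]
    coproductD(2-5)[OF R, of False, simplified]
  show ?L
    unfolding is_binary_coproduct_def
  proof (intro conjI ballI)
    fix z f g assume z: "z \<in> Obj C" "f \<in> hom C x z" "g \<in> hom C y z"
    then have "\<forall>b\<in>UNIV. (if b then f else g) \<in> hom C (if b then x else y) z" by auto
    from coproduct_ex1[OF R z(1) this] show "\<exists>!h. h \<in> hom C s z \<and> h \<cdot> i = f \<and> h \<cdot> j = g"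
      by (simp add: all_bool_eq)
  qed (use d in auto)
qed

lemma binary_coproductD:
  assumes "is_binary_coproduct C x y s i j"
  shows "x \<in> Obj C" "y \<in> Obj C" "s \<in> Obj C" "i \<in> Arr C" "src C i = x" "tgt C i = s"
    "j \<in> Arr C" "src C j = y" "tgt C j = s"
  using assms unfolding is_binary_coproduct_def by auto

lemma binary_coproduct_ex:
  assumes "is_binary_coproduct C x y s i j" "f \<in> Arr C" "src C f = x" "tgt C f = z"
    "g \<in> Arr C" "src C g = y" "tgt C g = z"
  obtains h where "h \<in> Arr C" "src C h = s" "tgt C h = z" "h \<cdot> i = f" "h \<cdot> j = g"
proof -
  have "\<exists>!h. h \<in> hom C s z \<and> h \<cdot> i = f \<and> h \<cdot> j = g"
    using assms unfolding is_binary_coproduct_def by (metis in_hom tgt_Obj)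
  then show ?thesis using that by auto
qed

lemma binary_coproduct_eq:
  assumes "is_binary_coproduct C x y s i j" "h \<in> Arr C" "k \<in> Arr C" "src C h = s" "src C k = s"
    "tgt C h = tgt C k" "h \<cdot> i = k \<cdot> i" "h \<cdot> j = k \<cdot> j"
  shows "h = k"
  using coproduct_eq[OF assms(1)[unfolded binary_coproduct_iff], of h k] assms by auto

lemma binary_coproductI:
  assumes "s \<in> Obj C" "i \<in> hom C x s" "j \<in> hom C y s"
    and "\<And>z f g. f \<in> hom C x z \<Longrightarrow> g \<in> hom C y z \<Longrightarrow> \<exists>h\<in>hom C s z. h \<cdot> i = f \<and> h \<cdot> j = g"
    and "\<And>z h k. h \<in> hom C s z \<Longrightarrow> k \<in> hom C s z \<Longrightarrow> h \<cdot> i = k \<cdot> i \<Longrightarrow> h \<cdot> j = k \<cdot> j \<Longrightarrow> h = k"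
  shows "is_binary_coproduct C x y s i j"
proof -
  have "\<exists>!h. h \<in> hom C s z \<and> h \<cdot> i = f \<and> h \<cdot> j = g"
    if fg: "f \<in> hom C x z" "g \<in> hom C y z" for z f g
  proof -
    obtain h where "h \<in> hom C s z" "h \<cdot> i = f" "h \<cdot> j = g" using assms(4)[OF fg] by blast
    then show ?thesis using assms(5)[of _ z] by metis
  qed
  then show ?thesis unfolding is_binary_coproduct_def using assms(1-3) by (metis in_hom src_Obj)
qed

lemma binary_coproduct_sym:
  "is_binary_coproduct C x y s i j \<Longrightarrow> is_binary_coproduct C y x s j i"
  unfolding is_binary_coproduct_def by metis

text \<open>Reading an initial object as a coproduct of nothing lets initiality be transported by
  the same lemmas as coproducts, for instance along an equivalence.\<close>

lemma empty_coproduct: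
  "is_coproduct C {} D s inc \<longleftrightarrow> is_initial C s"
  unfolding is_coproduct_def is_initial_def by auto

lemma coproduct_cong:
  assumes "is_coproduct C I D s inc" "\<And>i. i \<in> I \<Longrightarrow> D i = D' i" "\<And>i. i \<in> I \<Longrightarrow> inc i = inc' i"
  shows "is_coproduct C I D' s inc'"
  using assms unfolding is_coproduct_def by auto

text \<open>This is how an index set of another type is exchanged for a subset of the universe
  type.\<close>

lemma coproduct_reindex:
  assumes c: "is_coproduct C I D s inc" and h: "bij_betw h J I"
  shows "is_coproduct C J (D \<circ> h) s (inc \<circ> h)"
proof (rule coproductI)
  note d = coproductD[OF c]
  have hJ: "\<And>j. j \<in> J \<Longrightarrow> h j \<in> I" using h by (auto simp: bij_betw_def)
  show "s \<in> Obj C" by (rule d)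
  show "\<And>j. j \<in> J \<Longrightarrow> (D \<circ> h) j \<in> Obj C" "\<And>j. j \<in> J \<Longrightarrow> (inc \<circ> h) j \<in> hom C ((D \<circ> h) j) s"
    using d hJ by auto
  let ?g = "inv_into J h"
  have g: "\<And>i. i \<in> I \<Longrightarrow> ?g i \<in> J \<and> h (?g i) = i" "\<And>j. j \<in> J \<Longrightarrow> ?g (h j) = j"
    using h by (auto simp: bij_betw_def f_inv_into_f inv_into_into)
  show "\<exists>k\<in>hom C s z. \<forall>j\<in>J. k \<cdot> (inc \<circ> h) j = f j"
    if z: "z \<in> Obj C" and f: "\<And>j. j \<in> J \<Longrightarrow> f j \<in> hom C ((D \<circ> h) j) z" for z f
  proof -
    have "\<And>i. i \<in> I \<Longrightarrow> f (?g i) \<in> hom C (D i) z" using f g by (metis comp_apply)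
    then obtain k where "k \<in> Arr C" "src C k = s" "tgt C k = z" "\<And>i. i \<in> I \<Longrightarrow> k \<cdot> inc i = f (?g i)"
      using coproduct_ex[OF c z, of "\<lambda>i. f (?g i)"] by metis
    then show ?thesis using hJ g by (intro bexI[of _ k]) auto
  qed
  show "k = l" if "k \<in> hom C s z" "l \<in> hom C s z"
    "\<And>j. j \<in> J \<Longrightarrow> k \<cdot> (inc \<circ> h) j = l \<cdot> (inc \<circ> h) j" for z k l
  proof (rule coproduct_eq[OF c])
    fix i assume "i \<in> I"
    then show "k \<cdot> inc i = l \<cdot> inc i" using that(3)[of "?g i"] g(1) by simp
  qed (use that in auto)
qed

lemma coproduct_unique:
  assumes "is_coproduct C I D s inc" "is_coproduct C I D s' inc'"
  obtains h k where "h \<in> Arr C" "src C h = s" "tgt C h = s'" "k \<in> Arr C" "src C k = s'" "tgt C k = s"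
    "k \<cdot> h = ident C s" "h \<cdot> k = ident C s'"
    "\<And>i. i \<in> I \<Longrightarrow> h \<cdot> inc i = inc' i" "\<And>i. i \<in> I \<Longrightarrow> k \<cdot> inc' i = inc i"
proof -
  note d = coproductD[OF assms(1)] coproductD[OF assms(2)]
  obtain h where h: "h \<in> Arr C" "src C h = s" "tgt C h = s'" "\<And>i. i \<in> I \<Longrightarrow> h \<cdot> inc i = inc' i"
    using coproduct_ex[OF assms(1), of s' inc'] d by auto
  obtain k where k: "k \<in> Arr C" "src C k = s'" "tgt C k = s" "\<And>i. i \<in> I \<Longrightarrow> k \<cdot> inc' i = inc i"
    using coproduct_ex[OF assms(2), of s inc] d by auto
  have "k \<cdot> h = ident C s" by (rule coproduct_eq[OF assms(1)]) (use h k d in auto)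
  moreover have "h \<cdot> k = ident C s'" by (rule coproduct_eq[OF assms(2)]) (use h k d in auto)
  ultimately show ?thesis using that h k by blast
qed

text \<open>A family on the new summands is precomposed with \<open>th' i\<close>, and the arrow it
  induces on the old sum with \<open>k\<close>. Sum and summands vary together, so that changing
  only one of them is the case where the other isomorphisms are identities.\<close>

lemma coproduct_iso:
  assumes c: "is_coproduct C I D s inc"
    and h: "h \<in> Arr C" "src C h = s" "k \<in> Arr C" "src C k = tgt C h" "tgt C k = s"
      "k \<cdot> h = ident C s" "h \<cdot> k = ident C (tgt C h)"
    and th: "\<And>i. i \<in> I \<Longrightarrow> th i \<in> hom C (D' i) (D i)" "\<And>i. i \<in> I \<Longrightarrow> th' i \<in> hom C (D i) (D' i)"
      "\<And>i. i \<in> I \<Longrightarrow> th' i \<cdot> th i = ident C (D' i)" "\<And>i. i \<in> I \<Longrightarrow> th i \<cdot> th' i = ident C (D i)"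
  shows "is_coproduct C I D' (tgt C h) (\<lambda>i. h \<cdot> (inc i \<cdot> th i))"
proof (rule coproductI)
  note d = coproductD[OF c]
  have th': "i \<in> I \<Longrightarrow> th i \<in> Arr C" "i \<in> I \<Longrightarrow> src C (th i) = D' i" "i \<in> I \<Longrightarrow> tgt C (th i) = D i"
    "i \<in> I \<Longrightarrow> th' i \<in> Arr C" "i \<in> I \<Longrightarrow> src C (th' i) = D i" "i \<in> I \<Longrightarrow> tgt C (th' i) = D' i" for i
    using th(1,2) by auto
  show "tgt C h \<in> Obj C" using h by simp
  show "\<And>i. i \<in> I \<Longrightarrow> D' i \<in> Obj C" using th' by (metis src_Obj)
  show "\<And>i. i \<in> I \<Longrightarrow> h \<cdot> (inc i \<cdot> th i) \<in> hom C (D' i) (tgt C h)" using d h th' by simp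
  show "\<exists>m\<in>hom C (tgt C h) z. \<forall>i\<in>I. m \<cdot> (h \<cdot> (inc i \<cdot> th i)) = f i"
    if z: "z \<in> Obj C" and f: "\<And>i. i \<in> I \<Longrightarrow> f i \<in> hom C (D' i) z" for z f
  proof -
    have f': "i \<in> I \<Longrightarrow> f i \<in> Arr C" "i \<in> I \<Longrightarrow> src C (f i) = D' i" "i \<in> I \<Longrightarrow> tgt C (f i) = z" for i
      using f by auto
    obtain m where m: "m \<in> Arr C" "src C m = s" "tgt C m = z" "\<And>i. i \<in> I \<Longrightarrow> m \<cdot> inc i = f i \<cdot> th' i"
      using coproduct_ex[OF c z, of "\<lambda>i. f i \<cdot> th' i"] f' th' by auto
    show ?thesis
      by (rule bexI[of _ "m \<cdot> k"])
        (use m h d th' f' in \<open>simp_all add: ext2[OF h(6)] ext2[OF m(4)] th(3)\<close>)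
  qed
  show "m = n" if mn: "m \<in> hom C (tgt C h) z" "n \<in> hom C (tgt C h) z"
    "\<And>i. i \<in> I \<Longrightarrow> m \<cdot> (h \<cdot> (inc i \<cdot> th i)) = n \<cdot> (h \<cdot> (inc i \<cdot> th i))" for z m n
  proof -
    have "m \<cdot> h = n \<cdot> h"
    proof (rule coproduct_eq[OF c])
      fix i assume i: "i \<in> I"
      have "(m \<cdot> (h \<cdot> (inc i \<cdot> th i))) \<cdot> th' i = (n \<cdot> (h \<cdot> (inc i \<cdot> th i))) \<cdot> th' i" using mn(3) i by simp
      then show "m \<cdot> h \<cdot> inc i = n \<cdot> h \<cdot> inc i" using i mn(1,2) h d th' by (simp add: th(4))
    qed (use mn h in auto)
    then have "m \<cdot> h \<cdot> k = n \<cdot> h \<cdot> k" by simp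
    then show ?thesis using mn(1,2) h by simp
  qed
qed

section \<open>Pullbacks\<close>

lemma pullbackD:
  assumes "is_pullback C p q f g"
  shows "p \<in> Arr C" "q \<in> Arr C" "f \<in> Arr C" "g \<in> Arr C" "src C q = src C p" "tgt C p = src C f"
    "tgt C q = src C g" "tgt C g = tgt C f" "g \<cdot> q = f \<cdot> p"
  using assms unfolding is_pullback_def by auto

lemma pullback_ex:
  assumes "is_pullback C p q f g" "r \<in> Arr C" "s \<in> Arr C" "src C r = src C s"
    "tgt C r = src C f" "tgt C s = src C g" "f \<cdot> r = g \<cdot> s"
  obtains h where "h \<in> Arr C" "src C h = src C r" "tgt C h = src C p" "p \<cdot> h = r" "q \<cdot> h = s"
proof -
  have "src C r \<in> Obj C" "r \<in> hom C (src C r) (src C f)" "s \<in> hom C (src C r) (src C g)"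
    using assms by auto
  then have "\<exists>!h. h \<in> hom C (src C r) (src C p) \<and> p \<cdot> h = r \<and> q \<cdot> h = s"
    using assms(1,7) unfolding is_pullback_def by blast
  then show ?thesis using that by auto
qed

lemma pullback_eq:
  assumes "is_pullback C p q f g" "h \<in> Arr C" "k \<in> Arr C" "src C h = src C k"
    "tgt C h = src C p" "tgt C k = src C p" "p \<cdot> h = p \<cdot> k" "q \<cdot> h = q \<cdot> k"
  shows "h = k"
proof -
  note d = pullbackD[OF assms(1)]
  have "src C k \<in> Obj C" "p \<cdot> k \<in> hom C (src C k) (src C f)" "q \<cdot> k \<in> hom C (src C k) (src C g)"
    "f \<cdot> (p \<cdot> k) = g \<cdot> (q \<cdot> k)"
    using assms d by (auto simp: ext2[OF d(9)])
  then have "\<exists>!h. h \<in> hom C (src C k) (src C p) \<and> p \<cdot> h = p \<cdot> k \<and> q \<cdot> h = q \<cdot> k"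
    using assms(1) unfolding is_pullback_def by blast
  then show ?thesis using assms by auto
qed

lemma pullbackI:
  assumes "p \<in> Arr C" "q \<in> Arr C" "f \<in> Arr C" "g \<in> Arr C" "src C q = src C p" "tgt C p = src C f"
    "tgt C q = src C g" "tgt C g = tgt C f" "f \<cdot> p = g \<cdot> q"
    and "\<And>r s. r \<in> Arr C \<Longrightarrow> s \<in> Arr C \<Longrightarrow> src C r = src C s \<Longrightarrow> tgt C r = src C f \<Longrightarrow>
      tgt C s = src C g \<Longrightarrow> f \<cdot> r = g \<cdot> s \<Longrightarrow> \<exists>h\<in>hom C (src C s) (src C p). p \<cdot> h = r \<and> q \<cdot> h = s"
    and "\<And>h k. h \<in> Arr C \<Longrightarrow> k \<in> Arr C \<Longrightarrow> src C h = src C k \<Longrightarrow> tgt C h = src C p \<Longrightarrow>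
      tgt C k = src C p \<Longrightarrow> p \<cdot> h = p \<cdot> k \<Longrightarrow> q \<cdot> h = q \<cdot> k \<Longrightarrow> h = k"
  shows "is_pullback C p q f g"
proof -
  have "\<exists>!h. h \<in> hom C z (src C p) \<and> p \<cdot> h = r \<and> q \<cdot> h = s"
    if rs: "r \<in> hom C z (src C f)" "s \<in> hom C z (src C g)" "f \<cdot> r = g \<cdot> s" for r s z
  proof -
    obtain h where h: "h \<in> hom C z (src C p)" "p \<cdot> h = r" "q \<cdot> h = s"
      using assms(10)[of r s] rs by auto
    show ?thesis
      using h assms(11) by fastforce
  qed
  then show ?thesis unfolding is_pullback_def using assms(1-9) by (intro conjI ballI impI) simp_all
qed

lemma pullback_sym:
  assumes "is_pullback C p q f g"
  shows "is_pullback C q p g f"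
proof (rule pullbackI)
  fix r s assume *: "r \<in> Arr C" "s \<in> Arr C" "src C r = src C s" "tgt C r = src C g" "tgt C s = src C f"
    "g \<cdot> r = f \<cdot> s"
  obtain h where "h \<in> Arr C" "src C h = src C s" "tgt C h = src C p" "p \<cdot> h = s" "q \<cdot> h = r"
    using pullback_ex[OF assms, of s r] * by metis
  then show "\<exists>h\<in>hom C (src C s) (src C q). q \<cdot> h = r \<and> p \<cdot> h = s"
    using pullbackD[OF assms] by auto
next
  fix h k assume "h \<in> Arr C" "k \<in> Arr C" "src C h = src C k" "tgt C h = src C q" "tgt C k = src C q"
    "q \<cdot> h = q \<cdot> k" "p \<cdot> h = p \<cdot> k"
  then show "h = k" using pullback_eq[OF assms, of h k] pullbackD[OF assms] by simp
qed (use pullbackD[OF assms] in auto)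

lemma pullback_paste:
  assumes 1: "is_pullback C p q f v" and 2: "is_pullback C r s q w"
  shows "is_pullback C (p \<cdot> r) s f (v \<cdot> w)"
proof -
  note d = pullbackD[OF 1] pullbackD[OF 2]
  show ?thesis
  proof (rule pullbackI)
    show "f \<cdot> (p \<cdot> r) = v \<cdot> w \<cdot> s" using d ext2[OF d(9), of r] by simp
    fix a b assume ab: "a \<in> Arr C" "b \<in> Arr C" "src C a = src C b" "tgt C a = src C f"
      "tgt C b = src C (v \<cdot> w)" "f \<cdot> a = v \<cdot> w \<cdot> b"
    obtain h where h: "h \<in> Arr C" "src C h = src C a" "tgt C h = src C p" "p \<cdot> h = a" "q \<cdot> h = w \<cdot> b"
      using pullback_ex[OF 1, of a "w \<cdot> b"] ab d by auto
    obtain k where k: "k \<in> Arr C" "src C k = src C h" "tgt C k = src C r" "r \<cdot> k = h" "s \<cdot> k = b"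
      using pullback_ex[OF 2, of h b] ab d h by auto
    show "\<exists>h\<in>hom C (src C b) (src C (p \<cdot> r)). p \<cdot> r \<cdot> h = a \<and> s \<cdot> h = b"
      by (rule bexI[of _ k]) (use k h d ab in auto)
  next
    fix h k assume hk: "h \<in> Arr C" "k \<in> Arr C" "src C h = src C k" "tgt C h = src C (p \<cdot> r)"
       "tgt C k = src C (p \<cdot> r)" "p \<cdot> r \<cdot> h = p \<cdot> r \<cdot> k" "s \<cdot> h = s \<cdot> k"
    have "r \<cdot> h = r \<cdot> k"
      by (rule pullback_eq[OF 1]) (use hk d ext2[OF d(18), of h] ext2[OF d(18), of k] in auto)
    show "h = k" by (rule pullback_eq[OF 2]) (use hk d \<open>r \<cdot> h = r \<cdot> k\<close> in auto)
  qed (use d in auto)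
qed

end

section \<open>Functors and natural transformations\<close>

lemma functorD:
  assumes "is_functor A B F"
  shows "category A" "category B"
    "x \<in> Obj A \<Longrightarrow> fobj F x \<in> Obj B"
    "f \<in> Arr A \<Longrightarrow> fmap F f \<in> Arr B"
    "f \<in> Arr A \<Longrightarrow> src B (fmap F f) = fobj F (src A f)"
    "f \<in> Arr A \<Longrightarrow> tgt B (fmap F f) = fobj F (tgt A f)"
    "x \<in> Obj A \<Longrightarrow> fmap F (ident A x) = ident B (fobj F x)"
    "f \<in> Arr A \<Longrightarrow> g \<in> Arr A \<Longrightarrow> tgt A f = src A g \<Longrightarrow>
      fmap F (g \<cdot>\<^bsub>A\<^esub> f) = fmap F g \<cdot>\<^bsub>B\<^esub> fmap F f"
  using assms unfolding is_functor_def hom_def by auto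

text \<open>Extensionality, which \<open>is_functor\<close> demands, comes from the two
  restrictions, so only the plain laws of the functions \<open>Fo\<close> and \<open>Fa\<close>
  remain to be checked.\<close>

lemma functorI:
  assumes "category A" "category B"
    and "\<And>x. x \<in> Obj A \<Longrightarrow> Fo x \<in> Obj B"
    and "\<And>f. f \<in> Arr A \<Longrightarrow> Fa f \<in> hom B (Fo (src A f)) (Fo (tgt A f))"
    and "\<And>x. x \<in> Obj A \<Longrightarrow> Fa (ident A x) = ident B (Fo x)"
    and "\<And>f g. f \<in> Arr A \<Longrightarrow> g \<in> Arr A \<Longrightarrow> tgt A f = src A g \<Longrightarrow> Fa (g \<cdot>\<^bsub>A\<^esub> f) = Fa g \<cdot>\<^bsub>B\<^esub> Fa f"
  shows "is_functor A B \<lparr>fobj = restrict Fo (Obj A), fmap = restrict Fa (Arr A)\<rparr>"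
proof -
  interpret A: cat A by standard fact
  interpret B: cat B by standard fact
  have "Fa f \<in> Arr B" "src B (Fa f) = Fo (src A f)" "tgt B (Fa f) = Fo (tgt A f)" if "f \<in> Arr A" for f
    using assms(4)[OF that] by auto
  then show ?thesis unfolding is_functor_def using assms by auto
qed

lemma id_functor: "category A \<Longrightarrow> is_functor A A (id_functor A)"
  unfolding id_functor_def by (rule functorI) (auto simp: hom_def)

lemma comp_functor:
  assumes "is_functor A B F" "is_functor B D G"
  shows "is_functor A D (comp_functor A G F)"
  unfolding comp_functor_def
  by (rule functorI) (use functorD[OF assms(1)] functorD[OF assms(2)] in \<open>auto simp: hom_def\<close>)

context
  fixes A :: "('o, 'a) cat" and B :: "('p, 'b) cat"
  assumes A: "category A" and B: "category B"
begin

interpretation A: cat A by standard (rule A)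
interpretation B: cat B by standard (rule B)

lemma nat_transD:
  assumes "nat_trans A B F G \<tau>"
  shows "x \<in> Obj A \<Longrightarrow> \<tau> x \<in> Arr B" "x \<in> Obj A \<Longrightarrow> src B (\<tau> x) = fobj F x"
    "x \<in> Obj A \<Longrightarrow> tgt B (\<tau> x) = fobj G x"
    "f \<in> Arr A \<Longrightarrow> \<tau> (tgt A f) \<cdot>\<^bsub>B\<^esub> fmap F f = fmap G f \<cdot>\<^bsub>B\<^esub> \<tau> (src A f)"
  using assms unfolding nat_trans_def by auto

lemma category_functor_cat: "category (functor_cat A B)"
proof -
  have comp: "nat_trans A B F H (restrict (\<lambda>x. \<sigma> x \<cdot>\<^bsub>B\<^esub> \<tau> x) (Obj A))"
    if fg: "is_functor A B F" "is_functor A B G" "is_functor A B H"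
      and "nat_trans A B F G \<tau>" "nat_trans A B G H \<sigma>" for F G H \<tau> \<sigma>
  proof -
    note t = nat_transD[OF that(4)] nat_transD[OF that(5)]
    note f = functorD[OF fg(1)] functorD[OF fg(2)] functorD[OF fg(3)]
    show ?thesis
      unfolding nat_trans_def
      by (auto simp: t f B.ext2[OF t(4)] B.ext2[OF t(8)])
  qed
  have idt: "nat_trans A B F F (restrict (\<lambda>x. ident B (fobj F x)) (Obj A))" if "is_functor A B F" for F
    using functorD[OF that] unfolding nat_trans_def by auto
  have ext: "\<tau> = \<sigma>" if "nat_trans A B F G \<tau>" "\<sigma> \<in> extensional (Obj A)"
    "\<And>x. x \<in> Obj A \<Longrightarrow> \<tau> x = \<sigma> x" for F G \<tau> \<sigma>
    using that unfolding nat_trans_def by (metis extensionalityI)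
  show ?thesis
    unfolding category_def
  proof (intro conjI ballI impI)
    fix f assume "f \<in> Arr (functor_cat A B)"
    then obtain F \<tau> G where f: "f = (F, \<tau>, G)" "is_functor A B F" "is_functor A B G" "nat_trans A B F G \<tau>"
      by (auto simp: functor_cat_def)
    note t = nat_transD[OF f(4)] functorD[OF f(2)] functorD[OF f(3)]
    show "src (functor_cat A B) f \<in> Obj (functor_cat A B)" "tgt (functor_cat A B) f \<in> Obj (functor_cat A B)"
      using f by (auto simp: functor_cat_def)
    show "f \<cdot>\<^bsub>functor_cat A B\<^esub> ident (functor_cat A B) (src (functor_cat A B) f) = f"
      "ident (functor_cat A B) (tgt (functor_cat A B) f) \<cdot>\<^bsub>functor_cat A B\<^esub> f = f"
      using f t by (auto simp: functor_cat_def intro!: ext[OF f(4), symmetric])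
  next
    fix f g assume "f \<in> Arr (functor_cat A B)" "g \<in> Arr (functor_cat A B)"
      "tgt (functor_cat A B) f = src (functor_cat A B) g"
    then show "g \<cdot>\<^bsub>functor_cat A B\<^esub> f \<in>
        hom (functor_cat A B) (src (functor_cat A B) f) (tgt (functor_cat A B) g)"
      by (auto simp: functor_cat_def hom_def intro: comp)
  next
    fix f g h assume "f \<in> Arr (functor_cat A B)" "g \<in> Arr (functor_cat A B)" "h \<in> Arr (functor_cat A B)"
      "tgt (functor_cat A B) f = src (functor_cat A B) g \<and> tgt (functor_cat A B) g = src (functor_cat A B) h"
    then show "h \<cdot>\<^bsub>functor_cat A B\<^esub> g \<cdot>\<^bsub>functor_cat A B\<^esub> f =
        h \<cdot>\<^bsub>functor_cat A B\<^esub> (g \<cdot>\<^bsub>functor_cat A B\<^esub> f)"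
      by (auto simp: functor_cat_def nat_transD intro!: restrict_ext)
  qed (auto simp: functor_cat_def hom_def intro: idt)
qed

end

lemma category_full_subcat: "category C \<Longrightarrow> category (full_subcat C P)"
  unfolding category_def full_subcat_def hom_def by auto

lemma category_FC: "category C \<Longrightarrow> category E \<Longrightarrow> category (FC C E)"
  unfolding FC_def by (intro category_full_subcat category_functor_cat)

lemma naturally_isomorphicI:
  assumes "is_functor A B F" "is_functor A B G"
    and "\<And>x. x \<in> Obj A \<Longrightarrow> t x \<in> hom B (fobj F x) (fobj G x)"
    and "\<And>x. x \<in> Obj A \<Longrightarrow> t' x \<in> hom B (fobj G x) (fobj F x)"
    and "\<And>x. x \<in> Obj A \<Longrightarrow> t' x \<cdot>\<^bsub>B\<^esub> t x = ident B (fobj F x)"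
    and "\<And>x. x \<in> Obj A \<Longrightarrow> t x \<cdot>\<^bsub>B\<^esub> t' x = ident B (fobj G x)"
    and "\<And>f. f \<in> Arr A \<Longrightarrow> t (tgt A f) \<cdot>\<^bsub>B\<^esub> fmap F f = fmap G f \<cdot>\<^bsub>B\<^esub> t (src A f)"
  shows "naturally_isomorphic A B F G"
  unfolding naturally_isomorphic_def
proof (intro exI conjI ballI)
  interpret A: cat A by standard (rule functorD[OF assms(1)])
  let ?t = "restrict t (Obj A)"
  show "nat_trans A B F G ?t" using assms unfolding nat_trans_def by auto
  fix x assume x: "x \<in> Obj A"
  then have tx: "t x \<in> Arr B" "src B (t x) = fobj F x" "tgt B (t x) = fobj G x"
    using assms(3) by (auto simp: hom_def)
  then show "is_iso B (?t x)" unfolding is_iso_def using x assms(4-6) by auto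
qed

section \<open>Equivalences from spans\<close>

text \<open>\<open>R\<close> and \<open>M\<close> are the objects and arrows of a category over \<open>P \<times> Q\<close> whose two projections are
  surjective on objects and fully faithful.\<close>

lemma span_functor:
  assumes P: "category P" and Q: "category Q"
    and ob: "\<And>a. a \<in> Obj P \<Longrightarrow> \<exists>b x. R a b x"
    and RQ: "\<And>a b x. R a b x \<Longrightarrow> b \<in> Obj Q"
    and ff: "\<And>a b x a' b' x' f. R a b x \<Longrightarrow> R a' b' x' \<Longrightarrow> f \<in> hom P a a' \<Longrightarrow>
      \<exists>!g. g \<in> hom Q b b' \<and> M x x' f g"
    and M_id: "\<And>a b x. R a b x \<Longrightarrow> M x x (ident P a) (ident Q b)"
    and M_comp: "\<And>a b x a' b' x' a'' b'' x'' f g f' g'. R a b x \<Longrightarrow> R a' b' x' \<Longrightarrow> R a'' b'' x'' \<Longrightarrow>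
      f \<in> hom P a a' \<Longrightarrow> f' \<in> hom P a' a'' \<Longrightarrow> g \<in> hom Q b b' \<Longrightarrow> g' \<in> hom Q b' b'' \<Longrightarrow>
      M x x' f g \<Longrightarrow> M x' x'' f' g' \<Longrightarrow> M x x'' (f' \<cdot>\<^bsub>P\<^esub> f) (g' \<cdot>\<^bsub>Q\<^esub> g)"
  shows "\<exists>F x. is_functor P Q F \<and> (\<forall>a\<in>Obj P. R a (fobj F a) (x a)) \<and>
    (\<forall>f\<in>Arr P. M (x (src P f)) (x (tgt P f)) f (fmap F f))"
proof -
  interpret P: cat P by standard (rule P)
  interpret Q: cat Q by standard (rule Q)
  obtain Fo x where R: "\<And>a. a \<in> Obj P \<Longrightarrow> R a (Fo a) (x a)" using ob by metis
  have "\<exists>g. g \<in> hom Q (Fo (src P f)) (Fo (tgt P f)) \<and> M (x (src P f)) (x (tgt P f)) f g"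
    if "f \<in> Arr P" for f
    using ff[OF R R, of "src P f" "tgt P f" f] that by auto
  then obtain Fa where Fa: "\<And>f. f \<in> Arr P \<Longrightarrow> Fa f \<in> hom Q (Fo (src P f)) (Fo (tgt P f))"
    "\<And>f. f \<in> Arr P \<Longrightarrow> M (x (src P f)) (x (tgt P f)) f (Fa f)" by metis
  \<comment> \<open>Uniqueness of partners under \<open>M\<close> makes the chosen arrow map
    functorial: an identity or a composite that is related by \<open>M\<close> has to be the chosen
    value.\<close>
  have Fa_eq: "Fa f = g" if "f \<in> Arr P" "g \<in> hom Q (Fo (src P f)) (Fo (tgt P f))"
    "M (x (src P f)) (x (tgt P f)) f g" for f g
    using ff[OF R R, of "src P f" "tgt P f" f] that Fa[OF that(1)] by auto
  let ?F = "\<lparr>fobj = restrict Fo (Obj P), fmap = restrict Fa (Arr P)\<rparr>"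
  have "is_functor P Q ?F"
  proof (rule functorI[OF P Q])
    show "Fo a \<in> Obj Q" if "a \<in> Obj P" for a using R[OF that] RQ by blast
    show "Fa f \<in> hom Q (Fo (src P f)) (Fo (tgt P f))" if "f \<in> Arr P" for f by (rule Fa[OF that])
    show "Fa (ident P a) = ident Q (Fo a)" if "a \<in> Obj P" for a
      by (rule Fa_eq) (use that M_id[OF R[OF that]] RQ[OF R[OF that]] in auto)
    show "Fa (g \<cdot>\<^bsub>P\<^esub> f) = Fa g \<cdot>\<^bsub>Q\<^esub> Fa f" if "f \<in> Arr P" "g \<in> Arr P" "tgt P f = src P g" for f g
    proof (rule Fa_eq)
      show "M (x (src P (g \<cdot>\<^bsub>P\<^esub> f))) (x (tgt P (g \<cdot>\<^bsub>P\<^esub> f))) (g \<cdot>\<^bsub>P\<^esub> f) (Fa g \<cdot>\<^bsub>Q\<^esub> Fa f)"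
        using M_comp[OF R R R, of "src P f" "tgt P f" "tgt P g" f g "Fa f" "Fa g"]
          that Fa[OF that(1)] Fa[OF that(2)] by simp
    qed (use that Fa[OF that(1)] Fa[OF that(2)] in auto)
  qed
  then show ?thesis using R Fa by (intro exI[of _ ?F] exI[of _ x]) auto
qed

text \<open>Both \<open>a\<close> and \<open>GF a\<close> are related to \<open>fobj F a\<close>, so
  the identity of \<open>fobj F a\<close> lifts to arrows in both directions between them.
  Invertibility and naturality of \<open>t\<close> compare two lifts of one arrow of
  \<open>Q\<close>; naturality of \<open>t'\<close> follows by composing with inverses. Both
  directions are concluded because \<open>equivalence\<close> asks for an isomorphism out of the
  identity on one side and into the identity on the other.\<close>

lemma span_unit:
  assumes F: "is_functor P Q F" and G: "is_functor Q P G"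
    and RF: "\<And>a. a \<in> Obj P \<Longrightarrow> R a (fobj F a) (x a)"
    and MF: "\<And>f. f \<in> Arr P \<Longrightarrow> M (x (src P f)) (x (tgt P f)) f (fmap F f)"
    and RG: "\<And>b. b \<in> Obj Q \<Longrightarrow> R (fobj G b) b (y b)"
    and MG: "\<And>g. g \<in> Arr Q \<Longrightarrow> M (y (src Q g)) (y (tgt Q g)) (fmap G g) g"
    and ff: "\<And>a b x a' b' x' g. R a b x \<Longrightarrow> R a' b' x' \<Longrightarrow> g \<in> hom Q b b' \<Longrightarrow>
      \<exists>!f. f \<in> hom P a a' \<and> M x x' f g"
    and M_id: "\<And>a b x. R a b x \<Longrightarrow> M x x (ident P a) (ident Q b)"
    and M_comp: "\<And>a b x a' b' x' a'' b'' x'' f g f' g'. R a b x \<Longrightarrow> R a' b' x' \<Longrightarrow> R a'' b'' x'' \<Longrightarrow>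
      f \<in> hom P a a' \<Longrightarrow> f' \<in> hom P a' a'' \<Longrightarrow> g \<in> hom Q b b' \<Longrightarrow> g' \<in> hom Q b' b'' \<Longrightarrow>
      M x x' f g \<Longrightarrow> M x' x'' f' g' \<Longrightarrow> M x x'' (f' \<cdot>\<^bsub>P\<^esub> f) (g' \<cdot>\<^bsub>Q\<^esub> g)"
  shows "naturally_isomorphic P P (id_functor P) (comp_functor P G F)"
    and "naturally_isomorphic P P (comp_functor P G F) (id_functor P)"
proof -
  interpret P: cat P by standard (rule functorD[OF F])
  interpret Q: cat Q by standard (rule functorD[OF F])
  note Fs = functorD[OF F] and Gs = functorD[OF G]
  define GF where "GF a = fobj G (fobj F a)" for a
  have R': "R (GF a) (fobj F a) (y (fobj F a))" if "a \<in> Obj P" for a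
    unfolding GF_def using RG Fs that by auto
  have GFo: "GF a \<in> Obj P" if "a \<in> Obj P" for a unfolding GF_def using Fs Gs that by auto
  have idF: "ident Q (fobj F a) \<in> hom Q (fobj F a) (fobj F a)" if "a \<in> Obj P" for a
    using Fs that by simp
  have "\<exists>f. f \<in> hom P a (GF a) \<and> M (x a) (y (fobj F a)) f (ident Q (fobj F a))" if "a \<in> Obj P" for a
    using ff[OF RF[OF that] R'[OF that] idF[OF that]] by blast
  then obtain t where t: "\<And>a. a \<in> Obj P \<Longrightarrow> t a \<in> hom P a (GF a)"
    "\<And>a. a \<in> Obj P \<Longrightarrow> M (x a) (y (fobj F a)) (t a) (ident Q (fobj F a))" by metis
  have "\<exists>f. f \<in> hom P (GF a) a \<and> M (y (fobj F a)) (x a) f (ident Q (fobj F a))" if "a \<in> Obj P" for a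
    using ff[OF R'[OF that] RF[OF that] idF[OF that]] by blast
  then obtain t' where t': "\<And>a. a \<in> Obj P \<Longrightarrow> t' a \<in> hom P (GF a) a"
    "\<And>a. a \<in> Obj P \<Longrightarrow> M (y (fobj F a)) (x a) (t' a) (ident Q (fobj F a))" by metis
  have eq: "f = f'" if "R a b x" "R a' b' x'" "f \<in> hom P a a'" "f' \<in> hom P a a'" "g \<in> hom Q b b'"
    "M x x' f g" "M x x' f' g" for a b x a' b' x' f f' g
    using ff[OF that(1,2,5)] that(3,4,6,7) by blast
  have inv1: "t' a \<cdot>\<^bsub>P\<^esub> t a = ident P a" if a: "a \<in> Obj P" for a
  proof (rule eq[OF RF[OF a] RF[OF a] _ _ idF[OF a]])
    show "M (x a) (x a) (t' a \<cdot>\<^bsub>P\<^esub> t a) (ident Q (fobj F a))"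
      using M_comp[OF RF[OF a] R'[OF a] RF[OF a] t(1)[OF a] t'(1)[OF a] idF[OF a] idF[OF a] t(2)[OF a] t'(2)[OF a]]
        Fs a by simp
  qed (use t(1)[OF a] t'(1)[OF a] M_id[OF RF[OF a]] a in auto)
  have inv2: "t a \<cdot>\<^bsub>P\<^esub> t' a = ident P (GF a)" if a: "a \<in> Obj P" for a
  proof (rule eq[OF R'[OF a] R'[OF a] _ _ idF[OF a]])
    show "M (y (fobj F a)) (y (fobj F a)) (t a \<cdot>\<^bsub>P\<^esub> t' a) (ident Q (fobj F a))"
      using M_comp[OF R'[OF a] RF[OF a] R'[OF a] t'(1)[OF a] t(1)[OF a] idF[OF a] idF[OF a] t'(2)[OF a] t(2)[OF a]]
        Fs a by simp
  qed (use t(1)[OF a] t'(1)[OF a] M_id[OF R'[OF a]] GFo a in auto)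
  have nat: "t (tgt P f) \<cdot>\<^bsub>P\<^esub> f = fmap G (fmap F f) \<cdot>\<^bsub>P\<^esub> t (src P f)" if f: "f \<in> Arr P" for f
  proof -
    let ?a = "src P f" and ?b = "tgt P f"
    have a: "?a \<in> Obj P" and b: "?b \<in> Obj P" using f by auto
    have fh: "f \<in> hom P ?a ?b" and Fh: "fmap F f \<in> hom Q (fobj F ?a) (fobj F ?b)"
      and GFh: "fmap G (fmap F f) \<in> hom P (GF ?a) (GF ?b)" using f Fs Gs by (auto simp: GF_def)
    show ?thesis
    proof (rule eq[OF RF[OF a] R'[OF b] _ _ Fh])
      show "M (x ?a) (y (fobj F ?b)) (t ?b \<cdot>\<^bsub>P\<^esub> f) (fmap F f)"
        using M_comp[OF RF[OF a] RF[OF b] R'[OF b] fh t(1)[OF b] Fh idF[OF b] MF[OF f] t(2)[OF b]] Fh by simp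
      have "M (y (fobj F ?a)) (y (fobj F ?b)) (fmap G (fmap F f)) (fmap F f)"
        using MG[of "fmap F f"] Fh by auto
      then show "M (x ?a) (y (fobj F ?b)) (fmap G (fmap F f) \<cdot>\<^bsub>P\<^esub> t ?a) (fmap F f)"
        using M_comp[OF RF[OF a] R'[OF a] R'[OF b] t(1)[OF a] GFh idF[OF a] Fh t(2)[OF a]] Fh by simp
    qed (use f t(1)[OF a] t(1)[OF b] GFh in auto)
  qed
  have nat': "t' (tgt P f) \<cdot>\<^bsub>P\<^esub> fmap G (fmap F f) = f \<cdot>\<^bsub>P\<^esub> t' (src P f)" if f: "f \<in> Arr P" for f
  proof -
    let ?a = "src P f" and ?b = "tgt P f"
    have a: "?a \<in> Obj P" and b: "?b \<in> Obj P" using f by auto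
    have h: "f \<in> Arr P" "fmap G (fmap F f) \<in> Arr P" "src P (fmap G (fmap F f)) = GF ?a"
      "tgt P (fmap G (fmap F f)) = GF ?b" using f Fs Gs by (auto simp: GF_def)
    note tt = t(1)[OF a] t(1)[OF b] t'(1)[OF a] t'(1)[OF b]
    have "t' ?b \<cdot>\<^bsub>P\<^esub> fmap G (fmap F f) = t' ?b \<cdot>\<^bsub>P\<^esub> (fmap G (fmap F f) \<cdot>\<^bsub>P\<^esub> t ?a) \<cdot>\<^bsub>P\<^esub> t' ?a"
      using tt h inv2[OF a] by simp
    also have "\<dots> = t' ?b \<cdot>\<^bsub>P\<^esub> (t ?b \<cdot>\<^bsub>P\<^esub> f) \<cdot>\<^bsub>P\<^esub> t' ?a" using nat[OF f] by simp
    also have "\<dots> = f \<cdot>\<^bsub>P\<^esub> t' ?a" using tt h by (simp add: P.ext2[OF inv1[OF b]])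
    finally show ?thesis .
  qed
  note cf = comp_functor[OF F G] id_functor[OF P.category]
  have o: "fobj (id_functor P) a = a" "fobj (comp_functor P G F) a = GF a" if "a \<in> Obj P" for a
    using that by (auto simp: id_functor_def comp_functor_def GF_def)
  have m: "fmap (id_functor P) f = f" "fmap (comp_functor P G F) f = fmap G (fmap F f)" if "f \<in> Arr P" for f
    using that by (auto simp: id_functor_def comp_functor_def)
  show "naturally_isomorphic P P (id_functor P) (comp_functor P G F)"
    by (rule naturally_isomorphicI[of _ _ _ _ t t', OF cf(2,1)])
      (simp_all only: o m t(1) t'(1) inv1 inv2 nat P.src_Obj P.tgt_Obj)
  show "naturally_isomorphic P P (comp_functor P G F) (id_functor P)"
    by (rule naturally_isomorphicI[of _ _ _ _ t' t, OF cf])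
      (simp_all only: o m t(1) t'(1) inv1 inv2 nat' P.src_Obj P.tgt_Obj)
qed

text \<open>The hypotheses are symmetric in \<open>P\<close> and \<open>Q\<close>, so
  \<open>span_functor\<close> and \<open>span_unit\<close> are each used twice, the second time with
  \<open>R\<close> and \<open>M\<close> read backwards. The witnesses \<open>x\<close> and
  \<open>y\<close> are kept in the conclusion because they later become the inclusions and the
  coprojections that describe the two functors.\<close>

lemma span_equivalence:
  assumes P: "category P" and Q: "category Q"
    and obP: "\<And>a. a \<in> Obj P \<Longrightarrow> \<exists>b x. R a b x" and obQ: "\<And>b. b \<in> Obj Q \<Longrightarrow> \<exists>a x. R a b x"
    and RP: "\<And>a b x. R a b x \<Longrightarrow> a \<in> Obj P" and RQ: "\<And>a b x. R a b x \<Longrightarrow> b \<in> Obj Q"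
    and ffP: "\<And>a b x a' b' x' f. R a b x \<Longrightarrow> R a' b' x' \<Longrightarrow> f \<in> hom P a a' \<Longrightarrow>
      \<exists>!g. g \<in> hom Q b b' \<and> M x x' f g"
    and ffQ: "\<And>a b x a' b' x' g. R a b x \<Longrightarrow> R a' b' x' \<Longrightarrow> g \<in> hom Q b b' \<Longrightarrow>
      \<exists>!f. f \<in> hom P a a' \<and> M x x' f g"
    and M_id: "\<And>a b x. R a b x \<Longrightarrow> M x x (ident P a) (ident Q b)"
    and M_comp: "\<And>a b x a' b' x' a'' b'' x'' f g f' g'. R a b x \<Longrightarrow> R a' b' x' \<Longrightarrow> R a'' b'' x'' \<Longrightarrow>
      f \<in> hom P a a' \<Longrightarrow> f' \<in> hom P a' a'' \<Longrightarrow> g \<in> hom Q b b' \<Longrightarrow> g' \<in> hom Q b' b'' \<Longrightarrow>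
      M x x' f g \<Longrightarrow> M x' x'' f' g' \<Longrightarrow> M x x'' (f' \<cdot>\<^bsub>P\<^esub> f) (g' \<cdot>\<^bsub>Q\<^esub> g)"
  shows "\<exists>F G x y. equivalence P Q F G \<and>
    (\<forall>a\<in>Obj P. R a (fobj F a) (x a)) \<and>
    (\<forall>f\<in>Arr P. M (x (src P f)) (x (tgt P f)) f (fmap F f)) \<and>
    (\<forall>b\<in>Obj Q. R (fobj G b) b (y b)) \<and>
    (\<forall>g\<in>Arr Q. M (y (src Q g)) (y (tgt Q g)) (fmap G g) g)"
proof -
  have "\<exists>F x. is_functor P Q F \<and> (\<forall>a\<in>Obj P. R a (fobj F a) (x a)) \<and>
    (\<forall>f\<in>Arr P. M (x (src P f)) (x (tgt P f)) f (fmap F f))"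
    by (rule span_functor[of P Q R M]; fact)
  then obtain F x where F: "is_functor P Q F" "\<And>a. a \<in> Obj P \<Longrightarrow> R a (fobj F a) (x a)"
    "\<And>f. f \<in> Arr P \<Longrightarrow> M (x (src P f)) (x (tgt P f)) f (fmap F f)"
    by blast
  have "\<exists>G y. is_functor Q P G \<and> (\<forall>b\<in>Obj Q. R (fobj G b) b (y b)) \<and>
    (\<forall>g\<in>Arr Q. M (y (src Q g)) (y (tgt Q g)) (fmap G g) g)"
  proof (rule span_functor[of Q P "\<lambda>b a. R a b" "\<lambda>x x' g f. M x x' f g"])
    show "M x x'' (f' \<cdot>\<^bsub>P\<^esub> f) (g' \<cdot>\<^bsub>Q\<^esub> g)" if "R a b x" "R a' b' x'" "R a'' b'' x''"
      "g \<in> hom Q b b'" "g' \<in> hom Q b' b''" "f \<in> hom P a a'" "f' \<in> hom P a' a''"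
      "M x x' f g" "M x' x'' f' g'" for a b x a' b' x' a'' b'' x'' f g f' g'
      by (rule M_comp[OF that(1-3,6,7,4,5,8,9)])
  qed (fact P Q obQ | erule RP M_id | erule (2) ffQ)+
  then obtain G y where G: "is_functor Q P G" "\<And>b. b \<in> Obj Q \<Longrightarrow> R (fobj G b) b (y b)"
    "\<And>g. g \<in> Arr Q \<Longrightarrow> M (y (src Q g)) (y (tgt Q g)) (fmap G g) g"
    by blast
  have 1: "naturally_isomorphic P P (id_functor P) (comp_functor P G F)"
    by (rule span_unit(1)[of P Q F G R x M y]; fact)
  have 2: "naturally_isomorphic Q Q (comp_functor Q F G) (id_functor Q)"
  proof (rule span_unit(2)[of Q P G F "\<lambda>b a. R a b" y "\<lambda>x x' g f. M x x' f g" x])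
    show "M x x'' (f' \<cdot>\<^bsub>P\<^esub> f) (g' \<cdot>\<^bsub>Q\<^esub> g)" if "R a b x" "R a' b' x'" "R a'' b'' x''"
      "g \<in> hom Q b b'" "g' \<in> hom Q b' b''" "f \<in> hom P a a'" "f' \<in> hom P a' a''"
      "M x x' f g" "M x' x'' f' g'" for a b x a' b' x' a'' b'' x'' f g f' g'
      by (rule M_comp[OF that(1-3,6,7,4,5,8,9)])
  qed (fact F G | erule M_id | erule (2) ffP)+
  have "equivalence P Q F G" unfolding equivalence_def using 1 2 F(1) G(1) by simp
  then show ?thesis using F G by (intro exI[of _ F] exI[of _ G] exI[of _ x] exI[of _ y]) simp
qed

section \<open>Small sets\<close>

lemma small_lepoll: "small U X \<Longrightarrow> Y \<lesssim> X \<Longrightarrow> small U Y"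
  unfolding small_def by (rule lesspoll_trans1)

lemma small_subset: "small U X \<Longrightarrow> Y \<subseteq> X \<Longrightarrow> small U Y"
  by (erule small_lepoll) (rule subset_imp_lepoll)

lemma small_image: "small U X \<Longrightarrow> small U (f ` X)"
  by (erule small_lepoll) (rule image_lepoll)

lemma small_inject:
  fixes X :: "'x set" and U :: "'u itself"
  assumes "small U X"
  obtains f :: "'x \<Rightarrow> 'u" where "inj_on f X" "small U (f ` X)"
proof -
  obtain f :: "'x \<Rightarrow> 'u" where "inj_on f X"
    using assms unfolding small_def lesspoll_def lepoll_def by blast
  then show ?thesis using that small_image[OF assms] by blast
qed

lemma small_Pow:
  fixes X :: "'x set" and U :: "'u itself"
  assumes U: "universe U" and X: "small U X"
  shows "small U (Pow X)"
proof -
  obtain f :: "'x \<Rightarrow> 'u" where f: "inj_on f X" "small U (f ` X)" using small_inject[OF X] by blast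
  have "inj_on ((`) f) (Pow X)" using f(1) by (rule inj_on_image_Pow)
  then have "Pow X \<lesssim> Pow (f ` X)" unfolding lepoll_def by (intro exI[of _ "(`) f"]) auto
  moreover have "small U (Pow (f ` X))" using U f(2) unfolding universe_def by blast
  ultimately show ?thesis using small_lepoll by blast
qed

lemma small_finite: "universe U \<Longrightarrow> finite X \<Longrightarrow> small U X"
  unfolding universe_def small_def by (simp add: finite_lesspoll_infinite)

text \<open>The union axiom of \<open>universe\<close> is indexed by elements of \<open>'u\<close>;
  an injection of \<open>I\<close> into \<open>'u\<close> transports the index set.\<close>

lemma small_UN:
  fixes I :: "'i set" and X :: "'i \<Rightarrow> 'u set" and U :: "'u itself"
  assumes U: "universe U" and I: "small U I" and X: "\<And>i. i \<in> I \<Longrightarrow> small U (X i)"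
  shows "small U (\<Union>i\<in>I. X i)"
proof -
  obtain f :: "'i \<Rightarrow> 'u" where f: "inj_on f I" "small U (f ` I)" using small_inject[OF I] by blast
  have "small U (\<Union>j\<in>f ` I. X (inv_into I f j))"
  proof -
    have *: "\<forall>j\<in>f ` I. small U (X (inv_into I f j))" using X by (simp add: f(1))
    have UN: "small U J \<and> (\<forall>j\<in>J. small U (Y j)) \<Longrightarrow> small U (\<Union>j\<in>J. Y j)"
      for J :: "'u set" and Y :: "'u \<Rightarrow> 'u set" using U unfolding universe_def by blast
    show ?thesis by (rule UN) (use f(2) * in blast)
  qed
  also have "(\<Union>j\<in>f ` I. X (inv_into I f j)) = (\<Union>i\<in>I. X i)" using f by auto
  finally show ?thesis .
qed

text \<open>Binary unions arise as unions over the booleans, and Kuratowski pairs embed the product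
  into a double power set, so the axioms on unions and power sets suffice.\<close>

lemma small_Times:
  fixes X Y :: "'u set" and U :: "'u itself"
  assumes U: "universe U" and X: "small U X" and Y: "small U Y"
  shows "small U (X \<times> Y)"
proof -
  have "small U (\<Union>b\<in>UNIV. if b then X else Y)"
    by (rule small_UN[OF U]) (use assms small_finite[OF U, of "UNIV :: bool set"] in auto)
  then have "small U (X \<union> Y)" by (simp add: Un_commute UNIV_bool)
  then have 1: "small U (Pow (Pow (X \<union> Y)))" by (intro small_Pow[OF U])
  have "inj_on (\<lambda>(x, y). {{x}, {x, y}}) (X \<times> Y)"
  proof (rule inj_onI, clarify)
    fix a b c d assume "{{a}, {a, b}} = {{c}, {c, d}}"
    then show "a = c \<and> b = d" unfolding doubleton_eq_iff by auto
  qed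
  moreover have "(\<lambda>(x, y). {{x}, {x, y}}) ` (X \<times> Y) \<subseteq> Pow (Pow (X \<union> Y))" by blast
  ultimately have "X \<times> Y \<lesssim> Pow (Pow (X \<union> Y))" unfolding lepoll_def by blast
  then show ?thesis by (rule small_lepoll[OF 1])
qed

section \<open>Equivalences are fully faithful and essentially surjective\<close>

lemma is_isoD:
  assumes "is_iso B k"
  obtains k' where "k \<in> Arr B" "k' \<in> Arr B" "src B k' = tgt B k" "tgt B k' = src B k"
    "k' \<cdot>\<^bsub>B\<^esub> k = ident B (src B k)" "k \<cdot>\<^bsub>B\<^esub> k' = ident B (tgt B k)"
  using assms unfolding is_iso_def hom_def by blast

text \<open>Naturality recovers \<open>f\<close> from \<open>fmap G (fmap F f)\<close> by cancelling
  an invertible component. Both directions of the isomorphism are allowed, since an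
  \<open>equivalence\<close> supplies one direction for each of the two composites; hence the lemma
  applies to either functor.\<close>

lemma unit_faithful:
  assumes F: "is_functor A B F" and G: "is_functor B A G"
    and n: "naturally_isomorphic A A (id_functor A) (comp_functor A G F)
      \<or> naturally_isomorphic A A (comp_functor A G F) (id_functor A)"
    and f: "f \<in> hom A x y" "g \<in> hom A x y" "fmap F f = fmap F g"
  shows "f = g"
proof -
  interpret A: cat A by standard (rule functorD[OF F])
  note Fs = functorD[OF F] and Gs = functorD[OF G]
  have c: "fmap (comp_functor A G F) h = fmap G (fmap F h)" "fmap (id_functor A) h = h" if "h \<in> Arr A" for h
    using that by (simp_all add: comp_functor_def id_functor_def)
  have c': "fobj (comp_functor A G F) a = fobj G (fobj F a)" "fobj (id_functor A) a = a" if "a \<in> Obj A" for a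
    using that by (simp_all add: comp_functor_def id_functor_def)
  have fg: "f \<in> Arr A" "src A f = x" "tgt A f = y" "g \<in> Arr A" "src A g = x" "tgt A g = y" using f by auto
  have xy: "x \<in> Obj A" "y \<in> Obj A" using fg by auto
  show ?thesis using n
  proof
    assume "naturally_isomorphic A A (id_functor A) (comp_functor A G F)"
    then obtain \<tau> where \<tau>: "nat_trans A A (id_functor A) (comp_functor A G F) \<tau>" "\<forall>x\<in>Obj A. is_iso A (\<tau> x)"
      unfolding naturally_isomorphic_def by auto
    note t = nat_transD[OF A.category A.category \<tau>(1)]
    obtain k where k: "k \<in> Arr A" "src A k = tgt A (\<tau> y)" "tgt A k = src A (\<tau> y)" "k \<cdot>\<^bsub>A\<^esub> \<tau> y = ident A (src A (\<tau> y))"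
      using is_isoD[of A "\<tau> y"] \<tau>(2) xy by metis
    have "\<tau> y \<cdot>\<^bsub>A\<^esub> f = \<tau> y \<cdot>\<^bsub>A\<^esub> g" using t(4)[of f] t(4)[of g] fg f(3) by (simp add: c)
    then have "k \<cdot>\<^bsub>A\<^esub> (\<tau> y \<cdot>\<^bsub>A\<^esub> f) = k \<cdot>\<^bsub>A\<^esub> (\<tau> y \<cdot>\<^bsub>A\<^esub> g)" by simp
    then show ?thesis using k t(1-3)[of y] xy fg by (simp add: A.ext2[OF k(4)] c')
  next
    assume "naturally_isomorphic A A (comp_functor A G F) (id_functor A)"
    then obtain \<tau> where \<tau>: "nat_trans A A (comp_functor A G F) (id_functor A) \<tau>" "\<forall>x\<in>Obj A. is_iso A (\<tau> x)"
      unfolding naturally_isomorphic_def by auto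
    note t = nat_transD[OF A.category A.category \<tau>(1)]
    obtain k where k: "k \<in> Arr A" "src A k = tgt A (\<tau> x)" "tgt A k = src A (\<tau> x)" "\<tau> x \<cdot>\<^bsub>A\<^esub> k = ident A (tgt A (\<tau> x))"
      using is_isoD[of A "\<tau> x"] \<tau>(2) xy by metis
    have "f \<cdot>\<^bsub>A\<^esub> \<tau> x = g \<cdot>\<^bsub>A\<^esub> \<tau> x" using t(4)[of f] t(4)[of g] fg f(3) by (simp add: c)
    then have "(f \<cdot>\<^bsub>A\<^esub> \<tau> x) \<cdot>\<^bsub>A\<^esub> k = (g \<cdot>\<^bsub>A\<^esub> \<tau> x) \<cdot>\<^bsub>A\<^esub> k" by simp
    then show ?thesis using k t(1-3)[of x] xy fg by (simp add: c')
  qed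
qed

lemma equivalence_faithful:
  assumes "equivalence A B F G" "f \<in> hom A x y" "g \<in> hom A x y" "fmap F f = fmap F g"
  shows "f = g"
  by (rule unit_faithful[OF _ _ _ assms(2-4), where G = G]) (use assms(1) in \<open>auto simp: equivalence_def\<close>)

text \<open>The preimage is \<open>fmap G h\<close> conjugated by the unit. Its image under
  \<open>F\<close> has the same image under \<open>G\<close> as \<open>h\<close>, and
  \<open>G\<close> is faithful by \<open>unit_faithful\<close>.\<close>

lemma equivalence_full:
  assumes e: "equivalence A B F G" and xy: "x \<in> Obj A" "y \<in> Obj A" and h: "h \<in> hom B (fobj F x) (fobj F y)"
  obtains f where "f \<in> Arr A" "src A f = x" "tgt A f = y" "fmap F f = h"
proof -
  have F: "is_functor A B F" and G: "is_functor B A G" using e unfolding equivalence_def by auto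
  interpret A: cat A by standard (rule functorD[OF F])
  interpret B: cat B by standard (rule functorD[OF F])
  note Fs = functorD[OF F] and Gs = functorD[OF G]
  have hh: "h \<in> Arr B" "src B h = fobj F x" "tgt B h = fobj F y" using h by auto
  have c: "fmap (comp_functor A G F) h = fmap G (fmap F h)" "fmap (id_functor A) h = h" if "h \<in> Arr A" for h
    using that by (simp_all add: comp_functor_def id_functor_def)
  have c': "fobj (comp_functor A G F) a = fobj G (fobj F a)" "fobj (id_functor A) a = a" if "a \<in> Obj A" for a
    using that by (simp_all add: comp_functor_def id_functor_def)
  obtain \<tau> where \<tau>: "nat_trans A A (id_functor A) (comp_functor A G F) \<tau>" "\<forall>x\<in>Obj A. is_iso A (\<tau> x)"
    using e unfolding equivalence_def naturally_isomorphic_def by auto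
  note t = nat_transD[OF A.category A.category \<tau>(1)]
  obtain ix where ix: "ix \<in> Arr A" "src A ix = tgt A (\<tau> x)" "tgt A ix = src A (\<tau> x)"
     "ix \<cdot>\<^bsub>A\<^esub> \<tau> x = ident A (src A (\<tau> x))" "\<tau> x \<cdot>\<^bsub>A\<^esub> ix = ident A (tgt A (\<tau> x))"
    using is_isoD[of A "\<tau> x"] \<tau>(2) xy by metis
  obtain iy where iy: "iy \<in> Arr A" "src A iy = tgt A (\<tau> y)" "tgt A iy = src A (\<tau> y)"
     "iy \<cdot>\<^bsub>A\<^esub> \<tau> y = ident A (src A (\<tau> y))" "\<tau> y \<cdot>\<^bsub>A\<^esub> iy = ident A (tgt A (\<tau> y))"
    using is_isoD[of A "\<tau> y"] \<tau>(2) xy by metis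
  note tx = t(1-3)[OF xy(1)] and ty = t(1-3)[OF xy(2)]
  let ?Gh = "fmap G h"
  have Gh: "?Gh \<in> Arr A" "src A ?Gh = fobj G (fobj F x)" "tgt A ?Gh = fobj G (fobj F y)" using Gs hh by auto
  define f where "f = iy \<cdot>\<^bsub>A\<^esub> (?Gh \<cdot>\<^bsub>A\<^esub> \<tau> x)"
  have f: "f \<in> Arr A" "src A f = x" "tgt A f = y" unfolding f_def using Gh tx ty ix iy xy by (auto simp: c')
  have "fmap G (fmap F f) \<cdot>\<^bsub>A\<^esub> \<tau> x = \<tau> y \<cdot>\<^bsub>A\<^esub> f" using t(4)[of f] f by (simp add: c)
  also have "\<dots> = ?Gh \<cdot>\<^bsub>A\<^esub> \<tau> x" unfolding f_def using Gh tx ty iy xy by (simp add: c' A.ext2[OF iy(5)])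
  finally have "(fmap G (fmap F f) \<cdot>\<^bsub>A\<^esub> \<tau> x) \<cdot>\<^bsub>A\<^esub> ix = (?Gh \<cdot>\<^bsub>A\<^esub> \<tau> x) \<cdot>\<^bsub>A\<^esub> ix" by simp
  then have eq: "fmap G (fmap F f) = ?Gh" using Gh tx ix f Fs Gs xy by (simp add: c')
  have "fmap F f = h"
    by (rule unit_faithful[OF G F, of _ "fobj F x" "fobj F y"])
      (use e Fs f hh eq in \<open>auto simp: equivalence_def\<close>)
  then show ?thesis using that f by blast
qed

lemma equivalence_ess_surj:
  assumes e: "equivalence A B F G" and b: "b \<in> Obj B"
  obtains a k k' where "a \<in> Obj A" "k \<in> Arr B" "src B k = fobj F a" "tgt B k = b"
    "k' \<in> Arr B" "src B k' = b" "tgt B k' = fobj F a"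
    "k' \<cdot>\<^bsub>B\<^esub> k = ident B (fobj F a)" "k \<cdot>\<^bsub>B\<^esub> k' = ident B b"
proof -
  have F: "is_functor A B F" and G: "is_functor B A G" using e unfolding equivalence_def by auto
  obtain \<tau> where \<tau>: "nat_trans B B (comp_functor B F G) (id_functor B) \<tau>" "\<forall>x\<in>Obj B. is_iso B (\<tau> x)"
    using e unfolding equivalence_def naturally_isomorphic_def by auto
  note t = nat_transD[OF functorD(2)[OF F] functorD(2)[OF F] \<tau>(1)]
  have "is_iso B (\<tau> b)" using \<tau>(2) b by blast
  from is_isoD[OF this] show ?thesis
    using that[of "fobj G b" "\<tau> b"] functorD(3)[OF G b] t(1-3)[OF b] b
    by (auto simp: comp_functor_def id_functor_def)
qed

section \<open>Extensive categories\<close>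

context cat
begin

lemma binary_coproduct_iso:
  assumes c: "is_binary_coproduct C x y s i j"
    and h: "h \<in> Arr C" "src C h = s" "k \<in> Arr C" "src C k = tgt C h" "tgt C k = s"
      "k \<cdot> h = ident C s" "h \<cdot> k = ident C (tgt C h)"
  shows "is_binary_coproduct C x y (tgt C h) (h \<cdot> i) (h \<cdot> j)"
proof -
  note d = binary_coproductD[OF c]
  have "is_coproduct C UNIV (\<lambda>b. if b then x else y) (tgt C h)
    (\<lambda>b. h \<cdot> ((if b then i else j) \<cdot> ident C (if b then x else y)))"
    by (rule coproduct_iso[OF c[unfolded binary_coproduct_iff] h,
          of "\<lambda>b. ident C (if b then x else y)" _ "\<lambda>b. ident C (if b then x else y)"])
      (use d in auto)
  then show ?thesis unfolding binary_coproduct_iff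
    by (rule coproduct_cong) (use d in auto)
qed

lemma initial_coproduct:
  assumes "x \<in> Obj C" "is_initial C (src C j)" "j \<in> Arr C" "tgt C j = x"
  shows "is_binary_coproduct C x (src C j) x (ident C x) j"
proof (rule binary_coproductI)
  show "\<exists>h\<in>hom C x z. h \<cdot> ident C x = f \<and> h \<cdot> j = g" if "f \<in> hom C x z" "g \<in> hom C (src C j) z" for z f g
    using that assms by (intro bexI[of _ f]) (auto intro!: initial_eq)
qed (use assms in auto)

lemma binary_coproduct_unique:
  assumes "is_binary_coproduct C x y s i j" "is_binary_coproduct C x y s' i' j'"
  obtains h k where "h \<in> Arr C" "src C h = s" "tgt C h = s'" "k \<in> Arr C" "src C k = s'" "tgt C k = s"
    "k \<cdot> h = ident C s" "h \<cdot> k = ident C s'" "h \<cdot> i = i'" "h \<cdot> j = j'" "k \<cdot> i' = i" "k \<cdot> j' = j"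
proof -
  obtain h k where hk: "h \<in> Arr C" "src C h = s" "tgt C h = s'" "k \<in> Arr C" "src C k = s'" "tgt C k = s"
    "k \<cdot> h = ident C s" "h \<cdot> k = ident C s'"
    "\<And>b :: bool. h \<cdot> (if b then i else j) = (if b then i' else j')"
    "\<And>b :: bool. k \<cdot> (if b then i' else j') = (if b then i else j)"
    using coproduct_unique[OF assms[unfolded binary_coproduct_iff]] by (metis UNIV_I)
  show ?thesis
    using that[OF hk(1-8)] hk(9)[of True] hk(9)[of False] hk(10)[of True] hk(10)[of False] by simp
qed

end

text \<open>Extensivity is a statement about one choice of coproducts. It is exploited here for that
  choice and transported to arbitrary coproducts afterwards, along the comparison
  isomorphism.\<close>

locale chosen_coproducts = cat +
  fixes S :: "'a \<Rightarrow> 'a \<Rightarrow> 'a" and l r :: "'a \<Rightarrow> 'a \<Rightarrow> 'b"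
  assumes choice: "binary_coproduct_choice C S l r"
begin

lemma chosen: "a \<in> Obj C \<Longrightarrow> b \<in> Obj C \<Longrightarrow> is_binary_coproduct C a b (S a b) (l a b) (r a b)"
  using choice unfolding binary_coproduct_choice_def by blast

lemma lr [simp]:
  assumes "a \<in> Obj C" "b \<in> Obj C"
  shows "S a b \<in> Obj C" "l a b \<in> Arr C" "src C (l a b) = a" "tgt C (l a b) = S a b"
    "r a b \<in> Arr C" "src C (r a b) = b" "tgt C (r a b) = S a b"
  using binary_coproductD[OF chosen[OF assms]] by auto

lemma sum_arr_ex1:
  assumes "f \<in> Arr C" "g \<in> Arr C"
  shows "\<exists>!h. h \<in> hom C (S (src C f) (src C g)) (S (tgt C f) (tgt C g)) \<and>
        h \<cdot> l (src C f) (src C g) = l (tgt C f) (tgt C g) \<cdot> f \<and>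
        h \<cdot> r (src C f) (src C g) = r (tgt C f) (tgt C g) \<cdot> g"
proof -
  have c: "is_binary_coproduct C (src C f) (src C g) (S (src C f) (src C g))
      (l (src C f) (src C g)) (r (src C f) (src C g))"
    using chosen assms by simp
  obtain h where h: "h \<in> Arr C" "src C h = S (src C f) (src C g)" "tgt C h = S (tgt C f) (tgt C g)"
    "h \<cdot> l (src C f) (src C g) = l (tgt C f) (tgt C g) \<cdot> f"
    "h \<cdot> r (src C f) (src C g) = r (tgt C f) (tgt C g) \<cdot> g"
    by (rule binary_coproduct_ex[OF c, of "l (tgt C f) (tgt C g) \<cdot> f" _ "r (tgt C f) (tgt C g) \<cdot> g"])
      (use assms in auto)
  show ?thesis
    using h binary_coproduct_eq c by auto
qed

lemma sum_arr:
  assumes "f \<in> Arr C" "g \<in> Arr C"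
  shows "sum_arr C S l r f g \<in> Arr C"
    "src C (sum_arr C S l r f g) = S (src C f) (src C g)"
    "tgt C (sum_arr C S l r f g) = S (tgt C f) (tgt C g)"
    "sum_arr C S l r f g \<cdot> l (src C f) (src C g) = l (tgt C f) (tgt C g) \<cdot> f"
    "sum_arr C S l r f g \<cdot> r (src C f) (src C g) = r (tgt C f) (tgt C g) \<cdot> g"
  using theI'[OF sum_arr_ex1[OF assms]] unfolding sum_arr_def[symmetric] by auto

context
  fixes a b G
  assumes ab: "a \<in> Obj C" "b \<in> Obj C"
    and eqv: "equivalence (prod_cat (slice_cat C a) (slice_cat C b)) (slice_cat C (S a b))
             (sum_functor C S l r a b) G"
begin

abbreviation (input) "K \<equiv> sum_functor C S l r a b"

lemma sum_fobj: "g \<in> Arr C \<Longrightarrow> h \<in> Arr C \<Longrightarrow> tgt C g = a \<Longrightarrow> tgt C h = b \<Longrightarrow>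
    fobj K (g, h) = sum_arr C S l r g h"
  by (simp add: sum_functor_def prod_cat_def slice_cat_def)

lemma sum_fmap: "((f, h, f'), (g, k, g')) \<in> Arr (prod_cat (slice_cat C a) (slice_cat C b)) \<Longrightarrow>
    fmap K ((f, h, f'), (g, k, g')) =
      (sum_arr C S l r f g, sum_arr C S l r h k, sum_arr C S l r f' g')"
  by (simp add: sum_functor_def)

text \<open>Essential surjectivity of the sum functor: as an object over \<open>S a b\<close>, the
  arrow \<open>f\<close> is isomorphic to the sum of some \<open>g\<close> and \<open>h\<close>, and
  the coprojections of the domain of that sum are carried along the isomorphism.\<close>

lemma chosen_decompose:
  assumes f: "f \<in> Arr C" "tgt C f = S a b"
  obtains z1 z2 p p' g h where "is_binary_coproduct C z1 z2 (src C f) p p'"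
    "g \<in> hom C z1 a" "h \<in> hom C z2 b" "f \<cdot> p = l a b \<cdot> g" "f \<cdot> p' = r a b \<cdot> h"
proof -
  have "f \<in> Obj (slice_cat C (S a b))" using f by (simp add: slice_cat_def)
  then obtain gh k k' where gh: "gh \<in> Obj (prod_cat (slice_cat C a) (slice_cat C b))"
    and k: "k \<in> Arr (slice_cat C (S a b))" "src (slice_cat C (S a b)) k = fobj K gh"
      "tgt (slice_cat C (S a b)) k = f"
      "k' \<in> Arr (slice_cat C (S a b))" "src (slice_cat C (S a b)) k' = f"
      "tgt (slice_cat C (S a b)) k' = fobj K gh"
      "k' \<cdot>\<^bsub>slice_cat C (S a b)\<^esub> k = ident (slice_cat C (S a b)) (fobj K gh)"
      "k \<cdot>\<^bsub>slice_cat C (S a b)\<^esub> k' = ident (slice_cat C (S a b)) f"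
    by (rule equivalence_ess_surj[OF eqv])
  obtain g h where gh_eq: "gh = (g, h)" and g: "g \<in> Arr C" "tgt C g = a" and h: "h \<in> Arr C" "tgt C h = b"
    using gh by (auto simp: prod_cat_def slice_cat_def)
  have K: "fobj K gh = sum_arr C S l r g h" using sum_fobj g h gh_eq by simp
  note s = sum_arr[OF g(1) h(1)]
  obtain t where t: "t \<in> Arr C" "src C t = S (src C g) (src C h)" "tgt C t = src C f"
    "f \<cdot> t = sum_arr C S l r g h" "k = (sum_arr C S l r g h, t, f)"
    using k(1-3) s by (auto simp: slice_cat_def K)
  obtain t' where t': "t' \<in> Arr C" "src C t' = src C f" "tgt C t' = S (src C g) (src C h)"
    "k' = (f, t', sum_arr C S l r g h)"
  proof (cases k')
    case (fields x1 x2 x3)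
    then have x: "x1 = f" "x3 = sum_arr C S l r g h" using k(5,6) by (simp_all add: slice_cat_def K)
    then have "x2 \<in> hom C (src C f) (src C (sum_arr C S l r g h))"
      using k(4) unfolding fields by (simp add: slice_cat_def)
    then show ?thesis using that[of x2] s(2) fields x by simp
  qed
  have tt: "t' \<cdot> t = ident C (S (src C g) (src C h))" "t \<cdot> t' = ident C (src C f)"
    using k(7,8) s by (auto simp: slice_cat_def K t(5) t'(4))
  have c: "is_binary_coproduct C (src C g) (src C h) (src C f)
      (t \<cdot> l (src C g) (src C h)) (t \<cdot> r (src C g) (src C h))"
    using binary_coproduct_iso[OF chosen[of "src C g" "src C h"], of t t'] t t' tt g h by simp
  have "f \<cdot> (t \<cdot> l (src C g) (src C h)) = l a b \<cdot> g" "f \<cdot> (t \<cdot> r (src C g) (src C h)) = r a b \<cdot> h"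
    using ext2[OF t(4), of "l (src C g) (src C h)"] ext2[OF t(4), of "r (src C g) (src C h)"] g h t(1-3) s f
    by simp_all
  then show ?thesis using that[OF c] g h by simp
qed

text \<open>Full faithfulness of the sum functor gives the universal property. A cone concerns the
  first summand only, so it is completed by the initial object \<open>z0\<close> in the second one,
  which turns it into an arrow of the slice between two sums.\<close>

lemma chosen_pullback:
  assumes z: "is_initial C z0" and c: "is_binary_coproduct C z1 z2 (src C f) p p'"
    and f: "f \<in> Arr C" "tgt C f = S a b"
    and g: "g \<in> hom C z1 a" and h: "h \<in> hom C z2 b"
    and e: "f \<cdot> p = l a b \<cdot> g" "f \<cdot> p' = r a b \<cdot> h"
  shows "is_pullback C p g f (l a b)"
proof -
  note d = binary_coproductD[OF c]
  have gh: "g \<in> Arr C" "src C g = z1" "tgt C g = a" "h \<in> Arr C" "src C h = z2" "tgt C h = b"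
    using g h by auto
  note s = sum_arr[OF gh(1,4), unfolded gh]
  have zO: "z0 \<in> Obj C" using z by (rule initial_Obj)
  obtain v where v: "v \<in> Arr C" "src C v = z0" "tgt C v = b" using initial_arr[OF z ab(2)] by blast
  obtain v' where v': "v' \<in> Arr C" "src C v' = z0" "tgt C v' = z2" using initial_arr[OF z d(2)] by blast
  have hv: "h \<cdot> v' = v" by (rule initial_eq) (use v v' gh z in auto)
  obtain t t' where t: "t \<in> Arr C" "src C t = src C f" "tgt C t = S z1 z2"
    "t' \<in> Arr C" "src C t' = S z1 z2" "tgt C t' = src C f"
    "t' \<cdot> t = ident C (src C f)" "t \<cdot> t' = ident C (S z1 z2)"
    "t \<cdot> p = l z1 z2" "t \<cdot> p' = r z1 z2" "t' \<cdot> l z1 z2 = p" "t' \<cdot> r z1 z2 = p'"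
    by (rule binary_coproduct_unique[OF c chosen[OF d(1,2)]])
  have ft: "sum_arr C S l r g h \<cdot> t = f"
    by (rule binary_coproduct_eq[OF c]) (use s t f d e ab gh in auto)
  have prodArr: "((x, k, g), (v, v', h)) \<in> Arr (prod_cat (slice_cat C a) (slice_cat C b))"
    "((x, k, g), (v, v', h)) \<in> hom (prod_cat (slice_cat C a) (slice_cat C b)) (x, v) (g, h)"
    if "k \<in> Arr C" "tgt C k = z1" "g \<cdot> k = x" for k x
    using that v v' gh hv by (auto simp: prod_cat_def slice_cat_def hom_def)
  show ?thesis
  proof (rule pullbackI)
    fix w y assume w: "w \<in> Arr C" "y \<in> Arr C" "src C w = src C y" "tgt C w = src C f"
      "tgt C y = src C (l a b)" "f \<cdot> w = l a b \<cdot> y"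
    have yO: "src C y \<in> Obj C" using w by simp
    note sy = sum_arr[OF w(2) v(1)]
    \<comment> \<open>The cone becomes an arrow \<open>m\<close> over \<open>S a b\<close> from the
      sum of \<open>y\<close> and \<open>v\<close> to the sum of \<open>g\<close> and
      \<open>h\<close>. By fullness it is itself a sum of arrows \<open>k1\<close> and
      \<open>k2\<close>, and \<open>k1\<close> is the mediating arrow.\<close>
    obtain m where m: "m \<in> Arr C" "src C m = S (src C y) z0" "tgt C m = S z1 z2"
      "m \<cdot> l (src C y) z0 = t \<cdot> w" "m \<cdot> r (src C y) z0 = r z1 z2 \<cdot> v'"
      by (rule binary_coproduct_ex[OF chosen[OF yO zO], of "t \<cdot> w" "S z1 z2" "r z1 z2 \<cdot> v'"])
        (use w t v' d in auto)
    have e1: "sum_arr C S l r g h \<cdot> (t \<cdot> w) = l a b \<cdot> y"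
      using ext2[OF ft, of w] w s t by simp
    have e2: "sum_arr C S l r g h \<cdot> (r z1 z2 \<cdot> v') = r a b \<cdot> v"
      using ext2[OF s(5), of v'] v' d s gh ab hv by simp
    have me: "sum_arr C S l r g h \<cdot> m = sum_arr C S l r y v"
      by (rule binary_coproduct_eq[OF chosen[OF yO zO]])
        (use s sy w(1,2,5) v m d ab zO e1 e2 in simp_all)
    have obj: "(y, v) \<in> Obj (prod_cat (slice_cat C a) (slice_cat C b))"
      "(g, h) \<in> Obj (prod_cat (slice_cat C a) (slice_cat C b))"
      using w v gh ab by (auto simp: prod_cat_def slice_cat_def)
    have fo: "fobj K (y, v) = sum_arr C S l r y v" "fobj K (g, h) = sum_arr C S l r g h"
      using sum_fobj w v gh ab by auto
    have "(sum_arr C S l r y v, m, sum_arr C S l r g h) \<in>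
        hom (slice_cat C (S a b)) (fobj K (y, v)) (fobj K (g, h))"
      using m s sy v w ab gh me unfolding fo by (auto simp: slice_cat_def hom_def)
    then obtain q where q: "q \<in> Arr (prod_cat (slice_cat C a) (slice_cat C b))"
      "src (prod_cat (slice_cat C a) (slice_cat C b)) q = (y, v)"
      "tgt (prod_cat (slice_cat C a) (slice_cat C b)) q = (g, h)"
      "fmap K q = (sum_arr C S l r y v, m, sum_arr C S l r g h)"
      by (rule equivalence_full[OF eqv obj])
    obtain k1 k2 where qe: "q = ((y, k1, g), (v, k2, h))" and k: "k1 \<in> Arr C" "src C k1 = src C y"
      "tgt C k1 = z1" "g \<cdot> k1 = y" "k2 \<in> Arr C" "src C k2 = z0" "tgt C k2 = z2"
    proof -
      obtain x1 x2 x3 y1 y2 y3 where e: "q = ((x1, x2, x3), (y1, y2, y3))" by (metis prod.exhaust)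
      then have x: "x1 = y" "x3 = g" "y1 = v" "y3 = h"
        using q(2,3) by (simp_all add: prod_cat_def slice_cat_def)
      then have "x2 \<in> hom C (src C y) (src C g)" "g \<cdot> x2 = y" "y2 \<in> hom C (src C v) (src C h)"
        using q(1) unfolding e by (simp_all add: prod_cat_def slice_cat_def)
      then show ?thesis using that[of x2 y2] e x gh v by simp
    qed
    have mk: "m = sum_arr C S l r k1 k2" using q(4) sum_fmap q(1) unfolding qe by auto
    have "t \<cdot> w = l z1 z2 \<cdot> k1" using m(4) sum_arr(4)[OF k(1,5)] k by (simp add: mk)
    then have "t' \<cdot> (t \<cdot> w) = t' \<cdot> (l z1 z2 \<cdot> k1)" by simp
    then have "p \<cdot> k1 = w" using t w k d by (simp add: ext2[OF t(7)] ext2[OF t(11)])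
    then show "\<exists>k\<in>hom C (src C y) (src C p). p \<cdot> k = w \<and> g \<cdot> k = y"
      using k d by (intro bexI[of _ k1]) auto
  next
    fix k k' assume k: "k \<in> Arr C" "k' \<in> Arr C" "src C k = src C k'" "tgt C k = src C p"
      "tgt C k' = src C p" "p \<cdot> k = p \<cdot> k'" "g \<cdot> k = g \<cdot> k'"
    \<comment> \<open>Two mediating arrows give two arrows of the product of slices with the same
      sum, so they coincide by faithfulness.\<close>
    let ?q = "((g \<cdot> k, k, g), (v, v', h))" and ?q' = "((g \<cdot> k, k', g), (v, v', h))"
    have "l z1 z2 \<cdot> k = t \<cdot> (p \<cdot> k)" "l z1 z2 \<cdot> k' = t \<cdot> (p \<cdot> k')"
      by (rule ext2[OF t(9), symmetric]; use k(1,2,4,5) t(1-3) d in simp)+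
    then have lk: "l z1 z2 \<cdot> k = l z1 z2 \<cdot> k'" using k(6) by simp
    note sk = sum_arr[OF k(1) v'(1)] and sk' = sum_arr[OF k(2) v'(1)]
    have kO: "src C k' \<in> Obj C" using k by simp
    have "sum_arr C S l r k v' = sum_arr C S l r k' v'"
      by (rule binary_coproduct_eq[OF chosen[OF kO zO]]) (use sk sk' k v' d lk in auto)
    then have "fmap K ?q = fmap K ?q'"
      using prodArr[of k "g \<cdot> k"] prodArr[of k' "g \<cdot> k"] k d by (simp add: sum_fmap)
    then have "?q = ?q'"
      using equivalence_faithful[OF eqv, of ?q "(g \<cdot> k, v)" "(g, h)" ?q']
        prodArr[of k "g \<cdot> k"] prodArr[of k' "g \<cdot> k"] k d by simp
    then show "k = k'" by simp
  qed (use d gh f ab e in auto)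
qed

end

end

locale extensive_cat = cat +
  assumes extensive: "extensive C"
begin

lemma initial_ex: "\<exists>z. is_initial C z"
  using extensive unfolding extensive_def by blast

lemma coproduct_chosen:
  obtains S l r where "chosen_coproducts C S l r"
    "\<forall>a\<in>Obj C. \<forall>b\<in>Obj C. \<exists>G.
      equivalence (prod_cat (slice_cat C a) (slice_cat C b)) (slice_cat C (S a b))
             (sum_functor C S l r a b) G"
proof -
  obtain S l r where *: "binary_coproduct_choice C S l r"
    "\<forall>a\<in>Obj C. \<forall>b\<in>Obj C. \<exists>G. equivalence (prod_cat (slice_cat C a) (slice_cat C b)) (slice_cat C (S a b))
             (sum_functor C S l r a b) G"
    using extensive unfolding extensive_def by blast
  have "chosen_coproducts C S l r" by unfold_locales (rule *)
  then show ?thesis using * that by blast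
qed

lemma binary_coproduct_exists:
  assumes "a \<in> Obj C" "b \<in> Obj C"
  obtains s i j where "is_binary_coproduct C a b s i j"
  using coproduct_chosen chosen_coproducts.chosen assms by metis

text \<open>The comparison isomorphism \<open>t\<close> from the given coproduct to the chosen one
  transports \<open>chosen_decompose\<close>.\<close>

lemma decompose:
  assumes c: "is_binary_coproduct C x y s i j" and f: "f \<in> Arr C" "tgt C f = s"
  obtains z1 z2 p p' g h where "is_binary_coproduct C z1 z2 (src C f) p p'"
    "g \<in> hom C z1 x" "h \<in> hom C z2 y" "f \<cdot> p = i \<cdot> g" "f \<cdot> p' = j \<cdot> h"
proof -
  note d = binary_coproductD[OF c]
  obtain S l r where ch: "chosen_coproducts C S l r"
    "\<forall>a\<in>Obj C. \<forall>b\<in>Obj C. \<exists>G.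
      equivalence (prod_cat (slice_cat C a) (slice_cat C b)) (slice_cat C (S a b))
             (sum_functor C S l r a b) G" by (rule coproduct_chosen)
  interpret ch: chosen_coproducts C S l r by (rule ch)
  obtain G where G: "equivalence (prod_cat (slice_cat C x) (slice_cat C y)) (slice_cat C (S x y))
             (sum_functor C S l r x y) G" using ch(2) d by blast
  obtain t t' where t: "t \<in> Arr C" "src C t = s" "tgt C t = S x y"
    "t' \<in> Arr C" "src C t' = S x y" "tgt C t' = s"
    "t' \<cdot> t = ident C s" "t \<cdot> t' = ident C (S x y)"
    "t \<cdot> i = l x y" "t \<cdot> j = r x y" "t' \<cdot> l x y = i" "t' \<cdot> r x y = j"
    by (rule binary_coproduct_unique[OF c ch.chosen[OF d(1,2)]])
  have tf: "t \<cdot> f \<in> Arr C" "tgt C (t \<cdot> f) = S x y" using t f by auto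
  obtain z1 z2 p p' g h where z: "is_binary_coproduct C z1 z2 (src C (t \<cdot> f)) p p'"
    "g \<in> hom C z1 x" "h \<in> hom C z2 y" "t \<cdot> f \<cdot> p = l x y \<cdot> g" "t \<cdot> f \<cdot> p' = r x y \<cdot> h"
    by (rule ch.chosen_decompose[OF d(1,2) G tf])
  have z1: "is_binary_coproduct C z1 z2 (src C f) p p'" using z(1) t f by simp
  note dz = binary_coproductD[OF z1]
  have "t' \<cdot> (t \<cdot> f \<cdot> p) = t' \<cdot> (l x y \<cdot> g)" "t' \<cdot> (t \<cdot> f \<cdot> p') = t' \<cdot> (r x y \<cdot> h)" using z by auto
  then have "f \<cdot> p = i \<cdot> g" "f \<cdot> p' = j \<cdot> h"
    using t f dz z(2,3) d by (simp_all add: ext2[OF t(7)] ext2[OF t(11)] ext2[OF t(12)])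
  then show ?thesis using that[OF z1 z(2,3)] by blast
qed

text \<open>Composition with the invertible comparison \<open>t\<close> turns the square into one
  over the chosen coproduct, where \<open>chosen_pullback\<close> applies, and leaves the cones
  unchanged.\<close>

lemma sum_pullback:
  assumes c: "is_binary_coproduct C x y s i j" and cz: "is_binary_coproduct C z1 z2 (src C f) p p'"
    and f: "f \<in> Arr C" "tgt C f = s"
    and g: "g \<in> hom C z1 x" and h: "h \<in> hom C z2 y"
    and e: "f \<cdot> p = i \<cdot> g" "f \<cdot> p' = j \<cdot> h"
  shows "is_pullback C p g f i"
proof -
  note d = binary_coproductD[OF c]
  note dz = binary_coproductD[OF cz]
  have gh: "g \<in> Arr C" "src C g = z1" "tgt C g = x" "h \<in> Arr C" "src C h = z2" "tgt C h = y"
    using g h by auto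
  obtain S l r where ch: "chosen_coproducts C S l r"
    "\<forall>a\<in>Obj C. \<forall>b\<in>Obj C. \<exists>G.
      equivalence (prod_cat (slice_cat C a) (slice_cat C b)) (slice_cat C (S a b))
             (sum_functor C S l r a b) G" by (rule coproduct_chosen)
  interpret ch: chosen_coproducts C S l r by (rule ch)
  obtain G where G: "equivalence (prod_cat (slice_cat C x) (slice_cat C y)) (slice_cat C (S x y))
             (sum_functor C S l r x y) G" using ch(2) d by blast
  obtain z where z: "is_initial C z" using initial_ex by blast
  obtain t t' where t: "t \<in> Arr C" "src C t = s" "tgt C t = S x y"
    "t' \<in> Arr C" "src C t' = S x y" "tgt C t' = s"
    "t' \<cdot> t = ident C s" "t \<cdot> t' = ident C (S x y)"
    "t \<cdot> i = l x y" "t \<cdot> j = r x y" "t' \<cdot> l x y = i" "t' \<cdot> r x y = j"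
    by (rule binary_coproduct_unique[OF c ch.chosen[OF d(1,2)]])
  have tf: "t \<cdot> f \<in> Arr C" "tgt C (t \<cdot> f) = S x y" "src C (t \<cdot> f) = src C f" using t f by auto
  have pb: "is_pullback C p g (t \<cdot> f) (l x y)"
    by (rule ch.chosen_pullback[OF d(1,2) G z _ tf(1,2) g h, of p p', unfolded tf(3), OF cz])
      (use t f dz d gh e in \<open>simp_all add: ext2[OF t(9)] ext2[OF t(10)]\<close>)
  show ?thesis
  proof (rule pullbackI)
    fix a b assume ab: "a \<in> Arr C" "b \<in> Arr C" "src C a = src C b" "tgt C a = src C f" "tgt C b = src C i"
      "f \<cdot> a = i \<cdot> b"
    obtain k where "k \<in> Arr C" "src C k = src C a" "tgt C k = src C p" "p \<cdot> k = a" "g \<cdot> k = b"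
      by (rule pullback_ex[OF pb, of a b]) (use ab t f d in \<open>auto simp: ext2[OF t(9)]\<close>)
    then show "\<exists>k\<in>hom C (src C b) (src C p). p \<cdot> k = a \<and> g \<cdot> k = b" using ab by (intro bexI[of _ k]) auto
  next
    fix h k assume "h \<in> Arr C" "k \<in> Arr C" "src C h = src C k" "tgt C h = src C p" "tgt C k = src C p"
      "p \<cdot> h = p \<cdot> k" "g \<cdot> h = g \<cdot> k"
    then show "h = k" by (rule pullback_eq[OF pb])
  qed (use d dz f gh e in auto)
qed

text \<open>With an arrow from an initial object into \<open>y\<close>, the coproduct of
  \<open>x\<close> and an initial object, again \<open>x\<close>, lies over that of \<open>x\<close>
  and \<open>y\<close>. So \<open>sum_pullback\<close> says that the kernel pair of \<open>i\<close>
  consists of identities.\<close>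

lemma coprojection_mono1:
  assumes c: "is_binary_coproduct C x y s i j"
  shows "is_mono C i"
proof (rule is_monoI)
  note d = binary_coproductD[OF c]
  show "i \<in> Arr C" by (rule d)
  obtain z where z: "is_initial C z" using initial_ex by blast
  obtain m where m: "m \<in> Arr C" "src C m = z" "tgt C m = x" using initial_arr[OF z d(1)] by blast
  obtain n where n: "n \<in> Arr C" "src C n = z" "tgt C n = y" using initial_arr[OF z d(2)] by blast
  have "is_binary_coproduct C x z x (ident C x) m" using initial_coproduct[of x m] d m z by simp
  then have pb: "is_pullback C (ident C x) (ident C x) i i"
    by (intro sum_pullback[OF c, where h = n]) (use d m n z in \<open>auto intro: initial_eq\<close>)
  fix f g assume fg: "f \<in> Arr C" "g \<in> Arr C" "src C f = src C g" "tgt C f = src C i" "tgt C g = src C i"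
    "i \<cdot> f = i \<cdot> g"
  obtain k where "k \<in> Arr C" "tgt C k = x" "ident C x \<cdot> k = f" "ident C x \<cdot> k = g"
    by (rule pullback_ex[OF pb, of f g]) (use fg d in auto)
  then show "f = g" by simp
qed

text \<open>An initial object is a coproduct of two copies of itself with identities as
  coprojections. Decomposed over it, the domain of \<open>m\<close> becomes a coproduct whose
  coprojections are pullbacks of an identity and hence split epimorphisms. Parallel arrows
  \<open>u\<close>, \<open>v\<close> out of it coincide, because some \<open>e\<close> agrees with
  \<open>u\<close> on the first summand and with \<open>v\<close> on the second.\<close>

lemma strict_initial:
  assumes m: "m \<in> Arr C" "is_initial C (tgt C m)"
  shows "is_initial C (src C m)"
proof -
  let ?z = "tgt C m" and ?w = "src C m"
  have zO: "?z \<in> Obj C" using m by simp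
  have c: "is_binary_coproduct C ?z ?z ?z (ident C ?z) (ident C ?z)"
    using initial_coproduct[of ?z "ident C ?z"] m zO by simp
  obtain z1 z2 p p' g h where z: "is_binary_coproduct C z1 z2 ?w p p'"
    "g \<in> hom C z1 ?z" "h \<in> hom C z2 ?z" "m \<cdot> p = ident C ?z \<cdot> g" "m \<cdot> p' = ident C ?z \<cdot> h"
    by (rule decompose[OF c m(1)]) auto
  note d = binary_coproductD[OF z(1)]
  have gh: "g \<in> Arr C" "src C g = z1" "tgt C g = ?z" "h \<in> Arr C" "src C h = z2" "tgt C h = ?z"
    using z by auto
  have pb1: "is_pullback C p g m (ident C ?z)" by (rule sum_pullback[OF c z(1) m(1)]) (use z in auto)
  have pb2: "is_pullback C p' h m (ident C ?z)"
    by (rule sum_pullback[OF c binary_coproduct_sym[OF z(1)] m(1)]) (use z in auto)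
  obtain k where k: "k \<in> Arr C" "src C k = ?w" "tgt C k = z1" "p \<cdot> k = ident C ?w"
    by (rule pullback_ex[OF pb1, of "ident C ?w" m]) (use m zO d in auto)
  obtain k' where k': "k' \<in> Arr C" "src C k' = ?w" "tgt C k' = z2" "p' \<cdot> k' = ident C ?w"
    by (rule pullback_ex[OF pb2, of "ident C ?w" m]) (use m zO d in auto)
  have eq: "u = v" if uv: "u \<in> Arr C" "v \<in> Arr C" "src C u = ?w" "src C v = ?w" "tgt C u = tgt C v" for u v
  proof -
    obtain e where e: "e \<in> Arr C" "src C e = ?w" "tgt C e = tgt C v" "e \<cdot> p = u \<cdot> p" "e \<cdot> p' = v \<cdot> p'"
      by (rule binary_coproduct_ex[OF z(1), of "u \<cdot> p" "tgt C v" "v \<cdot> p'"]) (use uv d in auto)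
    have "(e \<cdot> p) \<cdot> k = (u \<cdot> p) \<cdot> k" "(e \<cdot> p') \<cdot> k' = (v \<cdot> p') \<cdot> k'" using e by auto
    then have "e = u" "e = v" using e(1-3) uv d k k' by auto
    then show ?thesis by simp
  qed
  have "\<exists>u. u \<in> hom C ?w x" if x: "x \<in> Obj C" for x
  proof -
    obtain n where "n \<in> Arr C" "src C n = ?z" "tgt C n = x" using initial_arr[OF m(2) x] by blast
    then show ?thesis using m by (intro exI[of _ "n \<cdot> m"]) simp
  qed
  then show ?thesis unfolding is_initial_def using eq m by (metis in_hom src_Obj)
qed

text \<open>The pullback of \<open>i\<close> along \<open>j\<close> has an initial domain, by
  \<open>sum_pullback\<close> for \<open>y\<close> as the coproduct of an initial object and
  \<open>y\<close>. So a cone over \<open>i\<close> and \<open>j\<close> maps into an initial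
  object, and initial objects are strict.\<close>

lemma coproduct_disjoint:
  assumes c: "is_binary_coproduct C x y s i j"
    and ab: "a \<in> Arr C" "b \<in> Arr C" "src C a = src C b" "tgt C a = x" "tgt C b = y" "i \<cdot> a = j \<cdot> b"
  shows "is_initial C (src C a)"
proof -
  note d = binary_coproductD[OF c]
  obtain z where z: "is_initial C z" using initial_ex by blast
  obtain m where m: "m \<in> Arr C" "src C m = z" "tgt C m = x" using initial_arr[OF z d(1)] by blast
  obtain n where n: "n \<in> Arr C" "src C n = z" "tgt C n = y" using initial_arr[OF z d(2)] by blast
  have "is_binary_coproduct C z y y n (ident C y)"
    using binary_coproduct_sym[OF initial_coproduct[of y n]] d n z by simp
  then have pb: "is_pullback C n m j i"
    by (intro sum_pullback[OF c, where h = "ident C y"]) (use d m n z in \<open>auto intro: initial_eq\<close>)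
  obtain k where "k \<in> Arr C" "src C k = src C b" "tgt C k = z"
    by (rule pullback_ex[OF pb, of b a]) (use ab d n in auto)
  then show ?thesis using strict_initial[of k] z ab by simp
qed

end

section \<open>Summands and ultrafilters\<close>

context cat
begin

lemma factors_throughI:
  "h \<in> Arr C \<Longrightarrow> g \<in> Arr C \<Longrightarrow> tgt C h = src C g \<Longrightarrow> g \<cdot> h = f \<Longrightarrow> factors_through C f g"
  unfolding factors_through_def by auto

lemma factors_throughE:
  assumes "factors_through C f g"
  obtains h where "h \<in> Arr C" "src C h = src C f" "tgt C h = src C g" "g \<cdot> h = f"
  using assms unfolding factors_through_def by auto

lemma factors_through_refl: "f \<in> Arr C \<Longrightarrow> factors_through C f f"
  by (rule factors_throughI[of "ident C (src C f)"]) auto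

lemma factors_through_trans:
  assumes "factors_through C f g" "factors_through C g h" "h \<in> Arr C"
  shows "factors_through C f h"
proof -
  obtain a where a: "a \<in> Arr C" "src C a = src C f" "tgt C a = src C g" "g \<cdot> a = f"
    using assms(1) by (rule factors_throughE)
  obtain b where b: "b \<in> Arr C" "src C b = src C g" "tgt C b = src C h" "h \<cdot> b = g"
    using assms(2) by (rule factors_throughE)
  show ?thesis
    by (rule factors_throughI[of "b \<cdot> a"]) (use a b assms(3) ext2[OF b(4), of a] in simp_all)
qed

lemma coprojection_compl:
  assumes "is_binary_coproduct C x y s i j"
  shows "coprojection C s i"
  unfolding coprojection_def by (rule exI[of _ j]) (simp add: assms binary_coproductD[OF assms])

lemma coprojectionE:
  assumes "coprojection C X m"
  obtains n where "is_binary_coproduct C (src C m) (src C n) X m n"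
  using assms unfolding coprojection_def by (elim exE)

lemma coprojectionD:
  assumes "coprojection C X m"
  shows "m \<in> Arr C" "tgt C m = X" "X \<in> Obj C"
proof -
  obtain n where "is_binary_coproduct C (src C m) (src C n) X m n" using assms by (rule coprojectionE)
  note d = binary_coproductD[OF this]
  show "m \<in> Arr C" "tgt C m = X" "X \<in> Obj C" by (rule d)+
qed

lemma coprojection_iso:
  assumes m: "coprojection C X m" and t: "t \<in> Arr C" "tgt C t = src C m"
    "t' \<in> Arr C" "src C t' = src C m" "tgt C t' = src C t" "t \<cdot> t' = ident C (src C m)" "t' \<cdot> t = ident C (src C t)"
  shows "coprojection C X (m \<cdot> t)"
proof -
  obtain n where n: "is_binary_coproduct C (src C m) (src C n) X m n" using m by (rule coprojectionE)
  note d = binary_coproductD[OF n]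
  have "is_binary_coproduct C (src C t) (src C n) X (m \<cdot> t) n"
  proof (rule binary_coproductI)
    fix z f g assume fg: "f \<in> hom C (src C t) z" "g \<in> hom C (src C n) z"
    obtain h where h: "h \<in> Arr C" "src C h = X" "tgt C h = z" "h \<cdot> m = f \<cdot> t'" "h \<cdot> n = g"
      by (rule binary_coproduct_ex[OF n, of "f \<cdot> t'" z g]) (use fg t in auto)
    show "\<exists>h\<in>hom C X z. h \<cdot> (m \<cdot> t) = f \<and> h \<cdot> n = g"
      by (rule bexI[of _ h]) (use h t d fg ext2[OF h(4), of t] in auto)
  next
    fix z h k assume hk: "h \<in> hom C X z" "k \<in> hom C X z" "h \<cdot> (m \<cdot> t) = k \<cdot> (m \<cdot> t)" "h \<cdot> n = k \<cdot> n"
    have "(h \<cdot> (m \<cdot> t)) \<cdot> t' = (k \<cdot> (m \<cdot> t)) \<cdot> t'" using hk by simp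
    then have "h \<cdot> m = k \<cdot> m" using hk(1,2) t d by simp
    then show "h = k" by (rule binary_coproduct_eq[OF n, rotated 5]) (use hk in auto)
  qed (use d t in auto)
  then show ?thesis using t d by (auto simp: coprojection_def)
qed

end

section \<open>The Boolean algebra of summands\<close>

context extensive_cat
begin

lemma coprojection_mono: "coprojection C X m \<Longrightarrow> is_mono C m"
  by (erule coprojectionE) (rule coprojection_mono1)

lemma coprojection_ident: "X \<in> Obj C \<Longrightarrow> coprojection C X (ident C X)"
  using initial_ex initial_arr initial_coproduct coprojection_compl by metis

lemma initial_coprojection:
  assumes "X \<in> Obj C"
  obtains n where "is_initial C (src C n)" "is_binary_coproduct C X (src C n) X (ident C X) n"
    "n \<in> Arr C" "tgt C n = X"
proof -
  obtain z where z: "is_initial C z" using initial_ex by blast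
  obtain m where "m \<in> Arr C" "src C m = z" "tgt C m = X" using initial_arr[OF z assms] by blast
  then show ?thesis using initial_coproduct[of X m] z assms that by auto
qed

text \<open>The complement of \<open>u \<cdot> v\<close> is \<open>n\<close>, which combines
  \<open>u \<cdot> v'\<close> and \<open>u'\<close> on a coproduct of the two complements.\<close>

lemma coprojection_comp:
  assumes u: "coprojection C X u" and v: "coprojection C (src C u) v"
  shows "coprojection C X (u \<cdot> v)"
proof -
  obtain u' where u': "is_binary_coproduct C (src C u) (src C u') X u u'" using u by (rule coprojectionE)
  obtain v' where v': "is_binary_coproduct C (src C v) (src C v') (src C u) v v'" using v by (rule coprojectionE)
  note d = binary_coproductD[OF u'] binary_coproductD[OF v']
  obtain s i j where s: "is_binary_coproduct C (src C v') (src C u') s i j"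
    by (rule binary_coproduct_exists[of "src C v'" "src C u'"]) (use d in auto)
  note ds = binary_coproductD[OF s]
  obtain n where n: "n \<in> Arr C" "src C n = s" "tgt C n = X" "n \<cdot> i = u \<cdot> v'" "n \<cdot> j = u'"
    by (rule binary_coproduct_ex[OF s, of "u \<cdot> v'" X u']) (use d in auto)
  have "is_binary_coproduct C (src C v) s X (u \<cdot> v) n"
  proof (rule binary_coproductI)
    fix z f g assume f: "f \<in> hom C (src C v) z" and g: "g \<in> hom C s z"
    obtain h1 where h1: "h1 \<in> Arr C" "src C h1 = src C u" "tgt C h1 = z" "h1 \<cdot> v = f" "h1 \<cdot> v' = g \<cdot> i"
      by (rule binary_coproduct_ex[OF v', of f z "g \<cdot> i"]) (use f g ds in auto)
    obtain h where h: "h \<in> Arr C" "src C h = X" "tgt C h = z" "h \<cdot> u = h1" "h \<cdot> u' = g \<cdot> j"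
      by (rule binary_coproduct_ex[OF u', of h1 z "g \<cdot> j"]) (use h1 g ds in auto)
    have "h \<cdot> n = g"
      by (rule binary_coproduct_eq[OF s]) (use h n g ds d h1 ext2[OF h(4), of v'] in auto)
    moreover have "h \<cdot> (u \<cdot> v) = f" using h h1 d ext2[OF h(4), of v] by simp
    ultimately show "\<exists>h\<in>hom C X z. h \<cdot> (u \<cdot> v) = f \<and> h \<cdot> n = g"
      using h by (intro bexI[of _ h]) auto
  next
    fix z h k assume hk: "h \<in> hom C X z" "k \<in> hom C X z" "h \<cdot> (u \<cdot> v) = k \<cdot> (u \<cdot> v)" "h \<cdot> n = k \<cdot> n"
    have "(h \<cdot> n) \<cdot> i = (k \<cdot> n) \<cdot> i" "(h \<cdot> n) \<cdot> j = (k \<cdot> n) \<cdot> j" using hk by auto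
    then have e: "h \<cdot> (u \<cdot> v') = k \<cdot> (u \<cdot> v')" "h \<cdot> u' = k \<cdot> u'" using hk(1,2) n ds by auto
    have "h \<cdot> u = k \<cdot> u"
      by (rule binary_coproduct_eq[OF v']) (use hk e d in auto)
    then show "h = k" by (rule binary_coproduct_eq[OF u', rotated 5]) (use hk e in auto)
  qed (use d n in auto)
  then show ?thesis by (rule coprojection_compl)
qed

text \<open>One decomposition of the domain of \<open>f\<close> yields both pullbacks, which is why
  inverse image respects complements.\<close>

lemma compl_pullback:
  assumes c: "is_binary_coproduct C x y s v v'" and f: "f \<in> Arr C" "tgt C f = s"
  obtains p q p' q' where "is_pullback C p q f v" "is_pullback C p' q' f v'"
    "is_binary_coproduct C (src C p) (src C p') (src C f) p p'"
proof -
  obtain z1 z2 p p' g h where z: "is_binary_coproduct C z1 z2 (src C f) p p'"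
    "g \<in> hom C z1 x" "h \<in> hom C z2 y" "f \<cdot> p = v \<cdot> g" "f \<cdot> p' = v' \<cdot> h"
    by (rule decompose[OF c f])
  have "is_pullback C p g f v" by (rule sum_pullback[OF c z(1) f z(2-5)])
  moreover have "is_pullback C p' h f v'"
    by (rule sum_pullback[OF binary_coproduct_sym[OF c] binary_coproduct_sym[OF z(1)] f z(3,2,5,4)])
  ultimately show ?thesis using that z(1) binary_coproductD[OF z(1)] by auto
qed

lemma coprojection_pullback_ex:
  assumes "coprojection C (tgt C f) v" "f \<in> Arr C"
  obtains p q where "is_pullback C p q f v"
  using assms(1) coprojectionE compl_pullback assms(2) by metis

text \<open>An arbitrary pullback is isomorphic to the one from \<open>compl_pullback\<close>, and
  coprojections are invariant under isomorphism of the domain.\<close>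

lemma coprojection_pullback:
  assumes v: "coprojection C Y v" and pb: "is_pullback C p q f v"
  shows "coprojection C (src C f) p"
proof -
  note d = pullbackD[OF pb]
  obtain v' where v': "is_binary_coproduct C (src C v) (src C v') Y v v'" using v by (rule coprojectionE)
  have Y: "tgt C f = Y" using d coprojectionD[OF v] by simp
  obtain p0 q0 p' q' where p0: "is_pullback C p0 q0 f v"
    "is_binary_coproduct C (src C p0) (src C p') (src C f) p0 p'"
    by (rule compl_pullback[OF v' d(3) Y])
  note d0 = pullbackD[OF p0(1)]
  obtain t where t: "t \<in> Arr C" "src C t = src C p" "tgt C t = src C p0" "p0 \<cdot> t = p" "q0 \<cdot> t = q"
    by (rule pullback_ex[OF p0(1), of p q]) (use d in auto)
  obtain t' where t': "t' \<in> Arr C" "src C t' = src C p0" "tgt C t' = src C p" "p \<cdot> t' = p0" "q \<cdot> t' = q0"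
    by (rule pullback_ex[OF pb, of p0 q0]) (use d0 in auto)
  have "t \<cdot> t' = ident C (src C p0)"
    by (rule pullback_eq[OF p0(1)])
      (use t t' d d0 ext2[OF t(4), of t'] ext2[OF t(5), of t'] in auto)
  moreover have "t' \<cdot> t = ident C (src C p)"
    by (rule pullback_eq[OF pb])
      (use t t' d d0 ext2[OF t'(4), of t] ext2[OF t'(5), of t] in auto)
  ultimately have "coprojection C (src C f) (p0 \<cdot> t)"
    by (intro coprojection_iso[OF coprojection_compl[OF p0(2)], of t t']) (use t t' in auto)
  then show ?thesis using t by simp
qed

text \<open>Coprojections are monic, so mutual factorisation already produces an isomorphism. From
  here on, the order on classes is handled through \<open>factors_through\<close> on
  representatives.\<close>

lemma sum_class_iff:
  assumes m: "coprojection C X m"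
  shows "n \<in> sum_class C X m \<longleftrightarrow>
    coprojection C X n \<and> factors_through C n m \<and> factors_through C m n"
proof
  assume "n \<in> sum_class C X m"
  then obtain h where n: "coprojection C X n" and h: "h \<in> hom C (src C n) (src C m)" "is_iso C h" "m \<cdot> h = n"
    unfolding sum_class_def by blast
  note d = coprojectionD[OF m] coprojectionD[OF n]
  obtain h' where h': "h' \<in> Arr C" "src C h' = tgt C h" "tgt C h' = src C h" "h \<cdot> h' = ident C (tgt C h)"
    using is_isoD[OF h(2)] by metis
  have "factors_through C n m" by (rule factors_throughI[of h]) (use h d in auto)
  moreover have "factors_through C m n"
  proof (rule factors_throughI[of h'])
    have hh: "h \<in> Arr C" "src C h = src C n" "tgt C h = src C m" using h(1) by auto
    have "n \<cdot> h' = m \<cdot> (h \<cdot> h')" by (rule ext2[OF h(3), symmetric]) (use hh h' d in simp_all)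
    then show "n \<cdot> h' = m" using hh h'(4) d by simp
    show "h' \<in> Arr C" "n \<in> Arr C" "tgt C h' = src C n" using h' hh d by simp_all
  qed
  ultimately show "coprojection C X n \<and> factors_through C n m \<and> factors_through C m n" using n by blast
next
  assume "coprojection C X n \<and> factors_through C n m \<and> factors_through C m n"
  then have n: "coprojection C X n" and nm: "factors_through C n m" and mn: "factors_through C m n" by auto
  note d = coprojectionD[OF m] coprojectionD[OF n]
  obtain h where h: "h \<in> Arr C" "src C h = src C n" "tgt C h = src C m" "m \<cdot> h = n"
    using nm by (rule factors_throughE)
  obtain k where k: "k \<in> Arr C" "src C k = src C m" "tgt C k = src C n" "n \<cdot> k = m"
    using mn by (rule factors_throughE)
  have "h \<cdot> k = ident C (src C m)"
    by (rule mono_cancel[OF coprojection_mono[OF m]]) (use h k d ext2[OF h(4), of k] in auto)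
  moreover have "k \<cdot> h = ident C (src C n)"
    by (rule mono_cancel[OF coprojection_mono[OF n]]) (use h k d ext2[OF k(4), of h] in auto)
  ultimately have "is_iso C h" unfolding is_iso_def using h k by auto
  then show "n \<in> sum_class C X m" unfolding sum_class_def using n h by auto
qed

lemma sum_class_self: "coprojection C X m \<Longrightarrow> m \<in> sum_class C X m"
  using sum_class_iff factors_through_refl coprojectionD(1) by blast

lemma sum_class_eq_iff:
  assumes m: "coprojection C X m" and n: "coprojection C X n"
  shows "sum_class C X m = sum_class C X n \<longleftrightarrow> factors_through C n m \<and> factors_through C m n"
proof
  assume "sum_class C X m = sum_class C X n"
  then show "factors_through C n m \<and> factors_through C m n"
    using sum_class_self[OF n] sum_class_iff[OF m] by blast
next
  assume "factors_through C n m \<and> factors_through C m n"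
  then show "sum_class C X m = sum_class C X n"
    using sum_class_iff[OF m] sum_class_iff[OF n] factors_through_trans coprojectionD(1) m n by blast
qed

lemma sum_le_iff:
  assumes m: "coprojection C X m" and n: "coprojection C X n"
  shows "sum_le C (sum_class C X m) (sum_class C X n) \<longleftrightarrow> factors_through C m n"
proof
  assume "sum_le C (sum_class C X m) (sum_class C X n)"
  then obtain m' n' where "m' \<in> sum_class C X m" "n' \<in> sum_class C X n" and mn: "factors_through C m' n'"
    unfolding sum_le_def by blast
  then have "factors_through C m m'" "factors_through C n' n" "coprojection C X n'"
    using sum_class_iff m n by blast+
  then show "factors_through C m n"
    using mn factors_through_trans[of m m' n'] factors_through_trans[of m n' n] coprojectionD(1) n by blast
next
  assume "factors_through C m n"
  then show "sum_le C (sum_class C X m) (sum_class C X n)"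
    unfolding sum_le_def using sum_class_self m n by blast
qed

text \<open>The meet of two summands is the diagonal of their pullback square.\<close>

lemma coprojection_meet:
  assumes m: "coprojection C X m" and n: "coprojection C X n"
  obtains c where "coprojection C X c" "factors_through C c m" "factors_through C c n"
    "\<And>t. factors_through C t m \<Longrightarrow> factors_through C t n \<Longrightarrow> factors_through C t c"
proof -
  note d = coprojectionD[OF m] coprojectionD[OF n]
  obtain p q where pb: "is_pullback C p q m n"
    by (rule coprojection_pullback_ex[of m n]) (use d n in auto)
  note dp = pullbackD[OF pb]
  have "coprojection C X (m \<cdot> p)"
    using coprojection_comp[OF m coprojection_pullback[OF n pb]] .
  moreover have "factors_through C (m \<cdot> p) m" by (rule factors_throughI[of p]) (use dp in auto)
  moreover have "factors_through C (m \<cdot> p) n" by (rule factors_throughI[of q]) (use dp in auto)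
  moreover have "factors_through C t (m \<cdot> p)" if t: "factors_through C t m" "factors_through C t n" for t
  proof -
    obtain h where h: "h \<in> Arr C" "src C h = src C t" "tgt C h = src C m" "m \<cdot> h = t"
      using t(1) by (rule factors_throughE)
    obtain k where k: "k \<in> Arr C" "src C k = src C t" "tgt C k = src C n" "n \<cdot> k = t"
      using t(2) by (rule factors_throughE)
    obtain l where "l \<in> Arr C" "src C l = src C h" "tgt C l = src C p" "p \<cdot> l = h" "q \<cdot> l = k"
      by (rule pullback_ex[OF pb, of h k]) (use h k in auto)
    then show ?thesis by (intro factors_throughI[of l]) (use dp h in auto)
  qed
  ultimately show ?thesis using that by blast
qed

lemma initial_factors:
  assumes "m \<in> Arr C" "is_initial C (src C m)" "n \<in> Arr C" "tgt C n = tgt C m"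
  shows "factors_through C m n"
proof -
  obtain h where h: "h \<in> Arr C" "src C h = src C m" "tgt C h = src C n"
    using initial_arr[OF assms(2), of "src C n"] assms by auto
  show ?thesis by (rule factors_throughI[of h]) (use h assms in \<open>auto intro!: initial_eq\<close>)
qed

lemma factors_both_initial:
  assumes c: "is_binary_coproduct C x y s m n" and t: "factors_through C t m" "factors_through C t n"
  shows "is_initial C (src C t)"
proof -
  note d = binary_coproductD[OF c]
  obtain h where h: "h \<in> Arr C" "src C h = src C t" "tgt C h = src C m" "m \<cdot> h = t"
    using t(1) by (rule factors_throughE)
  obtain k where k: "k \<in> Arr C" "src C k = src C t" "tgt C k = src C n" "n \<cdot> k = t"
    using t(2) by (rule factors_throughE)
  have "is_initial C (src C h)" by (rule coproduct_disjoint[OF c, of h k]) (use h k d in auto)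
  then show ?thesis using h by simp
qed

text \<open>The domain of \<open>w\<close> splits into a part over \<open>m\<close> and a part over
  \<open>n\<close>. The former factors through both \<open>w\<close> and \<open>m\<close>, so it is
  initial, and \<open>w\<close> is determined by the part over \<open>n\<close>.\<close>

lemma factors_compl:
  assumes c: "is_binary_coproduct C x y s m n" and w: "w \<in> Arr C" "tgt C w = s"
    and t: "\<And>t. factors_through C t w \<Longrightarrow> factors_through C t m \<Longrightarrow> is_initial C (src C t)"
  shows "factors_through C w n"
proof -
  note d = binary_coproductD[OF c]
  obtain z1 z2 p p' g h where z: "is_binary_coproduct C z1 z2 (src C w) p p'"
    "g \<in> hom C z1 x" "h \<in> hom C z2 y" "w \<cdot> p = m \<cdot> g" "w \<cdot> p' = n \<cdot> h"
    by (rule decompose[OF c w])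
  note dz = binary_coproductD[OF z(1)]
  have "is_initial C (src C (w \<cdot> p))"
  proof (rule t)
    show "factors_through C (w \<cdot> p) w" by (rule factors_throughI[of p]) (use w dz in auto)
    show "factors_through C (w \<cdot> p) m" by (rule factors_throughI[of g]) (use z d in auto)
  qed
  then have i: "is_initial C z1" using dz w by simp
  obtain a where a: "a \<in> Arr C" "src C a = z1" "tgt C a = y" using initial_arr[OF i d(2)] by blast
  obtain k where k: "k \<in> Arr C" "src C k = src C w" "tgt C k = y" "k \<cdot> p = a" "k \<cdot> p' = h"
    by (rule binary_coproduct_ex[OF z(1), of a y h]) (use a z in auto)
  have "n \<cdot> k = w"
    by (rule binary_coproduct_eq[OF z(1)]) (use k w d dz a i z in \<open>auto intro!: initial_eq\<close>)
  then show ?thesis by (intro factors_throughI[of k]) (use k d in auto)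
qed

end

text \<open>Ultrafilters consist of isomorphism classes; speaking of single coprojections allows the
  Boolean algebra to be replaced by the preorder of its representatives.\<close>

definition memb :: "('o, 'a) cat \<Rightarrow> 'o \<Rightarrow> 'a set set \<Rightarrow> 'a \<Rightarrow> bool" where
  "memb C X \<U> m \<longleftrightarrow> coprojection C X m \<and> sum_class C X m \<in> \<U>"

section \<open>Filters and ultrafilters through representatives\<close>

context extensive_cat
begin

lemma memb_coprojection: "memb C X \<U> m \<Longrightarrow> coprojection C X m"
  by (simp add: memb_def)

lemma membD:
  assumes "memb C X \<U> m"
  shows "m \<in> Arr C" "tgt C m = X" "X \<in> Obj C"
  using coprojectionD[OF memb_coprojection[OF assms]] by auto

text \<open>Properness enters in the last clause: an initial summand factors through every other
  one, so a filter containing it would contain all classes.\<close>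

lemma filter_memb:
  assumes F: "proper_filter (summands C X) (sum_le C) F"
  shows "W \<in> F \<Longrightarrow> \<exists>m. memb C X F m \<and> W = sum_class C X m"
    and "memb C X F m \<Longrightarrow> coprojection C X n \<Longrightarrow> factors_through C m n \<Longrightarrow> memb C X F n"
    and "memb C X F m \<Longrightarrow> memb C X F n \<Longrightarrow>
      \<exists>w. memb C X F w \<and> factors_through C w m \<and> factors_through C w n"
    and "memb C X F m \<Longrightarrow> \<not> is_initial C (src C m)"
proof -
  show 1: "\<exists>m. memb C X F m \<and> W = sum_class C X m" if "W \<in> F" for W
    using F that unfolding proper_filter_def summands_def memb_def by blast
  show 2: "memb C X F n" if "memb C X F m" "coprojection C X n" "factors_through C m n" for m n
  proof -
    have "sum_class C X n \<in> summands C X" using that(2) unfolding summands_def by blast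
    then have "sum_class C X n \<in> F"
      using F that sum_le_iff unfolding proper_filter_def memb_def by blast
    then show ?thesis using that(2) unfolding memb_def by simp
  qed
  show "\<exists>w. memb C X F w \<and> factors_through C w m \<and> factors_through C w n"
    if mn: "memb C X F m" "memb C X F n" for m n
  proof -
    obtain W where W: "W \<in> F" "sum_le C W (sum_class C X m)" "sum_le C W (sum_class C X n)"
      using F mn unfolding proper_filter_def memb_def by blast
    then obtain w where "memb C X F w" "W = sum_class C X w" using 1 by blast
    then show ?thesis using W sum_le_iff mn memb_coprojection by blast
  qed
  show "\<not> is_initial C (src C m)" if m: "memb C X F m" for m
  proof
    assume i: "is_initial C (src C m)"
    have "memb C X F k" if "coprojection C X k" for k
      using 2[OF m that] initial_factors[of m k] membD[OF m] i coprojectionD[OF that] by simp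
    then have "summands C X \<subseteq> F" unfolding memb_def summands_def by blast
    then show False using F unfolding proper_filter_def by blast
  qed
qed

lemma beta_proper: "\<U> \<in> beta C X \<Longrightarrow> proper_filter (summands C X) (sum_le C) \<U>"
  unfolding beta_def ultrafilter_on_def by blast

lemmas beta_class = filter_memb(1)[OF beta_proper]
lemmas memb_up = filter_memb(2)[OF beta_proper]
lemmas memb_meet = filter_memb(3)[OF beta_proper]
lemmas memb_not_initial = filter_memb(4)[OF beta_proper]

text \<open>If \<open>n\<close> is missing, then \<open>\<U>\<close> and \<open>m\<close> generate a
  proper filter, which maximality identifies with \<open>\<U>\<close>. Indeed, were it improper,
  some \<open>w\<close> in \<open>\<U>\<close> would meet \<open>m\<close> in an initial object
  only, and \<open>factors_compl\<close> would put \<open>w\<close> below \<open>n\<close>.\<close>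

lemma memb_xor:
  assumes U: "\<U> \<in> beta C X" and c: "is_binary_coproduct C x y X m n"
  shows "memb C X \<U> m \<longleftrightarrow> \<not> memb C X \<U> n"
proof
  assume m: "memb C X \<U> m"
  show "\<not> memb C X \<U> n"
  proof
    assume n: "memb C X \<U> n"
    then obtain w where "memb C X \<U> w" "factors_through C w m" "factors_through C w n"
      using memb_meet[OF U m n] by blast
    then show False using factors_both_initial[OF c] memb_not_initial[OF U] by blast
  qed
next
  assume n: "\<not> memb C X \<U> n"
  have pm: "coprojection C X m" and pn: "coprojection C X n"
    using coprojection_compl c binary_coproduct_sym by blast+
  \<comment> \<open>The filter generated by \<open>\<U>\<close> and \<open>m\<close>. That the meet
    of \<open>w\<close> and \<open>m\<close> lies below \<open>k\<close> is tested on all arrows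
    \<open>t\<close>, so no meet has to be chosen.\<close>
  define G where "G = {sum_class C X k | k. coprojection C X k \<and> (\<exists>w. memb C X \<U> w \<and>
      (\<forall>t. factors_through C t w \<longrightarrow> factors_through C t m \<longrightarrow> factors_through C t k))}"
  have G: "memb C X G k \<longleftrightarrow> coprojection C X k \<and> (\<exists>w. memb C X \<U> w \<and>
      (\<forall>t. factors_through C t w \<longrightarrow> factors_through C t m \<longrightarrow> factors_through C t k))" for k
  proof
    assume k: "memb C X G k"
    then obtain k' w where k': "sum_class C X k = sum_class C X k'" "coprojection C X k'" "memb C X \<U> w"
      "\<forall>t. factors_through C t w \<longrightarrow> factors_through C t m \<longrightarrow> factors_through C t k'"
      unfolding G_def memb_def by blast
    then have "factors_through C k' k" using sum_class_eq_iff memb_coprojection[OF k] by blast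
    then show "coprojection C X k \<and> (\<exists>w. memb C X \<U> w \<and>
      (\<forall>t. factors_through C t w \<longrightarrow> factors_through C t m \<longrightarrow> factors_through C t k))"
      using k' factors_through_trans membD(1)[OF k] memb_coprojection[OF k] by blast
  qed (auto simp: G_def memb_def)
  obtain W where "W \<in> \<U>" using beta_proper[OF U] unfolding proper_filter_def by blast
  then obtain w0 where w0: "memb C X \<U> w0" using beta_class[OF U] by blast
  have mG: "memb C X G m" using G pm w0 by blast
  have UG: "\<U> \<subseteq> G"
  proof
    fix W assume "W \<in> \<U>"
    then obtain w where "memb C X \<U> w" "W = sum_class C X w" using beta_class[OF U] by blast
    then show "W \<in> G" using memb_coprojection G[of w] unfolding memb_def by blast
  qed
  have "proper_filter (summands C X) (sum_le C) G"
    unfolding proper_filter_def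
  proof (intro conjI ballI impI)
    show "G \<subseteq> summands C X" unfolding G_def summands_def by blast
    show "G \<noteq> {}" using mG unfolding memb_def by blast
    obtain z where z: "is_initial C (src C z)" "is_binary_coproduct C X (src C z) X (ident C X) z"
      "z \<in> Arr C" "tgt C z = X"
      using initial_coprojection[of X] membD[OF w0] by metis
    have pz: "coprojection C X z" using coprojection_compl binary_coproduct_sym z(2) by blast
    show "G \<noteq> summands C X"
    proof
      assume "G = summands C X"
      then have "memb C X G z" using pz unfolding memb_def summands_def by blast
      then obtain w where w: "memb C X \<U> w"
        "\<forall>t. factors_through C t w \<longrightarrow> factors_through C t m \<longrightarrow> factors_through C t z" using G by blast
      have "factors_through C w n"
      proof (rule factors_compl[OF c membD(1,2)[OF w(1)]])
        fix t assume "factors_through C t w" "factors_through C t m"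
        then have "factors_through C t z" using w by blast
        then obtain h where "h \<in> Arr C" "src C h = src C t" "tgt C h = src C z"
          by (rule factors_throughE)
        then show "is_initial C (src C t)" using strict_initial[of h] z(1) by simp
      qed
      then have "memb C X \<U> n" using memb_up[OF U w(1) pn] by blast
      then show False using n by blast
    qed
  next
    fix A B assume A: "A \<in> G" "B \<in> summands C X" "sum_le C A B"
    then obtain k where k: "A = sum_class C X k" "coprojection C X k" unfolding G_def by blast
    obtain k' where k': "B = sum_class C X k'" "coprojection C X k'" using A unfolding summands_def by blast
    have "memb C X G k" using A k unfolding memb_def by simp
    moreover have "factors_through C k k'" using A k k' sum_le_iff by simp
    ultimately have "memb C X G k'"
      using G k' factors_through_trans coprojectionD(1)[OF k'(2)] by blast
    then show "B \<in> G" using k' unfolding memb_def by simp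
  next
    fix A B assume A: "A \<in> G" "B \<in> G"
    then obtain k k' where k: "A = sum_class C X k" "coprojection C X k"
       "B = sum_class C X k'" "coprojection C X k'" unfolding G_def by blast
    have "memb C X G k" "memb C X G k'" using A k unfolding memb_def by auto
    then obtain w w' where w: "memb C X \<U> w" "memb C X \<U> w'"
      "\<And>t. factors_through C t w \<Longrightarrow> factors_through C t m \<Longrightarrow> factors_through C t k"
      "\<And>t. factors_through C t w' \<Longrightarrow> factors_through C t m \<Longrightarrow> factors_through C t k'" using G by metis
    obtain v where v: "memb C X \<U> v" "factors_through C v w" "factors_through C v w'"
      using memb_meet[OF U w(1,2)] by blast
    obtain c where c: "coprojection C X c" "factors_through C c v" "factors_through C c m"
      "\<And>t. factors_through C t v \<Longrightarrow> factors_through C t m \<Longrightarrow> factors_through C t c"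
      using coprojection_meet[OF memb_coprojection[OF v(1)] pm] by blast
    have "factors_through C c w" "factors_through C c w'"
      using c(2) v(2,3) factors_through_trans membD(1)[OF w(1)] membD(1)[OF w(2)] by blast+
    then have "factors_through C c k" "factors_through C c k'" using w(3,4) c(3) by blast+
    moreover have "memb C X G c" using G c(1,4) v(1) by blast
    ultimately show "\<exists>D\<in>G. sum_le C D A \<and> sum_le C D B"
      using k c(1) sum_le_iff unfolding memb_def by blast
  qed
  then have "G = \<U>" using U UG unfolding beta_def ultrafilter_on_def by blast
  then show "memb C X \<U> m" using mG by simp
qed

lemma memb_ident: "\<U> \<in> beta C X \<Longrightarrow> X \<in> Obj C \<Longrightarrow> memb C X \<U> (ident C X)"
  using initial_coprojection[of X] memb_xor memb_not_initial by metis

text \<open>Maximality turns an inclusion of ultrafilters into an equality.\<close>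

lemma beta_eqI:
  assumes "\<U> \<in> beta C X" "\<V> \<in> beta C X" "\<And>m. memb C X \<U> m \<Longrightarrow> memb C X \<V> m"
  shows "\<U> = \<V>"
proof -
  have "\<U> \<subseteq> \<V>"
  proof
    fix W assume "W \<in> \<U>"
    then obtain m where "memb C X \<U> m" "W = sum_class C X m" using beta_class[OF assms(1)] by blast
    then show "W \<in> \<V>" using assms(3) unfolding memb_def by blast
  qed
  then show ?thesis using assms(1) beta_proper[OF assms(2)] unfolding beta_def ultrafilter_on_def by blast
qed

text \<open>Primeness implies maximality: a larger filter would contain some \<open>m\<close>
  together with its complement. Properness comes from \<open>xor\<close> for the identity and an
  initial summand, since \<open>up\<close> carries the latter to the former.\<close>

lemma betaI:
  assumes X: "X \<in> Obj C" and cop: "\<And>m. P m \<Longrightarrow> coprojection C X m"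
    and up: "\<And>m n. P m \<Longrightarrow> coprojection C X n \<Longrightarrow> factors_through C m n \<Longrightarrow> P n"
    and meet: "\<And>m n. P m \<Longrightarrow> P n \<Longrightarrow> \<exists>w. P w \<and> factors_through C w m \<and> factors_through C w n"
    and xor: "\<And>x y m n. is_binary_coproduct C x y X m n \<Longrightarrow> P m \<longleftrightarrow> \<not> P n"
  shows "{sum_class C X m | m. P m} \<in> beta C X"
    and "memb C X {sum_class C X m | m. P m} m \<longleftrightarrow> P m"
proof -
  let ?U = "{sum_class C X m | m. P m}"
  show U: "memb C X ?U m \<longleftrightarrow> P m" for m
  proof
    assume m: "memb C X ?U m"
    then obtain n where n: "sum_class C X m = sum_class C X n" "P n" unfolding memb_def by blast
    then show "P m" using up[of n m] memb_coprojection[OF m] sum_class_eq_iff cop by blast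
  qed (auto simp: memb_def cop)
  obtain z where z: "is_initial C (src C z)" "is_binary_coproduct C X (src C z) X (ident C X) z"
      "z \<in> Arr C" "tgt C z = X"
    using initial_coprojection[OF X] by metis
  have pz: "coprojection C X z" using coprojection_compl binary_coproduct_sym z(2) by blast
  have z_le: "factors_through C z k" if "coprojection C X k" for k
    using initial_factors[of z k] z coprojectionD[OF that] by simp
  have nz: "\<not> P z" using xor[OF z(2)] up[of z "ident C X"] z_le coprojection_ident[OF X] by blast
  have pid: "P (ident C X)" using xor[OF z(2)] nz by blast
  have proper: "proper_filter (summands C X) (sum_le C) ?U"
    unfolding proper_filter_def
  proof (intro conjI ballI impI)
    show "?U \<subseteq> summands C X" using cop unfolding summands_def by blast
    show "?U \<noteq> {}" using pid by blast
    show "?U \<noteq> summands C X" using U[of z] nz pz unfolding summands_def memb_def by blast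
  next
    fix A B assume A: "A \<in> ?U" "B \<in> summands C X" "sum_le C A B"
    then obtain k k' where "A = sum_class C X k" "P k" "B = sum_class C X k'" "coprojection C X k'"
      unfolding summands_def by blast
    then show "B \<in> ?U" using A(3) up cop sum_le_iff by blast
  next
    fix A B assume "A \<in> ?U" "B \<in> ?U"
    then obtain k k' where k: "A = sum_class C X k" "P k" "B = sum_class C X k'" "P k'" by blast
    then obtain w where w: "P w" "factors_through C w k" "factors_through C w k'" using meet by blast
    then have "sum_le C (sum_class C X w) A" "sum_le C (sum_class C X w) B"
      using k cop sum_le_iff by blast+
    then show "\<exists>D\<in>?U. sum_le C D A \<and> sum_le C D B" using w by blast
  qed
  have "G = ?U" if G: "proper_filter (summands C X) (sum_le C) G" "?U \<subseteq> G" for G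
  proof (rule ccontr)
    assume "G \<noteq> ?U"
    then obtain A where A: "A \<in> G" "A \<notin> ?U" using G by blast
    obtain m where m: "memb C X G m" "A = sum_class C X m" using filter_memb(1)[OF G(1) A(1)] by blast
    obtain n where n: "is_binary_coproduct C (src C m) (src C n) X m n"
      using memb_coprojection[OF m(1)] by (rule coprojectionE)
    have "\<not> P m" using A m by blast
    then have "P n" using xor[OF n] by blast
    then have "memb C X G n" using G(2) cop unfolding memb_def by blast
    then obtain w where "memb C X G w" "factors_through C w m" "factors_through C w n"
      using filter_memb(3)[OF G(1) m(1)] by blast
    then show False using factors_both_initial[OF n] filter_memb(4)[OF G(1)] by blast
  qed
  then show "?U \<in> beta C X" unfolding beta_def ultrafilter_on_def using proper by blast
qed

text \<open>Ultrafilters differ on some summand, and its complement belongs to the other one. Such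
  splittings later separate the parts of \<open>AX\<close> that belong to different
  ultrafilters.\<close>

lemma beta_separate:
  assumes "\<U> \<in> beta C X" "\<V> \<in> beta C X" "\<U> \<noteq> \<V>"
  obtains m n where "is_binary_coproduct C (src C m) (src C n) X m n" "memb C X \<U> m" "memb C X \<V> n"
  using beta_eqI assms memb_coprojection coprojectionE memb_xor assms(2) by metis

text \<open>Here the top summand is initial, which a proper filter excludes. It makes the sum over
  all ultrafilters empty, as preservation of the initial object requires.\<close>

lemma beta_initial:
  assumes "is_initial C z"
  shows "beta C z = {}"
  using memb_ident[of _ z] memb_not_initial[of _ z "ident C z"] initial_Obj[OF assms] assms by auto

end

section \<open>Inverse images of summands and direct images of ultrafilters\<close>

context extensive_cat
begin

text \<open>The universal property in the form of an adjunction between orders; it reduces the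
  behaviour of inverse images to that of \<open>factors_through\<close>.\<close>

lemma pullback_le_iff:
  assumes pb: "is_pullback C p q f v" and t: "t \<in> Arr C" "tgt C t = src C f"
  shows "factors_through C t p \<longleftrightarrow> factors_through C (f \<cdot> t) v"
proof
  note d = pullbackD[OF pb]
  assume "factors_through C t p"
  then obtain h where h: "h \<in> Arr C" "src C h = src C t" "tgt C h = src C p" "p \<cdot> h = t"
    by (rule factors_throughE)
  show "factors_through C (f \<cdot> t) v"
  proof (rule factors_throughI[of "q \<cdot> h"])
    have "v \<cdot> (q \<cdot> h) = (f \<cdot> p) \<cdot> h" by (rule ext2[OF d(9)]) (use d h in simp_all)
    then show "v \<cdot> (q \<cdot> h) = f \<cdot> t" using d h by simp
  qed (use d h in simp_all)
next
  note d = pullbackD[OF pb]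
  assume "factors_through C (f \<cdot> t) v"
  then obtain h where h: "h \<in> Arr C" "src C h = src C (f \<cdot> t)" "tgt C h = src C v" "v \<cdot> h = f \<cdot> t"
    by (rule factors_throughE)
  obtain k where "k \<in> Arr C" "src C k = src C t" "tgt C k = src C p" "p \<cdot> k = t" "q \<cdot> k = h"
    by (rule pullback_ex[OF pb, of t h]) (use h d t in simp_all)
  then show "factors_through C t p" by (intro factors_throughI[of k]) (use d in simp_all)
qed

text \<open>Pullbacks of equivalent coprojections factor through each other by
  \<open>pullback_le_iff\<close>. Conversely, a coprojection isomorphic to \<open>p\<close> by
  \<open>h\<close> is again a pullback of \<open>v\<close> along \<open>f\<close>, with second
  projection \<open>q \<cdot> h\<close>.\<close>

lemma pull_class:
  assumes v: "coprojection C Y v" and pb: "is_pullback C p q f v"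
  shows "pull C f (sum_class C Y v) = sum_class C (src C f) p"
proof (rule set_eqI, rule iffI)
  note d = pullbackD[OF pb]
  have p: "coprojection C (src C f) p" by (rule coprojection_pullback[OF v pb])
  fix p' assume "p' \<in> pull C f (sum_class C Y v)"
  then obtain v' q' where v': "v' \<in> sum_class C Y v" and pb': "is_pullback C p' q' f v'"
    unfolding pull_def by blast
  note d' = pullbackD[OF pb']
  have v'c: "coprojection C Y v'" "factors_through C v' v" "factors_through C v v'"
    using v' sum_class_iff[OF v] by auto
  have p': "coprojection C (src C f) p'" by (rule coprojection_pullback[OF v'c(1) pb'])
  have "factors_through C (f \<cdot> p') v'" by (rule factors_throughI[of q']) (use d' in auto)
  then have "factors_through C (f \<cdot> p') v" using v'c(2) by (rule factors_through_trans) (rule d)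
  then have 1: "factors_through C p' p" using pullback_le_iff[OF pb, of p'] d' by blast
  have "factors_through C (f \<cdot> p) v" by (rule factors_throughI[of q]) (use d in auto)
  then have "factors_through C (f \<cdot> p) v'" using v'c(3) by (rule factors_through_trans) (rule d')
  then have 2: "factors_through C p p'" using pullback_le_iff[OF pb', of p] d by blast
  show "p' \<in> sum_class C (src C f) p" using sum_class_iff[OF p] p' 1 2 by blast
next
  note d = pullbackD[OF pb]
  fix p' assume p'_in: "p' \<in> sum_class C (src C f) p"
  then obtain h where h: "h \<in> hom C (src C p') (src C p)" "is_iso C h" "p \<cdot> h = p'"
    unfolding sum_class_def by blast
  obtain h' where h': "h' \<in> Arr C" "src C h' = tgt C h" "tgt C h' = src C h"
    "h' \<cdot> h = ident C (src C h)" "h \<cdot> h' = ident C (tgt C h)"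
    using is_isoD[OF h(2)] by metis
  have hh: "h \<in> Arr C" "src C h = src C p'" "tgt C h = src C p" using h(1) by auto
  have "is_pullback C p' (q \<cdot> h) f v"
  proof (rule pullbackI)
    show "f \<cdot> p' = v \<cdot> (q \<cdot> h)" using hh d ext2[OF d(9), of h] by (simp add: h(3)[symmetric])
    fix r s assume rs: "r \<in> Arr C" "s \<in> Arr C" "src C r = src C s" "tgt C r = src C f"
      "tgt C s = src C v" "f \<cdot> r = v \<cdot> s"
    obtain k where k: "k \<in> Arr C" "src C k = src C r" "tgt C k = src C p" "p \<cdot> k = r" "q \<cdot> k = s"
      by (rule pullback_ex[OF pb, of r s]) (use rs in auto)
    show "\<exists>k\<in>hom C (src C s) (src C p'). p' \<cdot> k = r \<and> (q \<cdot> h) \<cdot> k = s"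
      by (rule bexI[of _ "h' \<cdot> k"])
        (use k hh h'(1-3) d rs ext2[OF h'(5), of k] in \<open>simp_all add: h(3)[symmetric]\<close>)
  next
    fix a b assume ab: "a \<in> Arr C" "b \<in> Arr C" "src C a = src C b" "tgt C a = src C p'" "tgt C b = src C p'"
      "p' \<cdot> a = p' \<cdot> b" "(q \<cdot> h) \<cdot> a = (q \<cdot> h) \<cdot> b"
    have "p \<cdot> (h \<cdot> a) = p' \<cdot> a" "p \<cdot> (h \<cdot> b) = p' \<cdot> b"
      by (rule ext2[OF h(3)]; use ab hh d in simp)+
    then have "h \<cdot> a = h \<cdot> b"
      by (intro pullback_eq[OF pb, of "h \<cdot> a" "h \<cdot> b"]) (use ab hh d in simp_all)
    then have "h' \<cdot> (h \<cdot> a) = h' \<cdot> (h \<cdot> b)" by simp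
    then show "a = b" using ab hh h'(1-3) ext2[OF h'(4), of a] ext2[OF h'(4), of b] by simp
  next
    have "p \<cdot> h \<in> Arr C" "tgt C (p \<cdot> h) = tgt C p" using hh d by simp_all
    then show "p' \<in> Arr C" "tgt C p' = src C f" using h(3) d by simp_all
  qed (use hh d in simp_all)
  then show "p' \<in> pull C f (sum_class C Y v)"
    unfolding pull_def using sum_class_self[OF v] by blast
qed

lemma memb_pushforward:
  assumes v: "coprojection C Y v" and pb: "is_pullback C p q f v"
  shows "memb C Y (pushforward C f \<U>) v \<longleftrightarrow> memb C (src C f) \<U> p"
proof -
  have "tgt C f = Y" using pullbackD[OF pb] coprojectionD[OF v] by simp
  then show ?thesis
    unfolding memb_def pushforward_def
    using v pull_class[OF v pb] coprojection_pullback[OF v pb] by (auto simp: summands_def)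
qed

text \<open>Inverse image preserves order, meets and complements, so the conditions of
  \<open>betaI\<close> pass from \<open>\<U>\<close> to the summands whose inverse image lies in
  \<open>\<U>\<close>.\<close>

lemma pushforward_beta:
  assumes f: "f \<in> Arr C" and U: "\<U> \<in> beta C (src C f)"
  shows "pushforward C f \<U> \<in> beta C (tgt C f)"
proof -
  let ?X = "src C f" and ?Y = "tgt C f"
  define P where "P v \<longleftrightarrow> coprojection C ?Y v \<and> (\<exists>p q. is_pullback C p q f v \<and> memb C ?X \<U> p)" for v
  have P_iff: "P v \<longleftrightarrow> memb C ?X \<U> p" if v: "coprojection C ?Y v" and pb: "is_pullback C p q f v" for v p q
    using P_def memb_pushforward v pb by blast
  have eq: "pushforward C f \<U> = {sum_class C ?Y v | v. P v}" (is "_ = ?R")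
  proof (intro equalityI subsetI)
    fix V assume "V \<in> pushforward C f \<U>"
    then obtain v where v: "coprojection C ?Y v" "V = sum_class C ?Y v" "pull C f (sum_class C ?Y v) \<in> \<U>"
      unfolding pushforward_def summands_def by blast
    obtain p q where pb: "is_pullback C p q f v" by (rule coprojection_pullback_ex[OF v(1) f])
    have "memb C ?X \<U> p" using v pull_class[OF v(1) pb] coprojection_pullback[OF v(1) pb]
      unfolding memb_def by simp
    then show "V \<in> ?R" using P_iff[OF v(1) pb] v by blast
  next
    fix V assume "V \<in> ?R"
    then obtain v p q where v: "coprojection C ?Y v" "V = sum_class C ?Y v" "is_pullback C p q f v"
      "memb C ?X \<U> p" unfolding P_def by blast
    then have "memb C ?Y (pushforward C f \<U>) v" using memb_pushforward by blast
    then show "V \<in> pushforward C f \<U>" using v unfolding memb_def by simp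
  qed
  have le: "factors_through C (f \<cdot> p) v" if pb: "is_pullback C p q f v" for p q v
    by (rule factors_throughI[of q]) (use pullbackD[OF pb] in auto)
  show ?thesis
    unfolding eq
  proof (rule betaI(1))
    show "?Y \<in> Obj C" using f by simp
    show "coprojection C ?Y v" if "P v" for v using that unfolding P_def by blast
    fix v v' assume v: "P v" and v': "coprojection C ?Y v'" "factors_through C v v'"
    obtain p q where pb: "is_pullback C p q f v" and p: "memb C ?X \<U> p" using v unfolding P_def by blast
    obtain p' q' where pb': "is_pullback C p' q' f v'" by (rule coprojection_pullback_ex[OF v'(1) f])
    have "factors_through C (f \<cdot> p) v'"
      using le[OF pb] v' factors_through_trans coprojectionD(1)[OF v'(1)] by blast
    then have "factors_through C p p'" using pullback_le_iff[OF pb', of p] pullbackD[OF pb] by simp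
    then have "memb C ?X \<U> p'" using memb_up[OF U p] coprojection_pullback[OF v'(1) pb'] by blast
    then show "P v'" using P_iff[OF v'(1) pb'] by blast
  next
    fix v v' assume "P v" "P v'"
    then obtain p q p' q' where pb: "is_pullback C p q f v" "is_pullback C p' q' f v'"
      and p: "memb C ?X \<U> p" "memb C ?X \<U> p'" and v: "coprojection C ?Y v" "coprojection C ?Y v'"
      unfolding P_def by blast
    obtain w where w: "memb C ?X \<U> w" "factors_through C w p" "factors_through C w p'"
      using memb_meet[OF U p] by blast
    obtain c where c: "coprojection C ?Y c" "factors_through C c v" "factors_through C c v'"
      "\<And>t. factors_through C t v \<Longrightarrow> factors_through C t v' \<Longrightarrow> factors_through C t c"
      using coprojection_meet[OF v] by blast
    obtain r s where rs: "is_pullback C r s f c" by (rule coprojection_pullback_ex[OF c(1) f])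
    have "factors_through C (f \<cdot> w) v" "factors_through C (f \<cdot> w) v'"
      using pullback_le_iff[OF pb(1), of w] pullback_le_iff[OF pb(2), of w] w membD[OF w(1)] by auto
    then have "factors_through C w r"
      using c(4) pullback_le_iff[OF rs, of w] membD[OF w(1)] by simp
    then have "memb C ?X \<U> r" using memb_up[OF U w(1)] coprojection_pullback[OF c(1) rs] by blast
    then show "\<exists>w. P w \<and> factors_through C w v \<and> factors_through C w v'"
      using P_iff[OF c(1) rs] c by blast
  next
    fix x y m n assume c: "is_binary_coproduct C x y ?Y m n"
    obtain p q p' q' where pb: "is_pullback C p q f m" "is_pullback C p' q' f n"
      "is_binary_coproduct C (src C p) (src C p') ?X p p'" by (rule compl_pullback[OF c f refl])
    have "coprojection C ?Y m" "coprojection C ?Y n"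
      using coprojection_compl c binary_coproduct_sym by blast+
    then show "P m \<longleftrightarrow> \<not> P n" using P_iff pb memb_xor[OF U pb(3)] by blast
  qed
qed

end

text \<open>When \<open>\<U>\<close> contains \<open>u\<close>, this is the unique ultrafilter on
  the domain of \<open>u\<close> whose direct image along \<open>u\<close> is \<open>\<U>\<close>;
  see \<open>pushforward_restr\<close> and \<open>restr_pushforward\<close>.\<close>

definition restr_uf :: "('o, 'a) cat \<Rightarrow> 'a \<Rightarrow> 'a set set \<Rightarrow> 'a set set" where
  "restr_uf C u \<U> = {sum_class C (src C u) v | v. coprojection C (src C u) v \<and>
      memb C (tgt C u) \<U> (u \<cdot>\<^bsub>C\<^esub> v)}"

context extensive_cat
begin

context
  fixes X \<U> u
  assumes U: "\<U> \<in> beta C X" and u: "memb C X \<U> u"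
begin

lemma restr_uf:
  shows "restr_uf C u \<U> \<in> beta C (src C u)"
    and "memb C (src C u) (restr_uf C u \<U>) v \<longleftrightarrow> coprojection C (src C u) v \<and> memb C X \<U> (u \<cdot> v)"
proof -
  note du = membD[OF u]
  have cu: "coprojection C X u" by (rule memb_coprojection[OF u])
  note mono = mono_cancel[OF coprojection_mono[OF cu]]
  let ?P = "\<lambda>v. coprojection C (src C u) v \<and> memb C X \<U> (u \<cdot> v)"
  have le: "factors_through C (u \<cdot> a) (u \<cdot> b)"
    if ab: "factors_through C a b" "b \<in> Arr C" "tgt C b = src C u" for a b
  proof -
    obtain h where "h \<in> Arr C" "src C h = src C a" "tgt C h = src C b" "b \<cdot> h = a"
      using ab(1) by (rule factors_throughE)
    then show ?thesis by (intro factors_throughI[of h]) (use ab du in auto)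
  qed
  \<comment> \<open>An arrow below \<open>u\<close> has the form \<open>u \<cdot> a\<close>; since
    \<open>u\<close> is monic, comparing it with \<open>u \<cdot> b\<close> amounts to comparing
    \<open>a\<close> with \<open>b\<close>.\<close>
  have le_u: "\<exists>a. a \<in> Arr C \<and> tgt C a = src C u \<and> w = u \<cdot> a \<and> (\<forall>b. b \<in> Arr C \<longrightarrow> tgt C b = src C u \<longrightarrow>
      factors_through C w (u \<cdot> b) \<longrightarrow> factors_through C a b)" if w: "factors_through C w u" for w
  proof -
    obtain a where a: "a \<in> Arr C" "src C a = src C w" "tgt C a = src C u" "u \<cdot> a = w"
      using w by (rule factors_throughE)
    have "factors_through C a b" if b: "b \<in> Arr C" "tgt C b = src C u" "factors_through C w (u \<cdot> b)" for b
    proof -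
      obtain h where h: "h \<in> Arr C" "src C h = src C w" "tgt C h = src C (u \<cdot> b)" "(u \<cdot> b) \<cdot> h = w"
        using b(3) by (rule factors_throughE)
      have "b \<cdot> h = a" by (rule mono) (use h b a du in auto)
      then show ?thesis by (intro factors_throughI[of h]) (use h b du in auto)
    qed
    then show ?thesis using a by blast
  qed
  \<comment> \<open>Each condition of \<open>betaI\<close> occurs twice below, once for each of its
    two conclusions.\<close>
  have beta: "{sum_class C (src C u) v | v. ?P v} \<in> beta C (src C u) \<and>
     (memb C (src C u) {sum_class C (src C u) v | v. ?P v} v \<longleftrightarrow> ?P v)" for v
  proof (intro conjI; rule betaI)
    show "src C u \<in> Obj C" using du by simp
    show "src C u \<in> Obj C" using du by simp
    show "coprojection C (src C u) v" if "?P v" for v using that by blast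
    show "coprojection C (src C u) v" if "?P v" for v using that by blast
    have up: "?P n" if "?P m" "coprojection C (src C u) n" "factors_through C m n" for m n
      using that memb_up[OF U _ coprojection_comp[OF cu that(2)]] le[OF that(3)] coprojectionD[OF that(2)]
      by blast
    then show "?P n" if "?P m" "coprojection C (src C u) n" "factors_through C m n" for m n using that by blast
    show "?P n" if "?P m" "coprojection C (src C u) n" "factors_through C m n" for m n using that up by blast
    have meet: "\<exists>w. ?P w \<and> factors_through C w m \<and> factors_through C w n" if m: "?P m" and n: "?P n" for m n
    proof -
      note dm = coprojectionD[OF conjunct1[OF m]] and dn = coprojectionD[OF conjunct1[OF n]]
      obtain w where w: "memb C X \<U> w" "factors_through C w (u \<cdot> m)" "factors_through C w (u \<cdot> n)"
        using memb_meet[OF U] m n by blast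
      have "factors_through C (u \<cdot> m) u" by (rule factors_throughI[of m]) (use dm du in auto)
      then obtain a where a: "a \<in> Arr C" "tgt C a = src C u" "w = u \<cdot> a"
         "\<forall>b. b \<in> Arr C \<longrightarrow> tgt C b = src C u \<longrightarrow> factors_through C w (u \<cdot> b) \<longrightarrow> factors_through C a b"
        using le_u w(2) factors_through_trans du(1) by meson
      obtain c where c: "coprojection C (src C u) c" "factors_through C c m" "factors_through C c n"
        "\<And>t. factors_through C t m \<Longrightarrow> factors_through C t n \<Longrightarrow> factors_through C t c"
        using coprojection_meet m n by blast
      note dc = coprojectionD[OF c(1)]
      have "factors_through C a c" using c(4) a(4) w dm dn by blast
      then have "factors_through C w (u \<cdot> c)" using le[of a c] dc a(3) by simp
      then have "?P c" using memb_up[OF U w(1) coprojection_comp[OF cu c(1)]] c(1) by blast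
      then show ?thesis using c by blast
    qed
    then show "\<exists>w. ?P w \<and> factors_through C w m \<and> factors_through C w n" if "?P m" "?P n" for m n
      using that by blast
    show "\<exists>w. ?P w \<and> factors_through C w m \<and> factors_through C w n" if "?P m" "?P n" for m n
      using that meet by blast
    have xor: "?P m \<longleftrightarrow> \<not> ?P n" if c: "is_binary_coproduct C x y (src C u) m n" for x y m n
    proof -
      note dc = binary_coproductD[OF c]
      have pm: "coprojection C (src C u) m" and pn: "coprojection C (src C u) n"
        using coprojection_compl c binary_coproduct_sym by blast+
      have cm: "coprojection C X (u \<cdot> m)" by (rule coprojection_comp[OF cu pm])
      have un: "factors_through C t m \<and> factors_through C t n \<Longrightarrow> is_initial C (src C t)" for t
        using factors_both_initial[OF c] by blast
      have nb: "\<not> (memb C X \<U> (u \<cdot> m) \<and> memb C X \<U> (u \<cdot> n))"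
      proof
        assume "memb C X \<U> (u \<cdot> m) \<and> memb C X \<U> (u \<cdot> n)"
        then obtain w where w: "memb C X \<U> w" "factors_through C w (u \<cdot> m)" "factors_through C w (u \<cdot> n)"
          using memb_meet[OF U] by blast
        have "factors_through C (u \<cdot> m) u" by (rule factors_throughI[of m]) (use dc du in auto)
        then obtain a where a: "a \<in> Arr C" "tgt C a = src C u" "w = u \<cdot> a"
           "\<forall>b. b \<in> Arr C \<longrightarrow> tgt C b = src C u \<longrightarrow> factors_through C w (u \<cdot> b) \<longrightarrow> factors_through C a b"
          using le_u w(2) factors_through_trans du(1) by meson
        have "is_initial C (src C a)" using un a w dc by blast
        then have "is_initial C (src C w)" using a du by simp
        then show False using memb_not_initial[OF U w(1)] by blast
      qed
      \<comment> \<open>If \<open>u \<cdot> m\<close> is missing, its complement \<open>k\<close> is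
        present. A member below both \<open>u\<close> and \<open>k\<close> has the form
        \<open>u \<cdot> a\<close> with \<open>a\<close> disjoint from \<open>m\<close>, so
        \<open>a\<close> lies below \<open>n\<close>.\<close>
      have "memb C X \<U> (u \<cdot> n)" if nm: "\<not> memb C X \<U> (u \<cdot> m)"
      proof -
        obtain k where k: "is_binary_coproduct C (src C (u \<cdot> m)) (src C k) X (u \<cdot> m) k"
          using cm by (rule coprojectionE)
        have "memb C X \<U> k" using nm memb_xor[OF U k] by blast
        then obtain w where w: "memb C X \<U> w" "factors_through C w u" "factors_through C w k"
          using memb_meet[OF U u] by blast
        obtain a where a: "a \<in> Arr C" "tgt C a = src C u" "w = u \<cdot> a" using le_u[OF w(2)] by blast
        have "factors_through C a n"
        proof (rule factors_compl[OF c a(1,2)])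
          fix t assume t: "factors_through C t a" "factors_through C t m"
          obtain h where h: "h \<in> Arr C" "src C h = src C t" "tgt C h = src C a" "a \<cdot> h = t"
            using t(1) by (rule factors_throughE)
          have tA: "t \<in> Arr C" "tgt C t = src C u" using h a by auto
          have "factors_through C (u \<cdot> t) (u \<cdot> m)" using le[OF t(2)] dc by simp
          moreover have "factors_through C (u \<cdot> t) k"
            using le[OF t(1) a(1,2)] w(3) factors_through_trans binary_coproductD(7)[OF k] a(3) by blast
          ultimately have "is_initial C (src C (u \<cdot> t))" using factors_both_initial[OF k] by blast
          then show "is_initial C (src C t)" using tA du by simp
        qed
        then have "factors_through C w (u \<cdot> n)" using le[of a n] dc a(3) by simp
        then show ?thesis using memb_up[OF U w(1) coprojection_comp[OF cu pn]] by blast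
      qed
      then show ?thesis using nb pm pn by blast
    qed
    then show "?P m \<longleftrightarrow> \<not> ?P n" if "is_binary_coproduct C x y (src C u) m n" for x y m n using that by blast
    show "?P m \<longleftrightarrow> \<not> ?P n" if "is_binary_coproduct C x y (src C u) m n" for x y m n using that xor by blast
  qed
  show "restr_uf C u \<U> \<in> beta C (src C u)" unfolding restr_uf_def du(2) using beta by blast
  show "memb C (src C u) (restr_uf C u \<U>) v \<longleftrightarrow> ?P v" unfolding restr_uf_def du(2) using beta by blast
qed

text \<open>By \<open>beta_eqI\<close> one inclusion suffices: the inverse image of \<open>v\<close>
  under \<open>u\<close>, regarded as a summand of \<open>X\<close>, lies below
  \<open>v\<close>.\<close>

lemma pushforward_restr: "pushforward C u (restr_uf C u \<U>) = \<U>"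
proof -
  note du = membD[OF u]
  have b: "pushforward C u (restr_uf C u \<U>) \<in> beta C X"
    using pushforward_beta[OF du(1)] restr_uf(1) du(2) by simp
  show ?thesis
  proof (rule beta_eqI[OF b U])
    fix v assume v: "memb C X (pushforward C u (restr_uf C u \<U>)) v"
    have cv: "coprojection C X v" by (rule memb_coprojection[OF v])
    obtain p q where pb: "is_pullback C p q u v"
      by (rule coprojection_pullback_ex[of u v]) (use cv du in auto)
    note d = pullbackD[OF pb]
    have "memb C X \<U> (u \<cdot> p)" using v memb_pushforward[OF cv pb] restr_uf(2) by blast
    moreover have "factors_through C (u \<cdot> p) v" by (rule factors_throughI[of q]) (use d in auto)
    ultimately show "memb C X \<U> v" using memb_up[OF U] cv by blast
  qed
qed

end

lemma compose_class:
  assumes u: "coprojection C X u" and p: "coprojection C (src C u) p"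
  shows "compose_class C X u (sum_class C (src C u) p) = sum_class C X (u \<cdot> p)"
proof -
  note d = coprojectionD[OF u]
  have le: "factors_through C (u \<cdot> a) (u \<cdot> b)"
    if ab: "factors_through C a b" "b \<in> Arr C" "tgt C b = src C u" for a b
  proof -
    obtain h where "h \<in> Arr C" "src C h = src C a" "tgt C h = src C b" "b \<cdot> h = a"
      using ab(1) by (rule factors_throughE)
    then show ?thesis by (intro factors_throughI[of h]) (use ab d in auto)
  qed
  have "sum_class C X (u \<cdot> p') = sum_class C X (u \<cdot> p)" if "p' \<in> sum_class C (src C u) p" for p'
  proof -
    have p': "coprojection C (src C u) p'" "factors_through C p' p" "factors_through C p p'"
      using that sum_class_iff[OF p] by auto
    show ?thesis
      using sum_class_eq_iff[OF coprojection_comp[OF u p'(1)] coprojection_comp[OF u p]]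
        le[OF p'(2)] le[OF p'(3)] coprojectionD[OF p] coprojectionD[OF p'(1)] by blast
  qed
  then show ?thesis unfolding compose_class_def using sum_class_self[OF p] by blast
qed

text \<open>The equivalence required for all summands of \<open>Y\<close> says that
  \<open>\<V>\<close> and the direct image of the restricted ultrafilter have the same members. So
  the target ultrafilter of a continuous partial map is determined by the map and the source
  ultrafilter.\<close>

lemma continuous_iff:
  assumes U: "\<U> \<in> beta C X" and V: "\<V> \<in> beta C Y"
  shows "continuous_partial C (X, \<U>) (Y, \<V>) (u, f) \<longleftrightarrow>
    memb C X \<U> u \<and> f \<in> hom C (src C u) Y \<and> \<V> = pushforward C f (restr_uf C u \<U>)"
proof (cases "memb C X \<U> u \<and> f \<in> hom C (src C u) Y")
  case True
  then have u: "memb C X \<U> u" and f: "f \<in> Arr C" "src C f = src C u" "tgt C f = Y" by auto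
  note du = membD[OF u]
  have cu: "coprojection C X u" by (rule memb_coprojection[OF u])
  let ?W = "pushforward C f (restr_uf C u \<U>)"
  have W: "?W \<in> beta C Y" using pushforward_beta[OF f(1)] restr_uf(1)[OF U u] f by simp
  have key: "compose_class C X u (pull C f (sum_class C Y v)) \<in> \<U> \<longleftrightarrow> memb C Y ?W v"
    if v: "coprojection C Y v" for v
  proof -
    obtain p q where pb: "is_pullback C p q f v"
      by (rule coprojection_pullback_ex[of f v]) (use v f in auto)
    have p: "coprojection C (src C u) p" using coprojection_pullback[OF v pb] f by simp
    have "pull C f (sum_class C Y v) = sum_class C (src C u) p" using pull_class[OF v pb] f by simp
    then have "compose_class C X u (pull C f (sum_class C Y v)) = sum_class C X (u \<cdot> p)"
      using compose_class[OF cu p] by simp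
    then show ?thesis
      using memb_pushforward[OF v pb, of "restr_uf C u \<U>"] restr_uf(2)[OF U u, of p] p
        coprojection_comp[OF cu p] f
      by (simp add: memb_def)
  qed
  have "(\<forall>S\<in>summands C Y. S \<in> \<V> \<longleftrightarrow> compose_class C X u (pull C f S) \<in> \<U>) \<longleftrightarrow>
      (\<forall>v. coprojection C Y v \<longrightarrow> (memb C Y \<V> v \<longleftrightarrow> memb C Y ?W v))"
    using key unfolding summands_def memb_def by auto
  also have "\<dots> \<longleftrightarrow> \<V> = ?W"
    using beta_eqI[OF V W] memb_coprojection by blast
  finally show ?thesis using True cu u unfolding continuous_partial_def memb_def by auto
next
  case False
  then show ?thesis unfolding continuous_partial_def memb_def by auto
qed

lemma continuousD:
  assumes U: "\<U> \<in> beta C X" and V: "\<V> \<in> beta C Y" and c: "continuous_partial C (X, \<U>) (Y, \<V>) (u, f)"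
  shows "memb C X \<U> u" "f \<in> Arr C" "src C f = src C u" "tgt C f = Y"
    "memb C Y \<V> v \<Longrightarrow> is_pullback C p q f v \<Longrightarrow> memb C X \<U> (u \<cdot> p)"
proof -
  show 1: "memb C X \<U> u" "f \<in> Arr C" "src C f = src C u" "tgt C f = Y"
    using c continuous_iff[OF U V] by auto
  assume v: "memb C Y \<V> v" and pb: "is_pullback C p q f v"
  have "\<V> = pushforward C f (restr_uf C u \<U>)" using c continuous_iff[OF U V] by blast
  then have "memb C (src C u) (restr_uf C u \<U>) p"
    using memb_pushforward[OF memb_coprojection[OF v] pb] v 1 by simp
  then show "memb C X \<U> (u \<cdot> p)" using restr_uf(2)[OF U 1(1)] by blast
qed

text \<open>Continuity near the ultrafilter: on a smaller member \<open>u \<cdot> a\<close> of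
  \<open>\<U>\<close>, the map takes values in \<open>v\<close>. The inverse image of
  \<open>v\<close> serves as \<open>a\<close>.\<close>

lemma continuous_germ:
  assumes U: "\<U> \<in> beta C X" and V: "\<V> \<in> beta C Y" and c: "continuous_partial C (X, \<U>) (Y, \<V>) (u, f)"
    and v: "memb C Y \<V> v"
  obtains a b where "memb C X \<U> (u \<cdot> a)" "a \<in> Arr C" "b \<in> Arr C" "tgt C a = src C u" "src C b = src C a"
     "tgt C b = src C v" "f \<cdot> a = v \<cdot> b" "coprojection C (src C u) a"
proof -
  note f = continuousD[OF U V c]
  obtain p q where pb: "is_pullback C p q f v"
    by (rule coprojection_pullback_ex[of f v]) (use memb_coprojection[OF v] f in auto)
  show ?thesis
    using that[of p q] f(5)[OF v pb] pullbackD[OF pb] coprojection_pullback[OF memb_coprojection[OF v] pb] f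
    by simp
qed

text \<open>The condition on germs gives one inclusion between \<open>\<V>\<close> and the direct
  image; maximality of ultrafilters supplies the other.\<close>

lemma continuousI:
  assumes U: "\<U> \<in> beta C X" and V: "\<V> \<in> beta C Y" and u: "memb C X \<U> u"
    and f: "f \<in> Arr C" "src C f = src C u" "tgt C f = Y"
    and germ: "\<And>v. memb C Y \<V> v \<Longrightarrow> \<exists>a b. memb C X \<U> (u \<cdot> a) \<and> a \<in> Arr C \<and> b \<in> Arr C \<and>
      tgt C a = src C u \<and> src C b = src C a \<and> tgt C b = src C v \<and> f \<cdot> a = v \<cdot> b"
  shows "continuous_partial C (X, \<U>) (Y, \<V>) (u, f)"
proof -
  note du = membD[OF u]
  have cu: "coprojection C X u" by (rule memb_coprojection[OF u])
  let ?W = "pushforward C f (restr_uf C u \<U>)"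
  have W: "?W \<in> beta C Y" using pushforward_beta[OF f(1)] restr_uf(1)[OF U u] f by simp
  have "\<V> = ?W"
  proof (rule beta_eqI[OF V W])
    fix v assume v: "memb C Y \<V> v"
    have cv: "coprojection C Y v" by (rule memb_coprojection[OF v])
    obtain p q where pb: "is_pullback C p q f v"
      by (rule coprojection_pullback_ex[of f v]) (use cv f in auto)
    note d = pullbackD[OF pb]
    have cp: "coprojection C (src C u) p" using coprojection_pullback[OF cv pb] f by simp
    obtain a b where ab: "memb C X \<U> (u \<cdot> a)" "a \<in> Arr C" "b \<in> Arr C"
      "tgt C a = src C u" "src C b = src C a" "tgt C b = src C v" "f \<cdot> a = v \<cdot> b"
      using germ[OF v] by blast
    obtain k where k: "k \<in> Arr C" "src C k = src C a" "tgt C k = src C p" "p \<cdot> k = a" "q \<cdot> k = b"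
      by (rule pullback_ex[OF pb, of a b]) (use ab f in auto)
    have "factors_through C (u \<cdot> a) (u \<cdot> p)"
      by (rule factors_throughI[of k]) (use k d du f in auto)
    then have "memb C X \<U> (u \<cdot> p)" using memb_up[OF U ab(1) coprojection_comp[OF cu cp]] by blast
    then show "memb C Y ?W v" using memb_pushforward[OF cv pb] restr_uf(2)[OF U u] cp f by simp
  qed
  then show ?thesis using continuous_iff[OF U V] u f by simp
qed

section \<open>The category of ultrafilters\<close>

lemma uf_eqI:
  assumes "memb C X \<U> (u \<cdot> h)" "h \<in> Arr C" "h' \<in> Arr C" "tgt C h = src C u" "tgt C h' = src C u'"
    "u \<in> Arr C" "u' \<in> Arr C" "u \<cdot> h = u' \<cdot> h'" "f \<cdot> h = f' \<cdot> h'"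
  shows "uf_eq C (X, \<U>) (u, f) (u', f')"
proof -
  have "src C h = src C (u \<cdot> h)" using assms(2,4,6) by simp
  also have "\<dots> = src C h'" unfolding assms(8) using assms(3,5,7) by simp
  finally have "src C h' = src C h" by simp
  then show ?thesis
    unfolding uf_eq_def prod.case
    by (intro exI[of _ "u \<cdot> h"] conjI bexI[of _ h] bexI[of _ h'])
      (use assms in \<open>auto simp: memb_def\<close>)
qed

lemma uf_eqE:
  assumes "uf_eq C (X, \<U>) (u, f) (u', f')" "u \<in> Arr C"
  obtains h h' where "memb C X \<U> (u \<cdot> h)" "h \<in> Arr C" "h' \<in> Arr C" "tgt C h = src C u"
    "tgt C h' = src C u'" "src C h' = src C h" "u \<cdot> h = u' \<cdot> h'" "f \<cdot> h = f' \<cdot> h'"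
proof -
  obtain w h h' where w: "coprojection C X w" "sum_class C X w \<in> \<U>" "h \<in> hom C (src C w) (src C u)"
    "h' \<in> hom C (src C w) (src C u')" "u \<cdot> h = w" "u' \<cdot> h' = w" "f \<cdot> h = f' \<cdot> h'"
    using assms(1) unfolding uf_eq_def by auto
  have "memb C X \<U> (u \<cdot> h)" using w(1,2,5) unfolding memb_def by simp
  then show ?thesis using that[of h h'] w by simp
qed

lemma uf_eq_refl:
  assumes "memb C X \<U> u" "f \<in> Arr C" "src C f = src C u"
  shows "uf_eq C (X, \<U>) (u, f) (u, f)"
  by (rule uf_eqI[of _ _ _ "ident C (src C u)" "ident C (src C u)"])
    (use assms membD[OF assms(1)] in simp_all)

lemma uf_eq_sym:
  assumes "uf_eq C (X, \<U>) (u, f) (u', f')" "u \<in> Arr C" "u' \<in> Arr C"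
  shows "uf_eq C (X, \<U>) (u', f') (u, f)"
  using assms(1,2) by (rule uf_eqE) (rule uf_eqI, use assms in auto)

text \<open>The two domains of agreement are cut down to a common member \<open>w\<close>. On it,
  the two factorisations through \<open>u'\<close> coincide because \<open>u'\<close> is
  monic.\<close>

lemma uf_eq_trans:
  assumes U: "\<U> \<in> beta C X" and m: "memb C X \<U> u" "memb C X \<U> u'" "memb C X \<U> u''"
    and f: "f \<in> Arr C" "src C f = src C u" "f' \<in> Arr C" "src C f' = src C u'" "f'' \<in> Arr C" "src C f'' = src C u''"
    and 1: "uf_eq C (X, \<U>) (u, f) (u', f')" and 2: "uf_eq C (X, \<U>) (u', f') (u'', f'')"
  shows "uf_eq C (X, \<U>) (u, f) (u'', f'')"
proof -
  note d = membD[OF m(1)] membD[OF m(2)] membD[OF m(3)]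
  obtain h h' where h: "memb C X \<U> (u \<cdot> h)" "h \<in> Arr C" "h' \<in> Arr C" "tgt C h = src C u"
    "tgt C h' = src C u'" "src C h' = src C h" "u \<cdot> h = u' \<cdot> h'" "f \<cdot> h = f' \<cdot> h'"
    using 1 d(1) by (rule uf_eqE)
  obtain k k' where k: "memb C X \<U> (u' \<cdot> k)" "k \<in> Arr C" "k' \<in> Arr C" "tgt C k = src C u'"
    "tgt C k' = src C u''" "src C k' = src C k" "u' \<cdot> k = u'' \<cdot> k'" "f' \<cdot> k = f'' \<cdot> k'"
    using 2 d(4) by (rule uf_eqE)
  obtain w where w: "memb C X \<U> w" "factors_through C w (u \<cdot> h)" "factors_through C w (u' \<cdot> k)"
    using memb_meet[OF U h(1) k(1)] by blast
  obtain a where a: "a \<in> Arr C" "src C a = src C w" "tgt C a = src C (u \<cdot> h)" "(u \<cdot> h) \<cdot> a = w"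
    using w(2) by (rule factors_throughE)
  obtain b where b: "b \<in> Arr C" "src C b = src C w" "tgt C b = src C (u' \<cdot> k)" "(u' \<cdot> k) \<cdot> b = w"
    using w(3) by (rule factors_throughE)
  have a': "tgt C a = src C h" and b': "tgt C b = src C k" using a b h k d by auto
  have ua: "u \<cdot> (h \<cdot> a) = w" "u' \<cdot> (h' \<cdot> a) = w"
    using a a' h(2-6) d ext2[OF h(7), of a] by simp_all
  have ub: "u' \<cdot> (k \<cdot> b) = w" "u'' \<cdot> (k' \<cdot> b) = w"
    using b b' k(2-6) d ext2[OF k(7), of b] by simp_all
  have hk: "h' \<cdot> a = k \<cdot> b"
    by (rule mono_cancel[OF coprojection_mono[OF memb_coprojection[OF m(2)]]])
      (use ua ub a b a' b' h(2-6) k(2-6) d in simp_all)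
  have "f \<cdot> (h \<cdot> a) = f' \<cdot> (h' \<cdot> a)" using ext2[OF h(8), of a] a a' h(2-6) f by simp
  also have "\<dots> = f'' \<cdot> (k' \<cdot> b)" unfolding hk using ext2[OF k(8), of b] b b' k(2-6) f by simp
  finally show ?thesis
    by (intro uf_eqI[of _ _ _ "h \<cdot> a" "k' \<cdot> b"]) (use ua ub a b a' b' h(2-6) k(2-6) d w in simp_all)
qed

end

section \<open>Composition of classes of partial maps\<close>

context extensive_cat
begin

lemma uf_class_eqI:
  assumes U: "\<U> \<in> beta C X" and V: "\<V> \<in> beta C Y"
    and c: "continuous_partial C (X, \<U>) (Y, \<V>) (u, f)" "continuous_partial C (X, \<U>) (Y, \<V>) (u', f')"
    and e: "uf_eq C (X, \<U>) (u, f) (u', f')"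
  shows "uf_class C (X, \<U>) (Y, \<V>) (u, f) = uf_class C (X, \<U>) (Y, \<V>) (u', f')"
proof -
  note d = continuousD(1-3)[OF U V c(1)] and d' = continuousD(1-3)[OF U V c(2)]
  note m = membD[OF d(1)] membD[OF d'(1)]
  have e': "uf_eq C (X, \<U>) (u', f') (u, f)" by (rule uf_eq_sym[OF e]) (use m in simp_all)
  have "uf_eq C (X, \<U>) (u, f) (u'', f'') \<longleftrightarrow> uf_eq C (X, \<U>) (u', f') (u'', f'')"
    if c'': "continuous_partial C (X, \<U>) (Y, \<V>) (u'', f'')" for u'' f''
  proof -
    note d'' = continuousD(1-3)[OF U V c'']
    show ?thesis
      using uf_eq_trans[OF U d'(1) d(1) d''(1) d'(2,3) d(2,3) d''(2,3) e']
        uf_eq_trans[OF U d(1) d'(1) d''(1) d(2,3) d'(2,3) d''(2,3) e] by blast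
  qed
  then show ?thesis unfolding uf_class_def by auto
qed

lemma uf_arr_eqI:
  assumes "\<U> \<in> beta C X" "\<V> \<in> beta C Y"
    "continuous_partial C (X, \<U>) (Y, \<V>) (u, f)" "continuous_partial C (X, \<U>) (Y, \<V>) (u', f')"
    "uf_eq C (X, \<U>) (u, f) (u', f')"
  shows "uf_arr C (X, \<U>) (Y, \<V>) (u, f) = uf_arr C (X, \<U>) (Y, \<V>) (u', f')"
  using uf_class_eqI[OF assms] unfolding uf_arr_def by simp

text \<open>If \<open>g\<close> takes values in \<open>z\<close> on \<open>v \<cdot> a\<close>,
  continuity of \<open>f\<close> at \<open>v \<cdot> a\<close> gives a member of \<open>\<U>\<close>
  that maps there; it lies below the domain of the composite by the universal property of the
  pullback.\<close>

lemma continuous_comp: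
  assumes U: "\<U> \<in> beta C X" and V: "\<V> \<in> beta C Y" and W: "\<W> \<in> beta C Z"
    and c: "continuous_partial C (X, \<U>) (Y, \<V>) (u, f)" "continuous_partial C (Y, \<V>) (Z, \<W>) (v, g)"
    and pb: "is_pullback C p q f v"
  shows "continuous_partial C (X, \<U>) (Z, \<W>) (u \<cdot> p, g \<cdot> q)"
proof -
  note f = continuousD[OF U V c(1)] and g = continuousD[OF V W c(2)]
  note d = pullbackD[OF pb] and m = membD[OF f(1)] membD[OF g(1)]
  show ?thesis
  proof (rule continuousI[OF U W f(5)[OF g(1) pb]])
    fix z assume z: "memb C Z \<W> z"
    obtain a b where ab: "memb C Y \<V> (v \<cdot> a)" "a \<in> Arr C" "b \<in> Arr C" "tgt C a = src C v" "src C b = src C a"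
     "tgt C b = src C z" "g \<cdot> a = z \<cdot> b"
      by (rule continuous_germ[OF V W c(2) z])
    obtain a' b' where ab': "memb C X \<U> (u \<cdot> a')" "a' \<in> Arr C" "b' \<in> Arr C" "tgt C a' = src C u"
      "src C b' = src C a'" "tgt C b' = src C (v \<cdot> a)" "f \<cdot> a' = (v \<cdot> a) \<cdot> b'"
      by (rule continuous_germ[OF U V c(1) ab(1)])
    have b': "tgt C b' = src C a" using ab' ab m by simp
    obtain k where k: "k \<in> Arr C" "src C k = src C a'" "tgt C k = src C p" "p \<cdot> k = a'" "q \<cdot> k = a \<cdot> b'"
      by (rule pullback_ex[OF pb, of a' "a \<cdot> b'"]) (use ab ab' b' f m in simp_all)
    have "(g \<cdot> q) \<cdot> k = z \<cdot> (b \<cdot> b')"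
      using k d g ab(2-6) ab'(2-6) b' ext2[OF ab(7), of b'] membD[OF z] by simp
    moreover have "(u \<cdot> p) \<cdot> k = u \<cdot> a'" using k d f m by simp
    ultimately show "\<exists>a b. memb C X \<U> ((u \<cdot> p) \<cdot> a) \<and> a \<in> Arr C \<and> b \<in> Arr C \<and>
      tgt C a = src C (u \<cdot> p) \<and> src C b = src C a \<and> tgt C b = src C z \<and> (g \<cdot> q) \<cdot> a = z \<cdot> b"
      using ab'(1) k(1-3) ab ab' b' d f m by (intro exI[of _ k] exI[of _ "b \<cdot> b'"]) simp
  qed (use d f g m in simp_all)
qed

text \<open>Everything is restricted to a member \<open>w\<close> of \<open>\<U>\<close> on which
  \<open>f\<close> and \<open>f'\<close> agree and whose image lies in a member of
  \<open>\<V>\<close> on which \<open>g\<close> and \<open>g'\<close> agree. The arrows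
  \<open>t\<close> and \<open>t'\<close> place the domain of \<open>w\<close> in the two
  pullbacks.\<close>

lemma uf_eq_comp:
  assumes U: "\<U> \<in> beta C X" and V: "\<V> \<in> beta C Y" and W: "\<W> \<in> beta C Z"
    and c: "continuous_partial C (X, \<U>) (Y, \<V>) (u, f)" "continuous_partial C (Y, \<V>) (Z, \<W>) (v, g)"
    and c': "continuous_partial C (X, \<U>) (Y, \<V>) (u', f')" "continuous_partial C (Y, \<V>) (Z, \<W>) (v', g')"
    and e: "uf_eq C (X, \<U>) (u, f) (u', f')" "uf_eq C (Y, \<V>) (v, g) (v', g')"
    and pb: "is_pullback C p q f v" and pb': "is_pullback C p' q' f' v'"
  shows "uf_eq C (X, \<U>) (u \<cdot> p, g \<cdot> q) (u' \<cdot> p', g' \<cdot> q')"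
proof -
  note f = continuousD(1-4)[OF U V c(1)] and g = continuousD(1-4)[OF V W c(2)]
  note f' = continuousD(1-4)[OF U V c'(1)] and g' = continuousD(1-4)[OF V W c'(2)]
  note d = pullbackD[OF pb] pullbackD[OF pb']
  note m = membD[OF f(1)] membD[OF g(1)] membD[OF f'(1)] membD[OF g'(1)]
  obtain h h' where h: "memb C X \<U> (u \<cdot> h)" "h \<in> Arr C" "h' \<in> Arr C" "tgt C h = src C u"
    "tgt C h' = src C u'" "src C h' = src C h" "u \<cdot> h = u' \<cdot> h'" "f \<cdot> h = f' \<cdot> h'"
    using e(1) m(1) by (rule uf_eqE)
  obtain k k' where k: "memb C Y \<V> (v \<cdot> k)" "k \<in> Arr C" "k' \<in> Arr C" "tgt C k = src C v"
    "tgt C k' = src C v'" "src C k' = src C k" "v \<cdot> k = v' \<cdot> k'" "g \<cdot> k = g' \<cdot> k'"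
    using e(2) m(4) by (rule uf_eqE)
  obtain a b where ab: "memb C X \<U> (u \<cdot> a)" "a \<in> Arr C" "b \<in> Arr C" "tgt C a = src C u" "src C b = src C a"
     "tgt C b = src C (v \<cdot> k)" "f \<cdot> a = (v \<cdot> k) \<cdot> b"
    by (rule continuous_germ[OF U V c(1) k(1)])
  have b: "tgt C b = src C k" using ab k m by simp
  obtain w where w: "memb C X \<U> w" "factors_through C w (u \<cdot> h)" "factors_through C w (u \<cdot> a)"
    using memb_meet[OF U h(1) ab(1)] by blast
  obtain r where r: "r \<in> Arr C" "src C r = src C w" "tgt C r = src C (u \<cdot> h)" "(u \<cdot> h) \<cdot> r = w"
    using w(2) by (rule factors_throughE)
  obtain s where s: "s \<in> Arr C" "src C s = src C w" "tgt C s = src C (u \<cdot> a)" "(u \<cdot> a) \<cdot> s = w"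
    using w(3) by (rule factors_throughE)
  have r': "tgt C r = src C h" using r(3) h(2,4) m by simp
  have s': "tgt C s = src C a" using s(3) ab(2,4) m by simp
  have ur: "u \<cdot> (h \<cdot> r) = w" using r r' h(2,4) m by simp
  have us: "u \<cdot> (a \<cdot> s) = w" using s s' ab(2,4) m by simp
  have u'r: "u' \<cdot> (h' \<cdot> r) = w" using ext2[OF h(7), of r] ur r r' h(2-6) m by simp
  have hr: "h \<cdot> r = a \<cdot> s"
    by (rule mono_cancel[OF coprojection_mono[OF memb_coprojection[OF f(1)]]])
      (use ur us r s r' s' h(2-6) ab(2-6) m in simp_all)
  have fhr: "f \<cdot> (h \<cdot> r) = v \<cdot> (k \<cdot> (b \<cdot> s))"
  proof -
    have "f \<cdot> (a \<cdot> s) = ((v \<cdot> k) \<cdot> b) \<cdot> s" by (rule ext2[OF ab(7)]) (use ab s s' f in simp_all)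
    then show ?thesis unfolding hr using ab(2-5) b s s' k(2-6) m by simp
  qed
  have f'hr: "f' \<cdot> (h' \<cdot> r) = v' \<cdot> (k' \<cdot> (b \<cdot> s))"
  proof -
    have "f' \<cdot> (h' \<cdot> r) = (f \<cdot> h) \<cdot> r" unfolding h(8) using r r' h(2-6) f' by simp
    also have "\<dots> = v \<cdot> (k \<cdot> (b \<cdot> s))" using fhr r r' h(2-6) f by simp
    also have "\<dots> = (v' \<cdot> k') \<cdot> (b \<cdot> s)" by (rule ext2[OF k(7)]) (use k(2-6) b ab s s' m in simp_all)
    also have "\<dots> = v' \<cdot> (k' \<cdot> (b \<cdot> s))" using k(2-6) b ab s s' m by simp
    finally show ?thesis .
  qed
  obtain t where t: "t \<in> Arr C" "src C t = src C (h \<cdot> r)" "tgt C t = src C p" "p \<cdot> t = h \<cdot> r" "q \<cdot> t = k \<cdot> (b \<cdot> s)"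
    by (rule pullback_ex[OF pb, of "h \<cdot> r" "k \<cdot> (b \<cdot> s)"])
      (use fhr r r' s s' h(2-6) k(2-6) ab(2-5) b f in simp_all)
  obtain t' where t': "t' \<in> Arr C" "src C t' = src C (h' \<cdot> r)" "tgt C t' = src C p'" "p' \<cdot> t' = h' \<cdot> r"
     "q' \<cdot> t' = k' \<cdot> (b \<cdot> s)"
    by (rule pullback_ex[OF pb', of "h' \<cdot> r" "k' \<cdot> (b \<cdot> s)"])
      (use f'hr r r' s s' h(2-6) k(2-6) ab(2-5) b f' in simp_all)
  have gk: "g \<cdot> (k \<cdot> (b \<cdot> s)) = g' \<cdot> (k' \<cdot> (b \<cdot> s))"
    using ext2[OF k(8), of "b \<cdot> s"] k(2-6) b ab(2-5) s s' g g' by simp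
  show ?thesis
    by (rule uf_eqI[of _ _ _ t t']) (use t t' ur u'r gk d f g f' g' m w(1) in simp_all)
qed

lemma UF_simps [simp]:
  "(X, \<U>) \<in> Obj (UF C) \<longleftrightarrow> X \<in> Obj C \<and> \<U> \<in> beta C X"
  "src (UF C) (uf_arr C x y g) = x" "tgt (UF C) (uf_arr C x y g) = y"
  "ident (UF C) x = uf_arr C x x (ident C (fst x), ident C (fst x))"
  by (simp_all add: UF_def uf_arr_def)

lemma uf_arr_Arr:
  assumes "X \<in> Obj C" "\<U> \<in> beta C X" "Y \<in> Obj C" "\<V> \<in> beta C Y"
    "continuous_partial C (X, \<U>) (Y, \<V>) g"
  shows "uf_arr C (X, \<U>) (Y, \<V>) g \<in> Arr (UF C)"
  using assms unfolding UF_def by (cases g) (simp, blast)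

lemma UF_ArrE:
  assumes "a \<in> Arr (UF C)"
  obtains X \<U> Y \<V> u f where "X \<in> Obj C" "\<U> \<in> beta C X" "Y \<in> Obj C" "\<V> \<in> beta C Y"
    "continuous_partial C (X, \<U>) (Y, \<V>) (u, f)" "a = uf_arr C (X, \<U>) (Y, \<V>) (u, f)"
  using assms by (auto simp: UF_def)

text \<open>Composition in \<open>UF C\<close> is a union over all representatives and all
  pullbacks. By \<open>uf_eq_comp\<close> they all give the same class, so a single choice computes
  the composite.\<close>

lemma UF_comp:
  assumes U: "\<U> \<in> beta C X" and V: "\<V> \<in> beta C Y" and W: "\<W> \<in> beta C Z"
    and c: "continuous_partial C (X, \<U>) (Y, \<V>) (u, f)" "continuous_partial C (Y, \<V>) (Z, \<W>) (v, g)"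
    and pb: "is_pullback C p q f v"
  shows "uf_arr C (Y, \<V>) (Z, \<W>) (v, g) \<cdot>\<^bsub>UF C\<^esub> uf_arr C (X, \<U>) (Y, \<V>) (u, f) =
    uf_arr C (X, \<U>) (Z, \<W>) (u \<cdot> p, g \<cdot> q)"
proof -
  note f = continuousD(1-4)[OF U V c(1)] and g = continuousD(1-4)[OF V W c(2)]
  let ?K = "{uf_class C (X, \<U>) (Z, \<W>) (u' \<cdot> p', g' \<cdot> q') | u' f' v' g' p' q'.
    (u', f') \<in> uf_class C (X, \<U>) (Y, \<V>) (u, f) \<and> (v', g') \<in> uf_class C (Y, \<V>) (Z, \<W>) (v, g) \<and>
    is_pullback C p' q' f' v'}"
  let ?c = "uf_class C (X, \<U>) (Z, \<W>) (u \<cdot> p, g \<cdot> q)"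
  have 1: "(u, f) \<in> uf_class C (X, \<U>) (Y, \<V>) (u, f)" "(v, g) \<in> uf_class C (Y, \<V>) (Z, \<W>) (v, g)"
    using c uf_eq_refl[OF f(1-3)] uf_eq_refl[OF g(1-3)] unfolding uf_class_def by simp_all
  have 2: "uf_class C (X, \<U>) (Z, \<W>) (u' \<cdot> p', g' \<cdot> q') = ?c"
    if u': "(u', f') \<in> uf_class C (X, \<U>) (Y, \<V>) (u, f)" and v': "(v', g') \<in> uf_class C (Y, \<V>) (Z, \<W>) (v, g)"
      and pb': "is_pullback C p' q' f' v'" for u' f' v' g' p' q'
  proof -
    have c': "continuous_partial C (X, \<U>) (Y, \<V>) (u', f')" "continuous_partial C (Y, \<V>) (Z, \<W>) (v', g')"
      and e: "uf_eq C (X, \<U>) (u, f) (u', f')" "uf_eq C (Y, \<V>) (v, g) (v', g')"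
      using u' v' unfolding uf_class_def by auto
    show ?thesis
      by (rule uf_class_eqI[OF U W continuous_comp[OF U V W c pb] continuous_comp[OF U V W c' pb']
            uf_eq_comp[OF U V W c c' e pb pb'], symmetric])
  qed
  have "?K = {?c}" using 1 2 pb by blast
  then have "\<Union> ?K = ?c" by simp
  then show ?thesis by (simp add: UF_def uf_arr_def)
qed

lemma continuous_ident:
  assumes "X \<in> Obj C" "\<U> \<in> beta C X"
  shows "continuous_partial C (X, \<U>) (X, \<U>) (ident C X, ident C X)"
proof (rule continuousI[OF assms(2,2) memb_ident[OF assms(2,1)]])
  fix v assume v: "memb C X \<U> v"
  then show "\<exists>a b. memb C X \<U> (ident C X \<cdot> a) \<and> a \<in> Arr C \<and> b \<in> Arr C \<and>
      tgt C a = src C (ident C X) \<and> src C b = src C a \<and> tgt C b = src C v \<and> ident C X \<cdot> a = v \<cdot> b"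
    using membD[OF v] by (intro exI[of _ v] exI[of _ "ident C (src C v)"]) simp
qed (use assms in simp_all)

lemma pullback_ident:
  assumes "u \<in> Arr C" "src C u = x" "tgt C u = y"
  shows "is_pullback C u (ident C x) (ident C y) u" "is_pullback C (ident C x) u u (ident C y)"
proof -
  have xy: "x \<in> Obj C" "y \<in> Obj C" using assms by auto
  show "is_pullback C u (ident C x) (ident C y) u"
    using pullbackI assms xy by fastforce
  then show "is_pullback C (ident C x) u u (ident C y)" by (rule pullback_sym)
qed

lemma category_UF: "category (UF C)"
  unfolding category_def
proof (intro conjI ballI impI)
  fix a assume a: "a \<in> Arr (UF C)"
  obtain X \<U> Y \<V> u f where X: "X \<in> Obj C" and U: "\<U> \<in> beta C X" and Y: "Y \<in> Obj C" and V: "\<V> \<in> beta C Y"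
    and c: "continuous_partial C (X, \<U>) (Y, \<V>) (u, f)" and ae: "a = uf_arr C (X, \<U>) (Y, \<V>) (u, f)"
    using a by (rule UF_ArrE)
  note f = continuousD(1-4)[OF U V c]
  note m = membD[OF f(1)]
  show "src (UF C) a \<in> Obj (UF C)" "tgt (UF C) a \<in> Obj (UF C)" unfolding ae using X U Y V by simp_all
  have pb: "is_pullback C u (ident C (src C u)) (ident C X) u"
    by (rule pullback_ident) (use m in simp_all)
  have pb': "is_pullback C (ident C (src C u)) f f (ident C Y)"
    by (rule pullback_ident) (use f in simp_all)
  show "a \<cdot>\<^bsub>UF C\<^esub> ident (UF C) (src (UF C) a) = a"
    unfolding ae using UF_comp[OF U U V continuous_ident[OF X U] c pb] m f by simp
  show "ident (UF C) (tgt (UF C) a) \<cdot>\<^bsub>UF C\<^esub> a = a"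
    unfolding ae using UF_comp[OF U V V c continuous_ident[OF Y V] pb'] m f by simp
next
  fix x assume "x \<in> Obj (UF C)"
  then show "ident (UF C) x \<in> hom (UF C) x x"
    using uf_arr_Arr continuous_ident by (cases x) (simp add: hom_def)
next
  fix a b assume a: "a \<in> Arr (UF C)" and b: "b \<in> Arr (UF C)" and ab: "tgt (UF C) a = src (UF C) b"
  obtain X \<U> Y \<V> u f where X: "X \<in> Obj C" and U: "\<U> \<in> beta C X" and Y: "Y \<in> Obj C" and V: "\<V> \<in> beta C Y"
    and c: "continuous_partial C (X, \<U>) (Y, \<V>) (u, f)" and ae: "a = uf_arr C (X, \<U>) (Y, \<V>) (u, f)"
    using a by (rule UF_ArrE)
  obtain Y' \<V>' Z \<W> v g where Y': "Y' \<in> Obj C" and V': "\<V>' \<in> beta C Y'" and Z: "Z \<in> Obj C" and W: "\<W> \<in> beta C Z"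
    and c': "continuous_partial C (Y', \<V>') (Z, \<W>) (v, g)" and be: "b = uf_arr C (Y', \<V>') (Z, \<W>) (v, g)"
    using b by (rule UF_ArrE)
  have e: "Y' = Y" "\<V>' = \<V>" using ab unfolding ae be by auto
  note c' = c'[unfolded e]
  note f = continuousD(1-4)[OF U V c] and g = continuousD(1-4)[OF V W c']
  obtain p q where pb: "is_pullback C p q f v"
    by (rule coprojection_pullback_ex[of f v]) (use memb_coprojection[OF g(1)] f in auto)
  show "b \<cdot>\<^bsub>UF C\<^esub> a \<in> hom (UF C) (src (UF C) a) (tgt (UF C) b)"
    unfolding ae be e UF_comp[OF U V W c c' pb]
    using uf_arr_Arr[OF X U Z W continuous_comp[OF U V W c c' pb]] by (simp add: hom_def)
next
  fix a b d assume a: "a \<in> Arr (UF C)" and b: "b \<in> Arr (UF C)" and d: "d \<in> Arr (UF C)"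
    and ab: "tgt (UF C) a = src (UF C) b \<and> tgt (UF C) b = src (UF C) d"
  obtain X \<U> Y \<V> u f where X: "X \<in> Obj C" and U: "\<U> \<in> beta C X" and Y: "Y \<in> Obj C" and V: "\<V> \<in> beta C Y"
    and c: "continuous_partial C (X, \<U>) (Y, \<V>) (u, f)" and ae: "a = uf_arr C (X, \<U>) (Y, \<V>) (u, f)"
    using a by (rule UF_ArrE)
  obtain Y' \<V>' Z \<W> v g where Z: "Z \<in> Obj C" and W: "\<W> \<in> beta C Z"
    and c': "continuous_partial C (Y', \<V>') (Z, \<W>) (v, g)" and be: "b = uf_arr C (Y', \<V>') (Z, \<W>) (v, g)"
    using b by (rule UF_ArrE)
  obtain Z' \<W>' T \<T> t h where T: "T \<in> Obj C" and TT: "\<T> \<in> beta C T"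
    and c'': "continuous_partial C (Z', \<W>') (T, \<T>) (t, h)" and de: "d = uf_arr C (Z', \<W>') (T, \<T>) (t, h)"
    using d by (rule UF_ArrE)
  have e: "Y' = Y" "\<V>' = \<V>" "Z' = Z" "\<W>' = \<W>" using ab unfolding ae be de by auto
  note c' = c'[unfolded e] and c'' = c''[unfolded e]
  note f = continuousD(1-4)[OF U V c] and g = continuousD(1-4)[OF V W c'] and h = continuousD(1-4)[OF W TT c'']
  note m = membD[OF f(1)] membD[OF g(1)] membD[OF h(1)]
  obtain p1 q1 where pb1: "is_pullback C p1 q1 f v"
    by (rule coprojection_pullback_ex[of f v]) (use memb_coprojection[OF g(1)] f in auto)
  note d1 = pullbackD[OF pb1]
  obtain p2 q2 where pb2: "is_pullback C p2 q2 (g \<cdot> q1) t"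
    by (rule coprojection_pullback_ex[of "g \<cdot> q1" t]) (use memb_coprojection[OF h(1)] d1 g in auto)
  note d2 = pullbackD[OF pb2]
  obtain p3 q3 where pb3: "is_pullback C p3 q3 g t"
    by (rule coprojection_pullback_ex[of g t]) (use memb_coprojection[OF h(1)] g in auto)
  note d3 = pullbackD[OF pb3]
  have cc: "continuous_partial C (Y, \<V>) (T, \<T>) (v \<cdot> p3, h \<cdot> q3)"
    by (rule continuous_comp[OF V W TT c' c'' pb3])
  note k = continuousD(1-4)[OF V TT cc]
  obtain p4 q4 where pb4: "is_pullback C p4 q4 f (v \<cdot> p3)"
    by (rule coprojection_pullback_ex[of f "v \<cdot> p3"]) (use memb_coprojection[OF k(1)] f in auto)
  note d4 = pullbackD[OF pb4]
  have cc2: "continuous_partial C (X, \<U>) (Z, \<W>) (u \<cdot> p1, g \<cdot> q1)"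
    by (rule continuous_comp[OF U V W c c' pb1])
  have L: "d \<cdot>\<^bsub>UF C\<^esub> (b \<cdot>\<^bsub>UF C\<^esub> a) = uf_arr C (X, \<U>) (T, \<T>) ((u \<cdot> p1) \<cdot> p2, h \<cdot> q2)"
    unfolding ae be de e UF_comp[OF U V W c c' pb1] by (rule UF_comp[OF U W TT cc2 c'' pb2])
  have R: "(d \<cdot>\<^bsub>UF C\<^esub> b) \<cdot>\<^bsub>UF C\<^esub> a = uf_arr C (X, \<U>) (T, \<T>) (u \<cdot> p4, (h \<cdot> q3) \<cdot> q4)"
    unfolding ae be de e UF_comp[OF V W TT c' c'' pb3] by (rule UF_comp[OF U V TT c cc pb4])
  \<comment> \<open>The two bracketings are compared on the domain of \<open>p2\<close>: the
    universal properties of the pullbacks yield \<open>x\<close> and then \<open>y\<close>, which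
    maps this domain into the one of the other triple composite.\<close>
  obtain x where x: "x \<in> Arr C" "src C x = src C (q1 \<cdot> p2)" "tgt C x = src C p3" "p3 \<cdot> x = q1 \<cdot> p2" "q3 \<cdot> x = q2"
    by (rule pullback_ex[OF pb3, of "q1 \<cdot> p2" q2]) (use d1 d2 g in simp_all)
  have fx: "f \<cdot> (p1 \<cdot> p2) = (v \<cdot> p3) \<cdot> x"
    using ext2[OF d1(9), of p2] d1 d2 d3 x m f g by simp
  obtain y where y: "y \<in> Arr C" "src C y = src C (p1 \<cdot> p2)" "tgt C y = src C p4" "p4 \<cdot> y = p1 \<cdot> p2" "q4 \<cdot> y = x"
    by (rule pullback_ex[OF pb4, of "p1 \<cdot> p2" x]) (use fx d1 d2 d3 x m f g in simp_all)
  have C1: "continuous_partial C (X, \<U>) (T, \<T>) ((u \<cdot> p1) \<cdot> p2, h \<cdot> q2)"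
    by (rule continuous_comp[OF U W TT cc2 c'' pb2])
  have C2: "continuous_partial C (X, \<U>) (T, \<T>) (u \<cdot> p4, (h \<cdot> q3) \<cdot> q4)"
    by (rule continuous_comp[OF U V TT c cc pb4])
  have mm: "memb C X \<U> ((u \<cdot> p1) \<cdot> p2)" by (rule continuousD(1)[OF U TT C1])
  have "uf_eq C (X, \<U>) ((u \<cdot> p1) \<cdot> p2, h \<cdot> q2) (u \<cdot> p4, (h \<cdot> q3) \<cdot> q4)"
  proof (rule uf_eqI[of _ _ _ "ident C (src C p2)" y])
    show "memb C X \<U> (((u \<cdot> p1) \<cdot> p2) \<cdot> ident C (src C p2))" using mm m d1 d2 f g by simp
    show "(u \<cdot> p1) \<cdot> p2 \<cdot> ident C (src C p2) = (u \<cdot> p4) \<cdot> y" using y m d1 d2 d4 f g by simp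
    have "(h \<cdot> q3) \<cdot> q4 \<cdot> y = h \<cdot> (q3 \<cdot> (q4 \<cdot> y))" using y(1-3) m d1 d2 d3 d4 f g h by simp
    also have "\<dots> = h \<cdot> q2" using x y by simp
    finally show "(h \<cdot> q2) \<cdot> ident C (src C p2) = (h \<cdot> q3) \<cdot> q4 \<cdot> y" using m d1 d2 f g h by simp
  qed (use y m d1 d2 d4 f g in simp_all)
  from uf_arr_eqI[OF U TT C1 C2 this]
  show "(d \<cdot>\<^bsub>UF C\<^esub> b) \<cdot>\<^bsub>UF C\<^esub> a = d \<cdot>\<^bsub>UF C\<^esub> (b \<cdot>\<^bsub>UF C\<^esub> a)" unfolding L R by simp
qed

section \<open>Total maps, and restriction to a member of the ultrafilter\<close>

lemma continuous_total:
  assumes f: "f \<in> Arr C" and V: "\<V> \<in> beta C (src C f)"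
  shows "continuous_partial C (src C f, \<V>) (tgt C f, pushforward C f \<V>) (ident C (src C f), f)"
proof -
  let ?Y = "src C f"
  have Y: "?Y \<in> Obj C" using f by simp
  show ?thesis
  proof (rule continuousI[OF V pushforward_beta[OF f V] memb_ident[OF V Y]])
    fix v assume v: "memb C (tgt C f) (pushforward C f \<V>) v"
    have cv: "coprojection C (tgt C f) v" by (rule memb_coprojection[OF v])
    obtain p q where pb: "is_pullback C p q f v" by (rule coprojection_pullback_ex[OF cv f])
    note d = pullbackD[OF pb]
    have "memb C ?Y \<V> p" using memb_pushforward[OF cv pb] v by blast
    then show "\<exists>a b. memb C ?Y \<V> (ident C ?Y \<cdot> a) \<and> a \<in> Arr C \<and> b \<in> Arr C \<and>
        tgt C a = src C (ident C ?Y) \<and> src C b = src C a \<and> tgt C b = src C v \<and> f \<cdot> a = v \<cdot> b"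
      using d Y by (intro exI[of _ p] exI[of _ q]) simp
  qed (use f Y in simp_all)
qed

text \<open>In the category of ultrafilters, a summand in the ultrafilter is isomorphic to the whole, so
  every morphism is a total one after the inverse of such an isomorphism.\<close>

lemma continuous_restr:
  assumes U: "\<U> \<in> beta C X" and u: "memb C X \<U> u"
  shows "continuous_partial C (X, \<U>) (src C u, restr_uf C u \<U>) (u, ident C (src C u))"
proof -
  note m = membD[OF u]
  show ?thesis
  proof (rule continuousI[OF U restr_uf(1)[OF U u] u])
    fix v assume v: "memb C (src C u) (restr_uf C u \<U>) v"
    then have "memb C X \<U> (u \<cdot> v)" using restr_uf(2)[OF U u] by blast
    then show "\<exists>a b. memb C X \<U> (u \<cdot> a) \<and> a \<in> Arr C \<and> b \<in> Arr C \<and> tgt C a = src C u \<and>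
      src C b = src C a \<and> tgt C b = src C v \<and> ident C (src C u) \<cdot> a = v \<cdot> b"
      using membD[OF v] by (intro exI[of _ v] exI[of _ "ident C (src C v)"]) simp
  qed (use m in simp_all)
qed

lemma continuous_incl:
  assumes U: "\<U> \<in> beta C X" and u: "memb C X \<U> u"
  shows "continuous_partial C (src C u, restr_uf C u \<U>) (X, \<U>) (ident C (src C u), u)"
  using continuous_total[of u "restr_uf C u \<U>"] membD[OF u] restr_uf(1)[OF U u] pushforward_restr[OF U u]
  by simp

text \<open>The composite is represented by \<open>(u, u)\<close>, which agrees with the identity on
  the member \<open>u\<close> of \<open>\<U>\<close>.\<close>

lemma restr_incl:
  assumes U: "\<U> \<in> beta C X" and u: "memb C X \<U> u"
  shows "uf_arr C (src C u, restr_uf C u \<U>) (X, \<U>) (ident C (src C u), u) \<cdot>\<^bsub>UF C\<^esub>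
    uf_arr C (X, \<U>) (src C u, restr_uf C u \<U>) (u, ident C (src C u)) = ident (UF C) (X, \<U>)"
proof -
  note m = membD[OF u]
  let ?i = "ident C (src C u)"
  have i: "?i \<in> Arr C" "src C ?i = src C u" "tgt C ?i = src C u" using m by auto
  have pb: "is_pullback C ?i ?i ?i ?i" by (rule pullback_ident(1)[OF i])
  note c = continuous_restr[OF U u] continuous_incl[OF U u]
  have "continuous_partial C (X, \<U>) (X, \<U>) (u, u)"
    using continuous_comp[OF U restr_uf(1)[OF U u] U c pb] m by simp
  moreover have "uf_eq C (X, \<U>) (u, u) (ident C X, ident C X)"
    by (rule uf_eqI[of _ _ _ ?i u]) (use m u in simp_all)
  ultimately have "uf_arr C (X, \<U>) (X, \<U>) (u, u) = uf_arr C (X, \<U>) (X, \<U>) (ident C X, ident C X)"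
    using uf_arr_eqI[OF U U _ continuous_ident[OF m(3) U]] by blast
  then show ?thesis using UF_comp[OF U restr_uf(1)[OF U u] U c pb] m by simp
qed

text \<open>The composite is defined on the pullback of \<open>u\<close> along itself, which is
  trivial because \<open>u\<close> is monic.\<close>

lemma incl_restr:
  assumes U: "\<U> \<in> beta C X" and u: "memb C X \<U> u"
  shows "uf_arr C (X, \<U>) (src C u, restr_uf C u \<U>) (u, ident C (src C u)) \<cdot>\<^bsub>UF C\<^esub>
    uf_arr C (src C u, restr_uf C u \<U>) (X, \<U>) (ident C (src C u), u) =
    ident (UF C) (src C u, restr_uf C u \<U>)"
proof -
  note m = membD[OF u]
  let ?i = "ident C (src C u)"
  have pb: "is_pullback C ?i ?i u u"
  proof (rule pullbackI)
    fix r s assume rs: "r \<in> Arr C" "s \<in> Arr C" "src C r = src C s" "tgt C r = src C u" "tgt C s = src C u"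
      "u \<cdot> r = u \<cdot> s"
    then have "r = s" using mono_cancel[OF coprojection_mono[OF memb_coprojection[OF u]]] by blast
    then show "\<exists>h\<in>hom C (src C s) (src C ?i). ?i \<cdot> h = r \<and> ?i \<cdot> h = s"
      using rs m by (intro bexI[of _ s]) simp_all
  qed (use m in simp_all)
  show ?thesis
    using UF_comp[OF restr_uf(1)[OF U u] U restr_uf(1)[OF U u] continuous_incl[OF U u] continuous_restr[OF U u] pb] m
    by simp
qed

lemma continuous_restr_total:
  assumes U: "\<U> \<in> beta C X" and V: "\<V> \<in> beta C Y" and c: "continuous_partial C (X, \<U>) (Y, \<V>) (u, f)"
  shows "\<V> = pushforward C f (restr_uf C u \<U>)"
    "uf_arr C (src C u, restr_uf C u \<U>) (Y, \<V>) (ident C (src C u), f) \<cdot>\<^bsub>UF C\<^esub>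
      uf_arr C (X, \<U>) (src C u, restr_uf C u \<U>) (u, ident C (src C u)) = uf_arr C (X, \<U>) (Y, \<V>) (u, f)"
proof -
  note f = continuousD(1-4)[OF U V c]
  note m = membD[OF f(1)]
  show Ve: "\<V> = pushforward C f (restr_uf C u \<U>)" using c continuous_iff[OF U V] by blast
  let ?i = "ident C (src C u)"
  have i: "?i \<in> Arr C" "src C ?i = src C u" "tgt C ?i = src C u" using m by auto
  have pb: "is_pullback C ?i ?i ?i ?i" by (rule pullback_ident(1)[OF i])
  have "continuous_partial C (src C u, restr_uf C u \<U>) (Y, \<V>) (?i, f)"
    using continuous_total[of f "restr_uf C u \<U>"] f Ve restr_uf(1)[OF U f(1)] by simp
  then show "uf_arr C (src C u, restr_uf C u \<U>) (Y, \<V>) (ident C (src C u), f) \<cdot>\<^bsub>UF C\<^esub>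
      uf_arr C (X, \<U>) (src C u, restr_uf C u \<U>) (u, ident C (src C u)) = uf_arr C (X, \<U>) (Y, \<V>) (u, f)"
    using UF_comp[OF U restr_uf(1)[OF U f(1)] V continuous_restr[OF U f(1)] _ pb] m f by simp
qed

lemma pushforward_ident:
  assumes "X \<in> Obj C" "\<U> \<in> beta C X"
  shows "pushforward C (ident C X) \<U> = \<U>"
proof -
  have b: "pushforward C (ident C X) \<U> \<in> beta C X"
    using pushforward_beta[of "ident C X" \<U>] assms by simp
  show ?thesis
  proof (rule beta_eqI[OF b assms(2)])
    fix v assume v: "memb C X (pushforward C (ident C X) \<U>) v"
    have "is_pullback C v (ident C (src C v)) (ident C X) v"
      by (rule pullback_ident) (use membD[OF v] in simp_all)
    then show "memb C X \<U> v" using memb_pushforward[OF memb_coprojection[OF v]] v assms by simp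
  qed
qed

text \<open>A pullback of \<open>v\<close> along \<open>g\<close> and one along \<open>f\<close>
  paste to a pullback along the composite; this compares members in one direction, and
  \<open>beta_eqI\<close> does the rest.\<close>

lemma pushforward_comp:
  assumes f: "f \<in> Arr C" and g: "g \<in> Arr C" "src C g = tgt C f" and U: "\<U> \<in> beta C (src C f)"
  shows "pushforward C (g \<cdot> f) \<U> = pushforward C g (pushforward C f \<U>)"
proof -
  have b: "pushforward C (g \<cdot> f) \<U> \<in> beta C (tgt C g)"
    using pushforward_beta[of "g \<cdot> f" \<U>] f g U by simp
  have b': "pushforward C g (pushforward C f \<U>) \<in> beta C (tgt C g)"
    using pushforward_beta[OF g(1)] pushforward_beta[OF f U] g(2) by simp
  show ?thesis
  proof (rule beta_eqI[OF b b'])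
    fix v assume v: "memb C (tgt C g) (pushforward C (g \<cdot> f) \<U>) v"
    have cv: "coprojection C (tgt C g) v" by (rule memb_coprojection[OF v])
    obtain p q where pb: "is_pullback C p q g v" by (rule coprojection_pullback_ex[OF cv g(1)])
    have cp: "coprojection C (tgt C f) p" using coprojection_pullback[OF cv pb] g by simp
    obtain r s where pb2: "is_pullback C r s f p" by (rule coprojection_pullback_ex[OF cp f])
    have "is_pullback C r (q \<cdot> s) (g \<cdot> f) v"
      using pullback_sym[OF pullback_paste[OF pullback_sym[OF pb] pullback_sym[OF pb2]]] .
    then have "memb C (src C f) \<U> r" using memb_pushforward[OF cv] v f g by simp
    then have "memb C (src C g) (pushforward C f \<U>) p" using memb_pushforward[OF cp pb2] g by simp
    then show "memb C (tgt C g) (pushforward C g (pushforward C f \<U>)) v"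
      using memb_pushforward[OF cv pb] by blast
  qed
qed

text \<open>Together with \<open>pushforward_restr\<close> this matches the ultrafilters on the
  domain of \<open>u\<close> with those on \<open>X\<close> that contain \<open>u\<close>, so that a
  sum over the ultrafilters on a coproduct can be split by summands.\<close>

lemma restr_pushforward:
  assumes u: "coprojection C X u" and U: "\<U> \<in> beta C (src C u)"
  shows "memb C X (pushforward C u \<U>) u" "restr_uf C u (pushforward C u \<U>) = \<U>"
proof -
  note d = coprojectionD[OF u]
  have b: "pushforward C u \<U> \<in> beta C X" using pushforward_beta[OF d(1) U] d by simp
  have pb: "is_pullback C v (ident C (src C v)) u (u \<cdot> v)" if v: "v \<in> Arr C" "tgt C v = src C u" for v
  proof (rule pullbackI)
    fix r s assume rs: "r \<in> Arr C" "s \<in> Arr C" "src C r = src C s" "tgt C r = src C u"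
      "tgt C s = src C (u \<cdot> v)" "u \<cdot> r = u \<cdot> v \<cdot> s"
    have "r = v \<cdot> s" by (rule mono_cancel[OF coprojection_mono[OF u]]) (use rs v d in simp_all)
    then show "\<exists>h\<in>hom C (src C s) (src C v). v \<cdot> h = r \<and> ident C (src C v) \<cdot> h = s"
      using rs v d by (intro bexI[of _ s]) simp_all
  qed (use v d in simp_all)
  have su: "src C u \<in> Obj C" using d by simp
  have "is_pullback C (ident C (src C u)) (ident C (src C u)) u u"
    using pb[of "ident C (src C u)"] su d by simp
  then show m: "memb C X (pushforward C u \<U>) u" using memb_pushforward[OF u] memb_ident[OF U su] by blast
  show "restr_uf C u (pushforward C u \<U>) = \<U>"
  proof (rule beta_eqI[OF restr_uf(1)[OF b m] U])
    fix v assume "memb C (src C u) (restr_uf C u (pushforward C u \<U>)) v"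
    then have v: "coprojection C (src C u) v" "memb C X (pushforward C u \<U>) (u \<cdot> v)"
      using restr_uf(2)[OF b m] by auto
    show "memb C (src C u) \<U> v"
      using memb_pushforward[OF memb_coprojection[OF v(2)] pb] v coprojectionD[OF v(1)] by blast
  qed
qed

end

section \<open>Sheaves of small sets\<close>

lemma category_op_cat: "category J \<Longrightarrow> category (op_cat J)"
  unfolding category_def op_cat_def hom_def by auto

lemma category_set_cat: "category (set_cat U)"
proof -
  have 2: "compose X f (restrict (\<lambda>x. x) X) = f" "compose X (restrict (\<lambda>x. x) Y) f = f"
    if "f \<in> X \<rightarrow>\<^sub>E Y" for X Y :: "'a set" and f
    using that by (auto simp: compose_def fun_eq_iff PiE_iff extensional_def)
  have 3: "compose X (compose Y h g) f = compose X h (compose X g f)" if "f \<in> X \<rightarrow>\<^sub>E Y"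
    for X Y :: "'a set" and f g h :: "'a \<Rightarrow> 'a"
    using that by (auto simp: compose_def fun_eq_iff)
  show ?thesis
    unfolding category_def set_cat_def hom_def
    by (auto simp: 2 3) (auto simp: compose_def dest: PiE_mem)
qed

text \<open>Arrows of sheaves are handled through their action on sections; \<open>apD\<close>,
  \<open>ap_eq\<close>, \<open>ap_ex\<close> and \<open>ap_comp\<close> then hide the triples of
  \<open>set_cat\<close>.\<close>

definition ap :: "('o, 'a, 'u set, 'u set_arr) nt \<Rightarrow> 'o \<Rightarrow> 'u \<Rightarrow> 'u" where
  "ap t c = app (fst (snd t) c)"

locale site =
  fixes U :: "'u itself" and J :: "('u, 'u) cat" and T :: "'u \<Rightarrow> 'u set set"
  assumes universe: "universe U" and category_J: "category J"
    and small_Obj: "small U (Obj J)" and small_Arr: "small U (Arr J)"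
    and topology: "grothendieck_topology J T"
begin

sublocale J: cat J by standard (rule category_J)

abbreviation comp_J :: "'u \<Rightarrow> 'u \<Rightarrow> 'u" (infixl "\<bullet>" 70) where
  "g \<bullet> f \<equiv> g \<cdot>\<^bsub>J\<^esub> f"

abbreviation Sh :: "(('u, 'u, 'u set, 'u set_arr) fctr, ('u, 'u, 'u set, 'u set_arr) nt) cat" where
  "Sh \<equiv> sheaf_cat U J T"

abbreviation res :: "('u, 'u, 'u set, 'u set_arr) fctr \<Rightarrow> 'u \<Rightarrow> 'u \<Rightarrow> 'u" where
  "res P g x \<equiv> app (fmap P g) x"

lemma category_Sh: "category Sh"
  unfolding sheaf_cat_def
  by (intro category_full_subcat category_functor_cat category_op_cat category_set_cat category_J)

sublocale Sh: cat Sh by standard (rule category_Sh)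

lemma cover_sieve: "c \<in> Obj J \<Longrightarrow> R \<in> T c \<Longrightarrow> is_sieve J c R"
  using topology unfolding grothendieck_topology_def by blast

lemma cover_max: "c \<in> Obj J \<Longrightarrow> {f \<in> Arr J. tgt J f = c} \<in> T c"
  using topology unfolding grothendieck_topology_def by blast

lemma cover_pull: "R \<in> T (tgt J g) \<Longrightarrow> g \<in> Arr J \<Longrightarrow> pull_sieve J g R \<in> T (src J g)"
proof -
  assume R: "R \<in> T (tgt J g)" and g: "g \<in> Arr J"
  have "\<forall>c\<in>Obj J. \<forall>R\<in>T c. \<forall>g\<in>Arr J. tgt J g = c \<longrightarrow> pull_sieve J g R \<in> T (src J g)"
    using topology unfolding grothendieck_topology_def by (elim conjE)
  from this[rule_format, OF J.tgt_Obj[OF g] R g refl] show ?thesis .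
qed

lemma cover_local:
  "c \<in> Obj J \<Longrightarrow> R \<in> T c \<Longrightarrow> is_sieve J c Q \<Longrightarrow> (\<And>g. g \<in> R \<Longrightarrow> pull_sieve J g Q \<in> T (src J g)) \<Longrightarrow> Q \<in> T c"
proof -
  assume c: "c \<in> Obj J" "R \<in> T c" and Q: "is_sieve J c Q" "\<And>g. g \<in> R \<Longrightarrow> pull_sieve J g Q \<in> T (src J g)"
  have "\<forall>c\<in>Obj J. \<forall>R\<in>T c. \<forall>Q. is_sieve J c Q \<and> (\<forall>g\<in>R. pull_sieve J g Q \<in> T (src J g)) \<longrightarrow> Q \<in> T c"
    using topology unfolding grothendieck_topology_def by (elim conjE)
  then show ?thesis using c Q by simp
qed

lemma coverD:
  assumes "R \<in> T c" "c \<in> Obj J" "f \<in> R"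
  shows "f \<in> Arr J" "tgt J f = c" "g \<in> Arr J \<Longrightarrow> tgt J g = src J f \<Longrightarrow> f \<bullet> g \<in> R"
  using cover_sieve[OF assms(2,1)] assms(3) unfolding is_sieve_def by blast+

lemma cover_superset:
  assumes c: "c \<in> Obj J" and R: "R \<in> T c" and Q: "is_sieve J c Q" "R \<subseteq> Q"
  shows "Q \<in> T c"
proof (rule cover_local[OF c R Q(1)])
  fix g assume g: "g \<in> R"
  note d = coverD[OF R c g]
  have "pull_sieve J g Q = {f \<in> Arr J. tgt J f = src J g}"
    using d Q g unfolding pull_sieve_def by blast
  then show "pull_sieve J g Q \<in> T (src J g)" using cover_max d by simp
qed

lemma cover_Int:
  assumes c: "c \<in> Obj J" and R: "R \<in> T c" and R': "R' \<in> T c"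
  shows "R \<inter> R' \<in> T c"
proof (rule cover_local[OF c R])
  show "is_sieve J c (R \<inter> R')" using cover_sieve[OF c] R R' unfolding is_sieve_def by blast
  fix g assume g: "g \<in> R"
  note d = coverD[OF R c g]
  have "pull_sieve J g (R \<inter> R') = pull_sieve J g R'" using d unfolding pull_sieve_def by auto
  then show "pull_sieve J g (R \<inter> R') \<in> T (src J g)" using cover_pull R' d by simp
qed

lemma cover_empty_pull: "{} \<in> T (tgt J g) \<Longrightarrow> g \<in> Arr J \<Longrightarrow> {} \<in> T (src J g)"
  using cover_pull[of "{}" g] unfolding pull_sieve_def by simp

lemma cover_empty_local:
  assumes "c \<in> Obj J" "R \<in> T c" "\<And>g. g \<in> R \<Longrightarrow> {} \<in> T (src J g)"
  shows "{} \<in> T c"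
  by (rule cover_local[OF assms(1,2)]) (use assms(3) in \<open>auto simp: is_sieve_def pull_sieve_def\<close>)

lemma Sh_Obj: "P \<in> Obj Sh \<longleftrightarrow> is_functor (op_cat J) (set_cat U) P \<and> is_sheaf J T P"
  by (simp add: sheaf_cat_def full_subcat_def functor_cat_def)

lemma sheafD:
  assumes P: "P \<in> Obj Sh"
  shows "c \<in> Obj J \<Longrightarrow> small U (fobj P c)"
    and "g \<in> Arr J \<Longrightarrow> x \<in> fobj P (tgt J g) \<Longrightarrow> res P g x \<in> fobj P (src J g)"
    and "c \<in> Obj J \<Longrightarrow> x \<in> fobj P c \<Longrightarrow> res P (ident J c) x = x"
    and "f \<in> Arr J \<Longrightarrow> g \<in> Arr J \<Longrightarrow> tgt J f = src J g \<Longrightarrow> x \<in> fobj P (tgt J g) \<Longrightarrow>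
      res P (g \<bullet> f) x = res P f (res P g x)"
proof -
  have F: "is_functor (op_cat J) (set_cat U) P" using P Sh_Obj by blast
  note Fs = functorD(3-8)[OF F]
  show "c \<in> Obj J \<Longrightarrow> small U (fobj P c)" using Fs(1)[of c] by (simp add: op_cat_def set_cat_def)
  have fm: "\<exists>h. fmap P g = (fobj P (tgt J g), h, fobj P (src J g)) \<and> h \<in> fobj P (tgt J g) \<rightarrow>\<^sub>E fobj P (src J g)"
    if "g \<in> Arr J" for g
    using Fs(2-4)[of g] that by (auto simp: op_cat_def set_cat_def)
  show "res P g x \<in> fobj P (src J g)" if g: "g \<in> Arr J" "x \<in> fobj P (tgt J g)"
    using fm[OF g(1)] g(2) by (auto simp: app_def)
  show "c \<in> Obj J \<Longrightarrow> x \<in> fobj P c \<Longrightarrow> res P (ident J c) x = x"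
    using Fs(5)[of c] by (simp add: op_cat_def set_cat_def app_def)
  show "res P (g \<bullet> f) x = res P f (res P g x)"
    if fg: "f \<in> Arr J" "g \<in> Arr J" "tgt J f = src J g" "x \<in> fobj P (tgt J g)"
  proof -
    obtain hf where hf: "fmap P f = (fobj P (tgt J f), hf, fobj P (src J f))" using fm[OF fg(1)] by blast
    obtain hg where hg: "fmap P g = (fobj P (tgt J g), hg, fobj P (src J g))" using fm[OF fg(2)] by blast
    have "fmap P (g \<bullet> f) = fmap P f \<cdot>\<^bsub>set_cat U\<^esub> fmap P g"
      using Fs(6)[of g f] fg by (simp add: op_cat_def)
    then show ?thesis using fg(4) by (simp add: hf hg set_cat_def app_def compose_def)
  qed
qed

lemma sheaf_ex1:
  assumes P: "P \<in> Obj Sh" and c: "c \<in> Obj J" and R: "R \<in> T c"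
    and x: "(\<forall>f\<in>R. x f \<in> fobj P (src J f)) \<and>
        (\<forall>f\<in>R. \<forall>g\<in>Arr J. tgt J g = src J f \<longrightarrow> app (fmap P g) (x f) = x (f \<bullet> g))"
  shows "\<exists>!a. a \<in> fobj P c \<and> (\<forall>f\<in>R. app (fmap P f) a = x f)"
proof -
  have "is_sheaf J T P" using P Sh_Obj by blast
  from this[unfolded is_sheaf_def, rule_format, OF c R x] show ?thesis .
qed

lemma sheaf_glue:
  assumes P: "P \<in> Obj Sh" and c: "c \<in> Obj J" and R: "R \<in> T c"
    and x: "\<And>f. f \<in> R \<Longrightarrow> x f \<in> fobj P (src J f)"
    and compat: "\<And>f g. f \<in> R \<Longrightarrow> g \<in> Arr J \<Longrightarrow> tgt J g = src J f \<Longrightarrow> res P g (x f) = x (f \<bullet> g)"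
  obtains a where "a \<in> fobj P c" "\<And>f. f \<in> R \<Longrightarrow> res P f a = x f"
  using sheaf_ex1 P c R x compat by metis

lemma sheaf_eq:
  assumes P: "P \<in> Obj Sh" and c: "c \<in> Obj J" and R: "R \<in> T c"
    and ab: "a \<in> fobj P c" "b \<in> fobj P c" "\<And>f. f \<in> R \<Longrightarrow> res P f a = res P f b"
  shows "a = b"
proof -
  note d = coverD[OF R c]
  have "(\<forall>f\<in>R. res P f b \<in> fobj P (src J f)) \<and>
    (\<forall>f\<in>R. \<forall>g\<in>Arr J. tgt J g = src J f \<longrightarrow> app (fmap P g) (res P f b) = res P (f \<bullet> g) b)"
    using d sheafD(2,4)[OF P] ab(2) by simp
  then have "\<exists>!a. a \<in> fobj P c \<and> (\<forall>f\<in>R. app (fmap P f) a = res P f b)"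
    by (rule sheaf_ex1[OF P c R])
  then show ?thesis using ab by blast
qed

text \<open>Agreement on the empty sieve is vacuous. Hence sections from different summands of a
  coproduct may coincide over such an object, and disjointness has to exempt exactly these
  objects.\<close>

lemma sheaf_empty_cover:
  "P \<in> Obj Sh \<Longrightarrow> c \<in> Obj J \<Longrightarrow> {} \<in> T c \<Longrightarrow> a \<in> fobj P c \<Longrightarrow> b \<in> fobj P c \<Longrightarrow> a = b"
  by (rule sheaf_eq) auto

text \<open>The values of a sheaf are sets of elements of \<open>'u\<close>; a sheaf with small values of any other
  type is transported along injections \<open>e c\<close> into \<open>'u\<close>.\<close>

lemma sheaf_ex:
  fixes V :: "'u \<Rightarrow> 'x set" and act :: "'u \<Rightarrow> 'x \<Rightarrow> 'x"
  assumes small: "\<And>c. c \<in> Obj J \<Longrightarrow> small U (V c)"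
    and act: "\<And>g x. g \<in> Arr J \<Longrightarrow> x \<in> V (tgt J g) \<Longrightarrow> act g x \<in> V (src J g)"
    and act_id: "\<And>c x. c \<in> Obj J \<Longrightarrow> x \<in> V c \<Longrightarrow> act (ident J c) x = x"
    and act_comp: "\<And>f g x. f \<in> Arr J \<Longrightarrow> g \<in> Arr J \<Longrightarrow> tgt J f = src J g \<Longrightarrow> x \<in> V (tgt J g) \<Longrightarrow>
      act (g \<bullet> f) x = act f (act g x)"
    and glue: "\<And>c R x. c \<in> Obj J \<Longrightarrow> R \<in> T c \<Longrightarrow> (\<And>f. f \<in> R \<Longrightarrow> x f \<in> V (src J f)) \<Longrightarrow>
      (\<And>f g. f \<in> R \<Longrightarrow> g \<in> Arr J \<Longrightarrow> tgt J g = src J f \<Longrightarrow> act g (x f) = x (f \<bullet> g)) \<Longrightarrow>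
      \<exists>a\<in>V c. \<forall>f\<in>R. act f a = x f"
    and sep: "\<And>c R a b. c \<in> Obj J \<Longrightarrow> R \<in> T c \<Longrightarrow> a \<in> V c \<Longrightarrow> b \<in> V c \<Longrightarrow>
      (\<And>f. f \<in> R \<Longrightarrow> act f a = act f b) \<Longrightarrow> a = b"
    and e: "\<And>c. c \<in> Obj J \<Longrightarrow> inj_on (e c) (V c)"
  obtains P where "P \<in> Obj Sh" "\<And>c. c \<in> Obj J \<Longrightarrow> fobj P c = e c ` V c"
    "\<And>g x. g \<in> Arr J \<Longrightarrow> x \<in> V (tgt J g) \<Longrightarrow> res P g (e (tgt J g) x) = e (src J g) (act g x)"
proof -
  define d where "d c = inv_into (V c) (e c)" for c
  have de: "d c (e c x) = x" if "c \<in> Obj J" "x \<in> V c" for c x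
    unfolding d_def using e[OF that(1)] that(2) by simp
  define W where "W c = e c ` V c" for c
  define k where "k g = restrict (\<lambda>y. e (src J g) (act g (d (tgt J g) y))) (W (tgt J g))" for g
  define Pa where "Pa g = (W (tgt J g), k g, W (src J g))" for g
  define P where "P = \<lparr>fobj = restrict W (Obj (op_cat J)), fmap = restrict Pa (Arr (op_cat J))\<rparr>"
  have ke: "k g (e (tgt J g) x) = e (src J g) (act g x)" if "g \<in> Arr J" "x \<in> V (tgt J g)" for g x
    unfolding k_def W_def using that de by simp
  have kW: "k g \<in> W (tgt J g) \<rightarrow>\<^sub>E W (src J g)" if "g \<in> Arr J" for g
    using ke[OF that] act[OF that] unfolding W_def by (auto simp: k_def W_def)
  have F: "is_functor (op_cat J) (set_cat U) P"
    unfolding P_def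
  proof (rule functorI)
    show "category (op_cat J)" "category (set_cat U)"
      by (intro category_op_cat category_set_cat category_J)+
    show W: "W c \<in> Obj (set_cat U)" if "c \<in> Obj (op_cat J)" for c
      using small_image[OF small, of c "e c"] that by (simp add: W_def set_cat_def op_cat_def)
    show "Pa g \<in> hom (set_cat U) (W (src (op_cat J) g)) (W (tgt (op_cat J) g))" if "g \<in> Arr (op_cat J)" for g
      using that kW[of g] W[of "src J g"] W[of "tgt J g"] by (simp add: Pa_def set_cat_def op_cat_def hom_def)
    show "Pa (ident (op_cat J) c) = ident (set_cat U) (W c)" if "c \<in> Obj (op_cat J)" for c
    proof -
      have c: "c \<in> Obj J" using that by (simp add: op_cat_def)
      have "k (ident J c) y = restrict (\<lambda>x. x) (W c) y" for y
      proof (cases "y \<in> W c")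
        case True
        then obtain x where "x \<in> V c" "y = e c x" unfolding W_def by blast
        then show ?thesis using ke[of "ident J c" x] c act_id True by simp
      qed (use c in \<open>simp add: k_def\<close>)
      then have "k (ident J c) = restrict (\<lambda>x. x) (W c)" by blast
      then show ?thesis using c by (simp add: Pa_def op_cat_def set_cat_def)
    qed
    show "Pa (g \<cdot>\<^bsub>op_cat J\<^esub> f) = Pa g \<cdot>\<^bsub>set_cat U\<^esub> Pa f"
      if "f \<in> Arr (op_cat J)" "g \<in> Arr (op_cat J)" "tgt (op_cat J) f = src (op_cat J) g" for f g
    proof -
      have fg: "f \<in> Arr J" "g \<in> Arr J" "src J f = tgt J g" using that by (simp_all add: op_cat_def)
      have "k (f \<bullet> g) y = compose (W (tgt J f)) (k g) (k f) y" for y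
      proof (cases "y \<in> W (tgt J f)")
        case True
        then obtain x where x: "x \<in> V (tgt J f)" "y = e (tgt J f) x" unfolding W_def by blast
        then show ?thesis
          using ke[of "f \<bullet> g" x] ke[of f x] ke[of g "act f x"] act[of f x] fg act_comp[of g f x] True
          by (simp add: compose_def)
      qed (use fg in \<open>simp add: k_def compose_def\<close>)
      then have "k (f \<bullet> g) = compose (W (tgt J f)) (k g) (k f)" by blast
      then show ?thesis using fg by (simp add: Pa_def op_cat_def set_cat_def)
    qed
  qed
  have fo: "fobj P c = W c" if "c \<in> Obj J" for c using that by (simp add: P_def op_cat_def)
  have fm: "res P g (e (tgt J g) x) = e (src J g) (act g x)" if "g \<in> Arr J" "x \<in> V (tgt J g)" for g x
    using that ke by (simp add: P_def op_cat_def Pa_def app_def)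
  have "is_sheaf J T P"
    unfolding is_sheaf_def
  proof (intro ballI allI impI)
    fix c R x assume c: "c \<in> Obj J" and R: "R \<in> T c" and x: "(\<forall>f\<in>R. x f \<in> fobj P (src J f)) \<and>
        (\<forall>f\<in>R. \<forall>g\<in>Arr J. tgt J g = src J f \<longrightarrow> app (fmap P g) (x f) = x (f \<bullet> g))"
    note dR = coverD[OF R c]
    define y where "y f = d (src J f) (x f)" for f
    have y: "y f \<in> V (src J f)" "x f = e (src J f) (y f)" if "f \<in> R" for f
    proof -
      have "x f \<in> W (src J f)" using x that fo dR by simp
      then obtain z where "z \<in> V (src J f)" "x f = e (src J f) z" unfolding W_def by blast
      then show "y f \<in> V (src J f)" "x f = e (src J f) (y f)" unfolding y_def using de dR(1)[OF that] by simp_all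
    qed
    have "act g (y f) = y (f \<bullet> g)" if f: "f \<in> R" and g: "g \<in> Arr J" "tgt J g = src J f" for f g
    proof -
      have "e (src J g) (act g (y f)) = res P g (x f)" using fm[OF g(1), of "y f"] y[OF f] g(2) by simp
      also have "\<dots> = e (src J g) (y (f \<bullet> g))" using x f g y(2)[OF dR(3)[OF f g]] dR(1)[OF f] by simp
      finally show ?thesis
        using e[of "src J g"] act[OF g(1), of "y f"] y(1)[OF f] y(1)[OF dR(3)[OF f g]] g dR(1)[OF f]
        by (simp add: inj_on_def)
    qed
    then obtain a where a: "a \<in> V c" "\<And>f. f \<in> R \<Longrightarrow> act f a = y f"
      using glue[OF c R, of y] y(1) by blast
    show "\<exists>!a. a \<in> fobj P c \<and> (\<forall>f\<in>R. app (fmap P f) a = x f)"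
    proof (rule ex1I[of _ "e c a"])
      have "res P f (e c a) = x f" if f: "f \<in> R" for f
        using fm[OF dR(1)[OF f], of a] dR(2)[OF f] a(1) a(2)[OF f] y(2)[OF f] by simp
      then show "e c a \<in> fobj P c \<and> (\<forall>f\<in>R. app (fmap P f) (e c a) = x f)"
        using fo[OF c] a(1) unfolding W_def by simp
      fix b' assume b': "b' \<in> fobj P c \<and> (\<forall>f\<in>R. app (fmap P f) b' = x f)"
      then obtain b where b: "b \<in> V c" "b' = e c b" using fo[OF c] unfolding W_def by blast
      have "act f b = act f a" if f: "f \<in> R" for f
      proof -
        have "e (src J f) (act f b) = e (src J f) (act f a)"
          using fm[OF dR(1)[OF f], of b] dR(2)[OF f] b b' f a(2)[OF f] y(2)[OF f] by simp
        then show ?thesis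
          using e[of "src J f"] act[OF dR(1)[OF f]] dR(1,2)[OF f] a(1) b(1) by (simp add: inj_on_def)
      qed
      then show "b' = e c a" using sep[OF c R b(1) a(1)] b by simp
    qed
  qed
  then have "P \<in> Obj Sh" using F Sh_Obj by blast
  then show ?thesis using that[of P] fo fm unfolding W_def by blast
qed

section \<open>Arrows of sheaves as functions on sections\<close>

lemma Sh_Arr: "t \<in> Arr Sh \<longleftrightarrow> (\<exists>P \<tau> Q. t = (P, \<tau>, Q) \<and> P \<in> Obj Sh \<and> Q \<in> Obj Sh \<and>
    nat_trans (op_cat J) (set_cat U) P Q \<tau>)"
  unfolding Sh_Obj by (auto simp: sheaf_cat_def full_subcat_def functor_cat_def)

lemma Sh_simps [simp]: "src Sh (P, \<tau>, Q) = P" "tgt Sh (P, \<tau>, Q) = Q"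
  by (simp_all add: sheaf_cat_def full_subcat_def functor_cat_def)

lemma nat_trans_fm:
  assumes "nat_trans (op_cat J) (set_cat U) P Q \<tau>" "c \<in> Obj J"
  shows "\<exists>h. \<tau> c = (fobj P c, h, fobj Q c) \<and> h \<in> fobj P c \<rightarrow>\<^sub>E fobj Q c"
  using assms unfolding nat_trans_def hom_def by (auto simp: op_cat_def set_cat_def)

lemma functor_fm:
  assumes "P \<in> Obj Sh" "g \<in> Arr J"
  shows "\<exists>h. fmap P g = (fobj P (tgt J g), h, fobj P (src J g)) \<and> h \<in> fobj P (tgt J g) \<rightarrow>\<^sub>E fobj P (src J g)"
proof -
  have F: "is_functor (op_cat J) (set_cat U) P" using assms Sh_Obj by blast
  show ?thesis using functorD(4-6)[OF F, of g] assms(2) by (auto simp: op_cat_def set_cat_def)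
qed

lemma apD:
  assumes t: "t \<in> Arr Sh"
  shows "c \<in> Obj J \<Longrightarrow> x \<in> fobj (src Sh t) c \<Longrightarrow> ap t c x \<in> fobj (tgt Sh t) c"
    and "g \<in> Arr J \<Longrightarrow> x \<in> fobj (src Sh t) (tgt J g) \<Longrightarrow>
      ap t (src J g) (res (src Sh t) g x) = res (tgt Sh t) g (ap t (tgt J g) x)"
proof -
  obtain P \<tau> Q where te: "t = (P, \<tau>, Q)" and PQ: "P \<in> Obj Sh" "Q \<in> Obj Sh"
    and n: "nat_trans (op_cat J) (set_cat U) P Q \<tau>" using t Sh_Arr by blast
  show "ap t c x \<in> fobj (tgt Sh t) c" if c: "c \<in> Obj J" "x \<in> fobj (src Sh t) c"
    using nat_trans_fm[OF n c(1)] c(2) by (auto simp: te ap_def app_def)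
  show "ap t (src J g) (res (src Sh t) g x) = res (tgt Sh t) g (ap t (tgt J g) x)"
    if g: "g \<in> Arr J" "x \<in> fobj (src Sh t) (tgt J g)"
  proof -
    have nat: "\<tau> (src J g) \<cdot>\<^bsub>set_cat U\<^esub> fmap P g = fmap Q g \<cdot>\<^bsub>set_cat U\<^esub> \<tau> (tgt J g)"
      using n g(1) unfolding nat_trans_def by (simp add: op_cat_def)
    obtain h1 h2 h3 h4 where h: "fmap P g = (fobj P (tgt J g), h1, fobj P (src J g))"
      "fmap Q g = (fobj Q (tgt J g), h2, fobj Q (src J g))"
      "\<tau> (src J g) = (fobj P (src J g), h3, fobj Q (src J g))"
      "\<tau> (tgt J g) = (fobj P (tgt J g), h4, fobj Q (tgt J g))"
      using functor_fm[OF PQ(1) g(1)] functor_fm[OF PQ(2) g(1)] nat_trans_fm[OF n, of "src J g"]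
        nat_trans_fm[OF n, of "tgt J g"] g(1) by auto
    have "compose (fobj P (tgt J g)) h3 h1 = compose (fobj P (tgt J g)) h2 h4"
      using nat unfolding h by (simp add: set_cat_def)
    then have "h3 (h1 x) = h2 (h4 x)" using g(2) te by (metis compose_eq Sh_simps(1))
    then show ?thesis by (simp add: te ap_def h app_def)
  qed
qed

lemma ap_eq:
  assumes t: "t \<in> Arr Sh" "t' \<in> Arr Sh" "src Sh t = src Sh t'" "tgt Sh t = tgt Sh t'"
    and e: "\<And>c x. c \<in> Obj J \<Longrightarrow> x \<in> fobj (src Sh t') c \<Longrightarrow> ap t c x = ap t' c x"
  shows "t = t'"
proof -
  obtain P \<tau> Q where te: "t = (P, \<tau>, Q)" and n: "nat_trans (op_cat J) (set_cat U) P Q \<tau>"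
    using t Sh_Arr by blast
  obtain \<tau>' where te': "t' = (P, \<tau>', Q)" and n': "nat_trans (op_cat J) (set_cat U) P Q \<tau>'"
    using t Sh_Arr te by auto
  have "\<tau> c = \<tau>' c" if c: "c \<in> Obj J" for c
  proof -
    obtain h where h: "\<tau> c = (fobj P c, h, fobj Q c)" "h \<in> fobj P c \<rightarrow>\<^sub>E fobj Q c"
      using nat_trans_fm[OF n c] by blast
    obtain h' where h': "\<tau>' c = (fobj P c, h', fobj Q c)" "h' \<in> fobj P c \<rightarrow>\<^sub>E fobj Q c"
      using nat_trans_fm[OF n' c] by blast
    have "h = h'" by (rule PiE_ext[OF h(2) h'(2)]) (use e[OF c] in \<open>simp add: te te' ap_def h h' app_def\<close>)
    then show ?thesis using h h' by simp
  qed
  moreover have "\<tau> \<in> extensional (Obj J)" "\<tau>' \<in> extensional (Obj J)"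
    using n n' unfolding nat_trans_def by (simp_all add: op_cat_def)
  ultimately have "\<tau> = \<tau>'" by (intro extensionalityI[of _ "Obj J"])
  then show ?thesis using te te' by simp
qed

lemma ap_ex:
  assumes PQ: "P \<in> Obj Sh" "Q \<in> Obj Sh"
    and k: "\<And>c x. c \<in> Obj J \<Longrightarrow> x \<in> fobj P c \<Longrightarrow> k c x \<in> fobj Q c"
    and nat: "\<And>g x. g \<in> Arr J \<Longrightarrow> x \<in> fobj P (tgt J g) \<Longrightarrow> k (src J g) (res P g x) = res Q g (k (tgt J g) x)"
  obtains t where "t \<in> Arr Sh" "src Sh t = P" "tgt Sh t = Q"
    "\<And>c x. c \<in> Obj J \<Longrightarrow> x \<in> fobj P c \<Longrightarrow> ap t c x = k c x"
proof -
  define \<tau> where "\<tau> = restrict (\<lambda>c. (fobj P c, restrict (k c) (fobj P c), fobj Q c)) (Obj J)"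
  have "nat_trans (op_cat J) (set_cat U) P Q \<tau>"
    unfolding nat_trans_def
  proof (intro conjI ballI)
    show "\<tau> \<in> extensional (Obj (op_cat J))" by (simp add: \<tau>_def op_cat_def)
    show "\<tau> c \<in> hom (set_cat U) (fobj P c) (fobj Q c)" if "c \<in> Obj (op_cat J)" for c
      using that k sheafD(1)[OF PQ(1)] sheafD(1)[OF PQ(2)] by (simp add: \<tau>_def op_cat_def set_cat_def hom_def)
    show "\<tau> (tgt (op_cat J) g) \<cdot>\<^bsub>set_cat U\<^esub> fmap P g = fmap Q g \<cdot>\<^bsub>set_cat U\<^esub> \<tau> (src (op_cat J) g)"
      if "g \<in> Arr (op_cat J)" for g
    proof -
      have g: "g \<in> Arr J" using that by (simp add: op_cat_def)
      obtain h1 h2 where h: "fmap P g = (fobj P (tgt J g), h1, fobj P (src J g))"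
        "h1 \<in> fobj P (tgt J g) \<rightarrow>\<^sub>E fobj P (src J g)"
        "fmap Q g = (fobj Q (tgt J g), h2, fobj Q (src J g))"
        using functor_fm[OF PQ(1) g] functor_fm[OF PQ(2) g] by auto
      have "restrict (k (src J g)) (fobj P (src J g)) (h1 x) = h2 (restrict (k (tgt J g)) (fobj P (tgt J g)) x)"
        if x: "x \<in> fobj P (tgt J g)" for x
      proof -
        have "h1 x \<in> fobj P (src J g)" using h(2) x by auto
        then show ?thesis using nat[OF g x] x by (simp add: h app_def)
      qed
      then have "compose (fobj P (tgt J g)) (restrict (k (src J g)) (fobj P (src J g))) h1 =
          compose (fobj P (tgt J g)) h2 (restrict (k (tgt J g)) (fobj P (tgt J g)))"
        by (auto simp: compose_def)
      then show ?thesis using g by (simp add: op_cat_def \<tau>_def h set_cat_def)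
    qed
  qed
  then have "(P, \<tau>, Q) \<in> Arr Sh" using PQ Sh_Arr by blast
  then show ?thesis using that[of "(P, \<tau>, Q)"] by (simp add: ap_def \<tau>_def app_def)
qed

lemma ap_comp:
  assumes t: "t \<in> Arr Sh" "t' \<in> Arr Sh" "tgt Sh t = src Sh t'" and c: "c \<in> Obj J" and x: "x \<in> fobj (src Sh t) c"
  shows "ap (t' \<cdot>\<^bsub>Sh\<^esub> t) c x = ap t' c (ap t c x)"
proof -
  obtain P \<tau> Q where te: "t = (P, \<tau>, Q)" and n: "nat_trans (op_cat J) (set_cat U) P Q \<tau>"
    using t Sh_Arr by blast
  obtain \<tau>' R where te': "t' = (Q, \<tau>', R)" and n': "nat_trans (op_cat J) (set_cat U) Q R \<tau>'"
    using t Sh_Arr te by auto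
  obtain h where h: "\<tau> c = (fobj P c, h, fobj Q c)" using nat_trans_fm[OF n c] by blast
  obtain h' where h': "\<tau>' c = (fobj Q c, h', fobj R c)" using nat_trans_fm[OF n' c] by blast
  have "t' \<cdot>\<^bsub>Sh\<^esub> t = (P, restrict (\<lambda>x. \<tau>' x \<cdot>\<^bsub>set_cat U\<^esub> \<tau> x) (Obj J), R)"
    by (simp add: te te' sheaf_cat_def full_subcat_def functor_cat_def op_cat_def)
  then show ?thesis using x c by (simp add: te te' ap_def h h' set_cat_def app_def compose_def)
qed

section \<open>Coproducts of sheaves\<close>

text \<open>Sectionwise description of a disjoint coproduct of sheaves: each summand embeds,
  different summands overlap only where the empty sieve covers, and every section comes locally from
  a summand. Unlike the universal property, this passes directly to pullbacks.\<close>

definition covering_family ::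
  "'i set \<Rightarrow> ('i \<Rightarrow> ('u, 'u, 'u set, 'u set_arr) fctr) \<Rightarrow> ('u, 'u, 'u set, 'u set_arr) fctr \<Rightarrow>
    ('i \<Rightarrow> ('u, 'u, 'u set, 'u set_arr) nt) \<Rightarrow> bool" where
  "covering_family I D Q m \<longleftrightarrow> Q \<in> Obj Sh \<and> (\<forall>i\<in>I. D i \<in> Obj Sh \<and> m i \<in> hom Sh (D i) Q) \<and>
    (\<forall>i\<in>I. \<forall>c\<in>Obj J. inj_on (ap (m i) c) (fobj (D i) c)) \<and>
    (\<forall>i\<in>I. \<forall>j\<in>I. \<forall>c\<in>Obj J. \<forall>x\<in>fobj (D i) c. \<forall>y\<in>fobj (D j) c.
      ap (m i) c x = ap (m j) c y \<longrightarrow> i \<noteq> j \<longrightarrow> {} \<in> T c) \<and>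
    (\<forall>c\<in>Obj J. \<forall>q\<in>fobj Q c. {f \<in> Arr J. tgt J f = c \<and>
      (\<exists>i\<in>I. \<exists>x\<in>fobj (D i) (src J f). ap (m i) (src J f) x = res Q f q)} \<in> T c)"

context
  fixes I D Q m
  assumes fam: "covering_family I D Q m"
begin

lemma famD:
  shows "Q \<in> Obj Sh" "i \<in> I \<Longrightarrow> D i \<in> Obj Sh" "i \<in> I \<Longrightarrow> m i \<in> Arr Sh" "i \<in> I \<Longrightarrow> src Sh (m i) = D i"
    "i \<in> I \<Longrightarrow> tgt Sh (m i) = Q"
    "i \<in> I \<Longrightarrow> c \<in> Obj J \<Longrightarrow> x \<in> fobj (D i) c \<Longrightarrow> y \<in> fobj (D i) c \<Longrightarrow> ap (m i) c x = ap (m i) c y \<Longrightarrow> x = y"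
    "i \<in> I \<Longrightarrow> j \<in> I \<Longrightarrow> c \<in> Obj J \<Longrightarrow> x \<in> fobj (D i) c \<Longrightarrow> y \<in> fobj (D j) c \<Longrightarrow>
      ap (m i) c x = ap (m j) c y \<Longrightarrow> i \<noteq> j \<Longrightarrow> {} \<in> T c"
    "c \<in> Obj J \<Longrightarrow> q \<in> fobj Q c \<Longrightarrow> {f \<in> Arr J. tgt J f = c \<and>
      (\<exists>i\<in>I. \<exists>x\<in>fobj (D i) (src J f). ap (m i) (src J f) x = res Q f q)} \<in> T c"
  using fam unfolding covering_family_def Sh.in_hom by (blast, blast, blast, blast, blast, meson inj_onD, blast, blast)

lemma covering_family_coproduct: "is_coproduct Sh I D Q m"
proof (rule Sh.coproductI)
  show "Q \<in> Obj Sh" "\<And>i. i \<in> I \<Longrightarrow> D i \<in> Obj Sh" "\<And>i. i \<in> I \<Longrightarrow> m i \<in> hom Sh (D i) Q"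
    using famD by auto
  fix Z f assume Z: "Z \<in> Obj Sh" and f: "\<And>i. i \<in> I \<Longrightarrow> f i \<in> hom Sh (D i) Z"
  have f': "i \<in> I \<Longrightarrow> f i \<in> Arr Sh" "i \<in> I \<Longrightarrow> src Sh (f i) = D i" "i \<in> I \<Longrightarrow> tgt Sh (f i) = Z" for i
    using f by auto
  \<comment> \<open>The graph of the induced arrow, tested on those restrictions of \<open>q\<close>
    that come from some \<open>D i\<close>. Such restrictions form a covering sieve, so gluing gives
    a value at \<open>q\<close> and separation makes it unique.\<close>
  define ok where "ok c q z \<longleftrightarrow> z \<in> fobj Z c \<and> (\<forall>g\<in>Arr J. tgt J g = c \<longrightarrow>
    (\<forall>i\<in>I. \<forall>x\<in>fobj (D i) (src J g). ap (m i) (src J g) x = res Q g q \<longrightarrow> res Z g z = ap (f i) (src J g) x))"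
    for c q z
  have wd: "ap (f i) c x = ap (f j) c y"
    if "i \<in> I" "j \<in> I" "c \<in> Obj J" "x \<in> fobj (D i) c" "y \<in> fobj (D j) c" "ap (m i) c x = ap (m j) c y"
    for i j c x y
  proof (cases "i = j")
    case True
    then show ?thesis using famD(6)[of i c x y] that by simp
  next
    case False
    \<comment> \<open>Sections with different indices agree only over an object covered by the empty
      sieve, and there any two sections of \<open>Z\<close> are equal.\<close>
    then have "{} \<in> T c" using famD(7) that by blast
    then show ?thesis
      by (rule sheaf_empty_cover[OF Z that(3)])
        (use apD(1)[OF f'(1)] f' that in auto)
  qed
  have ok_ex: "\<exists>z. ok c q z" if c: "c \<in> Obj J" and q: "q \<in> fobj Q c" for c q
  proof -
    let ?R = "{f \<in> Arr J. tgt J f = c \<and> (\<exists>i\<in>I. \<exists>x\<in>fobj (D i) (src J f). ap (m i) (src J f) x = res Q f q)}"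
    have R: "?R \<in> T c" by (rule famD(8)[OF c q])
    note dR = coverD[OF R c]
    define y where "y g = (SOME y. \<exists>i\<in>I. \<exists>x\<in>fobj (D i) (src J g). ap (m i) (src J g) x = res Q g q \<and>
        y = ap (f i) (src J g) x)" for g
    have y: "y g = ap (f i) (src J g) x" if "g \<in> Arr J" "i \<in> I" "x \<in> fobj (D i) (src J g)"
      "ap (m i) (src J g) x = res Q g q" for g i x
    proof -
      have "\<exists>y. \<exists>i\<in>I. \<exists>x\<in>fobj (D i) (src J g). ap (m i) (src J g) x = res Q g q \<and> y = ap (f i) (src J g) x"
        using that by blast
      from someI_ex[OF this] obtain i' x' where "i' \<in> I" "x' \<in> fobj (D i') (src J g)"
        "ap (m i') (src J g) x' = res Q g q" "y g = ap (f i') (src J g) x'" unfolding y_def by blast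
      then show ?thesis using wd[of i' i "src J g" x' x] that by simp
    qed
    obtain z where z: "z \<in> fobj Z c" "\<And>g. g \<in> ?R \<Longrightarrow> res Z g z = y g"
    proof (rule sheaf_glue[OF Z c R, of y])
      fix g assume "g \<in> ?R"
      then obtain i x where *: "g \<in> Arr J" "i \<in> I" "x \<in> fobj (D i) (src J g)"
         "ap (m i) (src J g) x = res Q g q" "tgt J g = c" by blast
      show "y g \<in> fobj Z (src J g)" using y[OF *(1-4)] apD(1)[OF f'(1)[OF *(2)], of "src J g" x] * f' by simp
      fix h assume h: "h \<in> Arr J" "tgt J h = src J g"
      have x': "res (D i) h x \<in> fobj (D i) (src J h)"
        using sheafD(2)[OF famD(2)[OF *(2)] h(1)] * h by simp
      have "ap (m i) (src J h) (res (D i) h x) = res Q h (res Q g q)"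
        using apD(2)[OF famD(3)[OF *(2)] h(1)] famD * h by simp
      also have "\<dots> = res Q (g \<bullet> h) q" using sheafD(4)[OF famD(1) h(1) *(1)] h * q by simp
      finally have "y (g \<bullet> h) = ap (f i) (src J h) (res (D i) h x)"
        using y[of "g \<bullet> h" i] * h x' by simp
      also have "\<dots> = res Z h (y g)"
        using apD(2)[OF f'(1)[OF *(2)] h(1)] f' * h y[OF *(1-4)] by simp
      finally show "res Z h (y g) = y (g \<bullet> h)" by simp
    qed blast
    have "res Z g z = ap (f i) (src J g) x" if "g \<in> Arr J" "tgt J g = c" "i \<in> I" "x \<in> fobj (D i) (src J g)"
      "ap (m i) (src J g) x = res Q g q" for g i x
    proof -
      have "g \<in> ?R" using that by blast
      then show ?thesis using z(2) y[OF that(1,3,4,5)] by simp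
    qed
    then show ?thesis unfolding ok_def using z(1) by blast
  qed
  have ok_eq: "z = z'" if c: "c \<in> Obj J" and q: "q \<in> fobj Q c" and z: "ok c q z" "ok c q z'" for c q z z'
  proof (rule sheaf_eq[OF Z c famD(8)[OF c q]])
    fix g assume "g \<in> {f \<in> Arr J. tgt J f = c \<and>
        (\<exists>i\<in>I. \<exists>x\<in>fobj (D i) (src J f). ap (m i) (src J f) x = res Q f q)}"
    then obtain i x where "g \<in> Arr J" "i \<in> I" "x \<in> fobj (D i) (src J g)"
         "ap (m i) (src J g) x = res Q g q" "tgt J g = c" by blast
    then show "res Z g z = res Z g z'" using z unfolding ok_def by (metis (no_types))
  qed (use z in \<open>auto simp: ok_def\<close>)
  define k where "k c q = (SOME z. ok c q z)" for c q
  have k: "ok c q (k c q)" if "c \<in> Obj J" "q \<in> fobj Q c" for c q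
    unfolding k_def using ok_ex[OF that] by (rule someI_ex)
  obtain t where t: "t \<in> Arr Sh" "src Sh t = Q" "tgt Sh t = Z"
    "\<And>c x. c \<in> Obj J \<Longrightarrow> x \<in> fobj Q c \<Longrightarrow> ap t c x = k c x"
  proof (rule ap_ex[OF famD(1) Z, of k])
    show "k c x \<in> fobj Z c" if "c \<in> Obj J" "x \<in> fobj Q c" for c x using k[OF that] unfolding ok_def by blast
    fix g q assume g: "g \<in> Arr J" and q: "q \<in> fobj Q (tgt J g)"
    have gq: "res Q g q \<in> fobj Q (src J g)" by (rule sheafD(2)[OF famD(1) g q])
    have k1: "ok (tgt J g) q (k (tgt J g) q)" using k g q by simp
    then have kz: "k (tgt J g) q \<in> fobj Z (tgt J g)" unfolding ok_def by blast
    have "ok (src J g) (res Q g q) (res Z g (k (tgt J g) q))"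
      unfolding ok_def
    proof (intro conjI ballI impI)
      show "res Z g (k (tgt J g) q) \<in> fobj Z (src J g)" by (rule sheafD(2)[OF Z g kz])
      fix h i x assume h: "h \<in> Arr J" "tgt J h = src J g" and i: "i \<in> I" and x: "x \<in> fobj (D i) (src J h)"
        and e: "ap (m i) (src J h) x = res Q h (res Q g q)"
      have "ap (m i) (src J (g \<bullet> h)) x = res Q (g \<bullet> h) q"
        using e sheafD(4)[OF famD(1) h(1) g h(2) q] h g by simp
      then have "res Z (g \<bullet> h) (k (tgt J g) q) = ap (f i) (src J h) x"
        using k1 h g i x unfolding ok_def by simp
      then show "res Z h (res Z g (k (tgt J g) q)) = ap (f i) (src J h) x"
        using sheafD(4)[OF Z h(1) g h(2) kz] by simp
    qed
    then show "k (src J g) (res Q g q) = res Z g (k (tgt J g) q)"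
      using ok_eq[OF _ gq k[OF _ gq]] g by simp
  qed blast
  have "t \<cdot>\<^bsub>Sh\<^esub> m i = f i" if i: "i \<in> I" for i
  proof (rule ap_eq)
    note fi = f'[OF i] and mi = famD(2-5)[OF i]
    show "t \<cdot>\<^bsub>Sh\<^esub> m i \<in> Arr Sh" "f i \<in> Arr Sh" "src Sh (t \<cdot>\<^bsub>Sh\<^esub> m i) = src Sh (f i)"
      "tgt Sh (t \<cdot>\<^bsub>Sh\<^esub> m i) = tgt Sh (f i)" using t fi mi by simp_all
    fix c x assume c: "c \<in> Obj J" and x: "x \<in> fobj (src Sh (f i)) c"
    have xD: "x \<in> fobj (D i) c" using x fi by simp
    have mx: "ap (m i) c x \<in> fobj Q c" using apD(1)[OF mi(2) c] xD mi by simp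
    have fx: "ap (f i) c x \<in> fobj Z c" using apD(1)[OF fi(1) c] xD fi by simp
    have "ok c (ap (m i) c x) (ap (f i) c x)"
      unfolding ok_def
    proof (intro conjI ballI impI)
      fix g j y assume g: "g \<in> Arr J" "tgt J g = c" and j: "j \<in> I" and y: "y \<in> fobj (D j) (src J g)"
        and e: "ap (m j) (src J g) y = res Q g (ap (m i) c x)"
      have "ap (m j) (src J g) y = ap (m i) (src J g) (res (D i) g x)"
        using e apD(2)[OF mi(2) g(1)] g(2) xD mi by simp
      moreover have "res (D i) g x \<in> fobj (D i) (src J g)" using sheafD(2)[OF mi(1) g(1)] g(2) xD by simp
      ultimately have "ap (f j) (src J g) y = ap (f i) (src J g) (res (D i) g x)"
        using wd[OF j i _ y] g by simp
      then show "res Z g (ap (f i) c x) = ap (f j) (src J g) y"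
        using apD(2)[OF fi(1) g(1)] g(2) xD fi by simp
    qed (rule fx)
    then have "k c (ap (m i) c x) = ap (f i) c x" using ok_eq[OF c mx k[OF c mx]] by blast
    then show "ap (t \<cdot>\<^bsub>Sh\<^esub> m i) c x = ap (f i) c x"
      using ap_comp[OF mi(2) t(1) _ c] mi t xD mx c by simp
  qed
  then show "\<exists>h\<in>hom Sh Q Z. \<forall>i\<in>I. h \<cdot>\<^bsub>Sh\<^esub> m i = f i" using t by (intro bexI[of _ t]) auto
next
  fix Z h k assume h: "h \<in> hom Sh Q Z" and k: "k \<in> hom Sh Q Z"
    and e: "\<And>i. i \<in> I \<Longrightarrow> h \<cdot>\<^bsub>Sh\<^esub> m i = k \<cdot>\<^bsub>Sh\<^esub> m i"
  have hk: "h \<in> Arr Sh" "src Sh h = Q" "tgt Sh h = Z" "k \<in> Arr Sh" "src Sh k = Q" "tgt Sh k = Z"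
    using h k by auto
  have Z: "Z \<in> Obj Sh" using hk(1,3) Sh.tgt_Obj by blast
  show "h = k"
  proof (rule ap_eq)
    fix c q assume c: "c \<in> Obj J" and q: "q \<in> fobj (src Sh k) c"
    have q: "q \<in> fobj Q c" using q hk by simp
    show "ap h c q = ap k c q"
    proof (rule sheaf_eq[OF Z c famD(8)[OF c q]])
      show "ap h c q \<in> fobj Z c" "ap k c q \<in> fobj Z c"
        using apD(1)[OF hk(1) c] apD(1)[OF hk(4) c] hk q by simp_all
      fix g assume "g \<in> {f \<in> Arr J. tgt J f = c \<and>
        (\<exists>i\<in>I. \<exists>x\<in>fobj (D i) (src J f). ap (m i) (src J f) x = res Q f q)}"
      then obtain i x where g: "g \<in> Arr J" "i \<in> I" "x \<in> fobj (D i) (src J g)"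
         "ap (m i) (src J g) x = res Q g q" "tgt J g = c" by blast
      note mi = famD(2-5)[OF g(2)]
      have "res Z g (ap h c q) = ap h (src J g) (res Q g q)" using apD(2)[OF hk(1) g(1)] hk q g by simp
      also have "\<dots> = ap (h \<cdot>\<^bsub>Sh\<^esub> m i) (src J g) x" using ap_comp[OF mi(2) hk(1)] mi hk g by simp
      also have "\<dots> = ap k (src J g) (res Q g q)"
        unfolding e[OF g(2)] using ap_comp[OF mi(2) hk(4)] mi hk g by simp
      also have "\<dots> = res Z g (ap k c q)" using apD(2)[OF hk(4) g(1)] hk q g by simp
      finally show "res Z g (ap h c q) = res Z g (ap k c q)" .
    qed
  qed (use hk in simp_all)
qed

lemma covering_family_mono:
  assumes i: "i \<in> I"
  shows "is_mono Sh (m i)"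
proof (rule Sh.is_monoI)
  note mi = famD(2-5)[OF i]
  fix f g assume fg: "f \<in> Arr Sh" "g \<in> Arr Sh" "src Sh f = src Sh g" "tgt Sh f = src Sh (m i)"
    "tgt Sh g = src Sh (m i)" "m i \<cdot>\<^bsub>Sh\<^esub> f = m i \<cdot>\<^bsub>Sh\<^esub> g"
  show "f = g"
    using ap_eq ap_comp fg(1) mi(2) fg(2) fg famD(6) i apD(1) mi by metis
qed (rule famD(3)[OF i])

text \<open>A section \<open>x\<close> of the common domain has images under \<open>a\<close> and
  \<open>b\<close> that become equal in \<open>Q\<close>, so the overlap clause applies. With
  \<open>empty_family_initial\<close> the common domain is then initial.\<close>

lemma covering_family_disjoint:
  assumes ij: "i \<in> I" "j \<in> I" "i \<noteq> j" and ab: "a \<in> Arr Sh" "b \<in> Arr Sh" "src Sh a = src Sh b"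
    "tgt Sh a = D i" "tgt Sh b = D j" "m i \<cdot>\<^bsub>Sh\<^esub> a = m j \<cdot>\<^bsub>Sh\<^esub> b" and c: "c \<in> Obj J" "x \<in> fobj (src Sh a) c"
  shows "{} \<in> T c"
proof -
  note mi = famD(2-5)[OF ij(1)] and mj = famD(2-5)[OF ij(2)]
  have "ap (m i) c (ap a c x) = ap (m j) c (ap b c x)"
    using ap_comp[OF ab(1) mi(2) _ c(1)] ap_comp[OF ab(2) mj(2) _ c(1)] ab mi mj c by simp
  then show ?thesis
    by (rule famD(7)[OF ij(1,2) c(1) _ _ _ ij(3), rotated 2])
      (use apD(1)[OF ab(1) c(1)] apD(1)[OF ab(2) c(1)] ab c in simp_all)
qed

text \<open>The part of the domain of \<open>n\<close> over \<open>i\<close> consists of the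
  sections whose image under \<open>n\<close> comes from \<open>D i\<close>. It is a sheaf because
  \<open>m i\<close> is injective on sections, so that local preimages in \<open>D i\<close> are
  unique and glue.\<close>

lemma covering_family_pullback:
  assumes n: "n \<in> Arr Sh" "tgt Sh n = Q"
  shows "\<exists>N p q. covering_family I N (src Sh n) p \<and>
    (\<forall>i\<in>I. q i \<in> hom Sh (N i) (D i) \<and> n \<cdot>\<^bsub>Sh\<^esub> p i = m i \<cdot>\<^bsub>Sh\<^esub> q i)"
proof -
  let ?N = "src Sh n"
  have N: "?N \<in> Obj Sh" using n by simp
  have nq: "ap n c a \<in> fobj Q c" if "c \<in> Obj J" "a \<in> fobj ?N c" for c a
    using apD(1)[OF n(1)] that n(2) by simp
  define ok where "ok i P p q \<longleftrightarrow> P \<in> Obj Sh \<and> p \<in> hom Sh P ?N \<and> q \<in> hom Sh P (D i) \<and> n \<cdot>\<^bsub>Sh\<^esub> p = m i \<cdot>\<^bsub>Sh\<^esub> q \<and>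
     (\<forall>c\<in>Obj J. fobj P c = {a \<in> fobj ?N c. \<exists>x\<in>fobj (D i) c. ap n c a = ap (m i) c x}) \<and>
     (\<forall>c\<in>Obj J. \<forall>a\<in>fobj P c. ap p c a = a)" for i P p q
  have one: "\<exists>P p q. ok i P p q" if i: "i \<in> I" for i
  proof -
    note mi = famD(2-5)[OF i]
    let ?V = "\<lambda>c. {a \<in> fobj ?N c. \<exists>x\<in>fobj (D i) c. ap n c a = ap (m i) c x}"
    have actV: "res ?N g a \<in> ?V (src J g)" if g: "g \<in> Arr J" and a: "a \<in> ?V (tgt J g)" for g a
    proof -
      obtain x where x: "x \<in> fobj (D i) (tgt J g)" "ap n (tgt J g) a = ap (m i) (tgt J g) x" using a by blast
      have "ap n (src J g) (res ?N g a) = ap (m i) (src J g) (res (D i) g x)"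
        using apD(2)[OF n(1) g] apD(2)[OF mi(2) g] x a n mi by simp
      moreover have "res (D i) g x \<in> fobj (D i) (src J g)" using sheafD(2)[OF mi(1) g x(1)] .
      ultimately show ?thesis using sheafD(2)[OF N g] a by blast
    qed
    obtain P where P: "P \<in> Obj Sh" "\<And>c. c \<in> Obj J \<Longrightarrow> fobj P c = (\<lambda>x. x) ` ?V c"
      "\<And>g x. g \<in> Arr J \<Longrightarrow> x \<in> ?V (tgt J g) \<Longrightarrow> res P g x = res ?N g x"
    \<comment> \<open>The values are already sets of elements of the universe type, so the encoding
      is the identity.\<close>
    proof (rule sheaf_ex[of ?V "res ?N" "\<lambda>c x. x"])
      show "small U (?V c)" if "c \<in> Obj J" for c
        by (rule small_subset[OF sheafD(1)[OF N that]]) blast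
      show "res ?N g a \<in> ?V (src J g)" if "g \<in> Arr J" "a \<in> ?V (tgt J g)" for g a by (rule actV[OF that])
      show "res ?N (ident J c) x = x" if "c \<in> Obj J" "x \<in> ?V c" for c x using sheafD(3)[OF N] that by blast
      show "res ?N (g \<bullet> f) x = res ?N f (res ?N g x)"
        if "f \<in> Arr J" "g \<in> Arr J" "tgt J f = src J g" "x \<in> ?V (tgt J g)" for f g x
        using sheafD(4)[OF N that(1-3)] that(4) by blast
      show "\<exists>a\<in>?V c. \<forall>f\<in>R. res ?N f a = x f" if c: "c \<in> Obj J" and R: "R \<in> T c"
        and x: "\<And>f. f \<in> R \<Longrightarrow> x f \<in> ?V (src J f)"
        and co: "\<And>f g. f \<in> R \<Longrightarrow> g \<in> Arr J \<Longrightarrow> tgt J g = src J f \<Longrightarrow> res ?N g (x f) = x (f \<bullet> g)"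
        for c R x
      proof -
        note dR = coverD[OF R c]
        obtain a where a: "a \<in> fobj ?N c" "\<And>f. f \<in> R \<Longrightarrow> res ?N f a = x f"
          by (rule sheaf_glue[OF N c R, of x]) (use x co in auto)
        have "\<forall>f\<in>R. \<exists>y. y \<in> fobj (D i) (src J f) \<and> ap n (src J f) (x f) = ap (m i) (src J f) y"
          using x by blast
        then obtain y where y: "\<And>f. f \<in> R \<Longrightarrow> y f \<in> fobj (D i) (src J f)"
          "\<And>f. f \<in> R \<Longrightarrow> ap n (src J f) (x f) = ap (m i) (src J f) (y f)" by metis
        \<comment> \<open>The local preimages are compatible because they are so after applying
          \<open>m i\<close>, which is injective.\<close>
        obtain b where b: "b \<in> fobj (D i) c" "\<And>f. f \<in> R \<Longrightarrow> res (D i) f b = y f"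
        proof (rule sheaf_glue[OF mi(1) c R, of y])
          fix f g assume f: "f \<in> R" and g: "g \<in> Arr J" "tgt J g = src J f"
          note fa = dR[OF f]
          have "ap (m i) (src J g) (res (D i) g (y f)) = res Q g (ap n (src J f) (x f))"
            using apD(2)[OF mi(2) g(1)] y[OF f] g(2) mi by simp
          also have "\<dots> = ap n (src J g) (res ?N g (x f))"
            using apD(2)[OF n(1) g(1)] x[OF f] g(2) n by simp
          also have "\<dots> = ap (m i) (src J g) (y (f \<bullet> g))"
            using co[OF f g] y(2)[OF fa(3)[OF g]] g fa(1,2) by simp
          finally show "res (D i) g (y f) = y (f \<bullet> g)"
            by (rule famD(6)[OF i, rotated 3])
              (use g fa y(1)[OF f] y(1)[OF fa(3)[OF g]] sheafD(2)[OF mi(1) g(1)] in simp_all)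
        qed (use y in auto)
        have "ap n c a = ap (m i) c b"
        proof (rule sheaf_eq[OF famD(1) c R])
          show "ap n c a \<in> fobj Q c" "ap (m i) c b \<in> fobj Q c"
            using nq[OF c a(1)] apD(1)[OF mi(2) c] b(1) mi by simp_all
          fix f assume f: "f \<in> R"
          have "res Q f (ap n c a) = ap n (src J f) (x f)"
            using apD(2)[OF n(1) dR(1)[OF f], of a] dR(2)[OF f] a(1) a(2)[OF f] n by simp
          also have "\<dots> = ap (m i) (src J f) (y f)" by (rule y(2)[OF f])
          also have "\<dots> = res Q f (ap (m i) c b)"
            using apD(2)[OF mi(2) dR(1)[OF f], of b] dR(2)[OF f] b(1) b(2)[OF f] mi by simp
          finally show "res Q f (ap n c a) = res Q f (ap (m i) c b)" .
        qed
        then show ?thesis using a b(1) by blast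
      qed
      show "a = b" if "c \<in> Obj J" "R \<in> T c" "a \<in> ?V c" "b \<in> ?V c"
        "\<And>f. f \<in> R \<Longrightarrow> res ?N f a = res ?N f b" for c R a b
        by (rule sheaf_eq[OF N that(1,2)]) (use that in auto)
    qed auto
    have Pc: "fobj P c = ?V c" if "c \<in> Obj J" for c using P(2)[OF that] by simp
    obtain p where p: "p \<in> Arr Sh" "src Sh p = P" "tgt Sh p = ?N"
      "\<And>c x. c \<in> Obj J \<Longrightarrow> x \<in> fobj P c \<Longrightarrow> ap p c x = x"
      by (rule ap_ex[OF P(1) N, of "\<lambda>c x. x"]) (use Pc P(3) in auto)
    define k where "k c a = (SOME x. x \<in> fobj (D i) c \<and> ap n c a = ap (m i) c x)" for c a
    have k: "k c a \<in> fobj (D i) c" "ap n c a = ap (m i) c (k c a)" if "c \<in> Obj J" "a \<in> fobj P c" for c a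
    proof -
      have "\<exists>x. x \<in> fobj (D i) c \<and> ap n c a = ap (m i) c x" using Pc that by blast
      from someI_ex[OF this] show "k c a \<in> fobj (D i) c" "ap n c a = ap (m i) c (k c a)" unfolding k_def by auto
    qed
    obtain q where q: "q \<in> Arr Sh" "src Sh q = P" "tgt Sh q = D i"
      "\<And>c x. c \<in> Obj J \<Longrightarrow> x \<in> fobj P c \<Longrightarrow> ap q c x = k c x"
    proof (rule ap_ex[OF P(1) mi(1), of k])
      show "k c x \<in> fobj (D i) c" if "c \<in> Obj J" "x \<in> fobj P c" for c x by (rule k[OF that])
      fix g a assume g: "g \<in> Arr J" and a: "a \<in> fobj P (tgt J g)"
      have c: "src J g \<in> Obj J" "tgt J g \<in> Obj J" using g by auto
      have aV: "a \<in> ?V (tgt J g)" using a Pc[OF c(2)] by simp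
      have ga: "res P g a \<in> fobj P (src J g)" by (rule sheafD(2)[OF P(1) g a])
      have kg: "res (D i) g (k (tgt J g) a) \<in> fobj (D i) (src J g)"
        by (rule sheafD(2)[OF mi(1) g k(1)[OF c(2) a]])
      have "ap (m i) (src J g) (k (src J g) (res P g a)) = ap n (src J g) (res ?N g a)"
        using k(2)[OF c(1) ga] P(3)[OF g aV] by simp
      also have "\<dots> = res Q g (ap (m i) (tgt J g) (k (tgt J g) a))"
        using apD(2)[OF n(1) g] aV n k(2)[OF c(2) a] by simp
      also have "\<dots> = ap (m i) (src J g) (res (D i) g (k (tgt J g) a))"
        using apD(2)[OF mi(2) g] k(1)[OF c(2) a] mi by simp
      finally show "k (src J g) (res P g a) = res (D i) g (k (tgt J g) a)"
        by (rule famD(6)[OF i c(1) k(1)[OF c(1) ga] kg])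
    qed blast
    have "n \<cdot>\<^bsub>Sh\<^esub> p = m i \<cdot>\<^bsub>Sh\<^esub> q"
    proof (rule ap_eq)
      fix c x assume c: "c \<in> Obj J" and "x \<in> fobj (src Sh (m i \<cdot>\<^bsub>Sh\<^esub> q)) c"
      then have x: "x \<in> fobj P c" using q mi by simp
      show "ap (n \<cdot>\<^bsub>Sh\<^esub> p) c x = ap (m i \<cdot>\<^bsub>Sh\<^esub> q) c x"
        using ap_comp[OF p(1) n(1) _ c] ap_comp[OF q(1) mi(2) _ c] p q mi x c k(2)[OF c x] by simp
    qed (use p q n mi in simp_all)
    then show ?thesis using P(1) p q Pc unfolding ok_def by (intro exI[of _ P] exI[of _ p] exI[of _ q]) auto
  qed
  obtain P p q where ok: "\<And>i. i \<in> I \<Longrightarrow> ok i (P i) (p i) (q i)" using one by metis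
  have P: "\<And>i. i \<in> I \<Longrightarrow> P i \<in> Obj Sh" "\<And>i. i \<in> I \<Longrightarrow> p i \<in> hom Sh (P i) ?N"
    "\<And>i. i \<in> I \<Longrightarrow> q i \<in> hom Sh (P i) (D i)" "\<And>i. i \<in> I \<Longrightarrow> n \<cdot>\<^bsub>Sh\<^esub> p i = m i \<cdot>\<^bsub>Sh\<^esub> q i"
    "\<And>i c. i \<in> I \<Longrightarrow> c \<in> Obj J \<Longrightarrow> fobj (P i) c = {a \<in> fobj ?N c. \<exists>x\<in>fobj (D i) c. ap n c a = ap (m i) c x}"
    "\<And>i c a. i \<in> I \<Longrightarrow> c \<in> Obj J \<Longrightarrow> a \<in> fobj (P i) c \<Longrightarrow> ap (p i) c a = a"
    using ok unfolding ok_def by blast+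
  have "covering_family I P ?N p"
    unfolding covering_family_def
  proof (intro conjI ballI impI)
    show "?N \<in> Obj Sh" by (rule N)
    show "P i \<in> Obj Sh" "p i \<in> hom Sh (P i) ?N" if "i \<in> I" for i using P that by auto
    show "inj_on (ap (p i) c) (fobj (P i) c)" if "i \<in> I" "c \<in> Obj J" for i c
      by (rule inj_onI) (use P(6)[OF that] in simp)
    show "{} \<in> T c" if i: "i \<in> I" and j: "j \<in> I" and c: "c \<in> Obj J" and x: "x \<in> fobj (P i) c" and y: "y \<in> fobj (P j) c"
      and e: "ap (p i) c x = ap (p j) c y" and "i \<noteq> j" for i j c x y
    proof -
      have "x = y" using e P(6)[OF i c x] P(6)[OF j c y] by simp
      then obtain a b where "a \<in> fobj (D i) c" "b \<in> fobj (D j) c" "ap n c x = ap (m i) c a" "ap n c x = ap (m j) c b"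
        using x y P(5)[OF i c] P(5)[OF j c] by auto
      then show ?thesis using famD(7)[OF i j c, of a b] \<open>i \<noteq> j\<close> by simp
    qed
    fix c a assume c: "c \<in> Obj J" and a: "a \<in> fobj ?N c"
    \<comment> \<open>A restriction of \<open>a\<close> lies in the part over \<open>i\<close>
      exactly when its image in \<open>Q\<close> comes from \<open>D i\<close>. So the sieve
      required for \<open>a\<close> is the one that the given family provides for
      \<open>ap n c a\<close>.\<close>
    have "(\<exists>x\<in>fobj (P i) (src J f). ap (p i) (src J f) x = res ?N f a) \<longleftrightarrow>
       (\<exists>x\<in>fobj (D i) (src J f). ap (m i) (src J f) x = res Q f (ap n c a))"
      if i: "i \<in> I" and f: "f \<in> Arr J" "tgt J f = c" for i f
    proof -
      have s: "src J f \<in> Obj J" using f by simp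
      have fa: "res ?N f a \<in> fobj ?N (src J f)" using sheafD(2)[OF N f(1)] a f(2) by simp
      have "(\<exists>x\<in>fobj (P i) (src J f). ap (p i) (src J f) x = res ?N f a) \<longleftrightarrow> res ?N f a \<in> fobj (P i) (src J f)"
        using P(6)[OF i s] by metis
      also have "\<dots> \<longleftrightarrow> (\<exists>x\<in>fobj (D i) (src J f). ap n (src J f) (res ?N f a) = ap (m i) (src J f) x)"
        using P(5)[OF i s] fa by blast
      also have "ap n (src J f) (res ?N f a) = res Q f (ap n c a)"
        using apD(2)[OF n(1) f(1)] a f n by simp
      finally show ?thesis by metis
    qed
    then have "{f \<in> Arr J. tgt J f = c \<and>
          (\<exists>i\<in>I. \<exists>x\<in>fobj (P i) (src J f). ap (p i) (src J f) x = res ?N f a)} =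
        {f \<in> Arr J. tgt J f = c \<and>
          (\<exists>i\<in>I. \<exists>x\<in>fobj (D i) (src J f). ap (m i) (src J f) x = res Q f (ap n c a))}" by blast
    then show "{f \<in> Arr J. tgt J f = c \<and>
          (\<exists>i\<in>I. \<exists>x\<in>fobj (P i) (src J f). ap (p i) (src J f) x = res ?N f a)} \<in> T c"
      using famD(8)[OF c nq[OF c a]] by simp
  qed
  then show ?thesis using P(3,4) by blast
qed

end

text \<open>The empty family is a covering family for \<open>Z\<close>: the sieve it requires is
  empty, and by hypothesis the empty sieve covers wherever there is a section to be covered.\<close>

lemma empty_family_initial:
  assumes Z: "Z \<in> Obj Sh" and e: "\<And>c x. c \<in> Obj J \<Longrightarrow> x \<in> fobj Z c \<Longrightarrow> {} \<in> T c"
  shows "is_initial Sh Z"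
proof -
  have "covering_family {} (\<lambda>_. Z) Z (\<lambda>_. ident Sh Z)"
    unfolding covering_family_def using assms by simp
  from covering_family_coproduct[OF this] show ?thesis by (simp add: Sh.empty_coproduct)
qed

end

text \<open>A section of the coproduct of \<open>D\<close> over \<open>c\<close> is locally a section \<open>x\<close> of one of the \<open>D i\<close>. It is
  encoded as the set of all triples \<open>(f, i, x)\<close> such that its restriction along \<open>f\<close> is the section
  \<open>x\<close> of \<open>D i\<close>.\<close>

locale site_family = site +
  fixes I :: "'a set" and D :: "'a \<Rightarrow> ('a, 'a, 'a set, 'a set_arr) fctr"
  assumes small_I: "small U I" and D_Obj: "\<And>i. i \<in> I \<Longrightarrow> D i \<in> Obj Sh"
begin

definition germs :: "'a \<Rightarrow> ('a \<times> 'a \<times> 'a) set" where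
  "germs c = {(f, i, x). f \<in> Arr J \<and> tgt J f = c \<and> i \<in> I \<and> x \<in> fobj (D i) (src J f)}"

text \<open>The last clause saturates \<open>s\<close>: a germ that belongs to it locally belongs to
  it. Each section then has exactly one encoding, so equality of sections is equality of sets and no
  quotient is taken. Two germs over one arrow may differ only where the empty sieve covers.\<close>

definition sections :: "'a \<Rightarrow> ('a \<times> 'a \<times> 'a) set set" where
  "sections c = {s. s \<subseteq> germs c \<and>
     (\<forall>f i x g. (f, i, x) \<in> s \<longrightarrow> g \<in> Arr J \<longrightarrow> tgt J g = src J f \<longrightarrow> (f \<bullet> g, i, res (D i) g x) \<in> s) \<and>
     (\<forall>f i x j y. (f, i, x) \<in> s \<longrightarrow> (f, j, y) \<in> s \<longrightarrow> i = j \<and> x = y \<or> {} \<in> T (src J f)) \<and>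
     {f. \<exists>i x. (f, i, x) \<in> s} \<in> T c \<and>
     (\<forall>f i x R. (f, i, x) \<in> germs c \<longrightarrow> R \<in> T (src J f) \<longrightarrow>
       (\<forall>g\<in>R. (f \<bullet> g, i, res (D i) g x) \<in> s) \<longrightarrow> (f, i, x) \<in> s)}"

definition restr :: "'a \<Rightarrow> ('a \<times> 'a \<times> 'a) set \<Rightarrow> ('a \<times> 'a \<times> 'a) set" where
  "restr h s = {(f, i, x). (f, i, x) \<in> germs (src J h) \<and> (h \<bullet> f, i, x) \<in> s}"

text \<open>The second alternative is forced by saturation: over an object covered by the empty
  sieve, every germ belongs to every section.\<close>

definition incl :: "'a \<Rightarrow> 'a \<Rightarrow> 'a \<Rightarrow> ('a \<times> 'a \<times> 'a) set" where
  "incl c i x = {(f, j, y). (f, j, y) \<in> germs c \<and> (j = i \<and> y = res (D i) f x \<or> {} \<in> T (src J f))}"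

lemma in_germs: "(f, i, x) \<in> germs c \<longleftrightarrow> f \<in> Arr J \<and> tgt J f = c \<and> i \<in> I \<and> x \<in> fobj (D i) (src J f)"
  by (simp add: germs_def)

lemma in_restr: "(f, i, x) \<in> restr h s \<longleftrightarrow> (f, i, x) \<in> germs (src J h) \<and> (h \<bullet> f, i, x) \<in> s"
  by (simp add: restr_def)

lemma in_incl: "(f, j, y) \<in> incl c i x \<longleftrightarrow>
    (f, j, y) \<in> germs c \<and> (j = i \<and> y = res (D i) f x \<or> {} \<in> T (src J f))"
  by (simp add: incl_def)

lemma sectionD:
  assumes "s \<in> sections c"
  shows "(f, i, x) \<in> s \<Longrightarrow> (f, i, x) \<in> germs c"
    "(f, i, x) \<in> s \<Longrightarrow> g \<in> Arr J \<Longrightarrow> tgt J g = src J f \<Longrightarrow> (f \<bullet> g, i, res (D i) g x) \<in> s"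
    "(f, i, x) \<in> s \<Longrightarrow> (f, j, y) \<in> s \<Longrightarrow> i = j \<and> x = y \<or> {} \<in> T (src J f)"
    "{f. \<exists>i x. (f, i, x) \<in> s} \<in> T c"
    "(f, i, x) \<in> germs c \<Longrightarrow> R \<in> T (src J f) \<Longrightarrow>
       (\<And>g. g \<in> R \<Longrightarrow> (f \<bullet> g, i, res (D i) g x) \<in> s) \<Longrightarrow> (f, i, x) \<in> s"
  using assms unfolding sections_def by blast+

lemma sectionI:
  assumes "\<And>f i x. (f, i, x) \<in> s \<Longrightarrow> (f, i, x) \<in> germs c"
    "\<And>f i x g. (f, i, x) \<in> s \<Longrightarrow> g \<in> Arr J \<Longrightarrow> tgt J g = src J f \<Longrightarrow> (f \<bullet> g, i, res (D i) g x) \<in> s"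
    "\<And>f i x j y. (f, i, x) \<in> s \<Longrightarrow> (f, j, y) \<in> s \<Longrightarrow> i = j \<and> x = y \<or> {} \<in> T (src J f)"
    "{f. \<exists>i x. (f, i, x) \<in> s} \<in> T c"
    "\<And>f i x R. (f, i, x) \<in> germs c \<Longrightarrow> R \<in> T (src J f) \<Longrightarrow>
       (\<And>g. g \<in> R \<Longrightarrow> (f \<bullet> g, i, res (D i) g x) \<in> s) \<Longrightarrow> (f, i, x) \<in> s"
  shows "s \<in> sections c"
proof -
  have "s \<subseteq> germs c" using assms(1) by (auto simp: subset_iff)
  then show ?thesis unfolding sections_def using assms(2-5) by simp
qed

lemma germs_res:
  assumes "(f, i, x) \<in> germs c" "g \<in> Arr J" "tgt J g = src J f"
  shows "(f \<bullet> g, i, res (D i) g x) \<in> germs c"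
  using assms sheafD(2)[OF D_Obj, of i g x] by (simp add: in_germs)

lemma res_comp:
  assumes "i \<in> I" "f \<in> Arr J" "g \<in> Arr J" "tgt J f = src J g" "x \<in> fobj (D i) (tgt J g)"
  shows "res (D i) (g \<bullet> f) x = res (D i) f (res (D i) g x)"
  by (rule sheafD(4)[OF D_Obj]) (use assms in simp_all)

lemma small_sections:
  assumes c: "c \<in> Obj J"
  shows "small U (sections c)"
proof -
  have "small U (\<Union>i\<in>I. \<Union>d\<in>Obj J. fobj (D i) d)"
    by (intro small_UN[OF universe] small_I small_Obj sheafD(1)[OF D_Obj])
  then have "small U (I \<times> (\<Union>i\<in>I. \<Union>d\<in>Obj J. fobj (D i) d))"
    by (rule small_Times[OF universe small_I])
  \<comment> \<open>\<open>small_Times\<close> multiplies subsets of the universe type, so the pairs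
    of an index and a section are encoded there before the arrows are added as a further
    factor.\<close>
  then obtain e :: "'a \<times> 'a \<Rightarrow> 'a" where e: "inj_on e (I \<times> (\<Union>i\<in>I. \<Union>d\<in>Obj J. fobj (D i) d))"
    "small U (e ` (I \<times> (\<Union>i\<in>I. \<Union>d\<in>Obj J. fobj (D i) d)))" by (rule small_inject)
  have "small U (Arr J \<times> e ` (I \<times> (\<Union>i\<in>I. \<Union>d\<in>Obj J. fobj (D i) d)))" (is "small U ?K")
    by (rule small_Times[OF universe small_Arr e(2)])
  moreover have "germs c \<lesssim> ?K"
    unfolding lepoll_def
  proof (intro exI[of _ "\<lambda>(f, ix). (f, e ix)"] conjI)
    have sub: "f \<in> Arr J" "(i, x) \<in> I \<times> (\<Union>i\<in>I. \<Union>d\<in>Obj J. fobj (D i) d)"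
      if "(f, i, x) \<in> germs c" for f i x
    proof -
      have f: "f \<in> Arr J" "i \<in> I" "x \<in> fobj (D i) (src J f)" using that by (simp_all add: in_germs)
      have "src J f \<in> Obj J" using f(1) by simp
      then have "x \<in> (\<Union>i\<in>I. \<Union>d\<in>Obj J. fobj (D i) d)" using f by blast
      then show "f \<in> Arr J" "(i, x) \<in> I \<times> (\<Union>i\<in>I. \<Union>d\<in>Obj J. fobj (D i) d)" using f by simp_all
    qed
    show "inj_on (\<lambda>(f, ix). (f, e ix)) (germs c)"
    proof (rule inj_onI)
      fix a b assume a: "a \<in> germs c" and b: "b \<in> germs c"
        and eq: "(\<lambda>(f, ix). (f, e ix)) a = (\<lambda>(f, ix). (f, e ix)) b"
      obtain f i x where a': "a = (f, i, x)" by (cases a)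
      obtain g j y where b': "b = (g, j, y)" by (cases b)
      have "f = g" "e (i, x) = e (j, y)" using eq a' b' by simp_all
      with inj_onD[OF e(1) this(2) sub(2) sub(2)] show "a = b" using a b a' b' by simp
    qed
    show "(\<lambda>(f, ix). (f, e ix)) ` germs c \<subseteq> ?K"
      using sub by auto
  qed
  ultimately have "small U (germs c)" by (rule small_lepoll)
  then have "small U (Pow (germs c))" by (rule small_Pow[OF universe])
  then show ?thesis by (rule small_subset) (auto simp: sections_def)
qed

lemma restr_section:
  assumes h: "h \<in> Arr J" and s: "s \<in> sections (tgt J h)"
  shows "restr h s \<in> sections (src J h)"
proof (rule sectionI)
  fix f i x assume a: "(f, i, x) \<in> restr h s"
  then have f: "(f, i, x) \<in> germs (src J h)" "(h \<bullet> f, i, x) \<in> s" by (auto simp: in_restr)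
  then have fa: "f \<in> Arr J" "tgt J f = src J h" by (auto simp: in_germs)
  show "(f, i, x) \<in> germs (src J h)" by (rule f)
  show "(f \<bullet> g, i, res (D i) g x) \<in> restr h s" if "g \<in> Arr J" "tgt J g = src J f" for g
    using sectionD(2)[OF s f(2) that(1)] germs_res[OF f(1) that] that fa h by (simp add: in_restr)
  show "i = j \<and> x = y \<or> {} \<in> T (src J f)" if "(f, j, y) \<in> restr h s" for j y
    using sectionD(3)[OF s f(2), of j y] that fa h by (simp add: in_restr)
next
  have "{f. \<exists>i x. (f, i, x) \<in> restr h s} = pull_sieve J h {f. \<exists>i x. (f, i, x) \<in> s}"
  proof (rule set_eqI)
    fix f
    have "(\<exists>i x. (f, i, x) \<in> restr h s) \<longleftrightarrow> f \<in> Arr J \<and> tgt J f = src J h \<and> (\<exists>i x. (h \<bullet> f, i, x) \<in> s)"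
      using sectionD(1) s h in_germs in_restr by fastforce
    then show "f \<in> {f. \<exists>i x. (f, i, x) \<in> restr h s} \<longleftrightarrow> f \<in> pull_sieve J h {f. \<exists>i x. (f, i, x) \<in> s}"
      unfolding pull_sieve_def by simp
  qed
  then show "{f. \<exists>i x. (f, i, x) \<in> restr h s} \<in> T (src J h)"
    using cover_pull[OF sectionD(4)[OF s] h] by simp
next
  fix f i x R assume f: "(f, i, x) \<in> germs (src J h)" and R: "R \<in> T (src J f)"
    and g: "\<And>g. g \<in> R \<Longrightarrow> (f \<bullet> g, i, res (D i) g x) \<in> restr h s"
  have fa: "f \<in> Arr J" "tgt J f = src J h" "i \<in> I" "x \<in> fobj (D i) (src J f)" using f by (auto simp: in_germs)
  note dR = coverD[OF R J.src_Obj[OF fa(1)]]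
  have "(h \<bullet> f, i, x) \<in> s"
    using sectionD(5) s R fa h in_germs g dR(1,2) in_restr by simp
  then show "(f, i, x) \<in> restr h s" using f by (simp add: in_restr)
qed

lemma restr_ident: "c \<in> Obj J \<Longrightarrow> s \<in> sections c \<Longrightarrow> restr (ident J c) s = s"
proof (rule set_eqI)
  fix z :: "'a \<times> 'a \<times> 'a" assume c: "c \<in> Obj J" and s: "s \<in> sections c"
  obtain f i x where z: "z = (f, i, x)" by (cases z)
  have "(f, i, x) \<in> restr (ident J c) s \<longleftrightarrow> (f, i, x) \<in> germs c \<and> (f, i, x) \<in> s"
    using c by (auto simp: in_restr in_germs)
  then show "z \<in> restr (ident J c) s \<longleftrightarrow> z \<in> s" using sectionD(1)[OF s, of f i x] z by blast
qed

lemma restr_comp: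
  assumes "f \<in> Arr J" "g \<in> Arr J" "tgt J f = src J g"
  shows "restr (g \<bullet> f) s = restr f (restr g s)"
  using assms by (auto simp: in_restr in_germs)

text \<open>A germ of \<open>s\<close> over \<open>f\<close> is tested on the pullback of
  \<open>R\<close> along \<open>f\<close>, where the restrictions of both sections coincide;
  saturation of \<open>s'\<close> brings it back. Equality of the sections is obtained by applying
  this in both directions.\<close>

lemma section_separated:
  assumes c: "c \<in> Obj J" and R: "R \<in> T c" and s: "s \<in> sections c" "s' \<in> sections c"
    and e: "\<And>f. f \<in> R \<Longrightarrow> restr f s = restr f s'"
  shows "s \<subseteq> s'"
proof (rule subsetI)
  note dR = coverD[OF R c]
  fix z assume "z \<in> s"
  obtain f i x where z: "z = (f, i, x)" by (cases z)
  with \<open>z \<in> s\<close> have f: "(f, i, x) \<in> s" by simp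
  have fg: "(f, i, x) \<in> germs c" by (rule sectionD(1)[OF s(1) f])
  then have fa: "f \<in> Arr J" "tgt J f = c" "i \<in> I" "x \<in> fobj (D i) (src J f)" by (auto simp: in_germs)
  have "(f, i, x) \<in> s'"
  proof (rule sectionD(5)[OF s(2) fg])
    show "pull_sieve J f R \<in> T (src J f)" using cover_pull[of R f] R fa by simp
    fix g assume "g \<in> pull_sieve J f R"
    then have g: "g \<in> Arr J" "tgt J g = src J f" "f \<bullet> g \<in> R" by (auto simp: pull_sieve_def)
    have fgs: "(f \<bullet> g, i, res (D i) g x) \<in> s" by (rule sectionD(2)[OF s(1) f g(1,2)])
    have "(ident J (src J g), i, res (D i) g x) \<in> germs (src J g)"
      using sectionD(1)[OF s(1) fgs] g fa by (simp add: in_germs)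
    then have "(ident J (src J g), i, res (D i) g x) \<in> restr (f \<bullet> g) s"
      using fgs g fa by (simp add: in_restr)
    then show "(f \<bullet> g, i, res (D i) g x) \<in> s'"
      unfolding e[OF g(3)] using g fa by (simp add: in_restr)
  qed
  then show "z \<in> s'" using z by simp
qed

text \<open>A germ is put into the glued section when it lies locally in the given ones, that is,
  when the sieve \<open>K\<close> covers. Saturation and the covering clause then come from the
  local character of the topology.\<close>

lemma section_glue:
  assumes c: "c \<in> Obj J" and R: "R \<in> T c" and s: "\<And>f. f \<in> R \<Longrightarrow> s f \<in> sections (src J f)"
    and co: "\<And>f g. f \<in> R \<Longrightarrow> g \<in> Arr J \<Longrightarrow> tgt J g = src J f \<Longrightarrow> restr g (s f) = s (f \<bullet> g)"
  shows "\<exists>a\<in>sections c. \<forall>f\<in>R. restr f a = s f"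
proof -
  note dR = coverD[OF R c]
  \<comment> \<open>A restriction of the germ along \<open>g\<close> is looked up in the section
    given over \<open>h \<bullet> g\<close>, where it appears as a germ over the identity.\<close>
  define K where "K h i x = {g \<in> Arr J. tgt J g = src J h \<and> h \<bullet> g \<in> R \<and>
      (ident J (src J g), i, res (D i) g x) \<in> s (h \<bullet> g)}" for h i x
  define a where "a = {(h, i, x). (h, i, x) \<in> germs c \<and> K h i x \<in> T (src J h)}"
  have in_a: "(h, i, x) \<in> a \<longleftrightarrow> (h, i, x) \<in> germs c \<and> K h i x \<in> T (src J h)" for h i x
    by (simp add: a_def)
  have K_sieve: "is_sieve J (src J h) (K h i x)" if h: "(h, i, x) \<in> germs c" for h i x
    unfolding is_sieve_def
  proof (intro conjI ballI impI)
    show "K h i x \<subseteq> {f \<in> Arr J. tgt J f = src J h}" unfolding K_def by blast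
    fix g k assume "g \<in> K h i x" and k: "k \<in> Arr J" "tgt J k = src J g"
    then have g: "g \<in> Arr J" "tgt J g = src J h" "h \<bullet> g \<in> R"
      "(ident J (src J g), i, res (D i) g x) \<in> s (h \<bullet> g)" unfolding K_def by auto
    have h': "h \<in> Arr J" "tgt J h = c" "i \<in> I" "x \<in> fobj (D i) (src J h)" using h by (auto simp: in_germs)
    have R': "h \<bullet> (g \<bullet> k) \<in> R" using dR(3)[OF g(3) k(1)] k g h' by simp
    have sk: "s (h \<bullet> g) \<in> sections (src J (h \<bullet> g))" by (rule s[OF g(3)])
    have r: "res (D i) (g \<bullet> k) x = res (D i) k (res (D i) g x)"
      by (rule res_comp) (use k g h' in simp_all)
    have "(k, i, res (D i) (g \<bullet> k) x) \<in> s (h \<bullet> g)"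
      using sectionD(2)[OF sk g(4) k(1)] k g r by simp
    moreover have "(ident J (src J k), i, res (D i) (g \<bullet> k) x) \<in> germs (src J k)"
      using sectionD(1)[OF sk calculation] k by (simp add: in_germs)
    ultimately have "(ident J (src J k), i, res (D i) (g \<bullet> k) x) \<in> restr k (s (h \<bullet> g))"
      using k by (simp add: in_restr)
    then show "g \<bullet> k \<in> K h i x"
      unfolding K_def using co[OF g(3) k(1)] R' k g h' by simp
  qed
  have res_a: "(h, i, x) \<in> restr f a \<longleftrightarrow> (h, i, x) \<in> s f" if f: "f \<in> R" for f h i x
  proof -
    note fa = dR(1,2)[OF f]
    have sf: "s f \<in> sections (src J f)" by (rule s[OF f])
    have K: "K (f \<bullet> h) i x = {g \<in> Arr J. tgt J g = src J h \<and> (h \<bullet> g, i, res (D i) g x) \<in> s f}"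
      if h: "(h, i, x) \<in> germs (src J f)"
    proof -
      have h': "h \<in> Arr J" "tgt J h = src J f" "i \<in> I" "x \<in> fobj (D i) (src J h)" using h by (auto simp: in_germs)
      have "(ident J (src J g), i, res (D i) g x) \<in> s ((f \<bullet> h) \<bullet> g) \<longleftrightarrow>
          (h \<bullet> g, i, res (D i) g x) \<in> s f" if g: "g \<in> Arr J" "tgt J g = src J h" for g
      proof -
        have "s ((f \<bullet> h) \<bullet> g) = restr (h \<bullet> g) (s f)" using co[OF f, of "h \<bullet> g"] g h' fa by simp
        moreover have "res (D i) g x \<in> fobj (D i) (src J g)" using sheafD(2)[OF D_Obj[OF h'(3)] g(1)] g h' by simp
        ultimately show ?thesis using g h' by (simp add: in_restr in_germs)
      qed
      moreover have "(f \<bullet> h) \<bullet> g \<in> R" if "g \<in> Arr J" "tgt J g = src J h" for g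
        using dR(3)[OF f, of "h \<bullet> g"] that h' fa by simp
      ultimately show ?thesis unfolding K_def using h' fa by auto
    qed
    show ?thesis
    proof
      assume "(h, i, x) \<in> restr f a"
      then have h: "(h, i, x) \<in> germs (src J f)" "(f \<bullet> h, i, x) \<in> a" by (auto simp: in_restr)
      then have "h \<in> Arr J" "tgt J h = src J f" by (auto simp: in_germs)
      then have "K (f \<bullet> h) i x \<in> T (src J h)" using h(2) fa by (simp add: in_a)
      then show "(h, i, x) \<in> s f" unfolding K[OF h(1)] by (rule sectionD(5)[OF sf h(1)]) blast
    next
      assume h: "(h, i, x) \<in> s f"
      have hg: "(h, i, x) \<in> germs (src J f)" by (rule sectionD(1)[OF sf h])
      then have h': "h \<in> Arr J" "tgt J h = src J f" "i \<in> I" "x \<in> fobj (D i) (src J h)" by (auto simp: in_germs)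
      have "K (f \<bullet> h) i x = {g \<in> Arr J. tgt J g = src J h}"
        unfolding K[OF hg] using sectionD(2)[OF sf h] by blast
      then have "K (f \<bullet> h) i x \<in> T (src J h)" using cover_max h' by simp
      then show "(h, i, x) \<in> restr f a" using hg h' fa by (simp add: in_restr in_a in_germs)
    qed
  qed
  have "a \<in> sections c"
  proof (rule sectionI)
    fix f i x assume f: "(f, i, x) \<in> a"
    show fg: "(f, i, x) \<in> germs c" using f in_a by blast
    then have f': "f \<in> Arr J" "tgt J f = c" "i \<in> I" "x \<in> fobj (D i) (src J f)" by (auto simp: in_germs)
    have KT: "K f i x \<in> T (src J f)" using f in_a by blast
    show "(f \<bullet> g, i, res (D i) g x) \<in> a" if g: "g \<in> Arr J" "tgt J g = src J f" for g
    proof -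
      have "K (f \<bullet> g) i (res (D i) g x) = pull_sieve J g (K f i x)"
        unfolding K_def pull_sieve_def using g f' res_comp[OF f'(3) _ g(1), of _ x] by auto
      then show ?thesis using cover_pull[of "K f i x" g] KT g f' germs_res[OF fg g] by (simp add: in_a)
    qed
    show "i = j \<and> x = y \<or> {} \<in> T (src J f)" if y: "(f, j, y) \<in> a" for j y
    proof -
      have y': "j \<in> I" "y \<in> fobj (D j) (src J f)" using y by (auto simp: in_a in_germs)
      \<comment> \<open>Two germs of \<open>a\<close> over the same arrow are compared on the
        intersection of their sieves, which still covers; there both lie in a common given
        section.\<close>
      have R': "K f i x \<inter> K f j y \<in> T (src J f)"
        using cover_Int[of "src J f" "K f i x" "K f j y"] f' KT y in_a by simp
      have two: "i = j \<and> res (D i) g x = res (D j) g y \<or> {} \<in> T (src J g)" if "g \<in> K f i x \<inter> K f j y" for g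
      proof -
        have g: "g \<in> Arr J" "tgt J g = src J f" "f \<bullet> g \<in> R"
          "(ident J (src J g), i, res (D i) g x) \<in> s (f \<bullet> g)"
          "(ident J (src J g), j, res (D j) g y) \<in> s (f \<bullet> g)" using that unfolding K_def by auto
        show ?thesis using sectionD(3)[OF s[OF g(3)] g(4,5)] g(1) by simp
      qed
      show ?thesis
      proof (cases "i = j")
        case True
        have "x = y"
        proof (rule sheaf_eq[OF D_Obj[OF f'(3)] _ R' f'(4)])
          show "src J f \<in> Obj J" using f' by simp
          show "y \<in> fobj (D i) (src J f)" using y' True by simp
          fix g assume g: "g \<in> K f i x \<inter> K f j y"
          have ga: "g \<in> Arr J" "tgt J g = src J f" using g unfolding K_def by auto
          have "res (D i) g x \<in> fobj (D i) (src J g)" "res (D i) g y \<in> fobj (D i) (src J g)"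
            using sheafD(2)[OF D_Obj[OF f'(3)] ga(1)] ga f' y' True by simp_all
          then show "res (D i) g x = res (D i) g y"
            using two[OF g] sheaf_empty_cover[OF D_Obj[OF f'(3)], of "src J g"] ga True by auto
        qed
        then show ?thesis using True by simp
      next
        case False
        then show ?thesis using cover_empty_local[OF _ R'] two f' by simp
      qed
    qed
  next
    let ?B = "{f. \<exists>i x. (f, i, x) \<in> a}"
    show "?B \<in> T c"
    \<comment> \<open>Pulled back along a member \<open>f\<close> of \<open>R\<close>, the arrows
      that carry a germ of \<open>a\<close> become those that carry a germ of \<open>s f\<close>,
      and these cover.\<close>
    proof (rule cover_local[OF c R])
      show "is_sieve J c ?B"
        unfolding is_sieve_def
      proof (intro conjI ballI impI)
        show "?B \<subseteq> {f \<in> Arr J. tgt J f = c}" by (auto simp: in_a in_germs)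
        fix f g assume "f \<in> ?B" and g: "g \<in> Arr J" "tgt J g = src J f"
        then obtain i x where f: "(f, i, x) \<in> a" by blast
        then have fg: "(f, i, x) \<in> germs c" and KT: "K f i x \<in> T (src J f)" using in_a by blast+
        have f': "f \<in> Arr J" "tgt J f = c" "i \<in> I" "x \<in> fobj (D i) (src J f)" using fg by (auto simp: in_germs)
        have "K (f \<bullet> g) i (res (D i) g x) = pull_sieve J g (K f i x)"
          unfolding K_def pull_sieve_def using g f' res_comp[OF f'(3) _ g(1), of _ x] by auto
        then have "(f \<bullet> g, i, res (D i) g x) \<in> a"
          using cover_pull[of "K f i x" g] KT g f' germs_res[OF fg g] by (simp add: in_a)
        then show "f \<bullet> g \<in> ?B" by blast
      qed
      fix f assume f: "f \<in> R"
      note fa = dR(1,2)[OF f]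
      have "pull_sieve J f ?B = {h. \<exists>i x. (h, i, x) \<in> restr f a}"
        unfolding pull_sieve_def using fa by (auto simp: in_restr in_a in_germs; blast)
      also have "\<dots> = {h. \<exists>i x. (h, i, x) \<in> s f}" using res_a[OF f] by simp
      finally show "pull_sieve J f ?B \<in> T (src J f)" using sectionD(4)[OF s[OF f]] by simp
    qed
  next
    fix h i x R' assume h: "(h, i, x) \<in> germs c" and R': "R' \<in> T (src J h)"
      and g: "\<And>g. g \<in> R' \<Longrightarrow> (h \<bullet> g, i, res (D i) g x) \<in> a"
    have h': "h \<in> Arr J" "tgt J h = c" "i \<in> I" "x \<in> fobj (D i) (src J h)" using h by (auto simp: in_germs)
    have "K h i x \<in> T (src J h)"
    proof (rule cover_local[OF _ R' K_sieve[OF h]])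
      show "src J h \<in> Obj J" using h' by simp
      fix k assume k: "k \<in> R'"
      note ka = coverD(1,2)[OF R' J.src_Obj[OF h'(1)] k]
      have "K (h \<bullet> k) i (res (D i) k x) = pull_sieve J k (K h i x)"
        unfolding K_def pull_sieve_def using ka h' res_comp[OF h'(3) _ ka(1), of _ x] by auto
      then show "pull_sieve J k (K h i x) \<in> T (src J k)" using g[OF k] ka h' by (simp add: in_a)
    qed
    then show "(h, i, x) \<in> a" using h in_a by blast
  qed
  moreover have "restr f a = s f" if "f \<in> R" for f
    using res_a[OF that] by (auto simp: set_eq_iff)
  ultimately show ?thesis by blast
qed

lemma incl_section:
  assumes c: "c \<in> Obj J" and i: "i \<in> I" and x: "x \<in> fobj (D i) c"
  shows "incl c i x \<in> sections c"
proof (rule sectionI)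
  fix f j y assume "(f, j, y) \<in> incl c i x"
  then have f: "(f, j, y) \<in> germs c" "j = i \<and> y = res (D i) f x \<or> {} \<in> T (src J f)" by (auto simp: in_incl)
  then have f': "f \<in> Arr J" "tgt J f = c" "j \<in> I" "y \<in> fobj (D j) (src J f)" by (auto simp: in_germs)
  show "(f, j, y) \<in> germs c" by (rule f)
  show "(f \<bullet> g, j, res (D j) g y) \<in> incl c i x" if g: "g \<in> Arr J" "tgt J g = src J f" for g
    using germs_res[OF f(1) g] f(2) res_comp[OF i g(1) f'(1) g(2)] f' g x cover_empty_pull[of g]
    by (auto simp: in_incl)
  show "j = k \<and> y = z \<or> {} \<in> T (src J f)" if "(f, k, z) \<in> incl c i x" for k z
    using f(2) that by (auto simp: in_incl)
next
  have "(f, i, res (D i) f x) \<in> incl c i x" if "f \<in> Arr J" "tgt J f = c" for f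
    using that i x sheafD(2)[OF D_Obj[OF i]] by (auto simp: in_incl in_germs)
  then have "{f. \<exists>j y. (f, j, y) \<in> incl c i x} = {f \<in> Arr J. tgt J f = c}" by (auto simp: in_incl in_germs)
  then show "{f. \<exists>j y. (f, j, y) \<in> incl c i x} \<in> T c" using cover_max[OF c] by simp
next
  fix f j y R assume f: "(f, j, y) \<in> germs c" and R: "R \<in> T (src J f)"
    and g: "\<And>g. g \<in> R \<Longrightarrow> (f \<bullet> g, j, res (D j) g y) \<in> incl c i x"
  have f': "f \<in> Arr J" "tgt J f = c" "j \<in> I" "y \<in> fobj (D j) (src J f)" using f by (auto simp: in_germs)
  have sf: "src J f \<in> Obj J" using f' by simp
  note dR = coverD[OF R sf]
  have "j = i \<and> y = res (D i) f x \<or> {} \<in> T (src J f)"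
  proof (cases "j = i")
    case True
    have "y = res (D i) f x"
    proof (rule sheaf_eq[OF D_Obj[OF i] sf R])
      show "y \<in> fobj (D i) (src J f)" "res (D i) f x \<in> fobj (D i) (src J f)"
        using f' True x sheafD(2)[OF D_Obj[OF i] f'(1)] by simp_all
      fix k assume k: "k \<in> R"
      note ka = dR(1,2)[OF k]
      have "res (D i) k y = res (D i) (f \<bullet> k) x \<or> {} \<in> T (src J k)"
        using g[OF k] ka f' True by (auto simp: in_incl)
      moreover have r: "res (D i) (f \<bullet> k) x = res (D i) k (res (D i) f x)"
        by (rule res_comp) (use i ka f' x in simp_all)
      moreover have "res (D i) k y \<in> fobj (D i) (src J k)" "res (D i) k (res (D i) f x) \<in> fobj (D i) (src J k)"
        using sheafD(2)[OF D_Obj[OF i]] ka f' True x by simp_all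
      ultimately show "res (D i) k y = res (D i) k (res (D i) f x)"
        using sheaf_empty_cover[OF D_Obj[OF i], of "src J k"] ka by auto
    qed
    then show ?thesis using True by simp
  next
    case False
    have "{} \<in> T (src J k)" if k: "k \<in> R" for k
      using g[OF k] dR(1,2)[OF k] f' False by (auto simp: in_incl)
    then show ?thesis using cover_empty_local[OF sf R] by blast
  qed
  then show "(f, j, y) \<in> incl c i x" using f by (simp add: in_incl)
qed

lemma restr_incl:
  assumes h: "h \<in> Arr J" and i: "i \<in> I" and x: "x \<in> fobj (D i) (tgt J h)"
  shows "restr h (incl (tgt J h) i x) = incl (src J h) i (res (D i) h x)"
  using h res_comp[OF i _ h _ x] by (auto simp: in_restr in_incl in_germs)

text \<open>One inclusion is the uniqueness clause for germs over the same arrow; the other uses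
  closure under restriction, and saturation where the empty sieve covers. So every section of the
  coproduct comes locally from some \<open>D i\<close>.\<close>

lemma restr_germ:
  assumes c: "c \<in> Obj J" and s: "s \<in> sections c" and f: "(f, i, x) \<in> s"
  shows "restr f s = incl (src J f) i x"
proof (rule set_eqI)
  fix z :: "'a \<times> 'a \<times> 'a"
  obtain g j y where z: "z = (g, j, y)" by (cases z)
  have fg: "(f, i, x) \<in> germs c" by (rule sectionD(1)[OF s f])
  then have f': "f \<in> Arr J" "tgt J f = c" "i \<in> I" "x \<in> fobj (D i) (src J f)" by (auto simp: in_germs)
  have "(g, j, y) \<in> restr f s \<longleftrightarrow> (g, j, y) \<in> incl (src J f) i x"
  proof
    assume "(g, j, y) \<in> restr f s"
    then have g: "(g, j, y) \<in> germs (src J f)" "(f \<bullet> g, j, y) \<in> s" by (auto simp: in_restr)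
    then have g': "g \<in> Arr J" "tgt J g = src J f" by (auto simp: in_germs)
    show "(g, j, y) \<in> incl (src J f) i x"
      using sectionD(3)[OF s g(2) sectionD(2)[OF s f g']] g g' f' by (auto simp: in_incl)
  next
    assume "(g, j, y) \<in> incl (src J f) i x"
    then have g: "(g, j, y) \<in> germs (src J f)" "j = i \<and> y = res (D i) g x \<or> {} \<in> T (src J g)" by (auto simp: in_incl)
    then have g': "g \<in> Arr J" "tgt J g = src J f" "j \<in> I" "y \<in> fobj (D j) (src J g)" by (auto simp: in_germs)
    have "(f \<bullet> g, j, y) \<in> s" using g(2)
      using sectionD(2) s f g'(1,2) g' f' sectionD(5) in_germs by fastforce
    then show "(g, j, y) \<in> restr f s" using g by (simp add: in_restr)
  qed
  then show "z \<in> restr f s \<longleftrightarrow> z \<in> incl (src J f) i x" using z by simp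
qed

lemma covering_family_ex: "\<exists>Q m. covering_family I D Q m"
proof -
  have "\<exists>e :: ('a \<times> 'a \<times> 'a) set \<Rightarrow> 'a. inj_on e (sections c)" if "c \<in> Obj J" for c
    using small_inject[OF small_sections[OF that]] by metis
  then obtain e :: "'a \<Rightarrow> ('a \<times> 'a \<times> 'a) set \<Rightarrow> 'a" where e: "\<And>c. c \<in> Obj J \<Longrightarrow> inj_on (e c) (sections c)"
    by metis
  obtain Q where Q: "Q \<in> Obj Sh" "\<And>c. c \<in> Obj J \<Longrightarrow> fobj Q c = e c ` sections c"
    "\<And>g s. g \<in> Arr J \<Longrightarrow> s \<in> sections (tgt J g) \<Longrightarrow> res Q g (e (tgt J g) s) = e (src J g) (restr g s)"
  proof (rule sheaf_ex[of sections restr e])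
    show "a = b" if "c \<in> Obj J" "R \<in> T c" "a \<in> sections c" "b \<in> sections c"
      "\<And>f. f \<in> R \<Longrightarrow> restr f a = restr f b" for c R a b
      using section_separated[of c R a b] section_separated[of c R b a] that by (simp add: subset_antisym)
    show "small U (sections c)" if "c \<in> Obj J" for c by (rule small_sections[OF that])
    show "restr g s \<in> sections (src J g)" if "g \<in> Arr J" "s \<in> sections (tgt J g)" for g s
      by (rule restr_section[OF that])
    show "restr (ident J c) s = s" if "c \<in> Obj J" "s \<in> sections c" for c s by (rule restr_ident[OF that])
    show "restr (g \<bullet> f) s = restr f (restr g s)" if "f \<in> Arr J" "g \<in> Arr J" "tgt J f = src J g"
      for f g s by (rule restr_comp[OF that])
    show "\<exists>a\<in>sections c. \<forall>f\<in>R. restr f a = x f" if "c \<in> Obj J" "R \<in> T c"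
      "\<And>f. f \<in> R \<Longrightarrow> x f \<in> sections (src J f)"
      "\<And>f g. f \<in> R \<Longrightarrow> g \<in> Arr J \<Longrightarrow> tgt J g = src J f \<Longrightarrow> restr g (x f) = x (f \<bullet> g)" for c R x
      by (rule section_glue[OF that])
    show "inj_on (e c) (sections c)" if "c \<in> Obj J" for c by (rule e[OF that])
  qed blast
  have e_eq: "s = s'" if "c \<in> Obj J" "s \<in> sections c" "s' \<in> sections c" "e c s = e c s'" for c s s'
    using e[OF that(1)] that by (simp add: inj_on_def)
  have "\<exists>t. t \<in> hom Sh (D i) Q \<and> (\<forall>c\<in>Obj J. \<forall>x\<in>fobj (D i) c. ap t c x = e c (incl c i x))" if i: "i \<in> I" for i
  proof -
    obtain t where "t \<in> Arr Sh" "src Sh t = D i" "tgt Sh t = Q"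
      "\<And>c x. c \<in> Obj J \<Longrightarrow> x \<in> fobj (D i) c \<Longrightarrow> ap t c x = e c (incl c i x)"
    proof (rule ap_ex[OF D_Obj[OF i] Q(1), of "\<lambda>c x. e c (incl c i x)"])
      show "e c (incl c i x) \<in> fobj Q c" if "c \<in> Obj J" "x \<in> fobj (D i) c" for c x
        using Q(2)[OF that(1)] incl_section[OF that(1) i that(2)] by simp
      show "e (src J g) (incl (src J g) i (res (D i) g x)) = res Q g (e (tgt J g) (incl (tgt J g) i x))"
        if "g \<in> Arr J" "x \<in> fobj (D i) (tgt J g)" for g x
        using Q(3)[OF that(1) incl_section[OF _ i that(2)]] restr_incl[OF that(1) i that(2)] that by simp
    qed blast
    then show ?thesis by (intro exI[of _ t]) simp
  qed
  then obtain m where m: "\<And>i. i \<in> I \<Longrightarrow> m i \<in> hom Sh (D i) Q"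
    "\<And>i c x. i \<in> I \<Longrightarrow> c \<in> Obj J \<Longrightarrow> x \<in> fobj (D i) c \<Longrightarrow> ap (m i) c x = e c (incl c i x)" by metis
  have id_in: "(ident J c, i, x) \<in> incl c i x" if "c \<in> Obj J" "i \<in> I" "x \<in> fobj (D i) c" for c i x
    using that sheafD(3)[OF D_Obj] by (simp add: in_incl in_germs)
  have dis: "i = j \<and> x = y \<or> {} \<in> T c"
    if i: "i \<in> I" and j: "j \<in> I" and c: "c \<in> Obj J" and x: "x \<in> fobj (D i) c" and y: "y \<in> fobj (D j) c"
      and eq: "ap (m i) c x = ap (m j) c y" for i j c x y
  proof -
    have "incl c i x = incl c j y"
      by (rule e_eq[OF c incl_section[OF c i x] incl_section[OF c j y]]) (use eq m(2) i j c x y in simp)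
    then have "(ident J c, i, x) \<in> incl c j y" using id_in[OF c i x] by simp
    then show ?thesis using sheafD(3)[OF D_Obj[OF j] c y] c by (auto simp: in_incl)
  qed
  have "covering_family I D Q m"
    unfolding covering_family_def
  proof (intro conjI ballI impI)
    show "Q \<in> Obj Sh" by (rule Q)
    show "D i \<in> Obj Sh" "m i \<in> hom Sh (D i) Q" if "i \<in> I" for i using D_Obj m that by auto
    show "inj_on (ap (m i) c) (fobj (D i) c)" if i: "i \<in> I" and c: "c \<in> Obj J" for i c
    proof (rule inj_onI)
      fix x y assume xy: "x \<in> fobj (D i) c" "y \<in> fobj (D i) c" "ap (m i) c x = ap (m i) c y"
      from dis[OF i i c xy] sheaf_empty_cover[OF D_Obj[OF i] c _ xy(1,2)] show "x = y" by blast
    qed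
    show "{} \<in> T c" if "i \<in> I" "j \<in> I" "c \<in> Obj J" "x \<in> fobj (D i) c" "y \<in> fobj (D j) c"
      "ap (m i) c x = ap (m j) c y" "i \<noteq> j" for i j c x y
      using dis[OF that(1-6)] that(7) by blast
    fix c q assume c: "c \<in> Obj J" and q: "q \<in> fobj Q c"
    then obtain s where s: "s \<in> sections c" "q = e c s" using Q(2)[OF c] by blast
    let ?A = "{f \<in> Arr J. tgt J f = c \<and> (\<exists>i\<in>I. \<exists>x\<in>fobj (D i) (src J f). ap (m i) (src J f) x = res Q f q)}"
    show "?A \<in> T c"
    proof (rule cover_superset[OF c sectionD(4)[OF s(1)]])
      show "{f. \<exists>i x. (f, i, x) \<in> s} \<subseteq> ?A"
      proof
        fix f assume "f \<in> {f. \<exists>i x. (f, i, x) \<in> s}"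
        then obtain i x where f: "(f, i, x) \<in> s" by blast
        have f': "f \<in> Arr J" "tgt J f = c" "i \<in> I" "x \<in> fobj (D i) (src J f)"
          using sectionD(1)[OF s(1) f] by (auto simp: in_germs)
        have "ap (m i) (src J f) x = res Q f q"
          using m(2)[OF f'(3) _ f'(4)] Q(3)[OF f'(1), of s] restr_germ[OF c s(1) f] s f' by simp
        then show "f \<in> ?A" using f' by blast
      qed
      show "is_sieve J c ?A"
        unfolding is_sieve_def
      proof (intro conjI ballI impI)
        fix f g assume "f \<in> ?A" and g: "g \<in> Arr J" "tgt J g = src J f"
        then obtain i x where f: "f \<in> Arr J" "tgt J f = c" "i \<in> I" "x \<in> fobj (D i) (src J f)"
          "ap (m i) (src J f) x = res Q f q" by blast
        have mi: "m i \<in> Arr Sh" "src Sh (m i) = D i" "tgt Sh (m i) = Q" using m(1)[OF f(3)] by auto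
        have "ap (m i) (src J g) (res (D i) g x) = res Q (f \<bullet> g) q"
          using apD(2)[OF mi(1) g(1), of x] sheafD(4)[OF Q(1) g(1) f(1) g(2), of q] mi g f q by simp
        moreover have "res (D i) g x \<in> fobj (D i) (src J g)" using sheafD(2)[OF D_Obj[OF f(3)] g(1)] g f by simp
        ultimately show "f \<bullet> g \<in> ?A" using f g by auto
      qed blast
    qed
  qed
  then show ?thesis by blast
qed

end

section \<open>Stable disjoint coproducts\<close>

text \<open>Stability is phrased as a decomposition of the domain of every arrow into
  \<open>s\<close>, the form in which it is applied and in which it passes along an equivalence of
  categories.\<close>

definition stable_coproduct ::
  "('o, 'a) cat \<Rightarrow> 'i set \<Rightarrow> ('i \<Rightarrow> 'o) \<Rightarrow> 'o \<Rightarrow> ('i \<Rightarrow> 'a) \<Rightarrow> bool" where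
  "stable_coproduct E I D s inc \<longleftrightarrow> is_coproduct E I D s inc \<and>
     (\<forall>n\<in>Arr E. tgt E n = s \<longrightarrow> (\<exists>N p q. is_coproduct E I N (src E n) p \<and>
        (\<forall>i\<in>I. q i \<in> hom E (N i) (D i) \<and> n \<cdot>\<^bsub>E\<^esub> p i = inc i \<cdot>\<^bsub>E\<^esub> q i))) \<and>
     (\<forall>i\<in>I. is_mono E (inc i)) \<and>
     (\<forall>i\<in>I. \<forall>j\<in>I. i \<noteq> j \<longrightarrow> (\<forall>a\<in>Arr E. \<forall>b\<in>Arr E. src E a = src E b \<longrightarrow> tgt E a = D i \<longrightarrow>
        tgt E b = D j \<longrightarrow> inc i \<cdot>\<^bsub>E\<^esub> a = inc j \<cdot>\<^bsub>E\<^esub> b \<longrightarrow> is_initial E (src E a)))"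

lemma stable_coproductD:
  assumes "stable_coproduct E I D s inc"
  shows "is_coproduct E I D s inc"
    "n \<in> Arr E \<Longrightarrow> tgt E n = s \<Longrightarrow> \<exists>N p q. is_coproduct E I N (src E n) p \<and>
        (\<forall>i\<in>I. q i \<in> hom E (N i) (D i) \<and> n \<cdot>\<^bsub>E\<^esub> p i = inc i \<cdot>\<^bsub>E\<^esub> q i)"
    "i \<in> I \<Longrightarrow> is_mono E (inc i)"
    "i \<in> I \<Longrightarrow> j \<in> I \<Longrightarrow> i \<noteq> j \<Longrightarrow> a \<in> Arr E \<Longrightarrow> b \<in> Arr E \<Longrightarrow> src E a = src E b \<Longrightarrow> tgt E a = D i \<Longrightarrow>
        tgt E b = D j \<Longrightarrow> inc i \<cdot>\<^bsub>E\<^esub> a = inc j \<cdot>\<^bsub>E\<^esub> b \<Longrightarrow> is_initial E (src E a)"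
  using assms unfolding stable_coproduct_def by blast+

context cat
begin

text \<open>Composition with the comparison isomorphism transfers stability, disjointness and
  monicity, so having one stable coproduct of a family makes every coproduct of it stable.\<close>

lemma stable_coproduct_iso:
  assumes st: "stable_coproduct C I D s inc" and c: "is_coproduct C I D s' inc'"
  shows "stable_coproduct C I D s' inc'"
proof -
  note cs = stable_coproductD(1)[OF st]
  note d = coproductD[OF cs] coproductD[OF c]
  obtain h k where h: "h \<in> Arr C" "src C h = s" "tgt C h = s'" "k \<in> Arr C" "src C k = s'" "tgt C k = s"
    "k \<cdot> h = ident C s" "h \<cdot> k = ident C s'"
    "\<And>i. i \<in> I \<Longrightarrow> h \<cdot> inc i = inc' i" "\<And>i. i \<in> I \<Longrightarrow> k \<cdot> inc' i = inc i"
    using coproduct_unique[OF cs c] by metis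
  have ka: "inc i \<cdot> a = k \<cdot> (inc' i \<cdot> a)" if "i \<in> I" "a \<in> Arr C" "tgt C a = D i" for i a
    using ext2[OF h(10)[OF that(1)], of a] that d h by simp
  show ?thesis
    unfolding stable_coproduct_def
  proof (intro conjI ballI impI)
    show "is_coproduct C I D s' inc'" by (rule c)
    fix n assume n: "n \<in> Arr C" "tgt C n = s'"
    obtain N p q where N: "is_coproduct C I N (src C (k \<cdot> n)) p"
      "\<forall>i\<in>I. q i \<in> hom C (N i) (D i) \<and> (k \<cdot> n) \<cdot> p i = inc i \<cdot> q i"
      using stable_coproductD(2)[OF st, of "k \<cdot> n"] n h by auto
    have sn: "src C (k \<cdot> n) = src C n" using n h by simp
    note dN = coproductD[OF N(1)]
    have "n \<cdot> p i = inc' i \<cdot> q i" if i: "i \<in> I" for i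
    proof -
      have q: "q i \<in> Arr C" "src C (q i) = N i" "tgt C (q i) = D i" "(k \<cdot> n) \<cdot> p i = inc i \<cdot> q i" using N(2) i by auto
      have "h \<cdot> (k \<cdot> (n \<cdot> p i)) = h \<cdot> (k \<cdot> (inc' i \<cdot> q i))"
        using q(4) ka[OF i q(1,3)] n h dN(1) dN(2-5)[OF i] sn by simp
      then show ?thesis
        using ext2[OF h(8), of "n \<cdot> p i"] ext2[OF h(8), of "inc' i \<cdot> q i"] n h(1-6) dN(1) dN(2-5)[OF i] sn q(1-3)
          coproductD(2-5)[OF c i]
        by simp
    qed
    then show "\<exists>N p q. is_coproduct C I N (src C n) p \<and>
        (\<forall>i\<in>I. q i \<in> hom C (N i) (D i) \<and> n \<cdot> p i = inc' i \<cdot> q i)"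
      using N sn by (intro exI[of _ N] exI[of _ p] exI[of _ q]) simp
  next
    fix i assume i: "i \<in> I"
    show "is_mono C (inc' i)"
      using is_monoI mono_cancel stable_coproductD(3) st i ka d by metis
  next
    fix i j a b assume ij: "i \<in> I" "j \<in> I" "i \<noteq> j" and ab: "a \<in> Arr C" "b \<in> Arr C" "src C a = src C b"
      "tgt C a = D i" "tgt C b = D j" "inc' i \<cdot> a = inc' j \<cdot> b"
    then have "inc i \<cdot> a = inc j \<cdot> b" using ka[of i a] ka[of j b] by simp
    then show "is_initial C (src C a)" using stable_coproductD(4)[OF st ij ab(1-5)] by blast
  qed
qed

lemma stable_coproduct_reindex:
  assumes st: "stable_coproduct C I D s inc" and h: "bij_betw h K I"
  shows "stable_coproduct C K (D \<circ> h) s (inc \<circ> h)"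
  unfolding stable_coproduct_def
proof (intro conjI ballI impI)
  have hK: "\<And>j. j \<in> K \<Longrightarrow> h j \<in> I" using h by (auto simp: bij_betw_def)
  show "is_coproduct C K (D \<circ> h) s (inc \<circ> h)" by (rule coproduct_reindex[OF stable_coproductD(1)[OF st] h])
  fix n assume n: "n \<in> Arr C" "tgt C n = s"
  obtain N p q where N: "is_coproduct C I N (src C n) p"
    "\<forall>i\<in>I. q i \<in> hom C (N i) (D i) \<and> n \<cdot> p i = inc i \<cdot> q i"
    using stable_coproductD(2)[OF st n] by blast
  show "\<exists>N p q. is_coproduct C K N (src C n) p \<and>
      (\<forall>i\<in>K. q i \<in> hom C (N i) ((D \<circ> h) i) \<and> n \<cdot> p i = (inc \<circ> h) i \<cdot> q i)"
    using coproduct_reindex[OF N(1) h] N(2) hK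
    by (intro exI[of _ "N \<circ> h"] exI[of _ "p \<circ> h"] exI[of _ "q \<circ> h"]) simp
next
  fix i assume "i \<in> K"
  then have "h i \<in> I" using h by (auto simp: bij_betw_def)
  then show "is_mono C ((inc \<circ> h) i)" using stable_coproductD(3)[OF st] by simp
next
  fix i j a b assume ij: "i \<in> K" "j \<in> K" "i \<noteq> j" and ab: "a \<in> Arr C" "b \<in> Arr C" "src C a = src C b"
    "tgt C a = (D \<circ> h) i" "tgt C b = (D \<circ> h) j" "(inc \<circ> h) i \<cdot> a = (inc \<circ> h) j \<cdot> b"
  have "h i \<in> I" "h j \<in> I" "h i \<noteq> h j" using ij h by (auto simp: bij_betw_def inj_on_def)
  from stable_coproductD(4)[OF st this ab(1-3)] ab(4-6) show "is_initial C (src C a)" by simp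
qed

end

text \<open>Index sets are taken in \<open>'u\<close> because a statement cannot quantify over
  types; \<open>stable_coproduct_exists\<close> extends it to small index sets of any type.\<close>

definition has_stable_coproducts :: "'u itself \<Rightarrow> ('o, 'a) cat \<Rightarrow> bool" where
  "has_stable_coproducts U E \<longleftrightarrow> (\<forall>(I :: 'u set) D. small U I \<longrightarrow> (\<forall>i\<in>I. D i \<in> Obj E) \<longrightarrow>
     (\<exists>s inc. stable_coproduct E I D s inc))"

lemma (in site) sheaf_stable_coproducts: "has_stable_coproducts U Sh"
  unfolding has_stable_coproducts_def
proof (intro allI impI)
  fix I :: "'u set" and D assume I: "small U I" and D: "\<forall>i\<in>I. D i \<in> Obj Sh"
  interpret site_family U J T I D by unfold_locales (use I D in auto)
  obtain Q m where fam: "covering_family I D Q m" using covering_family_ex by blast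
  have "stable_coproduct Sh I D Q m"
    unfolding stable_coproduct_def
  proof (intro conjI ballI impI)
    show "is_coproduct Sh I D Q m" by (rule covering_family_coproduct[OF fam])
    show "is_mono Sh (m i)" if "i \<in> I" for i by (rule covering_family_mono[OF fam that])
    show "\<exists>N p q. is_coproduct Sh I N (src Sh n) p \<and>
        (\<forall>i\<in>I. q i \<in> hom Sh (N i) (D i) \<and> n \<cdot>\<^bsub>Sh\<^esub> p i = m i \<cdot>\<^bsub>Sh\<^esub> q i)"
      if "n \<in> Arr Sh" "tgt Sh n = Q" for n
      using covering_family_pullback[OF fam that] covering_family_coproduct by metis
    fix i j a b assume *: "i \<in> I" "j \<in> I" "i \<noteq> j" "a \<in> Arr Sh" "b \<in> Arr Sh" "src Sh a = src Sh b"
      "tgt Sh a = D i" "tgt Sh b = D j" "m i \<cdot>\<^bsub>Sh\<^esub> a = m j \<cdot>\<^bsub>Sh\<^esub> b"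
    show "is_initial Sh (src Sh a)"
      by (rule empty_family_initial[OF Sh.src_Obj[OF *(4)]]) (rule covering_family_disjoint[OF fam *])
  qed
  then show "\<exists>s inc. stable_coproduct Sh I D s inc" by blast
qed

text \<open>Since \<open>F\<close> is full and faithful, both the arrow induced on the coproduct in
  \<open>S\<close> and its uniqueness lift to \<open>E\<close>.\<close>

lemma equivalence_reflects_coproduct:
  assumes e: "equivalence E S F G" and s: "s \<in> Obj E" and D: "\<And>i. i \<in> I \<Longrightarrow> D i \<in> Obj E"
    and inc: "\<And>i. i \<in> I \<Longrightarrow> inc i \<in> hom E (D i) s"
    and c: "is_coproduct S I (\<lambda>i. fobj F (D i)) (fobj F s) (\<lambda>i. fmap F (inc i))"
  shows "is_coproduct E I D s inc"
proof -
  have F: "is_functor E S F" using e unfolding equivalence_def by blast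
  note Fs = functorD[OF F]
  interpret E: cat E by standard (rule Fs)
  interpret S: cat S by standard (rule Fs)
  have inc': "i \<in> I \<Longrightarrow> inc i \<in> Arr E" "i \<in> I \<Longrightarrow> src E (inc i) = D i" "i \<in> I \<Longrightarrow> tgt E (inc i) = s" for i
    using inc by auto
  show ?thesis
  proof (rule E.coproductI[OF s D inc])
    fix z f assume z: "z \<in> Obj E" and f: "\<And>i. i \<in> I \<Longrightarrow> f i \<in> hom E (D i) z"
    have f': "i \<in> I \<Longrightarrow> f i \<in> Arr E" "i \<in> I \<Longrightarrow> src E (f i) = D i" "i \<in> I \<Longrightarrow> tgt E (f i) = z" for i
      using f by auto
    obtain H where H: "H \<in> Arr S" "src S H = fobj F s" "tgt S H = fobj F z"
      "\<And>i. i \<in> I \<Longrightarrow> H \<cdot>\<^bsub>S\<^esub> fmap F (inc i) = fmap F (f i)"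
      by (rule S.coproduct_ex[OF c Fs(3)[OF z], of "\<lambda>i. fmap F (f i)"]) (use f' Fs in auto)
    obtain h where h: "h \<in> Arr E" "src E h = s" "tgt E h = z" "fmap F h = H"
      by (rule equivalence_full[OF e s z, of H]) (use H in auto)
    have "h \<cdot>\<^bsub>E\<^esub> inc i = f i" if i: "i \<in> I" for i
      by (rule equivalence_faithful[OF e, of _ "D i" z]) (use h f' inc' i H Fs in auto)
    then show "\<exists>h\<in>hom E s z. \<forall>i\<in>I. h \<cdot>\<^bsub>E\<^esub> inc i = f i" using h by (intro bexI[of _ h]) auto
  next
    fix z h k assume h: "h \<in> hom E s z" and k: "k \<in> hom E s z"
      and hk: "\<And>i. i \<in> I \<Longrightarrow> h \<cdot>\<^bsub>E\<^esub> inc i = k \<cdot>\<^bsub>E\<^esub> inc i"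
    have "fmap F h = fmap F k"
    proof (rule S.coproduct_eq[OF c])
      fix i assume i: "i \<in> I"
      show "fmap F h \<cdot>\<^bsub>S\<^esub> fmap F (inc i) = fmap F k \<cdot>\<^bsub>S\<^esub> fmap F (inc i)"
        using hk[OF i] h k inc' i Fs(8)[of "inc i" h] Fs(8)[of "inc i" k] by simp
    qed (use h k Fs in auto)
    then show "h = k" by (rule equivalence_faithful[OF e h k])
  qed
qed

text \<open>A stable coproduct of the images is moved to an object in the image of \<open>F\<close>,
  and its coprojections are lifted by fullness. The parts of a decomposed domain are replaced by
  isomorphic objects from the image in the same way. Initiality is reflected as the case of an empty
  coproduct.\<close>

lemma equivalence_stable_coproducts:
  fixes U :: "'u itself"
  assumes e: "equivalence E S F G" and S: "has_stable_coproducts U S"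
  shows "has_stable_coproducts U E"
  unfolding has_stable_coproducts_def
proof (intro allI impI)
  fix I :: "'u set" and D assume I: "small U I" and D: "\<forall>i\<in>I. D i \<in> Obj E"
  have F: "is_functor E S F" using e unfolding equivalence_def by blast
  note Fs = functorD[OF F]
  interpret E: cat E by standard (rule Fs)
  interpret S: cat S by standard (rule Fs)
  have FD: "\<forall>i\<in>I. fobj F (D i) \<in> Obj S" using D Fs by blast
  obtain s' inc' where st: "stable_coproduct S I (\<lambda>i. fobj F (D i)) s' inc'"
    using S[unfolded has_stable_coproducts_def, rule_format, OF I, of "\<lambda>i. fobj F (D i)"] FD by blast
  note cs = stable_coproductD(1)[OF st]
  note d = S.coproductD[OF cs]
  obtain s k k' where k: "s \<in> Obj E" "k \<in> Arr S" "src S k = fobj F s" "tgt S k = s'"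
    "k' \<in> Arr S" "src S k' = s'" "tgt S k' = fobj F s"
    "k' \<cdot>\<^bsub>S\<^esub> k = ident S (fobj F s)" "k \<cdot>\<^bsub>S\<^esub> k' = ident S s'"
    by (rule equivalence_ess_surj[OF e d(1)])
  have "\<exists>f. f \<in> hom E (D i) s \<and> fmap F f = k' \<cdot>\<^bsub>S\<^esub> inc' i" if i: "i \<in> I" for i
  proof -
    obtain f where "f \<in> Arr E" "src E f = D i" "tgt E f = s" "fmap F f = k' \<cdot>\<^bsub>S\<^esub> inc' i"
      by (rule equivalence_full[OF e _ k(1), of "D i" "k' \<cdot>\<^bsub>S\<^esub> inc' i"]) (use d k i D in auto)
    then show ?thesis by auto
  qed
  then obtain inc where inc: "\<And>i. i \<in> I \<Longrightarrow> inc i \<in> hom E (D i) s" "\<And>i. i \<in> I \<Longrightarrow> fmap F (inc i) = k' \<cdot>\<^bsub>S\<^esub> inc' i"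
    by metis
  have inc': "i \<in> I \<Longrightarrow> inc i \<in> Arr E" "i \<in> I \<Longrightarrow> src E (inc i) = D i" "i \<in> I \<Longrightarrow> tgt E (inc i) = s" for i
    using inc(1) by auto
  have "is_coproduct S I (\<lambda>i. fobj F (D i)) (tgt S k') (\<lambda>i. k' \<cdot>\<^bsub>S\<^esub> (inc' i \<cdot>\<^bsub>S\<^esub> ident S (fobj F (D i))))"
    by (rule S.coproduct_iso[OF cs, of k' k "\<lambda>i. ident S (fobj F (D i))" _ "\<lambda>i. ident S (fobj F (D i))"])
      (use k FD in auto)
  then have c': "is_coproduct S I (\<lambda>i. fobj F (D i)) (fobj F s) (\<lambda>i. fmap F (inc i))"
    unfolding k(7) by (rule S.coproduct_cong) (use inc d in auto)
  have st': "stable_coproduct S I (\<lambda>i. fobj F (D i)) (fobj F s) (\<lambda>i. fmap F (inc i))"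
    by (rule S.stable_coproduct_iso[OF st c'])
  have "stable_coproduct E I D s inc"
    unfolding stable_coproduct_def
  proof (intro conjI ballI impI)
    show "is_coproduct E I D s inc"
      by (rule equivalence_reflects_coproduct[OF e k(1) _ _ c']) (use D inc in auto)
    fix n assume n: "n \<in> Arr E" "tgt E n = s"
    obtain N' p' q' where N': "is_coproduct S I N' (src S (fmap F n)) p'"
      "\<forall>i\<in>I. q' i \<in> hom S (N' i) (fobj F (D i)) \<and> fmap F n \<cdot>\<^bsub>S\<^esub> p' i = fmap F (inc i) \<cdot>\<^bsub>S\<^esub> q' i"
      using stable_coproductD(2)[OF st', of "fmap F n"] n Fs by auto
    note dN = S.coproductD[OF N'(1)]
    have "\<exists>a t t'. a \<in> Obj E \<and> t \<in> hom S (fobj F a) (N' i) \<and> t' \<in> hom S (N' i) (fobj F a) \<and>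
        t' \<cdot>\<^bsub>S\<^esub> t = ident S (fobj F a) \<and> t \<cdot>\<^bsub>S\<^esub> t' = ident S (N' i)" if i: "i \<in> I" for i
      using equivalence_ess_surj e dN(2) i by force
    then obtain N t t' where N: "\<And>i. i \<in> I \<Longrightarrow> N i \<in> Obj E" "\<And>i. i \<in> I \<Longrightarrow> t i \<in> hom S (fobj F (N i)) (N' i)"
      "\<And>i. i \<in> I \<Longrightarrow> t' i \<in> hom S (N' i) (fobj F (N i))"
      "\<And>i. i \<in> I \<Longrightarrow> t' i \<cdot>\<^bsub>S\<^esub> t i = ident S (fobj F (N i))" "\<And>i. i \<in> I \<Longrightarrow> t i \<cdot>\<^bsub>S\<^esub> t' i = ident S (N' i)"
      by metis
    have nn: "src S (fmap F n) = fobj F (src E n)" "fmap F n \<in> Arr S" "tgt S (fmap F n) = fobj F s"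
      using n Fs by auto
    have "\<exists>p q. p \<in> hom E (N i) (src E n) \<and> fmap F p = p' i \<cdot>\<^bsub>S\<^esub> t i \<and> q \<in> hom E (N i) (D i) \<and> n \<cdot>\<^bsub>E\<^esub> p = inc i \<cdot>\<^bsub>E\<^esub> q"
      if i: "i \<in> I" for i
    proof -
      have ti: "t i \<in> Arr S" "src S (t i) = fobj F (N i)" "tgt S (t i) = N' i" using N(2)[OF i] by auto
      have qi: "q' i \<in> Arr S" "src S (q' i) = N' i" "tgt S (q' i) = fobj F (D i)"
        "fmap F n \<cdot>\<^bsub>S\<^esub> p' i = fmap F (inc i) \<cdot>\<^bsub>S\<^esub> q' i" using N'(2) i by auto
      obtain p where p: "p \<in> Arr E" "src E p = N i" "tgt E p = src E n" "fmap F p = p' i \<cdot>\<^bsub>S\<^esub> t i"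
        by (rule equivalence_full[OF e N(1)[OF i], of "src E n" "p' i \<cdot>\<^bsub>S\<^esub> t i"]) (use dN i ti n nn in auto)
      obtain q where q: "q \<in> Arr E" "src E q = N i" "tgt E q = D i" "fmap F q = q' i \<cdot>\<^bsub>S\<^esub> t i"
        by (rule equivalence_full[OF e N(1)[OF i], of "D i" "q' i \<cdot>\<^bsub>S\<^esub> t i"]) (use qi i ti D in auto)
      have "fmap F (n \<cdot>\<^bsub>E\<^esub> p) = fmap F (inc i \<cdot>\<^bsub>E\<^esub> q)"
        using S.ext2 qi(4) dN i ti nn S.assoc qi inc' Fs Fs(8) p n q by metis
      then have "n \<cdot>\<^bsub>E\<^esub> p = inc i \<cdot>\<^bsub>E\<^esub> q"
        by (rule equivalence_faithful[OF e, of _ "N i" s, rotated 2]) (use p q inc' i n in auto)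
      then show ?thesis using p q by (intro exI[of _ p] exI[of _ q]) simp
    qed
    then obtain p q where pq: "\<And>i. i \<in> I \<Longrightarrow> p i \<in> hom E (N i) (src E n)"
      "\<And>i. i \<in> I \<Longrightarrow> fmap F (p i) = p' i \<cdot>\<^bsub>S\<^esub> t i" "\<And>i. i \<in> I \<Longrightarrow> q i \<in> hom E (N i) (D i)"
      "\<And>i. i \<in> I \<Longrightarrow> n \<cdot>\<^bsub>E\<^esub> p i = inc i \<cdot>\<^bsub>E\<^esub> q i" by metis
    have sn: "fobj F (src E n) \<in> Obj S" using nn by (metis S.src_Obj)
    have "is_coproduct S I (\<lambda>i. fobj F (N i)) (tgt S (ident S (fobj F (src E n))))
        (\<lambda>i. ident S (fobj F (src E n)) \<cdot>\<^bsub>S\<^esub> (p' i \<cdot>\<^bsub>S\<^esub> t i))"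
      by (rule S.coproduct_iso[OF N'(1)[unfolded nn(1)] _ _ _ _ _ _ _ N(2,3,4,5),
            of "ident S (fobj F (src E n))" "ident S (fobj F (src E n))"]) (use sn in auto)
    then have "is_coproduct S I (\<lambda>i. fobj F (N i)) (fobj F (src E n))
        (\<lambda>i. ident S (fobj F (src E n)) \<cdot>\<^bsub>S\<^esub> (p' i \<cdot>\<^bsub>S\<^esub> t i))" using sn by simp
    then have cp: "is_coproduct S I (\<lambda>i. fobj F (N i)) (fobj F (src E n)) (\<lambda>i. fmap F (p i))"
      using S.coproduct_cong N(2) pq(2) dN nn by force
    have "is_coproduct E I N (src E n) p"
      by (rule equivalence_reflects_coproduct[OF e E.src_Obj[OF n(1)] N(1) pq(1) cp])
    then show "\<exists>N p q. is_coproduct E I N (src E n) p \<and>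
        (\<forall>i\<in>I. q i \<in> hom E (N i) (D i) \<and> n \<cdot>\<^bsub>E\<^esub> p i = inc i \<cdot>\<^bsub>E\<^esub> q i)"
      using pq(3,4) by (intro exI[of _ N] exI[of _ p] exI[of _ q] conjI ballI)
  next
    fix i assume i: "i \<in> I"
    show "is_mono E (inc i)"
    proof (rule E.is_monoI)
      fix f g assume fg: "f \<in> Arr E" "g \<in> Arr E" "src E f = src E g" "tgt E f = src E (inc i)"
        "tgt E g = src E (inc i)" "inc i \<cdot>\<^bsub>E\<^esub> f = inc i \<cdot>\<^bsub>E\<^esub> g"
      have "fmap F (inc i) \<cdot>\<^bsub>S\<^esub> fmap F f = fmap F (inc i) \<cdot>\<^bsub>S\<^esub> fmap F g"
        using Fs(8)[of f "inc i"] Fs(8)[of g "inc i"] fg inc'[OF i] by simp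
      then have "fmap F f = fmap F g"
        by (intro S.mono_cancel[OF stable_coproductD(3)[OF st' i], of "fmap F f" "fmap F g"])
          (use fg inc' i Fs in simp_all)
      then show "f = g"
        by (intro equivalence_faithful[OF e, of f "src E f" "tgt E f" g]) (use fg in simp_all)
    qed (use inc' i in simp)
  next
    fix i j a b assume ij: "i \<in> I" "j \<in> I" "i \<noteq> j" and ab: "a \<in> Arr E" "b \<in> Arr E" "src E a = src E b"
      "tgt E a = D i" "tgt E b = D j" "inc i \<cdot>\<^bsub>E\<^esub> a = inc j \<cdot>\<^bsub>E\<^esub> b"
    have "fmap F (inc i) \<cdot>\<^bsub>S\<^esub> fmap F a = fmap F (inc j) \<cdot>\<^bsub>S\<^esub> fmap F b"
      using Fs(8)[of a "inc i"] Fs(8)[of b "inc j"] ab inc' ij by simp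
    then have "is_initial S (src S (fmap F a))"
      by (intro stable_coproductD(4)[OF st' ij, of "fmap F a" "fmap F b"]) (use ab Fs in simp_all)
    then have "is_coproduct S {} (\<lambda>i. fobj F (D i)) (fobj F (src E a)) (\<lambda>i. fmap F (inc i))"
      using ab Fs by (simp add: S.empty_coproduct)
    then have "is_coproduct E {} D (src E a) inc"
      by (rule equivalence_reflects_coproduct[OF e, rotated 3]) (use ab in auto)
    then show "is_initial E (src E a)" by (simp add: E.empty_coproduct)
  qed
  then show "\<exists>s inc. stable_coproduct E I D s inc" by blast
qed

lemma topos_stable_coproducts:
  assumes "universe U" "grothendieck_topos U E"
  shows "has_stable_coproducts U E"
proof -
  obtain J :: "('a, 'a) cat" and T F G where J: "category J" "small U (Obj J)" "small U (Arr J)"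
    "grothendieck_topology J T" "equivalence E (sheaf_cat U J T) F G"
    using assms(2) unfolding grothendieck_topos_def by blast
  interpret site U J T by unfold_locales (rule assms J)+
  show ?thesis by (rule equivalence_stable_coproducts[OF J(5) sheaf_stable_coproducts])
qed

lemma stable_coproduct_cong:
  assumes st: "stable_coproduct E I D s inc"
    and e: "\<And>i. i \<in> I \<Longrightarrow> D i = D' i" "\<And>i. i \<in> I \<Longrightarrow> inc i = inc' i"
  shows "stable_coproduct E I D' s inc'"
proof -
  have "is_coproduct E I D' s inc'"
    using stable_coproductD(1)[OF st] e unfolding is_coproduct_def by auto
  then show ?thesis using st e unfolding stable_coproduct_def by simp
qed

locale stable_cat = cat C for C :: "('o, 'a) cat" (structure) +
  fixes U :: "'u itself"
  assumes universe: "universe U" and has_stable: "has_stable_coproducts U C"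
begin

lemma stable_coproduct_exists:
  fixes I :: "'i set"
  assumes I: "small U I" and D: "\<And>i. i \<in> I \<Longrightarrow> D i \<in> Obj C"
  obtains s inc where "stable_coproduct C I D s inc"
proof -
  obtain g :: "'i \<Rightarrow> 'u" where g: "inj_on g I" "small U (g ` I)" using I by (rule small_inject)
  have "\<forall>k\<in>g ` I. (D \<circ> inv_into I g) k \<in> Obj C" using D g(1) by simp
  then obtain s inc where st: "stable_coproduct C (g ` I) (D \<circ> inv_into I g) s inc"
    using has_stable[unfolded has_stable_coproducts_def, rule_format, OF g(2)] by blast
  have "stable_coproduct C I (D \<circ> inv_into I g \<circ> g) s (inc \<circ> g)"
    by (rule stable_coproduct_reindex[OF st]) (use g(1) in \<open>simp add: bij_betw_def\<close>)
  then have "stable_coproduct C I D s (inc \<circ> g)"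
    by (rule stable_coproduct_cong) (use g(1) in simp_all)
  then show ?thesis using that by blast
qed

lemma coproduct_stable:
  assumes "is_coproduct C I D s inc" "small U I"
  shows "stable_coproduct C I D s inc"
proof -
  obtain s' inc' where "stable_coproduct C I D s' inc'"
    by (rule stable_coproduct_exists[OF assms(2), of D]) (use coproductD[OF assms(1)] in auto)
  then show ?thesis using stable_coproduct_iso assms(1) by blast
qed

lemma small_bool: "small U (UNIV :: bool set)"
  by (rule small_finite[OF universe]) simp

lemma binary_stable:
  assumes "is_binary_coproduct C x y s i j"
  shows "stable_coproduct C UNIV (\<lambda>b. if b then x else y) s (\<lambda>b. if b then i else j)"
  using coproduct_stable[OF assms[unfolded binary_coproduct_iff] small_bool] .

lemma binary_mono: "is_binary_coproduct C x y s i j \<Longrightarrow> is_mono C i"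
  using stable_coproductD(3)[OF binary_stable, of x y s i j True] by simp

lemma binary_disjoint:
  assumes c: "is_binary_coproduct C x y s i j"
    and ab: "a \<in> Arr C" "b \<in> Arr C" "src C a = src C b" "tgt C a = x" "tgt C b = y" "i \<cdot> a = j \<cdot> b"
  shows "is_initial C (src C a)"
  using stable_coproductD(4)[OF binary_stable[OF c], of True False a b] ab by simp

lemma binary_decompose:
  assumes c: "is_binary_coproduct C x y s i j" and n: "n \<in> Arr C" "tgt C n = s"
  obtains z1 z2 p p' q q' where "is_binary_coproduct C z1 z2 (src C n) p p'"
    "q \<in> hom C z1 x" "q' \<in> hom C z2 y" "n \<cdot> p = i \<cdot> q" "n \<cdot> p' = j \<cdot> q'"
proof -
  obtain N p q where N: "is_coproduct C UNIV N (src C n) p"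
    "\<forall>b\<in>UNIV. q b \<in> hom C (N b) (if b then x else y) \<and> n \<cdot> p b = (if b then i else j) \<cdot> q b"
    using stable_coproductD(2)[OF binary_stable[OF c] n] by blast
  have "is_coproduct C UNIV (\<lambda>b. if b then N True else N False) (src C n) (\<lambda>b. if b then p True else p False)"
    by (rule coproduct_cong[OF N(1)]) simp_all
  then have "is_binary_coproduct C (N True) (N False) (src C n) (p True) (p False)"
    unfolding binary_coproduct_iff .
  moreover have "q True \<in> hom C (N True) x" "n \<cdot> p True = i \<cdot> q True"
    "q False \<in> hom C (N False) y" "n \<cdot> p False = j \<cdot> q False"
    using N(2)[rule_format, of True] N(2)[rule_format, of False] by simp_all
  ultimately show ?thesis using that by blast
qed

text \<open>Stability splits the domain of \<open>n\<close> along all coprojections. The part over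
  an index other than \<open>k\<close> lies in both halves of a separating binary coproduct, so it
  is initial, and \<open>n\<close> is determined by the part over \<open>k\<close>.\<close>

lemma factors_through_coprojection:
  assumes c: "is_coproduct C I D s inc" and I: "small U I" and k: "k \<in> I"
    and n: "n \<in> Arr C" "tgt C n = s"
    and sep: "\<And>i. i \<in> I \<Longrightarrow> i \<noteq> k \<Longrightarrow> \<exists>x y m m'. is_binary_coproduct C x y s m m' \<and>
      factors_through C n m \<and> factors_through C (inc i) m'"
  shows "factors_through C n (inc k)"
proof -
  note d = coproductD[OF c]
  obtain N p q where N: "is_coproduct C I N (src C n) p"
    and pq: "\<And>i. i \<in> I \<Longrightarrow> q i \<in> hom C (N i) (D i)" "\<And>i. i \<in> I \<Longrightarrow> n \<cdot> p i = inc i \<cdot> q i"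
    using stable_coproductD(2)[OF coproduct_stable[OF c I] n] by blast
  note dN = coproductD[OF N]
  have q: "i \<in> I \<Longrightarrow> q i \<in> Arr C" "i \<in> I \<Longrightarrow> src C (q i) = N i" "i \<in> I \<Longrightarrow> tgt C (q i) = D i" for i
    using pq(1) by auto
  have initial: "is_initial C (N i)" if i: "i \<in> I" "i \<noteq> k" for i
  proof -
    obtain x y m m' where b: "is_binary_coproduct C x y s m m'" and nm: "factors_through C n m"
      and im: "factors_through C (inc i) m'" using sep[OF i] by blast
    note db = binary_coproductD[OF b]
    obtain u where u': "u \<in> hom C (src C n) (src C m)" "m \<cdot> u = n"
      using nm unfolding factors_through_def by blast
    then have u: "u \<in> Arr C" "src C u = src C n" "tgt C u = x" "m \<cdot> u = n" using db by simp_all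
    obtain v where v': "v \<in> hom C (src C (inc i)) (src C m')" "m' \<cdot> v = inc i"
      using im unfolding factors_through_def by blast
    then have v: "v \<in> Arr C" "src C v = D i" "tgt C v = y" "m' \<cdot> v = inc i" using db d(4) i by simp_all
    note dNi = dN(2-5)[OF i(1)] and qi = q[OF i(1)]
    have "m \<cdot> (u \<cdot> p i) = n \<cdot> p i" by (rule ext2[OF u(4)]) (use u db dNi in simp_all)
    also have "\<dots> = inc i \<cdot> q i" by (rule pq(2)[OF i(1)])
    also have "\<dots> = m' \<cdot> (v \<cdot> q i)" by (rule ext2[OF v(4), symmetric]) (use v db qi in simp_all)
    finally have eq: "m \<cdot> (u \<cdot> p i) = m' \<cdot> (v \<cdot> q i)" .
    have a: "u \<cdot> p i \<in> Arr C" "src C (u \<cdot> p i) = N i" "tgt C (u \<cdot> p i) = x"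
      using u(1-3) dNi by simp_all
    have "v \<cdot> q i \<in> Arr C" "src C (v \<cdot> q i) = N i" "tgt C (v \<cdot> q i) = y"
      using v(1-3) qi by simp_all
    with a have "is_initial C (src C (u \<cdot> p i))"
      using binary_disjoint[OF b, of "u \<cdot> p i" "v \<cdot> q i"] eq by simp
    then show ?thesis using u dNi by simp
  qed
  \<comment> \<open>For an index other than \<open>k\<close> the part is initial, so the description
    picks the only arrow into \<open>D k\<close>.\<close>
  define f where "f i = (if i = k then q k else (SOME f. f \<in> hom C (N i) (D k)))" for i
  have f: "f i \<in> hom C (N i) (D k)" if i: "i \<in> I" for i
  proof (cases "i = k")
    case False
    obtain g where "g \<in> Arr C" "src C g = N i" "tgt C g = D k" using initial_arr[OF initial[OF i False] d(2)[OF k]] .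
    then have "\<exists>g. g \<in> hom C (N i) (D k)" by auto
    then have "(SOME f. f \<in> hom C (N i) (D k)) \<in> hom C (N i) (D k)" by (rule someI_ex)
    then show ?thesis using False by (simp add: f_def)
  qed (use pq(1)[OF k] in \<open>simp add: f_def\<close>)
  have f': "i \<in> I \<Longrightarrow> f i \<in> Arr C" "i \<in> I \<Longrightarrow> src C (f i) = N i" "i \<in> I \<Longrightarrow> tgt C (f i) = D k" for i
    using f by auto
  obtain h where h: "h \<in> Arr C" "src C h = src C n" "tgt C h = D k" "\<And>i. i \<in> I \<Longrightarrow> h \<cdot> p i = f i"
    using coproduct_ex[OF N d(2)[OF k] f] by blast
  note dk = d(2-5)[OF k]
  have "inc k \<cdot> h = n"
  proof (rule coproduct_eq[OF N])
    fix i assume i: "i \<in> I"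
    note dNi = dN(2-5)[OF i]
    show "(inc k \<cdot> h) \<cdot> p i = n \<cdot> p i"
    proof (cases "i = k")
      case True
      then show ?thesis using pq(2)[OF k] h(1-3) h(4)[OF k] dk dNi by (simp add: f_def)
    next
      case False
      show ?thesis by (rule initial_eq) (use initial[OF i False] h dk dNi n in simp_all)
    qed
  qed (use h dk n in simp_all)
  then show ?thesis unfolding factors_through_def using h dk by (intro bexI[of _ h]) auto
qed

end

section \<open>Locally connected toposes\<close>

lemma set_cat_hom: "F \<in> hom (set_cat U) X Y \<longleftrightarrow> (\<exists>f. F = (X, f, Y) \<and> small U X \<and> small U Y \<and> f \<in> X \<rightarrow>\<^sub>E Y)"
  by (cases F) (auto simp: hom_def set_cat_def)

lemma set_cat_eq:
  assumes "F \<in> hom (set_cat U) X Y" "G \<in> hom (set_cat U) X Y" "\<And>x. x \<in> X \<Longrightarrow> app F x = app G x"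
  shows "F = G"
proof -
  obtain f g where "F = (X, f, Y)" "f \<in> X \<rightarrow>\<^sub>E Y" "G = (X, g, Y)" "g \<in> X \<rightarrow>\<^sub>E Y"
    using assms(1,2) unfolding set_cat_hom by blast
  then show ?thesis using assms(3) PiE_ext[of f X "\<lambda>_. Y" g] by (simp add: app_def)
qed

lemma app_comp: "F \<in> hom (set_cat U) X Y \<Longrightarrow> G \<in> hom (set_cat U) Y Z \<Longrightarrow> x \<in> X \<Longrightarrow>
    app (G \<cdot>\<^bsub>set_cat U\<^esub> F) x = app G (app F x)"
  unfolding set_cat_hom by (auto simp: set_cat_def app_def compose_def)

lemma app_in: "F \<in> hom (set_cat U) X Y \<Longrightarrow> x \<in> X \<Longrightarrow> app F x \<in> Y"
  unfolding set_cat_hom by (auto simp: app_def)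

context stable_cat
begin

interpretation set: cat "set_cat U" by standard (rule category_set_cat)

context
  fixes \<Gamma> :: "('o, 'a, 'u set, 'u set_arr) fctr" and \<Delta> \<pi> t e
  assumes G: "is_functor C (set_cat U) \<Gamma>" and t: "is_terminal C t"
    and e: "\<And>y. y \<in> Obj C \<Longrightarrow> bij_betw (e y) (fobj \<Gamma> y) (hom C t y)"
      "\<And>g s. g \<in> Arr C \<Longrightarrow> s \<in> fobj \<Gamma> (src C g) \<Longrightarrow> e (tgt C g) (app (fmap \<Gamma> g) s) = g \<cdot> e (src C g) s"
    and adj1: "adjunction (set_cat U) C \<Delta> \<Gamma>" and adj2: "adjunction C (set_cat U) \<pi> \<Delta>"
begin

text \<open>\<open>\<Delta> S\<close> is a coproduct of copies of the terminal object, so the unit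
  \<open>\<eta>\<close> of the adjunction between \<pi> and \<Delta> cuts \<open>Z\<close> into
  pieces indexed by \<open>fobj \<pi> Z\<close>. A splitting of \<open>Z\<close> into two summands
  is recorded by an arrow \<open>g\<close> to \<Delta> of a two-element set. By adjunction
  \<open>g\<close> is the image of a function \<gamma> after \<open>\<eta>\<close>, hence constant
  on each piece, so the piece misses one of the two summands.\<close>

lemma connected_decomposition':
  assumes Z: "Z \<in> Obj C"
  shows "\<exists>(S :: 'u set) N z. small U S \<and> is_coproduct C S N Z z \<and>
    (\<forall>x y i j. is_binary_coproduct C x y Z i j \<longrightarrow>
      (\<forall>s\<in>S. factors_through C (z s) i \<or> factors_through C (z s) j))"
proof -
  have D: "is_functor (set_cat U) C \<Delta>" and P: "is_functor C (set_cat U) \<pi>"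
    using adj1 adj2 unfolding adjunction_def by auto
  note Gs = functorD[OF G] and Ds = functorD[OF D] and Ps = functorD[OF P]
  obtain \<phi> where \<phi>: "\<And>a b. a \<in> Obj (set_cat U) \<Longrightarrow> b \<in> Obj C \<Longrightarrow>
      bij_betw (\<phi> a b) (hom C (fobj \<Delta> a) b) (hom (set_cat U) a (fobj \<Gamma> b))"
    and \<phi>n: "\<And>k h f. k \<in> Arr (set_cat U) \<Longrightarrow> h \<in> Arr C \<Longrightarrow> f \<in> hom C (fobj \<Delta> (tgt (set_cat U) k)) (src C h) \<Longrightarrow>
      \<phi> (src (set_cat U) k) (tgt C h) (h \<cdot> (f \<cdot> fmap \<Delta> k)) =
      fmap \<Gamma> h \<cdot>\<^bsub>set_cat U\<^esub> (\<phi> (tgt (set_cat U) k) (src C h) f \<cdot>\<^bsub>set_cat U\<^esub> k)"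
    using adj1 unfolding adjunction_def by blast
  obtain \<psi> where \<psi>: "\<And>a b. a \<in> Obj C \<Longrightarrow> b \<in> Obj (set_cat U) \<Longrightarrow>
      bij_betw (\<psi> a b) (hom (set_cat U) (fobj \<pi> a) b) (hom C a (fobj \<Delta> b))"
    and \<psi>n: "\<And>k h f. k \<in> Arr C \<Longrightarrow> h \<in> Arr (set_cat U) \<Longrightarrow> f \<in> hom (set_cat U) (fobj \<pi> (tgt C k)) (src (set_cat U) h) \<Longrightarrow>
      \<psi> (src C k) (tgt (set_cat U) h) (h \<cdot>\<^bsub>set_cat U\<^esub> (f \<cdot>\<^bsub>set_cat U\<^esub> fmap \<pi> k)) =
      fmap \<Delta> h \<cdot> (\<psi> (tgt C k) (src (set_cat U) h) f \<cdot> k)"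
    using adj2 unfolding adjunction_def by blast
  have SO: "S \<in> Obj (set_cat U) \<longleftrightarrow> small U S" for S by (simp add: set_cat_def)
  have tO: "t \<in> Obj C" using t by (simp add: is_terminal_def)
  \<comment> \<open>\<open>unit\<close> is the unit of the adjunction between \<Delta> and \<Gamma>;
    it names for every \<open>s\<close> a global element \<open>pt S s\<close>, which will be the
    coprojection at \<open>s\<close>.\<close>
  define unit where "unit S = \<phi> S (fobj \<Delta> S) (ident C (fobj \<Delta> S))" for S
  define pt where "pt S s = e (fobj \<Delta> S) (app (unit S) s)" for S s
  have unit: "unit S \<in> hom (set_cat U) S (fobj \<Gamma> (fobj \<Delta> S))" if S: "small U S" for S
    unfolding unit_def by (rule bij_betw_apply[OF \<phi>]) (use S SO Ds in auto)
  have pt: "pt S s \<in> hom C t (fobj \<Delta> S)" if S: "small U S" and s: "s \<in> S" for S s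
    unfolding pt_def by (rule bij_betw_apply[OF e(1)]) (use S SO Ds app_in[OF unit[OF S] s] in auto)
  have ptD: "pt S s \<in> Arr C" "src C (pt S s) = t" "tgt C (pt S s) = fobj \<Delta> S" if "small U S" "s \<in> S" for S s
    using pt[OF that] by auto
  \<comment> \<open>Naturality of \<phi>: evaluating \<open>h\<close> at the point of
    \<open>s\<close> is the same as evaluating the transpose of \<open>h\<close> at
    \<open>s\<close>.\<close>
  have comp_pt: "h \<cdot> pt S s = e (tgt C h) (app (\<phi> S (tgt C h) h) s)"
    if S: "small U S" and s: "s \<in> S" and h: "h \<in> Arr C" "src C h = fobj \<Delta> S" for S s h
  proof -
    have O: "S \<in> Obj (set_cat U)" using S SO by simp
    have "\<phi> S (tgt C h) (h \<cdot> (ident C (fobj \<Delta> S) \<cdot> fmap \<Delta> (ident (set_cat U) S))) =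
      fmap \<Gamma> h \<cdot>\<^bsub>set_cat U\<^esub> (unit S \<cdot>\<^bsub>set_cat U\<^esub> ident (set_cat U) S)"
      using \<phi>n[of "ident (set_cat U) S" h "ident C (fobj \<Delta> S)"] O h Ds unfolding unit_def by simp
    then have "\<phi> S (tgt C h) h = fmap \<Gamma> h \<cdot>\<^bsub>set_cat U\<^esub> unit S"
      using O h Ds unit[OF S] by simp
    moreover have "fmap \<Gamma> h \<in> hom (set_cat U) (fobj \<Gamma> (fobj \<Delta> S)) (fobj \<Gamma> (tgt C h))" using Gs h by simp
    ultimately have "app (\<phi> S (tgt C h) h) s = app (fmap \<Gamma> h) (app (unit S) s)"
      using app_comp[OF unit[OF S] _ s] by simp
    then show ?thesis unfolding pt_def using e(2)[OF h(1)] app_in[OF unit[OF S] s] h by simp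
  qed
  have cop: "is_coproduct C S (\<lambda>_. t) (fobj \<Delta> S) (pt S)" if S: "small U S" for S
  proof (rule coproductI)
    have O: "S \<in> Obj (set_cat U)" using S SO by simp
    show DS: "fobj \<Delta> S \<in> Obj C" using O Ds by simp
    show "\<And>s. s \<in> S \<Longrightarrow> t \<in> Obj C" by (rule tO)
    show "\<And>s. s \<in> S \<Longrightarrow> pt S s \<in> hom C t (fobj \<Delta> S)" by (rule pt[OF S])
    fix z f assume z: "z \<in> Obj C" and f: "\<And>s. s \<in> S \<Longrightarrow> f s \<in> hom C t z"
    \<comment> \<open>A family of arrows out of the terminal object is a function from
      \<open>S\<close> to \<open>fobj \<Gamma> z\<close>, up to the bijection \<open>e z\<close>;
      its transpose under \<phi> is the arrow wanted for the coproduct.\<close>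
    define g where "g = (S, restrict (\<lambda>s. inv_into (fobj \<Gamma> z) (e z) (f s)) S, fobj \<Gamma> z)"
    have inv: "inv_into (fobj \<Gamma> z) (e z) (f s) \<in> fobj \<Gamma> z" "e z (inv_into (fobj \<Gamma> z) (e z) (f s)) = f s"
      if "s \<in> S" for s
      using e(1)[OF z] f[OF that] by (auto simp: bij_betw_def inv_into_into f_inv_into_f simp del: in_hom)
    have gh: "g \<in> hom (set_cat U) S (fobj \<Gamma> z)"
      unfolding set_cat_hom g_def using S Gs(3)[OF z] SO inv by auto
    have "\<phi> S z ` hom C (fobj \<Delta> S) z = hom (set_cat U) S (fobj \<Gamma> z)"
      using \<phi>[OF O z] by (simp add: bij_betw_def)
    then obtain h where h: "h \<in> hom C (fobj \<Delta> S) z" "\<phi> S z h = g" using gh by (metis imageE)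
    have "h \<cdot> pt S s = f s" if s: "s \<in> S" for s
      using comp_pt[OF S s, of h] h inv[OF s] s by (simp add: g_def app_def)
    then show "\<exists>h\<in>hom C (fobj \<Delta> S) z. \<forall>s\<in>S. h \<cdot> pt S s = f s" using h by blast
  next
    have O: "S \<in> Obj (set_cat U)" using S SO by simp
    fix z h k assume h: "h \<in> hom C (fobj \<Delta> S) z" and k: "k \<in> hom C (fobj \<Delta> S) z"
      and hk: "\<And>s. s \<in> S \<Longrightarrow> h \<cdot> pt S s = k \<cdot> pt S s"
    have z: "z \<in> Obj C" using h by auto
    have \<phi>h: "\<phi> S z h \<in> hom (set_cat U) S (fobj \<Gamma> z)" "\<phi> S z k \<in> hom (set_cat U) S (fobj \<Gamma> z)"
      using bij_betw_apply[OF \<phi>[OF O z]] h k by blast+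
    have "\<phi> S z h = \<phi> S z k"
    proof (rule set_cat_eq[OF \<phi>h])
      fix s assume s: "s \<in> S"
      have "e z (app (\<phi> S z h) s) = e z (app (\<phi> S z k) s)"
        using comp_pt[OF S s, of h] comp_pt[OF S s, of k] hk[OF s] h k by simp
      then show "app (\<phi> S z h) s = app (\<phi> S z k) s"
        using e(1)[OF z] app_in[OF \<phi>h(1) s] app_in[OF \<phi>h(2) s] by (auto simp: bij_betw_def inj_on_def)
    qed
    moreover have "inj_on (\<phi> S z) (hom C (fobj \<Delta> S) z)" using \<phi>[OF O z] by (simp add: bij_betw_def)
    ultimately show "h = k" using h k by (meson inj_onD)
  qed
  have Dpt: "fmap \<Delta> \<gamma> \<cdot> pt S s = pt S' (app \<gamma> s)"
    if S: "small U S" "small U S'" and s: "s \<in> S" and \<gamma>: "\<gamma> \<in> hom (set_cat U) S S'" for S S' s \<gamma>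
  proof -
    have O: "S \<in> Obj (set_cat U)" "S' \<in> Obj (set_cat U)" using S SO by auto
    have g: "\<gamma> \<in> Arr (set_cat U)" "src (set_cat U) \<gamma> = S" "tgt (set_cat U) \<gamma> = S'" using \<gamma> by auto
    have id: "ident C (fobj \<Delta> S') \<in> Arr C" "src C (ident C (fobj \<Delta> S')) = fobj \<Delta> S'"
      "tgt C (ident C (fobj \<Delta> S')) = fobj \<Delta> S'" using O Ds by auto
    have Dg: "fmap \<Delta> \<gamma> \<in> Arr C" "src C (fmap \<Delta> \<gamma>) = fobj \<Delta> S" "tgt C (fmap \<Delta> \<gamma>) = fobj \<Delta> S'" using Ds g by auto
    have "\<phi> S (fobj \<Delta> S') (fmap \<Delta> \<gamma>) = fmap \<Gamma> (ident C (fobj \<Delta> S')) \<cdot>\<^bsub>set_cat U\<^esub> (unit S' \<cdot>\<^bsub>set_cat U\<^esub> \<gamma>)"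
      using \<phi>n[OF g(1) id(1), of "ident C (fobj \<Delta> S')"] id g Dg by (simp add: unit_def)
    also have "\<dots> = unit S' \<cdot>\<^bsub>set_cat U\<^esub> \<gamma>"
      using Gs(7)[of "fobj \<Delta> S'"] Ds(3)[OF O(2)] unit[OF S(2)] g by simp
    finally have "app (\<phi> S (fobj \<Delta> S') (fmap \<Delta> \<gamma>)) s = app (unit S') (app \<gamma> s)"
      using app_comp[OF \<gamma> unit[OF S(2)] s] by simp
    then show ?thesis using comp_pt[OF S(1) s Dg(1,2)] Dg(3) by (simp add: pt_def)
  qed
  define S where "S = fobj \<pi> Z"
  have SS: "small U S" using Ps(3)[OF Z] SO by (simp add: S_def)
  have idS: "ident (set_cat U) S \<in> hom (set_cat U) S S" using SS SO by simp
  define \<eta> where "\<eta> = \<psi> Z S (ident (set_cat U) S)"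
  have \<eta>: "\<eta> \<in> hom C Z (fobj \<Delta> S)"
    unfolding \<eta>_def by (rule bij_betw_apply[OF \<psi>]) (use Z SS SO idS in \<open>simp_all add: S_def\<close>)
  have \<eta>': "\<eta> \<in> Arr C" "src C \<eta> = Z" "tgt C \<eta> = fobj \<Delta> S" using \<eta> by auto
  obtain N z q where N: "is_coproduct C S N Z z" and q: "\<And>s. s \<in> S \<Longrightarrow> q s \<in> hom C (N s) t"
    "\<And>s. s \<in> S \<Longrightarrow> \<eta> \<cdot> z s = pt S s \<cdot> q s"
    using stable_coproductD(2)[OF coproduct_stable[OF cop[OF SS] SS] \<eta>'(1,3)] \<eta>'(2) by blast
  note dN = coproductD[OF N]
  have q': "s \<in> S \<Longrightarrow> q s \<in> Arr C" "s \<in> S \<Longrightarrow> src C (q s) = N s" "s \<in> S \<Longrightarrow> tgt C (q s) = t" for s using q(1) by auto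
  have "infinite (UNIV :: 'u set)" using universe unfolding universe_def by blast
  then obtain a b :: 'u where ab: "a \<noteq> b" by (metis UNIV_I finite.simps finite_insert infinite_imp_nonempty insertI1 singletonD subsetI subset_antisym)
  let ?two = "{a, b}"
  have two: "small U ?two" by (rule small_finite[OF universe]) simp
  have main: "factors_through C (z s) i \<or> factors_through C (z s) j"
    if c: "is_binary_coproduct C x y Z i j" and s: "s \<in> S" for x y i j s
  proof -
    note d = binary_coproductD[OF c]
    obtain wx where wx: "wx \<in> Arr C" "src C wx = x" "tgt C wx = t" using t d(1) unfolding is_terminal_def by auto
    obtain wy where wy: "wy \<in> Arr C" "src C wy = y" "tgt C wy = t" using t d(2) unfolding is_terminal_def by auto
    note pa = ptD[OF two, of a, simplified] and pb = ptD[OF two, of b, simplified]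
    \<comment> \<open>The characteristic arrow of the splitting, constant at \<open>a\<close> on
      \<open>x\<close> and at \<open>b\<close> on \<open>y\<close>.\<close>
    obtain g where g: "g \<in> Arr C" "src C g = Z" "tgt C g = fobj \<Delta> ?two" "g \<cdot> i = pt ?two a \<cdot> wx" "g \<cdot> j = pt ?two b \<cdot> wy"
      by (rule binary_coproduct_ex[OF c, of "pt ?two a \<cdot> wx" "fobj \<Delta> ?two" "pt ?two b \<cdot> wy"])
        (use pa pb wx wy in simp_all)
    have "\<psi> Z ?two ` hom (set_cat U) S ?two = hom C Z (fobj \<Delta> ?two)"
      using \<psi>[OF Z, of ?two] two SO by (simp add: bij_betw_def S_def)
    moreover have "g \<in> hom C Z (fobj \<Delta> ?two)" using g by simp
    ultimately obtain \<gamma> where \<gamma>: "\<gamma> \<in> hom (set_cat U) S ?two" "\<psi> Z ?two \<gamma> = g" by (metis imageE)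
    have \<gamma>': "\<gamma> \<in> Arr (set_cat U)" "src (set_cat U) \<gamma> = S" "tgt (set_cat U) \<gamma> = ?two" using \<gamma> by auto
    have "\<psi> Z ?two (\<gamma> \<cdot>\<^bsub>set_cat U\<^esub> (ident (set_cat U) S \<cdot>\<^bsub>set_cat U\<^esub> fmap \<pi> (ident C Z))) =
        fmap \<Delta> \<gamma> \<cdot> (\<eta> \<cdot> ident C Z)"
      using \<psi>n[of "ident C Z" \<gamma> "ident (set_cat U) S"] Z \<gamma>' idS by (simp add: S_def \<eta>_def)
    then have g\<eta>: "g = fmap \<Delta> \<gamma> \<cdot> \<eta>"
      using \<gamma> \<gamma>' \<eta>' Ps(7)[OF Z] idS by (simp add: S_def)
    note dNs = dN(2-5)[OF s] and qs = q'[OF s] and ps = ptD[OF SS s]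
    have Dg: "fmap \<Delta> \<gamma> \<in> Arr C" "src C (fmap \<Delta> \<gamma>) = fobj \<Delta> S" "tgt C (fmap \<Delta> \<gamma>) = fobj \<Delta> ?two" using Ds \<gamma>' by auto
    have \<gamma>s: "app \<gamma> s \<in> ?two" by (rule app_in[OF \<gamma>(1) s])
    note pg = ptD[OF two \<gamma>s]
    have gz: "g \<cdot> z s = pt ?two (app \<gamma> s) \<cdot> q s"
    proof -
      have "g \<cdot> z s = fmap \<Delta> \<gamma> \<cdot> (\<eta> \<cdot> z s)" unfolding g\<eta> using Dg \<eta>' dNs by simp
      also have "\<dots> = fmap \<Delta> \<gamma> \<cdot> (pt S s \<cdot> q s)" using q(2)[OF s] by simp
      also have "\<dots> = pt ?two (app \<gamma> s) \<cdot> q s"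
        by (rule ext2[OF Dpt[OF SS two s \<gamma>(1)]]) (use Dg ps qs in simp_all)
      finally show ?thesis .
    qed
    \<comment> \<open>On the piece, \<open>g\<close> is constant at \<open>app \<gamma> s\<close>.
      If \<open>g\<close> has another value \<open>d'\<close> on \<open>y'\<close>, the part of the
      piece over \<open>y'\<close> is initial by disjointness of the points, so the piece factors
      through \<open>i'\<close>. Stated once for both orders of the summands.\<close>
    have key: "factors_through C (z s) i'"
      if c': "is_binary_coproduct C x' y' Z i' j'" and w: "w \<in> Arr C" "src C w = y'" "tgt C w = t"
        "g \<cdot> j' = pt ?two d' \<cdot> w" and d': "d' \<in> ?two" "app \<gamma> s \<noteq> d'" for x' y' i' j' w d'
    proof -
      note dc = binary_coproductD[OF c'] and pd = ptD[OF two d'(1)]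
      obtain z1 z2 p p' r r' where zz: "is_binary_coproduct C z1 z2 (src C (z s)) p p'"
        "r \<in> hom C z1 x'" "r' \<in> hom C z2 y'" "z s \<cdot> p = i' \<cdot> r" "z s \<cdot> p' = j' \<cdot> r'"
        by (rule binary_decompose[OF c', of "z s"]) (use dNs in auto)
      note dz = binary_coproductD[OF zz(1)]
      have r: "r \<in> Arr C" "src C r = z1" "tgt C r = x'" "r' \<in> Arr C" "src C r' = z2" "tgt C r' = y'" using zz by auto
      have "pt ?two (app \<gamma> s) \<cdot> (q s \<cdot> p') = (g \<cdot> z s) \<cdot> p'"
        unfolding gz using pg qs dz dNs by simp
      also have "\<dots> = g \<cdot> (j' \<cdot> r')" using zz(5) g dNs dz by simp
      also have "\<dots> = pt ?two d' \<cdot> (w \<cdot> r')"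
        using ext2[OF w(4), of r'] g dc r w pd by simp
      finally have "is_initial C (src C (q s \<cdot> p'))"
        by (rule stable_coproductD(4)[OF coproduct_stable[OF cop[OF two] two] \<gamma>s d', rotated 5])
          (use qs dz dNs w r in simp_all)
      then have i2: "is_initial C z2" using qs dz dNs by simp
      obtain m where m: "m \<in> Arr C" "src C m = z2" "tgt C m = x'" using initial_arr[OF i2 dc(1)] .
      obtain h where h: "h \<in> Arr C" "src C h = src C (z s)" "tgt C h = x'" "h \<cdot> p = r" "h \<cdot> p' = m"
        by (rule binary_coproduct_ex[OF zz(1), of r x' m]) (use r m in simp_all)
      have "i' \<cdot> h = z s"
        using binary_coproduct_eq zz(1) initial_eq i2 h m dc dz dNs zz(4) by simp
      then show ?thesis unfolding factors_through_def using h dc by (intro bexI[of _ h]) auto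
    qed
    show ?thesis
    proof (cases "app \<gamma> s = b")
      case False
      then show ?thesis using key[OF c wy g(5)] by simp
    next
      case True
      then show ?thesis using key[OF binary_coproduct_sym[OF c] wx g(4)] ab by simp
    qed
  qed
  show ?thesis using SS N main by blast
qed

end

lemma connected_decomposition:
  assumes lc: "locally_connected U C" and Z: "Z \<in> Obj C"
  obtains S :: "'u set" and N z where "small U S" "is_coproduct C S N Z z"
    "\<And>x y i j s. is_binary_coproduct C x y Z i j \<Longrightarrow> s \<in> S \<Longrightarrow>
      factors_through C (z s) i \<or> factors_through C (z s) j"
proof -
  obtain \<Gamma> \<Delta> \<pi> where g: "is_global_sections U C \<Gamma>" and adj: "adjunction (set_cat U) C \<Delta> \<Gamma>"
    "adjunction C (set_cat U) \<pi> \<Delta>" using lc unfolding locally_connected_def by blast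
  obtain t e where G: "is_functor C (set_cat U) \<Gamma>" and t: "is_terminal C t"
    and e: "\<forall>y\<in>Obj C. bij_betw (e y) (fobj \<Gamma> y) (hom C t y)"
      "\<forall>g\<in>Arr C. \<forall>s\<in>fobj \<Gamma> (src C g). e (tgt C g) (app (fmap \<Gamma> g) s) = g \<cdot> e (src C g) s"
    using g unfolding is_global_sections_def by blast
  have "\<exists>(S :: 'u set) N z. small U S \<and> is_coproduct C S N Z z \<and>
    (\<forall>x y i j. is_binary_coproduct C x y Z i j \<longrightarrow>
      (\<forall>s\<in>S. factors_through C (z s) i \<or> factors_through C (z s) j))"
    by (rule connected_decomposition'[OF G t _ _ adj Z]) (use e in blast)+
  then show ?thesis using that by blast
qed

end

section \<open>From functors on the category to functors on ultrafilters\<close>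

context cat
begin

text \<open>An initial summand leaves no freedom to arrows out of the sum. This serves to discard
  the pieces that determine no ultrafilter.\<close>

lemma coproduct_drop_initial:
  assumes c: "is_coproduct C I D s inc" and K: "K \<subseteq> I" and i: "\<And>i. i \<in> I \<Longrightarrow> i \<notin> K \<Longrightarrow> is_initial C (D i)"
  shows "is_coproduct C K D s inc"
proof (rule coproductI)
  note d = coproductD[OF c]
  show "s \<in> Obj C" "\<And>i. i \<in> K \<Longrightarrow> D i \<in> Obj C" "\<And>i. i \<in> K \<Longrightarrow> inc i \<in> hom C (D i) s" using d K by auto
  fix z f assume z: "z \<in> Obj C" and f: "\<And>i. i \<in> K \<Longrightarrow> f i \<in> hom C (D i) z"
  define g where "g i = (if i \<in> K then f i else SOME f. f \<in> hom C (D i) z)" for i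
  have g: "g i \<in> hom C (D i) z" if "i \<in> I" for i
  proof (cases "i \<in> K")
    case False
    then have "\<exists>f. f \<in> hom C (D i) z" using i[OF that] z unfolding is_initial_def by blast
    then have "(SOME f. f \<in> hom C (D i) z) \<in> hom C (D i) z" by (rule someI_ex)
    then show ?thesis using False by (simp add: g_def)
  qed (use f in \<open>simp add: g_def\<close>)
  obtain h where h: "h \<in> Arr C" "src C h = s" "tgt C h = z" "\<And>i. i \<in> I \<Longrightarrow> h \<cdot> inc i = g i"
    using coproduct_ex[OF c z g] by blast
  have "h \<cdot> inc i = f i" if "i \<in> K" for i using h(4)[of i] that K by (auto simp: g_def)
  then show "\<exists>h\<in>hom C s z. \<forall>i\<in>K. h \<cdot> inc i = f i" using h(1-3) by (intro bexI[of _ h]) simp_all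
next
  note d = coproductD[OF c]
  fix z h k assume h: "h \<in> hom C s z" "k \<in> hom C s z" and e: "\<And>i. i \<in> K \<Longrightarrow> h \<cdot> inc i = k \<cdot> inc i"
  show "h = k"
  proof (rule coproduct_eq[OF c])
    fix j assume j: "j \<in> I"
    show "h \<cdot> inc j = k \<cdot> inc j"
    proof (cases "j \<in> K")
      case False
      show ?thesis by (rule initial_eq) (use i[OF j False] d(2-5)[OF j] h in simp_all)
    qed (simp add: e)
  qed (use h in simp_all)
qed

lemma binary_coproduct_initial:
  assumes c: "is_binary_coproduct C x y s i j" and x: "is_initial C x" and y: "is_initial C y"
  shows "is_initial C s"
  using coproduct_drop_initial c binary_coproduct_iff x y empty_coproduct by fastforce

end

text \<open>Associativity of coproducts: the summands are added up along the fibres of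
  \<open>v\<close>. The set \<open>B\<close> may contain values that \<open>v\<close> does not
  attain; their fibre sum is empty and hence initial, so ultrafilters without pieces are
  covered.\<close>

lemma (in stable_cat) coproduct_group:
  fixes S :: "'s set" and v :: "'s \<Rightarrow> 'v"
  assumes c: "is_coproduct C S N Z z" and S: "small U S" and v: "\<And>s. s \<in> S \<Longrightarrow> v s \<in> B"
  shows "\<exists>T t j. is_coproduct C B T Z t \<and> (\<forall>V\<in>B. is_coproduct C {s \<in> S. v s = V} N (T V) j) \<and>
    (\<forall>s\<in>S. t (v s) \<cdot> j s = z s)"
proof -
  note d = coproductD[OF c]
  define ok where "ok V T j t \<longleftrightarrow> is_coproduct C {s \<in> S. v s = V} N T j \<and> t \<in> hom C T Z \<and>
    (\<forall>s\<in>{s \<in> S. v s = V}. t \<cdot> j s = z s)" for V T j t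
  have "\<exists>T j t. ok V T j t" for V
  proof -
    have "small U {s \<in> S. v s = V}" by (rule small_subset[OF S]) blast
    then obtain T j where T: "stable_coproduct C {s \<in> S. v s = V} N T j"
      by (rule stable_coproduct_exists[of _ N]) (use d in auto)
    note T = stable_coproductD(1)[OF T]
    obtain t where "t \<in> Arr C" "src C t = T" "tgt C t = Z" "\<And>s. s \<in> {s \<in> S. v s = V} \<Longrightarrow> t \<cdot> j s = z s"
      by (rule coproduct_ex[OF T d(1), of z]) (use d in auto)
    then show ?thesis using T unfolding ok_def by (intro exI[of _ T] exI[of _ j] exI[of _ t]) simp
  qed
  then obtain T J t where "\<And>V. ok V (T V) (J V) (t V)" by metis
  then have T: "\<And>V. is_coproduct C {s \<in> S. v s = V} N (T V) (J V)" "\<And>V. t V \<in> hom C (T V) Z"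
    "\<And>V s. s \<in> S \<Longrightarrow> v s = V \<Longrightarrow> t V \<cdot> J V s = z s"
    unfolding ok_def by blast+
  have t: "t V \<in> Arr C" "src C (t V) = T V" "tgt C (t V) = Z" for V using T(2) by auto
  have dT: "J (v s) s \<in> Arr C" "src C (J (v s) s) = N s" "tgt C (J (v s) s) = T (v s)" if "s \<in> S" for s
    using coproductD(3-5)[OF T(1)[of "v s"], of s] that by auto
  have TO: "T V \<in> Obj C" for V using coproductD(1)[OF T(1)] .
  \<comment> \<open>The coprojections \<open>J V\<close> are chosen separately for each fibre;
    taking \<open>V\<close> to be \<open>v s\<close> merges them into one family.\<close>
  define j where "j s = J (v s) s" for s
  have Tj: "is_coproduct C {s \<in> S. v s = V} N (T V) j" for V
    by (rule coproduct_cong[OF T(1)]) (auto simp: j_def)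
  have "is_coproduct C B T Z t"
  proof (rule coproductI)
    show "Z \<in> Obj C" "\<And>i. i \<in> B \<Longrightarrow> T i \<in> Obj C" "\<And>i. i \<in> B \<Longrightarrow> t i \<in> hom C (T i) Z" using d TO t by auto
    fix w f assume w: "w \<in> Obj C" and f: "\<And>V. V \<in> B \<Longrightarrow> f V \<in> hom C (T V) w"
    have f': "V \<in> B \<Longrightarrow> f V \<in> Arr C" "V \<in> B \<Longrightarrow> src C (f V) = T V" "V \<in> B \<Longrightarrow> tgt C (f V) = w" for V
      using f by auto
    obtain h where h: "h \<in> Arr C" "src C h = Z" "tgt C h = w" "\<And>s. s \<in> S \<Longrightarrow> h \<cdot> z s = f (v s) \<cdot> J (v s) s"
      by (rule coproduct_ex[OF c w, of "\<lambda>s. f (v s) \<cdot> J (v s) s"]) (use f' v dT in auto)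
    have "h \<cdot> t V = f V" if V: "V \<in> B" for V
    proof (rule coproduct_eq[OF T(1)[of V]])
      fix s assume "s \<in> {s \<in> S. v s = V}"
      then have s: "s \<in> S" "v s = V" by auto
      show "(h \<cdot> t V) \<cdot> J V s = f V \<cdot> J V s"
        using h(4)[OF s(1)] T(3)[OF s] dT[OF s(1)] h(1-3) t s(2) by simp
    qed (use h f' V t in simp_all)
    then show "\<exists>h\<in>hom C Z w. \<forall>V\<in>B. h \<cdot> t V = f V" using h(1-3) by (intro bexI[of _ h]) simp_all
  next
    fix w h k assume h: "h \<in> hom C Z w" "k \<in> hom C Z w" and e: "\<And>V. V \<in> B \<Longrightarrow> h \<cdot> t V = k \<cdot> t V"
    show "h = k"
    proof (rule coproduct_eq[OF c])
      fix s assume s: "s \<in> S"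
      have "(h \<cdot> t (v s)) \<cdot> J (v s) s = (k \<cdot> t (v s)) \<cdot> J (v s) s" using e v s by simp
      then show "h \<cdot> z s = k \<cdot> z s" using h t dT[OF s] T(3)[OF s refl] by simp
    qed (use h in simp_all)
  qed
  then show ?thesis using Tj T(3) by (intro exI[of _ T] exI[of _ t] exI[of _ j]) (simp add: j_def)
qed

text \<open>Of a Grothendieck topos this keeps the stable disjoint small coproducts supplied by
  \<open>topos_stable_coproducts\<close>, next to local connectedness.\<close>

locale extensive_to_topos =
  C: extensive_cat C + E: stable_cat E U
  for C :: "('o, 'a) cat" and E :: "('p, 'b) cat" and U :: "'u itself" +
  assumes small_summands: "\<And>X. X \<in> Obj C \<Longrightarrow> small U (summands C X)"
    and connected: "locally_connected U E"
begin

sublocale UF: cat "UF C" by standard (rule C.category_UF)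

abbreviation comp_E :: "'b \<Rightarrow> 'b \<Rightarrow> 'b" (infixl "\<bullet>" 70) where
  "g \<bullet> f \<equiv> g \<cdot>\<^bsub>E\<^esub> f"

abbreviation UFE where
  "UFE \<equiv> functor_cat (UF C) E"

lemma small_beta: "X \<in> Obj C \<Longrightarrow> small U (beta C X)"
  by (rule small_subset[OF small_Pow[OF E.universe small_summands[of X]]])
    (auto simp: beta_def ultrafilter_on_def proper_filter_def)

definition fc :: "('o, 'a, 'p, 'b) fctr \<Rightarrow> bool" where
  "fc A \<longleftrightarrow> is_functor C E A \<and> preserves_finite_coproducts C E A"

lemma fc_binary: "fc A \<Longrightarrow> is_binary_coproduct C x y s i j \<Longrightarrow>
    is_binary_coproduct E (fobj A x) (fobj A y) (fobj A s) (fmap A i) (fmap A j)"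
  unfolding fc_def preserves_finite_coproducts_def by blast

lemma fcD:
  assumes "fc A"
  shows "x \<in> Obj C \<Longrightarrow> fobj A x \<in> Obj E"
    "f \<in> Arr C \<Longrightarrow> fmap A f \<in> Arr E"
    "f \<in> Arr C \<Longrightarrow> src E (fmap A f) = fobj A (src C f)"
    "f \<in> Arr C \<Longrightarrow> tgt E (fmap A f) = fobj A (tgt C f)"
    "x \<in> Obj C \<Longrightarrow> fmap A (ident C x) = ident E (fobj A x)"
    "f \<in> Arr C \<Longrightarrow> g \<in> Arr C \<Longrightarrow> tgt C f = src C g \<Longrightarrow>
      fmap A (g \<cdot>\<^bsub>C\<^esub> f) = fmap A g \<bullet> fmap A f"
  using functorD[of C E A] assms unfolding fc_def by auto

lemma fc_mono: "fc A \<Longrightarrow> coprojection C X u \<Longrightarrow> is_mono E (fmap A u)"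
  using E.binary_mono fc_binary C.coprojectionE by metis

text \<open>Together with \<open>i\<close> this says that \<open>i \<V>\<close> is the intersection of the \<open>A v\<close> for \<open>v\<close> in \<open>\<V>\<close>.\<close>

lemma factors_through_tilde:
  assumes A: "fc A" and X: "X \<in> Obj C" and c: "is_coproduct E (beta C X) T (fobj A X) i"
    and i: "\<And>\<U> u. \<U> \<in> beta C X \<Longrightarrow> memb C X \<U> u \<Longrightarrow> factors_through E (i \<U>) (fmap A u)"
    and V: "\<V> \<in> beta C X" and n: "n \<in> Arr E" "tgt E n = fobj A X"
    and nv: "\<And>v. memb C X \<V> v \<Longrightarrow> factors_through E n (fmap A v)"
  shows "factors_through E n (i \<V>)"
  using E.factors_through_coprojection c small_beta X V n C.beta_separate fc_binary A nv i by metis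

lemma fc_factors:
  assumes A: "fc A" and n: "factors_through E n (fmap A u)"
    and u: "factors_through C u v" "v \<in> Arr C"
  shows "factors_through E n (fmap A v)"
proof -
  obtain h where h: "h \<in> Arr C" "src C h = src C u" "tgt C h = src C v" "v \<cdot>\<^bsub>C\<^esub> h = u"
    using u(1) by (rule C.factors_throughE)
  have "factors_through E (fmap A u) (fmap A v)"
    by (rule E.factors_throughI[of "fmap A h"]) (use fcD[OF A] h u in auto)
  then show ?thesis using E.factors_through_trans[OF n] fcD(2)[OF A u(2)] by blast
qed

text \<open>No intersection is formed directly: \<open>T \<U>\<close> is the sum of the pieces that
  determine \<open>\<U>\<close>, an empty sum if there are none. Its inclusion factors through each
  \<open>A u\<close> because every piece does; that it is the largest such part is the content of
  \<open>factors_through_tilde\<close>.\<close>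

lemma tilde_decomposition:
  assumes A: "fc A" and X: "X \<in> Obj C"
  obtains T i where "is_coproduct E (beta C X) T (fobj A X) i"
    "\<And>\<U> u. \<U> \<in> beta C X \<Longrightarrow> memb C X \<U> u \<Longrightarrow> factors_through E (i \<U>) (fmap A u)"
proof -
  note As = fcD[OF A]
  obtain S' :: "'u set" and N z where S': "small U S'" "is_coproduct E S' N (fobj A X) z"
    "\<And>x y i j s. is_binary_coproduct E x y (fobj A X) i j \<Longrightarrow> s \<in> S' \<Longrightarrow>
      factors_through E (z s) i \<or> factors_through E (z s) j"
    using E.connected_decomposition[OF connected As(1)[OF X]] by metis
  \<comment> \<open>An initial piece factors through every summand, so it determines no proper
    filter.\<close>
  define S where "S = {s \<in> S'. \<not> is_initial E (N s)}"
  have S: "small U S" by (rule small_subset[OF S'(1)]) (auto simp: S_def)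
  have c: "is_coproduct E S N (fobj A X) z"
    by (rule E.coproduct_drop_initial[OF S'(2)]) (auto simp: S_def)
  note d = E.coproductD[OF c]
  have conn: "factors_through E (z s) i \<or> factors_through E (z s) j"
    if "is_binary_coproduct E x y (fobj A X) i j" "s \<in> S" for x y i j s
    using S'(3)[OF that(1)] that(2) unfolding S_def by blast
  have ni: "\<not> is_initial E (N s)" if "s \<in> S" for s using that by (simp add: S_def)
  define P where "P s u \<longleftrightarrow> coprojection C X u \<and> factors_through E (z s) (fmap A u)" for s u
  define v where "v s = {sum_class C X u | u. P s u}" for s
  have v: "v s \<in> beta C X \<and> (memb C X (v s) u \<longleftrightarrow> P s u)" if s: "s \<in> S" for s u
  proof -
    have zs: "z s \<in> Arr E" "src E (z s) = N s" "tgt E (z s) = fobj A X" using d s by auto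
    have not_both: "\<not> (factors_through E (z s) i \<and> factors_through E (z s) j)"
      if b: "is_binary_coproduct E x y (fobj A X) i j" for x y i j
    proof
      assume f: "factors_through E (z s) i \<and> factors_through E (z s) j"
      note db = E.binary_coproductD[OF b]
      obtain a where a: "a \<in> Arr E" "src E a = src E (z s)" "tgt E a = src E i" "i \<bullet> a = z s"
        using f by (blast elim: E.factors_throughE)
      obtain a' where a': "a' \<in> Arr E" "src E a' = src E (z s)" "tgt E a' = src E j" "j \<bullet> a' = z s"
        using f by (blast elim: E.factors_throughE)
      have "is_initial E (src E a)"
        using E.binary_disjoint[OF b, of a a'] a a' db by simp
      then show False using ni[OF s] a zs by simp
    qed
    have xor: "P s m \<longleftrightarrow> \<not> P s n" if b: "is_binary_coproduct C x y X m n" for x y m n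
    proof -
      have "coprojection C X m" "coprojection C X n"
        using C.coprojection_compl b C.binary_coproduct_sym by blast+
      then show ?thesis
        unfolding P_def using conn[OF fc_binary[OF A b] s] not_both[OF fc_binary[OF A b]] by blast
    qed
    \<comment> \<open>If the piece did not factor through the meet of \<open>m\<close> and
      \<open>n\<close>, it would factor through the complement \<open>c'\<close> of the meet.
      Regarded in \<open>m\<close> by means of \<open>k\<close>, it splits into a part over
      \<open>n\<close> and a part over the complement \<open>n'\<close>. The first lies both in the
      meet and in \<open>c'\<close>, the second both in \<open>n\<close> and in \<open>n'\<close>;
      so both are initial, and hence the piece is, a contradiction.\<close>
    have meet: "\<exists>w. P s w \<and> factors_through C w m \<and> factors_through C w n" if m: "P s m" and n: "P s n" for m n
    proof -
      have cm: "coprojection C X m" and cn: "coprojection C X n" using m n unfolding P_def by auto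
      note dm = C.coprojectionD[OF cm] and dn = C.coprojectionD[OF cn]
      obtain n' where n': "is_binary_coproduct C (src C n) (src C n') X n n'" using cn by (rule C.coprojectionE)
      obtain p q p' q' where p: "is_pullback C p q m n" "is_pullback C p' q' m n'"
        "is_binary_coproduct C (src C p) (src C p') (src C m) p p'"
        by (rule C.compl_pullback[OF n' dm(1,2)])
      note dp = C.pullbackD[OF p(1)] and dp' = C.pullbackD[OF p(2)]
      have cc: "coprojection C X (m \<cdot>\<^bsub>C\<^esub> p)"
        by (rule C.coprojection_comp[OF cm C.coprojection_compl[OF p(3)]])
      obtain c' where c': "is_binary_coproduct C (src C (m \<cdot>\<^bsub>C\<^esub> p)) (src C c') X (m \<cdot>\<^bsub>C\<^esub> p) c'"
        using cc by (rule C.coprojectionE)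
      have "\<not> P s c'"
      proof
        assume "P s c'"
        then have "factors_through E (z s) (fmap A c')" unfolding P_def by blast
        then obtain w where w: "w \<in> Arr E" "src E w = src E (z s)" "tgt E w = src E (fmap A c')"
          "fmap A c' \<bullet> w = z s" by (rule E.factors_throughE)
        obtain k where k: "k \<in> Arr E" "src E k = src E (z s)" "tgt E k = src E (fmap A m)" "fmap A m \<bullet> k = z s"
          using m unfolding P_def by (blast elim: E.factors_throughE)
        obtain l where l: "l \<in> Arr E" "src E l = src E (z s)" "tgt E l = src E (fmap A n)" "fmap A n \<bullet> l = z s"
          using n unfolding P_def by (blast elim: E.factors_throughE)
        have k': "tgt E k = fobj A (src C m)" using k As dm by simp
        obtain z1 z2 x x' y y' where zz: "is_binary_coproduct E z1 z2 (src E k) x x'"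
          "y \<in> hom E z1 (fobj A (src C p))" "y' \<in> hom E z2 (fobj A (src C p'))"
          "k \<bullet> x = fmap A p \<bullet> y" "k \<bullet> x' = fmap A p' \<bullet> y'"
          by (rule E.binary_decompose[OF fc_binary[OF A p(3)] k(1) k'])
        note dz = E.binary_coproductD[OF zz(1)]
        have y: "y \<in> Arr E" "src E y = z1" "tgt E y = fobj A (src C p)"
          "y' \<in> Arr E" "src E y' = z2" "tgt E y' = fobj A (src C p')" using zz by auto
        have c'A: "c' \<in> Arr C" "tgt C c' = X" using C.binary_coproductD[OF c'] by auto
        have e1: "fmap A (m \<cdot>\<^bsub>C\<^esub> p) \<bullet> y = fmap A c' \<bullet> (w \<bullet> x)"
        proof -
          have "fmap A (m \<cdot>\<^bsub>C\<^esub> p) \<bullet> y = fmap A m \<bullet> (fmap A p \<bullet> y)"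
            using As dp dm y by simp
          also have "\<dots> = z s \<bullet> x"
            unfolding zz(4)[symmetric] by (rule E.ext2[OF k(4)]) (use k As dm dz in simp_all)
          also have "\<dots> = fmap A c' \<bullet> (w \<bullet> x)"
            by (rule E.ext2[OF w(4), symmetric]) (use w(1-3) k As c'A dz in simp_all)
          finally show ?thesis .
        qed
        have i1: "is_initial E z1"
          using E.binary_disjoint[OF fc_binary[OF A c'], of y "w \<bullet> x"] e1 y w(1-3) dz k(2) As c'A dp dm
          by simp
        have e2: "fmap A n' \<bullet> (fmap A q' \<bullet> y') = fmap A n \<bullet> (l \<bullet> x')"
        proof -
          have "fmap A n' \<bullet> (fmap A q' \<bullet> y') = fmap A (n' \<cdot>\<^bsub>C\<^esub> q') \<bullet> y'"
            using As(6)[of q' n'] As dp' y by simp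
          also have "\<dots> = fmap A m \<bullet> (fmap A p' \<bullet> y')"
            unfolding dp'(9) using As(6)[of p' m] As dp' dm y by simp
          also have "\<dots> = z s \<bullet> x'"
            unfolding zz(5)[symmetric] by (rule E.ext2[OF k(4)]) (use k As dm dz in simp_all)
          also have "\<dots> = fmap A n \<bullet> (l \<bullet> x')"
            by (rule E.ext2[OF l(4), symmetric]) (use l(1-3) k As dn dz in simp_all)
          finally show ?thesis .
        qed
        have i2: "is_initial E z2"
          using E.binary_disjoint[OF fc_binary[OF A n'], of "l \<bullet> x'" "fmap A q' \<bullet> y'"]
            e2 y l(1-3) dz k(2) As dp' dn by simp
        have "is_initial E (src E k)" by (rule E.binary_coproduct_initial[OF zz(1) i1 i2])
        then show False using ni[OF s] k zs by simp
      qed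
      then have "P s (m \<cdot>\<^bsub>C\<^esub> p)" using xor[OF c'] by blast
      moreover have "factors_through C (m \<cdot>\<^bsub>C\<^esub> p) m" by (rule C.factors_throughI[of p]) (use dp in auto)
      moreover have "factors_through C (m \<cdot>\<^bsub>C\<^esub> p) n" by (rule C.factors_throughI[of q]) (use dp in auto)
      ultimately show ?thesis by blast
    qed
    have up: "P s n" if "P s m" "coprojection C X n" "factors_through C m n" for m n
      using that fc_factors[OF A _ that(3) C.coprojectionD(1)[OF that(2)]] unfolding P_def by blast
    have cop: "coprojection C X m" if "P s m" for m using that unfolding P_def by blast
    have "{sum_class C X u | u. P s u} \<in> beta C X" by (rule C.betaI(1)[OF X]; fact cop up meet xor)
    moreover have "memb C X {sum_class C X u | u. P s u} u \<longleftrightarrow> P s u"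
      by (rule C.betaI(2)[OF X]; fact cop up meet xor)
    ultimately show ?thesis unfolding v_def by blast
  qed
  obtain T t j where T: "is_coproduct E (beta C X) T (fobj A X) t"
    "\<And>V. V \<in> beta C X \<Longrightarrow> is_coproduct E {s \<in> S. v s = V} N (T V) j"
    "\<And>s. s \<in> S \<Longrightarrow> t (v s) \<bullet> j s = z s"
    using E.coproduct_group[OF c S, of v "beta C X"] v by blast
  note dT = E.coproductD[OF T(1)]
  have "factors_through E (t \<U>) (fmap A u)" if U: "\<U> \<in> beta C X" and u: "memb C X \<U> u" for \<U> u
  proof -
    note du = C.membD[OF u]
    note cT = T(2)[OF U]
    note dc = E.coproductD[OF cT]
    have "\<exists>g. g \<in> hom E (N s) (fobj A (src C u)) \<and> fmap A u \<bullet> g = z s" if s: "s \<in> S" "v s = \<U>" for s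
    proof -
      have "factors_through E (z s) (fmap A u)" using v[OF s(1), of u] s(2) u unfolding P_def by blast
      then obtain g where "g \<in> Arr E" "src E g = src E (z s)" "tgt E g = src E (fmap A u)" "fmap A u \<bullet> g = z s"
        by (rule E.factors_throughE)
      then show ?thesis using d(4)[OF s(1)] As(3)[OF du(1)] by (intro exI[of _ g]) simp
    qed
    then obtain g where g: "\<And>s. s \<in> S \<Longrightarrow> v s = \<U> \<Longrightarrow> g s \<in> hom E (N s) (fobj A (src C u))"
      "\<And>s. s \<in> S \<Longrightarrow> v s = \<U> \<Longrightarrow> fmap A u \<bullet> g s = z s" by metis
    obtain h where h: "h \<in> Arr E" "src E h = T \<U>" "tgt E h = fobj A (src C u)"
      "\<And>s. s \<in> {s \<in> S. v s = \<U>} \<Longrightarrow> h \<bullet> j s = g s"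
      by (rule E.coproduct_ex[OF cT, of "fobj A (src C u)" g]) (use g As du in auto)
    have "fmap A u \<bullet> h = t \<U>"
    proof (rule E.coproduct_eq[OF cT])
      fix s assume s: "s \<in> {s \<in> S. v s = \<U>}"
      show "(fmap A u \<bullet> h) \<bullet> j s = t \<U> \<bullet> j s"
        using h(1-3) h(4)[OF s] g(2)[of s] T(3)[of s] s dc(3-5)[OF s] As du by simp
    qed (use h(1-3) dT U As du in simp_all)
    then show ?thesis by (intro E.factors_throughI[of h]) (use h(1-3) As du in simp_all)
  qed
  then show ?thesis using that T(1) by blast
qed

text \<open>\<open>B\<close> is \<open>\<tilde>A\<close> with inclusions \<open>\<iota>\<close>, and equivalently \<open>A\<close> is \<open>\<integral>B\<close> with
  coprojections \<open>\<iota>\<close>.\<close>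

definition represents ::
  "('o, 'a, 'p, 'b) fctr \<Rightarrow> (('o, 'a) uf_obj, ('o, 'a) uf_arr, 'p, 'b) fctr \<Rightarrow>
    (('o, 'a) uf_obj \<Rightarrow> 'b) \<Rightarrow> bool" where
  "represents A B \<iota> \<longleftrightarrow> fc A \<and> is_functor (UF C) E B \<and>
    (\<forall>X\<in>Obj C. is_coproduct E (beta C X) (\<lambda>\<U>. fobj B (X, \<U>)) (fobj A X) (\<lambda>\<U>. \<iota> (X, \<U>))) \<and>
    (\<forall>X\<in>Obj C. \<forall>\<U>\<in>beta C X. \<forall>Y\<in>Obj C. \<forall>\<V>\<in>beta C Y. \<forall>u f.
      continuous_partial C (X, \<U>) (Y, \<V>) (u, f) \<longrightarrow>
      (\<exists>k\<in>hom E (fobj B (X, \<U>)) (fobj A (src C u)). fmap A u \<bullet> k = \<iota> (X, \<U>) \<and>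
        \<iota> (Y, \<V>) \<bullet> fmap B (uf_arr C (X, \<U>) (Y, \<V>) (u, f)) = fmap A f \<bullet> k))"

lemma uf_arr_eqD:
  assumes U: "\<U> \<in> beta C X" and V: "\<V> \<in> beta C Y" and c: "continuous_partial C (X, \<U>) (Y, \<V>) (u', f')"
    and e: "uf_arr C (X, \<U>) (Y, \<V>) (u, f) = uf_arr C (X, \<U>) (Y, \<V>) (u', f')"
  shows "uf_eq C (X, \<U>) (u, f) (u', f')"
proof -
  have "(u', f') \<in> uf_class C (X, \<U>) (Y, \<V>) (u', f')"
    unfolding uf_class_def using c C.uf_eq_refl[OF C.continuousD(1-3)[OF U V c]] by simp
  then have "(u', f') \<in> uf_class C (X, \<U>) (Y, \<V>) (u, f)" using e unfolding uf_arr_def by simp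
  then show ?thesis unfolding uf_class_def by simp
qed

section \<open>The functor on ultrafilters obtained from a functor on the category\<close>

context
  fixes A :: "('o, 'a, 'p, 'b) fctr" and T :: "'o \<Rightarrow> 'a set set \<Rightarrow> 'p" and i :: "'o \<Rightarrow> 'a set set \<Rightarrow> 'b"
  assumes A: "fc A" and c: "\<And>X. X \<in> Obj C \<Longrightarrow> is_coproduct E (beta C X) (T X) (fobj A X) (i X)"
    and i: "\<And>X \<U> u. X \<in> Obj C \<Longrightarrow> \<U> \<in> beta C X \<Longrightarrow> memb C X \<U> u \<Longrightarrow> factors_through E (i X \<U>) (fmap A u)"
begin

lemma tilde_incl:
  assumes "X \<in> Obj C" "\<U> \<in> beta C X"
  shows "T X \<U> \<in> Obj E" "i X \<U> \<in> Arr E" "src E (i X \<U>) = T X \<U>" "tgt E (i X \<U>) = fobj A X" "is_mono E (i X \<U>)"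
  using E.coproductD[OF c[OF assms(1)]] assms(2)
    stable_coproductD(3)[OF E.coproduct_stable[OF c[OF assms(1)] small_beta[OF assms(1)]]] by auto

lemma tilde_factor:
  assumes "X \<in> Obj C" "\<U> \<in> beta C X" "memb C X \<U> u"
  obtains k where "k \<in> Arr E" "src E k = T X \<U>" "tgt E k = fobj A (src C u)" "fmap A u \<bullet> k = i X \<U>"
  using i assms E.factors_throughE tilde_incl assms(1,2) fcD(3) A C.membD(1) assms(3) by metis

text \<open>\<open>b\<close> is the value of \<open>\<tilde>A\<close> at the arrow represented by \<open>(u, f)\<close>.\<close>

definition tilde_arr :: "'o \<Rightarrow> 'a set set \<Rightarrow> 'o \<Rightarrow> 'a set set \<Rightarrow> 'a \<Rightarrow> 'a \<Rightarrow> 'b \<Rightarrow> bool" where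
  "tilde_arr X \<U> Y \<V> u f b \<longleftrightarrow> b \<in> hom E (T X \<U>) (T Y \<V>) \<and>
    (\<exists>k\<in>hom E (T X \<U>) (fobj A (src C u)). fmap A u \<bullet> k = i X \<U> \<and>
      i Y \<V> \<bullet> b = fmap A f \<bullet> k)"

text \<open>For each \<open>v\<close> in \<open>\<V>\<close>, continuity yields a member
  \<open>u \<cdot> a\<close> of \<open>\<U>\<close> on which \<open>f\<close> lands in
  \<open>v\<close>. As the inclusion \<open>k\<close> factors through the domain of this member,
  \<open>fmap A f \<bullet> k\<close> factors through \<open>A v\<close>, and so through the
  intersection.\<close>

lemma tilde_arr_ex:
  assumes X: "X \<in> Obj C" and U: "\<U> \<in> beta C X" and Y: "Y \<in> Obj C" and V: "\<V> \<in> beta C Y"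
    and cont: "continuous_partial C (X, \<U>) (Y, \<V>) (u, f)"
  shows "\<exists>b. tilde_arr X \<U> Y \<V> u f b"
proof -
  note As = fcD[OF A]
  note f = C.continuousD(1-4)[OF U V cont]
  note m = C.membD[OF f(1)]
  obtain k where k: "k \<in> Arr E" "src E k = T X \<U>" "tgt E k = fobj A (src C u)" "fmap A u \<bullet> k = i X \<U>"
    by (rule tilde_factor[OF X U f(1)])
  have n: "fmap A f \<bullet> k \<in> Arr E" "tgt E (fmap A f \<bullet> k) = fobj A Y" "src E (fmap A f \<bullet> k) = T X \<U>"
    using As f k(1-3) by simp_all
  have "factors_through E (fmap A f \<bullet> k) (i Y \<V>)"
  proof (rule factors_through_tilde[OF A Y c[OF Y] i[OF Y] V n(1,2)])
    fix v assume v: "memb C Y \<V> v"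
    obtain a b where ab: "memb C X \<U> (u \<cdot>\<^bsub>C\<^esub> a)" "a \<in> Arr C" "b \<in> Arr C" "tgt C a = src C u" "src C b = src C a"
     "tgt C b = src C v" "f \<cdot>\<^bsub>C\<^esub> a = v \<cdot>\<^bsub>C\<^esub> b" "coprojection C (src C u) a"
      by (rule C.continuous_germ[OF U V cont v])
    note mv = C.membD[OF v]
    obtain l where l: "l \<in> Arr E" "src E l = T X \<U>" "tgt E l = fobj A (src C (u \<cdot>\<^bsub>C\<^esub> a))"
      "fmap A (u \<cdot>\<^bsub>C\<^esub> a) \<bullet> l = i X \<U>"
      by (rule tilde_factor[OF X U ab(1)])
    have l': "tgt E l = fobj A (src C a)" using l ab m by simp
    have "fmap A u \<bullet> k = fmap A u \<bullet> (fmap A a \<bullet> l)"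
      unfolding k(4) using l(4) As(6)[of a u] As l(1,2) l' ab(2-4) m by simp
    then have ka: "k = fmap A a \<bullet> l"
      by (intro E.mono_cancel[OF fc_mono[OF A C.memb_coprojection[OF f(1)]], of k "fmap A a \<bullet> l"])
        (use k(1-3) l(1,2) l' ab m As in simp_all)
    have "fmap A v \<bullet> (fmap A b \<bullet> l) = fmap A (v \<cdot>\<^bsub>C\<^esub> b) \<bullet> l"
      using As(6)[of b v] As l(1) l' ab(2-6) mv by simp
    also have "\<dots> = fmap A f \<bullet> k"
      unfolding ab(7)[symmetric] ka using As(6)[of a f] As l(1) l' ab(2-6) f by simp
    finally show "factors_through E (fmap A f \<bullet> k) (fmap A v)"
      by (intro E.factors_throughI[of "fmap A b \<bullet> l"]) (use As l(1) l' ab(2-6) mv in simp_all)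
  qed
  then obtain b where b: "b \<in> Arr E" "src E b = src E (fmap A f \<bullet> k)" "tgt E b = src E (i Y \<V>)"
    "i Y \<V> \<bullet> b = fmap A f \<bullet> k" by (rule E.factors_throughE)
  have "b \<in> hom E (T X \<U>) (T Y \<V>)" using b(1-3) n(3) tilde_incl(3)[OF Y V] by simp
  moreover have "k \<in> hom E (T X \<U>) (fobj A (src C u))" using k(1-3) by simp
  ultimately have "tilde_arr X \<U> Y \<V> u f b" unfolding tilde_arr_def using k(4) b(4) by blast
  then show ?thesis by blast
qed

text \<open>The two partial maps agree on a member \<open>u \<cdot> h\<close> of
  \<open>\<U>\<close>, and both \<open>k\<close> and \<open>k'\<close> factor through its value
  under \<open>A\<close>. So the arrows agree after \<open>i Y \<V>\<close>, which is monic.\<close>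

lemma tilde_arr_eq:
  assumes X: "X \<in> Obj C" and U: "\<U> \<in> beta C X" and Y: "Y \<in> Obj C" and V: "\<V> \<in> beta C Y"
    and cont: "continuous_partial C (X, \<U>) (Y, \<V>) (u, f)" "continuous_partial C (X, \<U>) (Y, \<V>) (u', f')"
    and e: "uf_eq C (X, \<U>) (u, f) (u', f')"
    and b: "tilde_arr X \<U> Y \<V> u f b" "tilde_arr X \<U> Y \<V> u' f' b'"
  shows "b = b'"
proof -
  note As = fcD[OF A]
  note f = C.continuousD(1-4)[OF U V cont(1)] and f' = C.continuousD(1-4)[OF U V cont(2)]
  note m = C.membD[OF f(1)] and m' = C.membD[OF f'(1)]
  obtain k where bk: "b \<in> Arr E" "src E b = T X \<U>" "tgt E b = T Y \<V>"
    "k \<in> Arr E" "src E k = T X \<U>" "tgt E k = fobj A (src C u)" "fmap A u \<bullet> k = i X \<U>"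
    "i Y \<V> \<bullet> b = fmap A f \<bullet> k" using b(1) unfolding tilde_arr_def by auto
  obtain k' where bk': "b' \<in> Arr E" "src E b' = T X \<U>" "tgt E b' = T Y \<V>"
    "k' \<in> Arr E" "src E k' = T X \<U>" "tgt E k' = fobj A (src C u')" "fmap A u' \<bullet> k' = i X \<U>"
    "i Y \<V> \<bullet> b' = fmap A f' \<bullet> k'" using b(2) unfolding tilde_arr_def by auto
  obtain h h' where h: "memb C X \<U> (u \<cdot>\<^bsub>C\<^esub> h)" "h \<in> Arr C" "h' \<in> Arr C" "tgt C h = src C u"
    "tgt C h' = src C u'" "src C h' = src C h" "u \<cdot>\<^bsub>C\<^esub> h = u' \<cdot>\<^bsub>C\<^esub> h'" "f \<cdot>\<^bsub>C\<^esub> h = f' \<cdot>\<^bsub>C\<^esub> h'"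
    using e m(1) by (rule C.uf_eqE)
  obtain l where l0: "l \<in> Arr E" "src E l = T X \<U>" "tgt E l = fobj A (src C (u \<cdot>\<^bsub>C\<^esub> h))"
      "fmap A (u \<cdot>\<^bsub>C\<^esub> h) \<bullet> l = i X \<U>"
    by (rule tilde_factor[OF X U h(1)])
  have l: "l \<in> Arr E" "src E l = T X \<U>" "tgt E l = fobj A (src C h)" using l0(1-3) h(2,4) m by simp_all
  have "fmap A u \<bullet> k = fmap A u \<bullet> (fmap A h \<bullet> l)"
    unfolding bk(7) using l0(4) As(6)[of h u] As l h(2,4) m by simp
  then have k: "k = fmap A h \<bullet> l"
    by (intro E.mono_cancel[OF fc_mono[OF A C.memb_coprojection[OF f(1)]], of k "fmap A h \<bullet> l"])
      (use bk(4-6) l h m As in simp_all)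
  have "fmap A u' \<bullet> k' = fmap A u' \<bullet> (fmap A h' \<bullet> l)"
    unfolding bk'(7) using l0(4)[unfolded h(7)] As(6)[of h' u'] As l h(3,5,6) m' by simp
  then have k': "k' = fmap A h' \<bullet> l"
    by (intro E.mono_cancel[OF fc_mono[OF A C.memb_coprojection[OF f'(1)]], of k' "fmap A h' \<bullet> l"])
      (use bk'(4-6) l h m' As in simp_all)
  have "i Y \<V> \<bullet> b = fmap A (f \<cdot>\<^bsub>C\<^esub> h) \<bullet> l"
    unfolding bk(8) k using As(6)[of h f] As l h(2,4) f by simp
  also have "\<dots> = i Y \<V> \<bullet> b'"
    unfolding bk'(8) k' h(8) using As(6)[of h' f'] As l h(3,5,6) f' by simp
  finally show ?thesis
    by (intro E.mono_cancel[OF tilde_incl(5)[OF Y V], of b b']) (use bk(1-3) bk'(1-3) tilde_incl[OF Y V] in simp_all)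
qed

text \<open>The inclusion \<open>l\<close> into the value of \<open>A\<close> at the domain of the
  composite refines \<open>k\<close>. Since \<open>fmap A v\<close> is monic,
  \<open>k' \<bullet> b\<close> equals \<open>fmap A q \<bullet> l\<close>, which is the middle step
  of the composite.\<close>

lemma tilde_arr_comp:
  assumes X: "X \<in> Obj C" and U: "\<U> \<in> beta C X" and Y: "Y \<in> Obj C" and V: "\<V> \<in> beta C Y"
    and Z: "Z \<in> Obj C" and W: "\<W> \<in> beta C Z"
    and cont: "continuous_partial C (X, \<U>) (Y, \<V>) (u, f)" "continuous_partial C (Y, \<V>) (Z, \<W>) (v, g)"
    and pb: "is_pullback C p q f v"
    and b: "tilde_arr X \<U> Y \<V> u f b" "tilde_arr Y \<V> Z \<W> v g b'"
  shows "tilde_arr X \<U> Z \<W> (u \<cdot>\<^bsub>C\<^esub> p) (g \<cdot>\<^bsub>C\<^esub> q) (b' \<bullet> b)"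
proof -
  note As = fcD[OF A]
  note f = C.continuousD(1-4)[OF U V cont(1)] and g = C.continuousD(1-4)[OF V W cont(2)]
  note m = C.membD[OF f(1)] and m' = C.membD[OF g(1)]
  note d = C.pullbackD[OF pb]
  have up: "memb C X \<U> (u \<cdot>\<^bsub>C\<^esub> p)" by (rule C.continuousD(5)[OF U V cont(1) g(1) pb])
  obtain k where bk: "b \<in> Arr E" "src E b = T X \<U>" "tgt E b = T Y \<V>"
    "k \<in> Arr E" "src E k = T X \<U>" "tgt E k = fobj A (src C u)" "fmap A u \<bullet> k = i X \<U>"
    "i Y \<V> \<bullet> b = fmap A f \<bullet> k" using b(1) unfolding tilde_arr_def by auto
  obtain k' where bk': "b' \<in> Arr E" "src E b' = T Y \<V>" "tgt E b' = T Z \<W>"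
    "k' \<in> Arr E" "src E k' = T Y \<V>" "tgt E k' = fobj A (src C v)" "fmap A v \<bullet> k' = i Y \<V>"
    "i Z \<W> \<bullet> b' = fmap A g \<bullet> k'" using b(2) unfolding tilde_arr_def by auto
  obtain l where l0: "l \<in> Arr E" "src E l = T X \<U>" "tgt E l = fobj A (src C (u \<cdot>\<^bsub>C\<^esub> p))"
      "fmap A (u \<cdot>\<^bsub>C\<^esub> p) \<bullet> l = i X \<U>"
    by (rule tilde_factor[OF X U up])
  have l: "l \<in> Arr E" "src E l = T X \<U>" "tgt E l = fobj A (src C p)" using l0(1-3) d f m by simp_all
  have "fmap A u \<bullet> k = fmap A u \<bullet> (fmap A p \<bullet> l)"
    unfolding bk(7) using l0(4) As(6)[of p u] As l d f m by simp
  then have k: "k = fmap A p \<bullet> l"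
    by (intro E.mono_cancel[OF fc_mono[OF A C.memb_coprojection[OF f(1)]], of k "fmap A p \<bullet> l"])
      (use bk(4-6) l d f m As in simp_all)
  have "fmap A v \<bullet> (k' \<bullet> b) = i Y \<V> \<bullet> b"
    by (rule E.ext2[OF bk'(7)]) (use bk(1-3) bk'(4-6) As m' in simp_all)
  also have "\<dots> = fmap A (f \<cdot>\<^bsub>C\<^esub> p) \<bullet> l" unfolding bk(8) k using As(6)[of p f] As l d f by simp
  also have "\<dots> = fmap A v \<bullet> (fmap A q \<bullet> l)"
    unfolding d(9)[symmetric] using As(6)[of q v] As l d m' by simp
  finally have k'b: "k' \<bullet> b = fmap A q \<bullet> l"
    by (intro E.mono_cancel[OF fc_mono[OF A C.memb_coprojection[OF g(1)]], of "k' \<bullet> b" "fmap A q \<bullet> l"])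
      (use bk(1-3) bk'(4-6) l d f m' As in simp_all)
  have "i Z \<W> \<bullet> (b' \<bullet> b) = (fmap A g \<bullet> k') \<bullet> b"
    by (rule E.ext2[OF bk'(8)]) (use bk(1-3) bk'(1-3) tilde_incl[OF Z W] in simp_all)
  also have "\<dots> = fmap A g \<bullet> (k' \<bullet> b)" using bk(1-3) bk'(4-6) As g by simp
  also have "\<dots> = fmap A (g \<cdot>\<^bsub>C\<^esub> q) \<bullet> l" unfolding k'b using As(6)[of q g] As l d g by simp
  finally have eq: "i Z \<W> \<bullet> (b' \<bullet> b) = fmap A (g \<cdot>\<^bsub>C\<^esub> q) \<bullet> l" .
  have "b' \<bullet> b \<in> hom E (T X \<U>) (T Z \<W>)" using bk(1-3) bk'(1-3) by simp
  moreover have "l \<in> hom E (T X \<U>) (fobj A (src C (u \<cdot>\<^bsub>C\<^esub> p)))" using l0(1-3) by simp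
  ultimately show ?thesis unfolding tilde_arr_def using eq l0(4) by blast
qed

lemma tilde_represents: "\<exists>B. represents A B (\<lambda>(X, \<U>). i X \<U>)"
proof -
  note As = fcD[OF A]
  define ok where "ok a b \<longleftrightarrow> (\<exists>X \<U> Y \<V> u f. X \<in> Obj C \<and> \<U> \<in> beta C X \<and> Y \<in> Obj C \<and> \<V> \<in> beta C Y \<and>
    continuous_partial C (X, \<U>) (Y, \<V>) (u, f) \<and> a = uf_arr C (X, \<U>) (Y, \<V>) (u, f) \<and> tilde_arr X \<U> Y \<V> u f b)" for a b
  \<comment> \<open>An arrow of \<open>UF C\<close> is only a class of partial maps, so a value is
    chosen for some representative; by \<open>tilde_arr_eq\<close> it does not depend on which
    one.\<close>
  define Fa where "Fa a = (SOME b. ok a b)" for a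
  have Fa: "ok a (Fa a)" if arr: "a \<in> Arr (UF C)" for a
  proof -
    obtain X \<U> Y \<V> u f where *: "X \<in> Obj C" "\<U> \<in> beta C X" "Y \<in> Obj C" "\<V> \<in> beta C Y"
      "continuous_partial C (X, \<U>) (Y, \<V>) (u, f)" and a: "a = uf_arr C (X, \<U>) (Y, \<V>) (u, f)"
      using arr by (rule C.UF_ArrE)
    obtain b where "tilde_arr X \<U> Y \<V> u f b" using tilde_arr_ex[OF *] by blast
    then have "ok a b" unfolding ok_def using * a by blast
    then have "\<exists>b. ok a b" by blast
    then show ?thesis unfolding Fa_def by (rule someI_ex)
  qed
  have Fa_eq: "Fa (uf_arr C (X, \<U>) (Y, \<V>) (u, f)) = b"
    if X: "X \<in> Obj C" and U: "\<U> \<in> beta C X" and Y: "Y \<in> Obj C" and V: "\<V> \<in> beta C Y"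
      and cont: "continuous_partial C (X, \<U>) (Y, \<V>) (u, f)" and b: "tilde_arr X \<U> Y \<V> u f b" for X \<U> Y \<V> u f b
  proof -
    obtain X' \<U>' Y' \<V>' u' f' where a: "continuous_partial C (X', \<U>') (Y', \<V>') (u', f')"
      "uf_arr C (X, \<U>) (Y, \<V>) (u, f) = uf_arr C (X', \<U>') (Y', \<V>') (u', f')"
      "tilde_arr X' \<U>' Y' \<V>' u' f' (Fa (uf_arr C (X, \<U>) (Y, \<V>) (u, f)))"
      using Fa[OF C.uf_arr_Arr[OF X U Y V cont]] unfolding ok_def by blast
    have e: "X' = X" "\<U>' = \<U>" "Y' = Y" "\<V>' = \<V>" using a(2) unfolding uf_arr_def by auto
    note a = a[unfolded e]
    have "uf_eq C (X, \<U>) (u, f) (u', f')" by (rule uf_arr_eqD[OF U V a(1,2)])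
    from tilde_arr_eq[OF X U Y V cont a(1) this b a(3)] show ?thesis by simp
  qed
  have Fa_ok: "tilde_arr X \<U> Y \<V> u f (Fa (uf_arr C (X, \<U>) (Y, \<V>) (u, f)))"
    if "X \<in> Obj C" "\<U> \<in> beta C X" "Y \<in> Obj C" "\<V> \<in> beta C Y"
      and "continuous_partial C (X, \<U>) (Y, \<V>) (u, f)" for X \<U> Y \<V> u f
    using tilde_arr_ex[OF that] Fa_eq[OF that] by blast
  define B where "B = \<lparr>fobj = restrict (\<lambda>(X, \<U>). T X \<U>) (Obj (UF C)), fmap = restrict Fa (Arr (UF C))\<rparr>"
  have F: "is_functor (UF C) E B"
    unfolding B_def
  proof (rule functorI[OF UF.category E.category])
    show "(case x of (X, \<U>) \<Rightarrow> T X \<U>) \<in> Obj E" if "x \<in> Obj (UF C)" for x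
      using that tilde_incl by (cases x) simp
    show "Fa a \<in> hom E (case src (UF C) a of (X, \<U>) \<Rightarrow> T X \<U>) (case tgt (UF C) a of (X, \<U>) \<Rightarrow> T X \<U>)"
      if "a \<in> Arr (UF C)" for a
      using that
    proof (rule C.UF_ArrE)
      fix X \<U> Y \<V> u f assume *: "X \<in> Obj C" "\<U> \<in> beta C X" "Y \<in> Obj C" "\<V> \<in> beta C Y"
        "continuous_partial C (X, \<U>) (Y, \<V>) (u, f)" and a: "a = uf_arr C (X, \<U>) (Y, \<V>) (u, f)"
      show ?thesis using Fa_ok[OF *] unfolding a tilde_arr_def by simp
    qed
    show "Fa (ident (UF C) x) = ident E (case x of (X, \<U>) \<Rightarrow> T X \<U>)" if x: "x \<in> Obj (UF C)" for x
    proof -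
      obtain X \<U> where xe: "x = (X, \<U>)" by (cases x)
      have X: "X \<in> Obj C" and U: "\<U> \<in> beta C X" using x xe by auto
      note ti = tilde_incl[OF X U]
      have "tilde_arr X \<U> X \<U> (ident C X) (ident C X) (ident E (T X \<U>))"
        unfolding tilde_arr_def using ti X As by (auto intro!: bexI[of _ "i X \<U>"])
      from Fa_eq[OF X U X U C.continuous_ident[OF X U] this] show ?thesis by (simp add: xe)
    qed
    show "Fa (b \<cdot>\<^bsub>UF C\<^esub> a) = Fa b \<bullet> Fa a"
      if a: "a \<in> Arr (UF C)" and b: "b \<in> Arr (UF C)" and ab: "tgt (UF C) a = src (UF C) b" for a b
    proof -
      obtain X \<U> Y \<V> u f where X: "X \<in> Obj C" and U: "\<U> \<in> beta C X" and Y: "Y \<in> Obj C" and V: "\<V> \<in> beta C Y"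
        and c1: "continuous_partial C (X, \<U>) (Y, \<V>) (u, f)" and ae: "a = uf_arr C (X, \<U>) (Y, \<V>) (u, f)"
        using a by (rule C.UF_ArrE)
      obtain Y' \<V>' Z \<W> v g where Z: "Z \<in> Obj C" and W: "\<W> \<in> beta C Z"
        and c2: "continuous_partial C (Y', \<V>') (Z, \<W>) (v, g)" and be: "b = uf_arr C (Y', \<V>') (Z, \<W>) (v, g)"
        using b by (rule C.UF_ArrE)
      have e: "Y' = Y" "\<V>' = \<V>" using ab unfolding ae be by auto
      note c2 = c2[unfolded e]
      obtain p q where pb: "is_pullback C p q f v"
        by (rule C.coprojection_pullback_ex[of f v])
          (use C.memb_coprojection[OF C.continuousD(1)[OF V W c2]] C.continuousD(2,4)[OF U V c1] in auto)
      show ?thesis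
        unfolding ae be e C.UF_comp[OF U V W c1 c2 pb]
        by (rule Fa_eq[OF X U Z W C.continuous_comp[OF U V W c1 c2 pb]
              tilde_arr_comp[OF X U Y V Z W c1 c2 pb Fa_ok[OF X U Y V c1] Fa_ok[OF Y V Z W c2]]])
    qed
  qed
  have Bo: "fobj B (X, \<U>) = T X \<U>" if "X \<in> Obj C" "\<U> \<in> beta C X" for X \<U> using that by (simp add: B_def)
  have "represents A B (\<lambda>(X, \<U>). i X \<U>)"
    unfolding represents_def prod.case
  proof (intro conjI ballI allI impI)
    show "fc A" "is_functor (UF C) E B" by (rule A, rule F)
    show "is_coproduct E (beta C X) (\<lambda>\<U>. fobj B (X, \<U>)) (fobj A X) (i X)" if "X \<in> Obj C" for X
      by (rule E.coproduct_cong[OF c[OF that]]) (use Bo that in auto)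
    fix X \<U> Y \<V> u f assume *: "X \<in> Obj C" "\<U> \<in> beta C X" "Y \<in> Obj C" "\<V> \<in> beta C Y"
      "continuous_partial C (X, \<U>) (Y, \<V>) (u, f)"
    have "fmap B (uf_arr C (X, \<U>) (Y, \<V>) (u, f)) = Fa (uf_arr C (X, \<U>) (Y, \<V>) (u, f))"
      using C.uf_arr_Arr[OF *] by (simp add: B_def)
    then show "\<exists>k\<in>hom E (fobj B (X, \<U>)) (fobj A (src C u)). fmap A u \<bullet> k = i X \<U> \<and>
        i Y \<V> \<bullet> fmap B (uf_arr C (X, \<U>) (Y, \<V>) (u, f)) = fmap A f \<bullet> k"
      using Fa_ok[OF *] Bo[OF *(1,2)] unfolding tilde_arr_def by simp
  qed
  then show ?thesis by blast
qed

end

lemma tilde_exists: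
  assumes A: "fc A"
  shows "\<exists>B \<iota>. represents A B \<iota>"
proof -
  have "\<exists>T i. is_coproduct E (beta C X) T (fobj A X) i \<and>
    (\<forall>\<U> u. \<U> \<in> beta C X \<longrightarrow> memb C X \<U> u \<longrightarrow> factors_through E (i \<U>) (fmap A u))" if "X \<in> Obj C" for X
    using tilde_decomposition[OF A that] by metis
  then obtain T i where "\<And>X. X \<in> Obj C \<Longrightarrow> is_coproduct E (beta C X) (T X) (fobj A X) (i X)"
    "\<And>X \<U> u. X \<in> Obj C \<Longrightarrow> \<U> \<in> beta C X \<Longrightarrow> memb C X \<U> u \<Longrightarrow> factors_through E (i X \<U>) (fmap A u)"
    by metis
  from tilde_represents[OF A this] show ?thesis by blast
qed

end

section \<open>From functors on ultrafilters to functors on the category\<close>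

lemma (in extensive_cat) UF_comp_total:
  assumes f: "f \<in> Arr C" and g: "g \<in> Arr C" "src C g = tgt C f" and U: "\<U> \<in> beta C (src C f)"
  shows "uf_arr C (src C g, pushforward C f \<U>) (tgt C g, pushforward C g (pushforward C f \<U>)) (ident C (src C g), g)
      \<cdot>\<^bsub>UF C\<^esub> uf_arr C (src C f, \<U>) (tgt C f, pushforward C f \<U>) (ident C (src C f), f) =
    uf_arr C (src C f, \<U>) (tgt C g, pushforward C (g \<cdot> f) \<U>) (ident C (src C f), g \<cdot> f)"
proof -
  have V: "pushforward C f \<U> \<in> beta C (tgt C f)" by (rule pushforward_beta[OF f U])
  then have V': "pushforward C f \<U> \<in> beta C (src C g)" using g by simp
  have W: "pushforward C g (pushforward C f \<U>) \<in> beta C (tgt C g)" by (rule pushforward_beta[OF g(1) V'])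
  have pb: "is_pullback C (ident C (src C f)) f f (ident C (src C g))"
    by (rule pullback_ident) (use f g in simp_all)
  have sf: "src C f \<in> Obj C" using f by simp
  from UF_comp[OF U V W continuous_total[OF f U] continuous_total[OF g(1) V', unfolded g(2)] pb[unfolded g(2)]]
  show ?thesis unfolding pushforward_comp[OF f g U] g(2) using sf f g by simp
qed

context extensive_to_topos
begin

context
  fixes B :: "(('o, 'a) uf_obj, ('o, 'a) uf_arr, 'p, 'b) fctr"
    and Ao :: "'o \<Rightarrow> 'p" and \<kappa> :: "'o \<Rightarrow> 'a set set \<Rightarrow> 'b"
  assumes B: "is_functor (UF C) E B"
    and c: "\<And>X. X \<in> Obj C \<Longrightarrow> is_coproduct E (beta C X) (\<lambda>\<U>. fobj B (X, \<U>)) (Ao X) (\<kappa> X)"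
begin

lemma UF_functorD:
  assumes "X \<in> Obj C" "\<U> \<in> beta C X" "Y \<in> Obj C" "\<V> \<in> beta C Y"
    "continuous_partial C (X, \<U>) (Y, \<V>) g"
  shows "fmap B (uf_arr C (X, \<U>) (Y, \<V>) g) \<in> Arr E"
    "src E (fmap B (uf_arr C (X, \<U>) (Y, \<V>) g)) = fobj B (X, \<U>)"
    "tgt E (fmap B (uf_arr C (X, \<U>) (Y, \<V>) g)) = fobj B (Y, \<V>)"
  using functorD(4-6)[OF B C.uf_arr_Arr[OF assms]] by simp_all

lemma integral_incl:
  assumes "X \<in> Obj C" "\<U> \<in> beta C X"
  shows "fobj B (X, \<U>) \<in> Obj E" "\<kappa> X \<U> \<in> Arr E" "src E (\<kappa> X \<U>) = fobj B (X, \<U>)" "tgt E (\<kappa> X \<U>) = Ao X"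
  using E.coproductD[OF c[OF assms(1)]] assms(2) by auto

abbreviation (input) "total_arr f \<U> \<equiv>
  uf_arr C (src C f, \<U>) (tgt C f, pushforward C f \<U>) (ident C (src C f), f)"

lemma total:
  assumes f: "f \<in> Arr C" and U: "\<U> \<in> beta C (src C f)"
  shows "fmap B (total_arr f \<U>) \<in> Arr E" "src E (fmap B (total_arr f \<U>)) = fobj B (src C f, \<U>)"
    "tgt E (fmap B (total_arr f \<U>)) = fobj B (tgt C f, pushforward C f \<U>)" "total_arr f \<U> \<in> Arr (UF C)"
  using UF_functorD[OF _ U _ C.pushforward_beta[OF f U] C.continuous_total[OF f U]]
    C.uf_arr_Arr[OF _ U _ C.pushforward_beta[OF f U] C.continuous_total[OF f U]] f by simp_all

lemma integral_arr:
  assumes f: "f \<in> Arr C"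
  shows "\<exists>h. h \<in> hom E (Ao (src C f)) (Ao (tgt C f)) \<and>
    (\<forall>\<U>\<in>beta C (src C f). h \<bullet> \<kappa> (src C f) \<U> =
      \<kappa> (tgt C f) (pushforward C f \<U>) \<bullet> fmap B (total_arr f \<U>))"
proof -
  have O: "src C f \<in> Obj C" "tgt C f \<in> Obj C" using f by auto
  obtain h where "h \<in> Arr E" "src E h = Ao (src C f)" "tgt E h = Ao (tgt C f)"
    "\<And>\<U>. \<U> \<in> beta C (src C f) \<Longrightarrow> h \<bullet> \<kappa> (src C f) \<U> =
      \<kappa> (tgt C f) (pushforward C f \<U>) \<bullet> fmap B (total_arr f \<U>)"
    by (rule E.coproduct_ex[OF c[OF O(1)] E.coproductD(1)[OF c[OF O(2)]],
          of "\<lambda>\<U>. \<kappa> (tgt C f) (pushforward C f \<U>) \<bullet> fmap B (total_arr f \<U>)"])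
      (use total[OF f] integral_incl[OF O(2) C.pushforward_beta[OF f]] in auto)
  then show ?thesis by (intro exI[of _ h]) simp
qed

text \<open>For a coproduct in \<open>C\<close> with coprojections \<open>i\<close> and
  \<open>j\<close>, each ultrafilter on it contains exactly one of the two, and those containing
  \<open>i\<close> are the direct images of the ultrafilters on the domain of \<open>i\<close>. So
  the sum over all of them splits into the two smaller sums, which is why binary coproducts are
  preserved.\<close>

lemma integral_represents: "\<exists>A. represents A B (\<lambda>(X, \<U>). \<kappa> X \<U>)"
proof -
  note Bs = functorD[OF B]
  obtain Aa where Aa: "\<And>f. f \<in> Arr C \<Longrightarrow> Aa f \<in> hom E (Ao (src C f)) (Ao (tgt C f))"
    "\<And>f \<U>. f \<in> Arr C \<Longrightarrow> \<U> \<in> beta C (src C f) \<Longrightarrow> Aa f \<bullet> \<kappa> (src C f) \<U> =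
      \<kappa> (tgt C f) (pushforward C f \<U>) \<bullet> fmap B (total_arr f \<U>)"
    using integral_arr by metis
  have Aa': "f \<in> Arr C \<Longrightarrow> Aa f \<in> Arr E" "f \<in> Arr C \<Longrightarrow> src E (Aa f) = Ao (src C f)"
    "f \<in> Arr C \<Longrightarrow> tgt E (Aa f) = Ao (tgt C f)" for f using Aa(1) by auto
  have AoO: "Ao X \<in> Obj E" if "X \<in> Obj C" for X by (rule E.coproductD(1)[OF c[OF that]])
  define A where "A = \<lparr>fobj = restrict Ao (Obj C), fmap = restrict Aa (Arr C)\<rparr>"
  have F: "is_functor C E A"
    unfolding A_def
  proof (rule functorI[OF C.category E.category])
    show "Ao X \<in> Obj E" if "X \<in> Obj C" for X by (rule AoO[OF that])
    show "Aa f \<in> hom E (Ao (src C f)) (Ao (tgt C f))" if "f \<in> Arr C" for f by (rule Aa(1)[OF that])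
    show "Aa (ident C X) = ident E (Ao X)" if X: "X \<in> Obj C" for X
    proof (rule E.coproduct_eq[OF c[OF X]])
      fix \<U> assume U: "\<U> \<in> beta C X"
      have "fmap B (uf_arr C (X, \<U>) (X, \<U>) (ident C X, ident C X)) = ident E (fobj B (X, \<U>))"
        using Bs(7)[of "(X, \<U>)"] X U by simp
      then show "Aa (ident C X) \<bullet> \<kappa> X \<U> = ident E (Ao X) \<bullet> \<kappa> X \<U>"
        using Aa(2)[of "ident C X" \<U>] X U C.pushforward_ident[OF X U] integral_incl[OF X U] by simp
    qed (use Aa'[of "ident C X"] X AoO in simp_all)
    show "Aa (g \<cdot>\<^bsub>C\<^esub> f) = Aa g \<bullet> Aa f" if f: "f \<in> Arr C" and g: "g \<in> Arr C" and fg: "tgt C f = src C g" for f g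
    proof (rule E.coproduct_eq[OF c[of "src C f"]])
      note ff = Aa'[OF f] and gg = Aa'[OF g]
      fix \<U> assume U: "\<U> \<in> beta C (src C f)"
      have O: "src C f \<in> Obj C" "src C g \<in> Obj C" "tgt C g \<in> Obj C" using f g by auto
      have V: "pushforward C f \<U> \<in> beta C (src C g)" using C.pushforward_beta[OF f U] fg by simp
      have W: "pushforward C g (pushforward C f \<U>) \<in> beta C (tgt C g)" by (rule C.pushforward_beta[OF g V])
      note tf = total[OF f U] and tg = total[OF g V]
      note k1 = integral_incl[OF O(1) U] and k2 = integral_incl[OF O(2) V] and k3 = integral_incl[OF O(3) W]
      have "Aa (g \<cdot>\<^bsub>C\<^esub> f) \<bullet> \<kappa> (src C f) \<U> = \<kappa> (tgt C g) (pushforward C (g \<cdot>\<^bsub>C\<^esub> f) \<U>) \<bullet>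
          fmap B (uf_arr C (src C f, \<U>) (tgt C g, pushforward C (g \<cdot>\<^bsub>C\<^esub> f) \<U>) (ident C (src C f), g \<cdot>\<^bsub>C\<^esub> f))"
        using Aa(2)[of "g \<cdot>\<^bsub>C\<^esub> f" \<U>] f g fg U by simp
      also have "uf_arr C (src C f, \<U>) (tgt C g, pushforward C (g \<cdot>\<^bsub>C\<^esub> f) \<U>) (ident C (src C f), g \<cdot>\<^bsub>C\<^esub> f) =
          total_arr g (pushforward C f \<U>) \<cdot>\<^bsub>UF C\<^esub> total_arr f \<U>"
        using C.UF_comp_total[OF f g fg[symmetric] U] by simp
      also have "fmap B (total_arr g (pushforward C f \<U>) \<cdot>\<^bsub>UF C\<^esub> total_arr f \<U>) =
          fmap B (total_arr g (pushforward C f \<U>)) \<bullet> fmap B (total_arr f \<U>)"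
        by (rule Bs(8)[OF tf(4) tg(4)]) (simp add: fg)
      also have "\<kappa> (tgt C g) (pushforward C (g \<cdot>\<^bsub>C\<^esub> f) \<U>) = \<kappa> (tgt C g) (pushforward C g (pushforward C f \<U>))"
        using C.pushforward_comp[OF f g fg[symmetric] U] by simp
      also have "\<dots> \<bullet> (fmap B (total_arr g (pushforward C f \<U>)) \<bullet> fmap B (total_arr f \<U>)) =
          (Aa g \<bullet> \<kappa> (src C g) (pushforward C f \<U>)) \<bullet> fmap B (total_arr f \<U>)"
        unfolding Aa(2)[OF g V] using tf(1-3) tg(1-3) k3 fg by simp
      also have "\<dots> = Aa g \<bullet> (Aa f \<bullet> \<kappa> (src C f) \<U>)"
        unfolding Aa(2)[OF f U] using gg tf(1-3) k2 fg by simp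
      also have "\<dots> = (Aa g \<bullet> Aa f) \<bullet> \<kappa> (src C f) \<U>" using ff gg k1 fg by simp
      finally show "Aa (g \<cdot>\<^bsub>C\<^esub> f) \<bullet> \<kappa> (src C f) \<U> = (Aa g \<bullet> Aa f) \<bullet> \<kappa> (src C f) \<U>" .
    qed (use f g fg Aa'[OF f] Aa'[OF g] Aa'[of "g \<cdot>\<^bsub>C\<^esub> f"] in simp_all)
  qed
  have Ax: "fobj A X = Ao X" if "X \<in> Obj C" for X using that by (simp add: A_def)
  have Af: "fmap A f = Aa f" if "f \<in> Arr C" for f using that by (simp add: A_def)
  \<comment> \<open>The inclusion of \<open>B (X, \<U>)\<close> into the value at the domain of
    \<open>u\<close>: the isomorphism of \<open>(X, \<U>)\<close> with its restriction to
    \<open>u\<close>, followed by a coprojection.\<close>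
  define kk where "kk X \<U> u = \<kappa> (src C u) (restr_uf C u \<U>) \<bullet>
    fmap B (uf_arr C (X, \<U>) (src C u, restr_uf C u \<U>) (u, ident C (src C u)))" for X \<U> u
  have kk: "kk X \<U> u \<in> Arr E" "src E (kk X \<U> u) = fobj B (X, \<U>)" "tgt E (kk X \<U> u) = Ao (src C u)"
    "Aa u \<bullet> kk X \<U> u = \<kappa> X \<U>" if U: "\<U> \<in> beta C X" and u: "memb C X \<U> u" for X \<U> u
  proof -
    note m = C.membD[OF u]
    have su: "src C u \<in> Obj C" using m by simp
    have R: "restr_uf C u \<U> \<in> beta C (src C u)" by (rule C.restr_uf(1)[OF U u])
    note b1 = UF_functorD[OF m(3) U su R C.continuous_restr[OF U u]]
    note b2 = UF_functorD[OF su R m(3) U C.continuous_incl[OF U u]]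
    note k1 = integral_incl[OF su R] and k2 = integral_incl[OF m(3) U]
    show "kk X \<U> u \<in> Arr E" "src E (kk X \<U> u) = fobj B (X, \<U>)" "tgt E (kk X \<U> u) = Ao (src C u)"
      unfolding kk_def using b1 k1 by simp_all
    have "Aa u \<bullet> \<kappa> (src C u) (restr_uf C u \<U>) = \<kappa> X \<U> \<bullet>
        fmap B (uf_arr C (src C u, restr_uf C u \<U>) (X, \<U>) (ident C (src C u), u))"
      using Aa(2)[OF m(1) R] C.pushforward_restr[OF U u] m(2) by simp
    then have "Aa u \<bullet> kk X \<U> u = (\<kappa> X \<U> \<bullet>
        fmap B (uf_arr C (src C u, restr_uf C u \<U>) (X, \<U>) (ident C (src C u), u))) \<bullet>
        fmap B (uf_arr C (X, \<U>) (src C u, restr_uf C u \<U>) (u, ident C (src C u)))"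
      unfolding kk_def by (rule E.ext2) (use Aa'[OF m(1)] b1 k1 m(2) in simp_all)
    also have "\<dots> = \<kappa> X \<U> \<bullet>
        (fmap B (uf_arr C (src C u, restr_uf C u \<U>) (X, \<U>) (ident C (src C u), u)) \<bullet>
        fmap B (uf_arr C (X, \<U>) (src C u, restr_uf C u \<U>) (u, ident C (src C u))))"
      using b1 b2 k2 by simp
    also have "fmap B (uf_arr C (src C u, restr_uf C u \<U>) (X, \<U>) (ident C (src C u), u)) \<bullet>
        fmap B (uf_arr C (X, \<U>) (src C u, restr_uf C u \<U>) (u, ident C (src C u))) =
      fmap B (uf_arr C (src C u, restr_uf C u \<U>) (X, \<U>) (ident C (src C u), u) \<cdot>\<^bsub>UF C\<^esub>
        uf_arr C (X, \<U>) (src C u, restr_uf C u \<U>) (u, ident C (src C u)))"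
      by (rule Bs(8)[OF C.uf_arr_Arr[OF m(3) U su R C.continuous_restr[OF U u]]
            C.uf_arr_Arr[OF su R m(3) U C.continuous_incl[OF U u]], symmetric]) simp
    also have "\<dots> = ident E (fobj B (X, \<U>))"
      unfolding C.restr_incl[OF U u] by (rule Bs(7)) (use m U in simp)
    finally show "Aa u \<bullet> kk X \<U> u = \<kappa> X \<U>" using k2 by simp
  qed
  have pres: "preserves_finite_coproducts C E A"
    unfolding preserves_finite_coproducts_def
  proof (intro conjI allI impI)
    fix z assume z: "is_initial C z"
    then have zO: "z \<in> Obj C" by (rule C.initial_Obj)
    show "is_initial E (fobj A z)"
      using c[OF zO] C.beta_initial[OF z] Ax[OF zO] by (simp add: E.empty_coproduct)
  next
    fix x y s i j assume b: "is_binary_coproduct C x y s i j"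
    note d = C.binary_coproductD[OF b]
    have ci: "coprojection C s i" "coprojection C s j"
      using C.coprojection_compl b C.binary_coproduct_sym by blast+
    note ai = Aa'[OF d(4), unfolded d] and aj = Aa'[OF d(7), unfolded d]
    \<comment> \<open>The composite of \<open>h\<close> with \<open>Aa i'\<close> is tested on each
      ultrafilter of the domain of \<open>i'\<close>. This ultrafilter is the restriction of its
      direct image, and \<open>incl_restr\<close> cancels the passage to the direct image and
      back.\<close>
    have key: "h \<bullet> Aa i' = f"
      if h: "h \<in> Arr E" "src E h = Ao s" and f: "f \<in> Arr E" "src E f = Ao (src C i')" "tgt E f = tgt E h"
        and ci': "coprojection C s i'"
        and e: "\<And>\<W>. \<W> \<in> beta C s \<Longrightarrow> memb C s \<W> i' \<Longrightarrow> h \<bullet> \<kappa> s \<W> = f \<bullet> kk s \<W> i'" for h f i'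
    proof (rule E.coproduct_eq[OF c])
      note di = C.coprojectionD[OF ci']
      show sO: "src C i' \<in> Obj C" using di by simp
      note ai' = Aa'[OF di(1), unfolded di(2)]
      fix \<U> assume U: "\<U> \<in> beta C (src C i')"
      let ?W = "pushforward C i' \<U>"
      have W: "?W \<in> beta C s" using C.pushforward_beta[OF di(1) U] di by simp
      have mi: "memb C s ?W i'" and r: "restr_uf C i' ?W = \<U>" using C.restr_pushforward[OF ci' U] by auto
      have R: "restr_uf C i' ?W \<in> beta C (src C i')" using r U by simp
      note t = total[OF di(1) U, unfolded di(2)]
      note k1 = integral_incl[OF sO U] and k2 = integral_incl[OF di(3) W]
      note b1 = UF_functorD[OF di(3) W sO R C.continuous_restr[OF W mi], unfolded r]
      have "(h \<bullet> Aa i') \<bullet> \<kappa> (src C i') \<U> = h \<bullet> (Aa i' \<bullet> \<kappa> (src C i') \<U>)"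
        using h ai' k1 by simp
      also have "\<dots> = (h \<bullet> \<kappa> s ?W) \<bullet> fmap B (total_arr i' \<U>)"
        unfolding Aa(2)[OF di(1) U] using h k2 t(1-3) di(2) by simp
      also have "\<dots> = f \<bullet> (\<kappa> (src C i') \<U> \<bullet> (fmap B (uf_arr C (s, ?W) (src C i', \<U>) (i', ident C (src C i')))
          \<bullet> fmap B (total_arr i' \<U>)))"
        unfolding e[OF W mi] kk_def r using f k1 b1 t(1-3) di(2) by simp
      also have "fmap B (uf_arr C (s, ?W) (src C i', \<U>) (i', ident C (src C i'))) \<bullet> fmap B (total_arr i' \<U>) =
          fmap B (uf_arr C (s, ?W) (src C i', \<U>) (i', ident C (src C i')) \<cdot>\<^bsub>UF C\<^esub> total_arr i' \<U>)"
        by (rule Bs(8)[symmetric, OF total(4)[OF di(1) U]])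
          (use C.uf_arr_Arr[OF di(3) W sO R C.continuous_restr[OF W mi], unfolded r] di(2) in simp_all)
      also have "uf_arr C (s, ?W) (src C i', \<U>) (i', ident C (src C i')) \<cdot>\<^bsub>UF C\<^esub> total_arr i' \<U> =
          ident (UF C) (src C i', \<U>)"
        using C.incl_restr[OF W mi, unfolded r] di(2) by simp
      also have "fmap B \<dots> = ident E (fobj B (src C i', \<U>))" by (rule Bs(7)) (use sO U in simp)
      finally show "(h \<bullet> Aa i') \<bullet> \<kappa> (src C i') \<U> = f \<bullet> \<kappa> (src C i') \<U>" using k1 by simp
    qed (use h f Aa'[OF C.coprojectionD(1)[OF ci']] C.coprojectionD(2)[OF ci'] in simp_all)
    have "is_binary_coproduct E (Ao x) (Ao y) (Ao s) (Aa i) (Aa j)"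
    proof (rule E.binary_coproductI)
      show "Ao s \<in> Obj E" using AoO d by simp
      show "Aa i \<in> hom E (Ao x) (Ao s)" "Aa j \<in> hom E (Ao y) (Ao s)" using ai aj by simp_all
      fix z f g assume f: "f \<in> hom E (Ao x) z" and g: "g \<in> hom E (Ao y) z"
      have f': "f \<in> Arr E" "src E f = Ao x" "tgt E f = z" "g \<in> Arr E" "src E g = Ao y" "tgt E g = z" using f g by auto
      have zO: "z \<in> Obj E" using f by auto
      \<comment> \<open>The copairing of \<open>f\<close> and \<open>g\<close>, given on each
        ultrafilter through the coprojection that it contains.\<close>
      define r where "r \<W> = (if memb C s \<W> i then f \<bullet> kk s \<W> i else g \<bullet> kk s \<W> j)" for \<W>
      have r: "r \<W> \<in> hom E (fobj B (s, \<W>)) z" if W: "\<W> \<in> beta C s" for \<W>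
      proof (cases "memb C s \<W> i")
        case True
        then show ?thesis using kk(1-3)[OF W True] f' d by (simp add: r_def)
      next
        case False
        then have "memb C s \<W> j" using C.memb_xor[OF W b] by blast
        from kk(1-3)[OF W this] show ?thesis using False f' d by (simp add: r_def)
      qed
      obtain h where h: "h \<in> Arr E" "src E h = Ao s" "tgt E h = z" "\<And>\<W>. \<W> \<in> beta C s \<Longrightarrow> h \<bullet> \<kappa> s \<W> = r \<W>"
        using E.coproduct_ex[OF c[OF d(3)] zO r] by blast
      have "h \<bullet> Aa i = f"
        by (rule key[OF h(1,2) f'(1) _ _ ci(1)]) (use f' d h in \<open>simp_all add: r_def\<close>)
      moreover have "h \<bullet> Aa j = g"
        using key h(1,2) f'(4) ci(2) C.memb_xor b h(4) r_def f' d h(3) by simp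
      ultimately show "\<exists>h\<in>hom E (Ao s) z. h \<bullet> Aa i = f \<and> h \<bullet> Aa j = g" using h(1-3) by (intro bexI[of _ h]) simp_all
    next
      fix z h k assume h: "h \<in> hom E (Ao s) z" "k \<in> hom E (Ao s) z" and e: "h \<bullet> Aa i = k \<bullet> Aa i"
        "h \<bullet> Aa j = k \<bullet> Aa j"
      have h': "h \<in> Arr E" "src E h = Ao s" "tgt E h = z" "k \<in> Arr E" "src E k = Ao s" "tgt E k = z" using h by auto
      have through: "h \<bullet> \<kappa> s \<W> = k \<bullet> \<kappa> s \<W>"
        if W: "\<W> \<in> beta C s" and m: "memb C s \<W> i'" and ei: "h \<bullet> Aa i' = k \<bullet> Aa i'" for \<W> i'
      proof -
        note mi = C.membD[OF m] and q = kk[OF W m]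
        note ai' = Aa'[OF mi(1), unfolded mi(2)]
        have "h \<bullet> \<kappa> s \<W> = (h \<bullet> Aa i') \<bullet> kk s \<W> i'" unfolding q(4)[symmetric] using h' ai' q(1-3) by simp
        also have "\<dots> = k \<bullet> \<kappa> s \<W>" unfolding ei q(4)[symmetric] using h' ai' q(1-3) by simp
        finally show ?thesis .
      qed
      show "h = k"
      proof (rule E.coproduct_eq[OF c[OF d(3)]])
        fix \<W> assume W: "\<W> \<in> beta C s"
        show "h \<bullet> \<kappa> s \<W> = k \<bullet> \<kappa> s \<W>"
          using through[OF W _ e(1)] through[OF W _ e(2)] C.memb_xor[OF W b] by blast
      qed (use h' in simp_all)
    qed
    then show "is_binary_coproduct E (fobj A x) (fobj A y) (fobj A s) (fmap A i) (fmap A j)"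
      using Ax Af d by simp
  qed
  have "represents A B (\<lambda>(X, \<U>). \<kappa> X \<U>)"
    unfolding represents_def prod.case
  proof (intro conjI ballI allI impI)
    show "fc A" unfolding fc_def using F pres by blast
    show "is_functor (UF C) E B" by (rule B)
    show "is_coproduct E (beta C X) (\<lambda>\<U>. fobj B (X, \<U>)) (fobj A X) (\<kappa> X)" if "X \<in> Obj C" for X
      using c[OF that] Ax[OF that] by simp
    fix X \<U> Y \<V> u f assume X: "X \<in> Obj C" and U: "\<U> \<in> beta C X" and Y: "Y \<in> Obj C" and V: "\<V> \<in> beta C Y"
      and cont: "continuous_partial C (X, \<U>) (Y, \<V>) (u, f)"
    note f = C.continuousD(1-4)[OF U V cont]
    note m = C.membD[OF f(1)]
    have su: "src C u \<in> Obj C" using m by simp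
    have R: "restr_uf C u \<U> \<in> beta C (src C u)" by (rule C.restr_uf(1)[OF U f(1)])
    have R': "restr_uf C u \<U> \<in> beta C (src C f)" using R f by simp
    note q = kk[OF U f(1)]
    note e = C.continuous_restr_total[OF U V cont]
    note t = total[OF f(2) R', unfolded f(3,4) e(1)[symmetric]]
    note b1 = UF_functorD[OF X U su R C.continuous_restr[OF U f(1)]]
    note k1 = integral_incl[OF su R] and k2 = integral_incl[OF Y V]
    have af: "Aa f \<in> Arr E" "src E (Aa f) = Ao (src C u)" "tgt E (Aa f) = Ao Y" using Aa'[OF f(2)] f by simp_all
    \<comment> \<open>The class of \<open>(u, f)\<close> is the restriction to \<open>u\<close>
      followed by the total map \<open>f\<close>, and for total maps \<open>Aa\<close> is known on
      every coprojection.\<close>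
    have "\<kappa> Y \<V> \<bullet> fmap B (uf_arr C (X, \<U>) (Y, \<V>) (u, f)) =
        \<kappa> Y \<V> \<bullet> (fmap B (uf_arr C (src C u, restr_uf C u \<U>) (Y, \<V>) (ident C (src C u), f)) \<bullet>
          fmap B (uf_arr C (X, \<U>) (src C u, restr_uf C u \<U>) (u, ident C (src C u))))"
      unfolding e(2)[symmetric]
      using Bs(8)[OF C.uf_arr_Arr[OF X U su R C.continuous_restr[OF U f(1)]] t(4)] by simp
    also have "\<dots> = (\<kappa> Y \<V> \<bullet> fmap B (uf_arr C (src C u, restr_uf C u \<U>) (Y, \<V>) (ident C (src C u), f))) \<bullet>
          fmap B (uf_arr C (X, \<U>) (src C u, restr_uf C u \<U>) (u, ident C (src C u)))"
      using k2 t(1-3) b1 by simp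
    also have "\<kappa> Y \<V> \<bullet> fmap B (uf_arr C (src C u, restr_uf C u \<U>) (Y, \<V>) (ident C (src C u), f)) =
        Aa f \<bullet> \<kappa> (src C u) (restr_uf C u \<U>)"
      using Aa(2)[OF f(2) R'] unfolding f(3,4) e(1)[symmetric] by simp
    also have "(Aa f \<bullet> \<kappa> (src C u) (restr_uf C u \<U>)) \<bullet>
          fmap B (uf_arr C (X, \<U>) (src C u, restr_uf C u \<U>) (u, ident C (src C u))) = Aa f \<bullet> kk X \<U> u"
      unfolding kk_def using af k1 b1 by simp
    finally show "\<exists>k\<in>hom E (fobj B (X, \<U>)) (fobj A (src C u)). fmap A u \<bullet> k = \<kappa> X \<U> \<and>
        \<kappa> Y \<V> \<bullet> fmap B (uf_arr C (X, \<U>) (Y, \<V>) (u, f)) = fmap A f \<bullet> k"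
      using q Af[OF f(2)] Af[OF m(1)] Ax[OF su] by (intro bexI[of _ "kk X \<U> u"]) simp_all
  qed
  then show ?thesis by blast
qed

end

lemma integral_exists:
  assumes B: "is_functor (UF C) E B"
  shows "\<exists>A \<iota>. represents A B \<iota>"
proof -
  have "\<exists>s k. is_coproduct E (beta C X) (\<lambda>\<U>. fobj B (X, \<U>)) s k" if X: "X \<in> Obj C" for X
  proof -
    obtain s k where "stable_coproduct E (beta C X) (\<lambda>\<U>. fobj B (X, \<U>)) s k"
      by (rule E.stable_coproduct_exists[OF small_beta[OF X]]) (use functorD(3)[OF B] X in auto)
    from stable_coproductD(1)[OF this] show ?thesis by blast
  qed
  then obtain Ao \<kappa> where "\<And>X. X \<in> Obj C \<Longrightarrow> is_coproduct E (beta C X) (\<lambda>\<U>. fobj B (X, \<U>)) (Ao X) (\<kappa> X)"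
    by metis
  from integral_represents[OF B this] show ?thesis by blast
qed

end

section \<open>The equivalence\<close>

context extensive_to_topos
begin

lemma representsD:
  assumes r: "represents A B \<iota>"
  shows "fc A" "is_functor C E A" "is_functor (UF C) E B"
    "X \<in> Obj C \<Longrightarrow> is_coproduct E (beta C X) (\<lambda>\<U>. fobj B (X, \<U>)) (fobj A X) (\<lambda>\<U>. \<iota> (X, \<U>))"
    "X \<in> Obj C \<Longrightarrow> \<U> \<in> beta C X \<Longrightarrow> Y \<in> Obj C \<Longrightarrow> \<V> \<in> beta C Y \<Longrightarrow>
      continuous_partial C (X, \<U>) (Y, \<V>) (u, f) \<Longrightarrow>
      \<exists>k\<in>hom E (fobj B (X, \<U>)) (fobj A (src C u)). fmap A u \<bullet> k = \<iota> (X, \<U>) \<and>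
        \<iota> (Y, \<V>) \<bullet> fmap B (uf_arr C (X, \<U>) (Y, \<V>) (u, f)) = fmap A f \<bullet> k"
  using r unfolding represents_def fc_def by blast+

lemma represents_arr:
  assumes r: "represents A B \<iota>" and X: "X \<in> Obj C" and U: "\<U> \<in> beta C X" and Y: "Y \<in> Obj C" and V: "\<V> \<in> beta C Y"
    and c: "continuous_partial C (X, \<U>) (Y, \<V>) (u, f)"
  obtains k where "k \<in> Arr E" "src E k = fobj B (X, \<U>)" "tgt E k = fobj A (src C u)" "fmap A u \<bullet> k = \<iota> (X, \<U>)"
    "\<iota> (Y, \<V>) \<bullet> fmap B (uf_arr C (X, \<U>) (Y, \<V>) (u, f)) = fmap A f \<bullet> k"
  using representsD(5) r X U Y V c by fastforce

lemma represents_incl: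
  assumes r: "represents A B \<iota>" and X: "X \<in> Obj C" and U: "\<U> \<in> beta C X"
  shows "\<iota> (X, \<U>) \<in> Arr E" "src E (\<iota> (X, \<U>)) = fobj B (X, \<U>)" "tgt E (\<iota> (X, \<U>)) = fobj A X"
    "is_mono E (\<iota> (X, \<U>))" "fobj B (X, \<U>) \<in> Obj E"
  using E.coproductD[OF representsD(4)[OF r X]] U
    stable_coproductD(3)[OF E.coproduct_stable[OF representsD(4)[OF r X] small_beta[OF X]]] by auto

text \<open>The partial map from \<open>X\<close> to the domain of \<open>u\<close> with
  representative \<open>(u, ident C (src C u))\<close> is continuous; the arrow that
  \<open>represents\<close> attaches to it is the factorisation.\<close>

lemma represents_factors:
  assumes r: "represents A B \<iota>" and X: "X \<in> Obj C" and U: "\<U> \<in> beta C X" and u: "memb C X \<U> u"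
  shows "factors_through E (\<iota> (X, \<U>)) (fmap A u)"
proof -
  note m = C.membD[OF u]
  have su: "src C u \<in> Obj C" using m by simp
  obtain k where "k \<in> Arr E" "src E k = fobj B (X, \<U>)" "tgt E k = fobj A (src C u)" "fmap A u \<bullet> k = \<iota> (X, \<U>)"
    by (rule represents_arr[OF r X U su C.restr_uf(1)[OF U u] C.continuous_restr[OF U u]])
  then show ?thesis by (intro E.factors_throughI[of k]) (use fcD[OF representsD(1)[OF r]] m in simp_all)
qed

lemma represents_universal:
  assumes r: "represents A B \<iota>" and X: "X \<in> Obj C" and V: "\<V> \<in> beta C X" and n: "n \<in> Arr E" "tgt E n = fobj A X"
    and nv: "\<And>v. memb C X \<V> v \<Longrightarrow> factors_through E n (fmap A v)"
  shows "factors_through E n (\<iota> (X, \<V>))"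
  by (rule factors_through_tilde[OF representsD(1)[OF r] X representsD(4)[OF r X] _ V n nv])
    (rule represents_factors[OF r X])

text \<open>For a total map the arrow \<open>k\<close> is \<iota> itself, because \<open>A\<close>
  preserves identities. This is the formula that describes the integral on arrows.\<close>

lemma represents_total:
  assumes r: "represents A B \<iota>" and f: "f \<in> Arr C" and U: "\<U> \<in> beta C (src C f)"
  shows "fmap A f \<bullet> \<iota> (src C f, \<U>) = \<iota> (tgt C f, pushforward C f \<U>) \<bullet>
    fmap B (uf_arr C (src C f, \<U>) (tgt C f, pushforward C f \<U>) (ident C (src C f), f))"
proof -
  note As = fcD[OF representsD(1)[OF r]]
  have O: "src C f \<in> Obj C" "tgt C f \<in> Obj C" using f by auto
  obtain k where k: "k \<in> Arr E" "tgt E k = fobj A (src C (ident C (src C f)))"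
    "fmap A (ident C (src C f)) \<bullet> k = \<iota> (src C f, \<U>)"
    "\<iota> (tgt C f, pushforward C f \<U>) \<bullet>
      fmap B (uf_arr C (src C f, \<U>) (tgt C f, pushforward C f \<U>) (ident C (src C f), f)) = fmap A f \<bullet> k"
    by (rule represents_arr[OF r O(1) U O(2) C.pushforward_beta[OF f U] C.continuous_total[OF f U]])
  have "k = \<iota> (src C f, \<U>)" using k(1-3) O As by simp
  then show ?thesis using k(4) by simp
qed

text \<open>The arrows of the span: for fixed \<iota> and \<iota>', transformations \<alpha> on
  \<open>C\<close> and \<sigma> on \<open>UF C\<close> that are compatible determine each other by
  \<open>compatible_sigma\<close> and \<open>compatible_alpha\<close>.\<close>

definition compatible ::
  "(('o, 'a) uf_obj \<Rightarrow> 'b) \<Rightarrow> (('o, 'a) uf_obj \<Rightarrow> 'b) \<Rightarrow> ('o \<Rightarrow> 'b) \<Rightarrow> (('o, 'a) uf_obj \<Rightarrow> 'b) \<Rightarrow> bool" where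
  "compatible \<iota> \<iota>' \<alpha> \<sigma> \<longleftrightarrow> (\<forall>X\<in>Obj C. \<forall>\<U>\<in>beta C X. \<iota>' (X, \<U>) \<bullet> \<sigma> (X, \<U>) = \<alpha> X \<bullet> \<iota> (X, \<U>))"

context
  fixes A B \<iota> A' B' \<iota>'
  assumes r: "represents A B \<iota>" and r': "represents A' B' \<iota>'"
begin

text \<open>Here \<iota>' is used as an intersection: naturality of \<alpha> at each member
  \<open>v\<close> makes \<open>\<alpha> X \<bullet> \<iota> (X, \<U>)\<close> factor through
  \<open>A' v\<close>, hence through \<iota>'. Since \<iota>' is monic, \<sigma> is unique and its
  naturality can be checked after composing with \<iota>'.\<close>

lemma compatible_sigma:
  assumes \<alpha>: "nat_trans C E A A' \<alpha>"
  shows "\<exists>!\<sigma>. nat_trans (UF C) E B B' \<sigma> \<and> compatible \<iota> \<iota>' \<alpha> \<sigma>"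
proof -
  note As = fcD[OF representsD(1)[OF r]] and As' = fcD[OF representsD(1)[OF r']]
  note Bs = functorD[OF representsD(3)[OF r]] and Bs' = functorD[OF representsD(3)[OF r']]
  note a = nat_transD[OF C.category E.category \<alpha>]
  have ex: "\<exists>s. s \<in> hom E (fobj B (X, \<U>)) (fobj B' (X, \<U>)) \<and> \<iota>' (X, \<U>) \<bullet> s = \<alpha> X \<bullet> \<iota> (X, \<U>)"
    if X: "X \<in> Obj C" and U: "\<U> \<in> beta C X" for X \<U>
  proof -
    note i = represents_incl[OF r X U] and i' = represents_incl[OF r' X U] and aX = a(1-3)[OF X]
    have n: "\<alpha> X \<bullet> \<iota> (X, \<U>) \<in> Arr E" "tgt E (\<alpha> X \<bullet> \<iota> (X, \<U>)) = fobj A' X"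
      "src E (\<alpha> X \<bullet> \<iota> (X, \<U>)) = fobj B (X, \<U>)" using i aX by simp_all
    have "factors_through E (\<alpha> X \<bullet> \<iota> (X, \<U>)) (\<iota>' (X, \<U>))"
    proof (rule represents_universal[OF r' X U n(1,2)])
      fix v assume v: "memb C X \<U> v"
      note m = C.membD[OF v]
      have sv: "src C v \<in> Obj C" using m by simp
      obtain k where k: "k \<in> Arr E" "src E k = src E (\<iota> (X, \<U>))" "tgt E k = src E (fmap A v)" "fmap A v \<bullet> k = \<iota> (X, \<U>)"
        using represents_factors[OF r X U v] by (rule E.factors_throughE)
      have k': "tgt E k = fobj A (src C v)" using k(3) As m by simp
      have "fmap A' v \<bullet> (\<alpha> (src C v) \<bullet> k) = (\<alpha> X \<bullet> fmap A v) \<bullet> k"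
        using a(4)[OF m(1)] a(1-3)[OF sv] As' k(1) k' m by simp
      also have "\<dots> = \<alpha> X \<bullet> \<iota> (X, \<U>)" using aX As k m k' by simp
      finally show "factors_through E (\<alpha> X \<bullet> \<iota> (X, \<U>)) (fmap A' v)"
        by (intro E.factors_throughI[of "\<alpha> (src C v) \<bullet> k"]) (use a(1-3)[OF sv] As' k(1) k' m in simp_all)
    qed
    then obtain s where "s \<in> Arr E" "src E s = src E (\<alpha> X \<bullet> \<iota> (X, \<U>))" "tgt E s = src E (\<iota>' (X, \<U>))"
      "\<iota>' (X, \<U>) \<bullet> s = \<alpha> X \<bullet> \<iota> (X, \<U>)" by (rule E.factors_throughE)
    then show ?thesis using n(3) i' by (intro exI[of _ s]) simp
  qed
  define \<sigma> where "\<sigma> = restrict (\<lambda>x. SOME s. s \<in> hom E (fobj B x) (fobj B' x) \<and>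
    \<iota>' x \<bullet> s = \<alpha> (fst x) \<bullet> \<iota> x) (Obj (UF C))"
  have \<sigma>: "\<sigma> (X, \<U>) \<in> hom E (fobj B (X, \<U>)) (fobj B' (X, \<U>))" "\<iota>' (X, \<U>) \<bullet> \<sigma> (X, \<U>) = \<alpha> X \<bullet> \<iota> (X, \<U>)"
    if X: "X \<in> Obj C" and U: "\<U> \<in> beta C X" for X \<U>
    using someI_ex[OF ex[OF X U]] X U by (simp_all add: \<sigma>_def)
  have \<sigma>': "\<sigma> (X, \<U>) \<in> Arr E" "src E (\<sigma> (X, \<U>)) = fobj B (X, \<U>)" "tgt E (\<sigma> (X, \<U>)) = fobj B' (X, \<U>)"
    if X: "X \<in> Obj C" and U: "\<U> \<in> beta C X" for X \<U>
    using \<sigma>(1)[OF that] by auto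
  have "nat_trans (UF C) E B B' \<sigma>"
    unfolding nat_trans_def
  proof (intro conjI ballI)
    show "\<sigma> \<in> extensional (Obj (UF C))" by (simp add: \<sigma>_def)
    show "\<sigma> x \<in> hom E (fobj B x) (fobj B' x)" if "x \<in> Obj (UF C)" for x using \<sigma>(1) that by (cases x) simp
    fix b assume "b \<in> Arr (UF C)"
    then obtain X \<U> Y \<V> u f where X: "X \<in> Obj C" and U: "\<U> \<in> beta C X" and Y: "Y \<in> Obj C" and V: "\<V> \<in> beta C Y"
      and c: "continuous_partial C (X, \<U>) (Y, \<V>) (u, f)" and b: "b = uf_arr C (X, \<U>) (Y, \<V>) (u, f)"
      by (rule C.UF_ArrE)
    have bA: "b \<in> Arr (UF C)" unfolding b by (rule C.uf_arr_Arr[OF X U Y V c])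
    have sb: "src (UF C) b = (X, \<U>)" "tgt (UF C) b = (Y, \<V>)" by (simp_all add: b)
    note Bb = Bs(4-6)[OF bA, unfolded sb] and Bb' = Bs'(4-6)[OF bA, unfolded sb]
    note f = C.continuousD(1-4)[OF U V c]
    note m = C.membD[OF f(1)]
    have su: "src C u \<in> Obj C" using m by simp
    note sX = \<sigma>'[OF X U] and sY = \<sigma>'[OF Y V] and aX = a(1-3)[OF X] and aY = a(1-3)[OF Y] and au = a(1-3)[OF su]
    note iY = represents_incl[OF r Y V] and iY' = represents_incl[OF r' Y V]
    obtain k where k: "k \<in> Arr E" "src E k = fobj B (X, \<U>)" "tgt E k = fobj A (src C u)" "fmap A u \<bullet> k = \<iota> (X, \<U>)"
      "\<iota> (Y, \<V>) \<bullet> fmap B b = fmap A f \<bullet> k"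
      unfolding b by (rule represents_arr[OF r X U Y V c])
    obtain k' where k': "k' \<in> Arr E" "src E k' = fobj B' (X, \<U>)" "tgt E k' = fobj A' (src C u)"
      "fmap A' u \<bullet> k' = \<iota>' (X, \<U>)" "\<iota>' (Y, \<V>) \<bullet> fmap B' b = fmap A' f \<bullet> k'"
      unfolding b by (rule represents_arr[OF r' X U Y V c])
    have "fmap A' u \<bullet> (\<alpha> (src C u) \<bullet> k) = (fmap A' u \<bullet> \<alpha> (src C u)) \<bullet> k"
      using au As' k(1-3) m by simp
    also have "\<dots> = \<alpha> X \<bullet> (fmap A u \<bullet> k)"
      unfolding a(4)[OF m(1), symmetric] using aX As k(1-3) m by simp
    also have "\<dots> = \<iota>' (X, \<U>) \<bullet> \<sigma> (X, \<U>)" unfolding k(4) \<sigma>(2)[OF X U] ..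
    also have "\<dots> = fmap A' u \<bullet> (k' \<bullet> \<sigma> (X, \<U>))"
      unfolding k'(4)[symmetric] using As' k'(1-3) sX m by simp
    finally have ak: "\<alpha> (src C u) \<bullet> k = k' \<bullet> \<sigma> (X, \<U>)"
      by (intro E.mono_cancel[OF fc_mono[OF representsD(1)[OF r'] C.memb_coprojection[OF f(1)]],
            of "\<alpha> (src C u) \<bullet> k" "k' \<bullet> \<sigma> (X, \<U>)"])
        (use au As' k(1-3) k'(1-3) sX m in simp_all)
    have "\<iota>' (Y, \<V>) \<bullet> (\<sigma> (Y, \<V>) \<bullet> fmap B b) = (\<alpha> Y \<bullet> \<iota> (Y, \<V>)) \<bullet> fmap B b"
      by (rule E.ext2[OF \<sigma>(2)[OF Y V]]) (use iY' sY Bb in simp_all)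
    also have "\<dots> = \<alpha> Y \<bullet> (fmap A f \<bullet> k)" using aY iY Bb k(5) by simp
    also have "\<dots> = (\<alpha> (tgt C f) \<bullet> fmap A f) \<bullet> k" using aY As f k(1-3) by simp
    also have "\<dots> = fmap A' f \<bullet> (k' \<bullet> \<sigma> (X, \<U>))"
      unfolding a(4)[OF f(2)] ak[symmetric] using au As' f k(1-3) by simp
    also have "\<dots> = (\<iota>' (Y, \<V>) \<bullet> fmap B' b) \<bullet> \<sigma> (X, \<U>)"
      unfolding k'(5) using As' f k'(1-3) sX by simp
    also have "\<dots> = \<iota>' (Y, \<V>) \<bullet> (fmap B' b \<bullet> \<sigma> (X, \<U>))" using iY' Bb' sX by simp
    finally have "\<sigma> (Y, \<V>) \<bullet> fmap B b = fmap B' b \<bullet> \<sigma> (X, \<U>)"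
      by (intro E.mono_cancel[OF iY'(4), of "\<sigma> (Y, \<V>) \<bullet> fmap B b" "fmap B' b \<bullet> \<sigma> (X, \<U>)"])
        (use iY' sX sY Bb Bb' in simp_all)
    then show "\<sigma> (tgt (UF C) b) \<bullet> fmap B b = fmap B' b \<bullet> \<sigma> (src (UF C) b)" unfolding sb .
  qed
  moreover have "compatible \<iota> \<iota>' \<alpha> \<sigma>" unfolding compatible_def using \<sigma>(2) by blast
  moreover have "\<tau> = \<sigma>" if t: "nat_trans (UF C) E B B' \<tau>" "compatible \<iota> \<iota>' \<alpha> \<tau>" for \<tau>
  proof (rule extensionalityI[of _ "Obj (UF C)"])
    show "\<tau> \<in> extensional (Obj (UF C))" "\<sigma> \<in> extensional (Obj (UF C))"
      using t(1) by (simp_all add: \<sigma>_def nat_trans_def)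
    fix x assume x: "x \<in> Obj (UF C)"
    obtain X \<U> where xe: "x = (X, \<U>)" by (cases x)
    have X: "X \<in> Obj C" "\<U> \<in> beta C X" using x xe by auto
    have "\<iota>' (X, \<U>) \<bullet> \<tau> (X, \<U>) = \<iota>' (X, \<U>) \<bullet> \<sigma> (X, \<U>)"
      using t(2) \<sigma>(2)[OF X] X unfolding compatible_def by simp
    then have "\<tau> (X, \<U>) = \<sigma> (X, \<U>)"
      by (intro E.mono_cancel[OF represents_incl(4)[OF r' X], of "\<tau> (X, \<U>)" "\<sigma> (X, \<U>)"])
        (use nat_transD(1-3)[OF UF.category E.category t(1), of "(X, \<U>)"] \<sigma>'[OF X] represents_incl[OF r' X] X in simp_all)
    then show "\<tau> x = \<sigma> x" by (simp add: xe)
  qed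
  ultimately show ?thesis by blast
qed

text \<open>Here \<iota> is used as a family of coprojections: \<alpha> is defined on the summands,
  and its naturality and uniqueness are tested on them, with \<open>represents_total\<close>
  describing \<open>A\<close> and \<open>A'\<close> on each summand.\<close>

lemma compatible_alpha:
  assumes \<sigma>: "nat_trans (UF C) E B B' \<sigma>"
  shows "\<exists>!\<alpha>. nat_trans C E A A' \<alpha> \<and> compatible \<iota> \<iota>' \<alpha> \<sigma>"
proof -
  note As = fcD[OF representsD(1)[OF r]] and As' = fcD[OF representsD(1)[OF r']]
  note Bs = functorD[OF representsD(3)[OF r]] and Bs' = functorD[OF representsD(3)[OF r']]
  note s0 = nat_transD[OF UF.category E.category \<sigma>]
  have s: "\<sigma> (X, \<U>) \<in> Arr E" "src E (\<sigma> (X, \<U>)) = fobj B (X, \<U>)" "tgt E (\<sigma> (X, \<U>)) = fobj B' (X, \<U>)"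
    if "X \<in> Obj C" "\<U> \<in> beta C X" for X \<U> using s0(1-3)[of "(X, \<U>)"] that by simp_all
  have ex: "\<exists>a. a \<in> hom E (fobj A X) (fobj A' X) \<and> (\<forall>\<U>\<in>beta C X. \<iota>' (X, \<U>) \<bullet> \<sigma> (X, \<U>) = a \<bullet> \<iota> (X, \<U>))"
    if X: "X \<in> Obj C" for X
  proof -
    obtain a where "a \<in> Arr E" "src E a = fobj A X" "tgt E a = fobj A' X"
      "\<And>\<U>. \<U> \<in> beta C X \<Longrightarrow> a \<bullet> \<iota> (X, \<U>) = \<iota>' (X, \<U>) \<bullet> \<sigma> (X, \<U>)"
      by (rule E.coproduct_ex[OF representsD(4)[OF r X] As'(1)[OF X], of "\<lambda>\<U>. \<iota>' (X, \<U>) \<bullet> \<sigma> (X, \<U>)"])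
        (use s[OF X] represents_incl[OF r' X] in auto)
    then show ?thesis by (intro exI[of _ a]) simp
  qed
  define ok where "ok X a \<longleftrightarrow> a \<in> hom E (fobj A X) (fobj A' X) \<and>
    (\<forall>\<U>\<in>beta C X. \<iota>' (X, \<U>) \<bullet> \<sigma> (X, \<U>) = a \<bullet> \<iota> (X, \<U>))" for X a
  have "\<forall>X\<in>Obj C. \<exists>a. ok X a" using ex unfolding ok_def by blast
  then obtain h where h: "\<And>X. X \<in> Obj C \<Longrightarrow> ok X (h X)" by metis
  define \<alpha> where "\<alpha> = restrict h (Obj C)"
  have \<alpha>: "\<alpha> X \<in> hom E (fobj A X) (fobj A' X) \<and>
    (\<forall>\<U>\<in>beta C X. \<iota>' (X, \<U>) \<bullet> \<sigma> (X, \<U>) = \<alpha> X \<bullet> \<iota> (X, \<U>))" if "X \<in> Obj C" for X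
  proof -
    have "\<alpha> X = h X" using that by (simp add: \<alpha>_def)
    then show ?thesis using h[OF that] unfolding ok_def by metis
  qed
  have a: "\<alpha> X \<in> Arr E" "src E (\<alpha> X) = fobj A X" "tgt E (\<alpha> X) = fobj A' X" if "X \<in> Obj C" for X
    using \<alpha>[OF that] by auto
  have ai: "\<alpha> X \<bullet> \<iota> (X, \<U>) = \<iota>' (X, \<U>) \<bullet> \<sigma> (X, \<U>)" if "X \<in> Obj C" "\<U> \<in> beta C X" for X \<U>
    using \<alpha>[OF that(1)] that(2) by simp
  have "nat_trans C E A A' \<alpha>"
    unfolding nat_trans_def
  proof (intro conjI ballI)
    show "\<alpha> \<in> extensional (Obj C)" by (simp add: \<alpha>_def)
    show "\<alpha> X \<in> hom E (fobj A X) (fobj A' X)" if "X \<in> Obj C" for X using \<alpha>[OF that] by blast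
    fix f assume f: "f \<in> Arr C"
    let ?X = "src C f" and ?Y = "tgt C f"
    have O: "?X \<in> Obj C" "?Y \<in> Obj C" using f by auto
    note aX = a[OF O(1)] and aY = a[OF O(2)]
    show "\<alpha> ?Y \<bullet> fmap A f = fmap A' f \<bullet> \<alpha> ?X"
    proof (rule E.coproduct_eq[OF representsD(4)[OF r O(1)]])
      fix \<U> assume U: "\<U> \<in> beta C ?X"
      let ?V = "pushforward C f \<U>"
      let ?b = "uf_arr C (?X, \<U>) (?Y, ?V) (ident C ?X, f)"
      have V: "?V \<in> beta C ?Y" by (rule C.pushforward_beta[OF f U])
      have b: "?b \<in> Arr (UF C)" by (rule C.uf_arr_Arr[OF O(1) U O(2) V C.continuous_total[OF f U]])
      note Bb = Bs(4-6)[OF b] and Bb' = Bs'(4-6)[OF b] and sb = s0(4)[OF b]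
      note iX = represents_incl[OF r O(1) U] and iX' = represents_incl[OF r' O(1) U]
      note iY = represents_incl[OF r O(2) V] and iY' = represents_incl[OF r' O(2) V]
      note sX = s[OF O(1) U] and sY = s[OF O(2) V]
      have "(\<alpha> ?Y \<bullet> fmap A f) \<bullet> \<iota> (?X, \<U>) = \<alpha> ?Y \<bullet> (fmap A f \<bullet> \<iota> (?X, \<U>))"
        using aY As f iX by simp
      also have "\<dots> = (\<alpha> ?Y \<bullet> \<iota> (?Y, ?V)) \<bullet> fmap B ?b"
        unfolding represents_total[OF r f U] using aY iY Bb by simp
      also have "\<dots> = \<iota>' (?Y, ?V) \<bullet> (\<sigma> (?Y, ?V) \<bullet> fmap B ?b)"
        unfolding ai[OF O(2) V] using iY' sY Bb by simp
      also have "\<dots> = \<iota>' (?Y, ?V) \<bullet> (fmap B' ?b \<bullet> \<sigma> (?X, \<U>))" using sb by simp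
      also have "\<dots> = (\<iota>' (?Y, ?V) \<bullet> fmap B' ?b) \<bullet> \<sigma> (?X, \<U>)" using iY' Bb' sX by simp
      also have "\<dots> = fmap A' f \<bullet> (\<iota>' (?X, \<U>) \<bullet> \<sigma> (?X, \<U>))"
        unfolding represents_total[OF r' f U, symmetric] using As' f iX' sX by simp
      also have "\<dots> = (fmap A' f \<bullet> \<alpha> ?X) \<bullet> \<iota> (?X, \<U>)"
        unfolding ai[OF O(1) U, symmetric] using As' f aX iX by simp
      finally show "(\<alpha> ?Y \<bullet> fmap A f) \<bullet> \<iota> (?X, \<U>) = (fmap A' f \<bullet> \<alpha> ?X) \<bullet> \<iota> (?X, \<U>)" .
    qed (use f As As' aX aY in simp_all)
  qed
  moreover have "compatible \<iota> \<iota>' \<alpha> \<sigma>" unfolding compatible_def using ai by simp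
  moreover have "\<beta> = \<alpha>" if t: "nat_trans C E A A' \<beta>" "compatible \<iota> \<iota>' \<beta> \<sigma>" for \<beta>
  proof (rule extensionalityI[of _ "Obj C"])
    show "\<beta> \<in> extensional (Obj C)" "\<alpha> \<in> extensional (Obj C)"
      using t(1) by (simp_all add: \<alpha>_def nat_trans_def)
    fix X assume X: "X \<in> Obj C"
    note b = nat_transD(1-3)[OF C.category E.category t(1) X]
    show "\<beta> X = \<alpha> X"
      by (rule E.coproduct_eq[OF representsD(4)[OF r X]])
        (use t(2) ai[OF X] X b a[OF X] in \<open>simp_all add: compatible_def\<close>)
  qed
  ultimately show ?thesis by blast
qed

end

lemma FC_simps:
  "A \<in> Obj (FC C E) \<longleftrightarrow> fc A"
  "g \<in> hom (FC C E) A A' \<longleftrightarrow> fc A \<and> fc A' \<and> (\<exists>\<alpha>. g = (A, \<alpha>, A') \<and> nat_trans C E A A' \<alpha>)"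
  "g \<in> Arr (FC C E) \<longleftrightarrow> (\<exists>A \<alpha> A'. g = (A, \<alpha>, A') \<and> fc A \<and> fc A' \<and> nat_trans C E A A' \<alpha>)"
  "src (FC C E) (A, \<alpha>, A') = A" "tgt (FC C E) (A, \<alpha>, A') = A'"
  "ident (FC C E) A = (A, restrict (\<lambda>X. ident E (fobj A X)) (Obj C), A)"
  "(A', \<alpha>', A'') \<cdot>\<^bsub>FC C E\<^esub> (A, \<alpha>, A') = (A, restrict (\<lambda>X. \<alpha>' X \<bullet> \<alpha> X) (Obj C), A'')"
  by (auto simp: FC_def full_subcat_def functor_cat_def fc_def hom_def)

lemma UFE_simps:
  "B \<in> Obj UFE \<longleftrightarrow> is_functor (UF C) E B"
  "h \<in> hom UFE B B' \<longleftrightarrow> is_functor (UF C) E B \<and> is_functor (UF C) E B' \<and>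
    (\<exists>\<sigma>. h = (B, \<sigma>, B') \<and> nat_trans (UF C) E B B' \<sigma>)"
  "h \<in> Arr UFE \<longleftrightarrow> (\<exists>B \<sigma> B'. h = (B, \<sigma>, B') \<and> is_functor (UF C) E B \<and>
    is_functor (UF C) E B' \<and> nat_trans (UF C) E B B' \<sigma>)"
  "src UFE (B, \<sigma>, B') = B" "tgt UFE (B, \<sigma>, B') = B'"
  "ident UFE B = (B, restrict (\<lambda>x. ident E (fobj B x)) (Obj (UF C)), B)"
  "(B', \<sigma>', B'') \<cdot>\<^bsub>UFE\<^esub> (B, \<sigma>, B') = (B, restrict (\<lambda>x. \<sigma>' x \<bullet> \<sigma> x) (Obj (UF C)), B'')"
  by (auto simp: functor_cat_def hom_def)

text \<open>Factorisation through all the summands in the ultrafilter is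
  \<open>represents_factors\<close>; maximality in the subobject order is
  \<open>represents_universal\<close>, applied to a monic arrow.\<close>

lemma represents_tilde:
  assumes r: "represents A B \<iota>"
  shows "is_tilde C E A B \<iota>"
  unfolding is_tilde_def
proof (intro conjI ballI allI impI)
  show "is_functor (UF C) E B" by (rule representsD[OF r])
  fix x assume x: "x \<in> Obj (UF C)"
  obtain X \<U> where xe: "x = (X, \<U>)" by (cases x)
  have X: "X \<in> Obj C" and U: "\<U> \<in> beta C X" using x xe by auto
  note i = represents_incl[OF r X U]
  have "is_intersection E (fobj A X) {fmap A u |u. coprojection C X u \<and> sum_class C X u \<in> \<U>} (\<iota> (X, \<U>))"
    unfolding is_intersection_def
  proof (intro conjI ballI allI impI)
    show "is_mono E (\<iota> (X, \<U>))" "tgt E (\<iota> (X, \<U>)) = fobj A X" by (rule i)+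
    show "factors_through E (\<iota> (X, \<U>)) s" if "s \<in> {fmap A u |u. coprojection C X u \<and> sum_class C X u \<in> \<U>}" for s
      using that represents_factors[OF r X U] unfolding memb_def by blast
    fix n assume n: "is_mono E n \<and> tgt E n = fobj A X \<and>
      (\<forall>s\<in>{fmap A u |u. coprojection C X u \<and> sum_class C X u \<in> \<U>}. factors_through E n s)"
    show "factors_through E n (\<iota> (X, \<U>))"
      by (rule represents_universal[OF r X U]) (use n in \<open>auto simp: is_mono_def memb_def\<close>)
  qed
  then show "case x of (X, \<U>) \<Rightarrow> src E (\<iota> (X, \<U>)) = fobj B (X, \<U>) \<and>
        is_intersection E (fobj A X) {fmap A u |u. coprojection C X u \<and> sum_class C X u \<in> \<U>} (\<iota> (X, \<U>))"
    using i xe by simp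
next
  fix x y u f assume x: "x \<in> Obj (UF C)" and y: "y \<in> Obj (UF C)" and c: "continuous_partial C x y (u, f)"
  obtain X \<U> where xe: "x = (X, \<U>)" by (cases x)
  obtain Y \<V> where ye: "y = (Y, \<V>)" by (cases y)
  show "\<exists>k\<in>hom E (fobj B x) (fobj A (src C u)). fmap A u \<bullet> k = \<iota> x \<and>
      \<iota> y \<bullet> fmap B (uf_arr C x y (u, f)) = fmap A f \<bullet> k"
    using representsD(5)[OF r, of X \<U> Y \<V> u f] x y c unfolding xe ye by simp
qed

lemma represents_integral:
  assumes r: "represents A B \<iota>"
  shows "is_integral C E B A (\<lambda>Y \<V>. \<iota> (Y, \<V>))"
  unfolding is_integral_def
  using representsD r representsD(4) represents_total by auto

theorem equivalence_FC_UF: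
  "\<exists>\<Phi> \<Psi>. equivalence (FC C E) UFE \<Phi> \<Psi> \<and>
     is_tilde_functor C E \<Phi> \<and> is_integral_functor C E \<Psi>"
proof -
  \<comment> \<open>Arrows of both functor categories are triples of source, components and target;
    \<open>M\<close> relates their components.\<close>
  define M where "M = (\<lambda>\<iota> \<iota>' (g :: ('o, 'a, 'p, 'b) nt) (h :: (('o, 'a) uf_obj, ('o, 'a) uf_arr, 'p, 'b) nt).
    compatible \<iota> \<iota>' (fst (snd g)) (fst (snd h)))"
  have FC: "category (FC C E)" by (rule category_FC[OF C.category E.category])
  have UFE: "category UFE" by (rule category_functor_cat[OF UF.category E.category])
  have "\<exists>\<Phi> \<Psi> x y. equivalence (FC C E) UFE \<Phi> \<Psi> \<and>
    (\<forall>A\<in>Obj (FC C E). represents A (fobj \<Phi> A) (x A)) \<and>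
    (\<forall>g\<in>Arr (FC C E). M (x (src (FC C E) g)) (x (tgt (FC C E) g)) g (fmap \<Phi> g)) \<and>
    (\<forall>B\<in>Obj UFE. represents (fobj \<Psi> B) B (y B)) \<and>
    (\<forall>h\<in>Arr UFE. M (y (src UFE h)) (y (tgt UFE h)) (fmap \<Psi> h) h)"
  \<comment> \<open>Surjectivity on objects is \<open>tilde_exists\<close> and
    \<open>integral_exists\<close>; full faithfulness is \<open>compatible_sigma\<close> and
    \<open>compatible_alpha\<close>.\<close>
  proof (rule span_equivalence[OF FC UFE, of represents M])
    show "\<exists>B \<iota>. represents A B \<iota>" if "A \<in> Obj (FC C E)" for A
      using that tilde_exists unfolding FC_simps by blast
    show "\<exists>A \<iota>. represents A B \<iota>" if "B \<in> Obj UFE" for B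
      using that integral_exists unfolding UFE_simps by blast
    show "A \<in> Obj (FC C E)" if "represents A B \<iota>" for A B \<iota> using representsD(1)[OF that] FC_simps by blast
    show "B \<in> Obj UFE" if "represents A B \<iota>" for A B \<iota>
      using representsD(3)[OF that] UFE_simps by blast
    show "\<exists>!h. h \<in> hom UFE B B' \<and> M \<iota> \<iota>' g h"
      if r: "represents A B \<iota>" "represents A' B' \<iota>'" and g: "g \<in> hom (FC C E) A A'" for A B \<iota> A' B' \<iota>' g
    proof -
      obtain \<alpha> where ge: "g = (A, \<alpha>, A')" and \<alpha>: "nat_trans C E A A' \<alpha>" using g unfolding FC_simps by blast
      obtain \<sigma> where \<sigma>: "nat_trans (UF C) E B B' \<sigma>" "compatible \<iota> \<iota>' \<alpha> \<sigma>"
        "\<And>\<tau>. nat_trans (UF C) E B B' \<tau> \<Longrightarrow> compatible \<iota> \<iota>' \<alpha> \<tau> \<Longrightarrow> \<tau> = \<sigma>"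
        using compatible_sigma[OF r \<alpha>] by blast
      show ?thesis
        unfolding UFE_simps M_def
      proof (rule ex1I[of _ "(B, \<sigma>, B')"], goal_cases)
        case 1
        then show ?case using \<sigma>(1,2) representsD(3)[OF r(1)] representsD(3)[OF r(2)] by (simp add: ge)
      next
        case (2 h)
        then obtain \<tau> where \<tau>: "h = (B, \<tau>, B')" "nat_trans (UF C) E B B' \<tau>" by blast
        have "compatible \<iota> \<iota>' \<alpha> \<tau>" using 2 by (simp add: ge \<tau>(1))
        then show ?case using \<sigma>(3)[OF \<tau>(2)] \<tau>(1) by simp
      qed
    qed
    show "\<exists>!g. g \<in> hom (FC C E) A A' \<and> M \<iota> \<iota>' g h"
      if r: "represents A B \<iota>" "represents A' B' \<iota>'" and h: "h \<in> hom UFE B B'" for A B \<iota> A' B' \<iota>' h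
    proof -
      obtain \<sigma> where he: "h = (B, \<sigma>, B')" and \<sigma>: "nat_trans (UF C) E B B' \<sigma>" using h unfolding UFE_simps by blast
      obtain \<alpha> where \<alpha>: "nat_trans C E A A' \<alpha>" "compatible \<iota> \<iota>' \<alpha> \<sigma>"
        "\<And>\<beta>. nat_trans C E A A' \<beta> \<Longrightarrow> compatible \<iota> \<iota>' \<beta> \<sigma> \<Longrightarrow> \<beta> = \<alpha>"
        using compatible_alpha[OF r \<sigma>] by blast
      show ?thesis
        unfolding FC_simps M_def
      proof (rule ex1I[of _ "(A, \<alpha>, A')"], goal_cases)
        case 1
        then show ?case using \<alpha>(1,2) representsD(1)[OF r(1)] representsD(1)[OF r(2)] by (simp add: he)
      next
        case (2 g)
        then obtain \<beta> where \<beta>: "g = (A, \<beta>, A')" "nat_trans C E A A' \<beta>" by blast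
        have "compatible \<iota> \<iota>' \<beta> \<sigma>" using 2 by (simp add: he \<beta>(1))
        then show ?case using \<alpha>(3)[OF \<beta>(2)] \<beta>(1) by simp
      qed
    qed
    show "M \<iota> \<iota> (ident (FC C E) A) (ident UFE B)" if r: "represents A B \<iota>" for A B \<iota>
      unfolding FC_simps UFE_simps M_def compatible_def
      using represents_incl[OF r] by simp
    show "M \<iota> \<iota>'' (g' \<cdot>\<^bsub>FC C E\<^esub> g) (h' \<cdot>\<^bsub>UFE\<^esub> h)"
      if r: "represents A B \<iota>" and r': "represents A' B' \<iota>'" and r'': "represents A'' B'' \<iota>''"
        and g: "g \<in> hom (FC C E) A A'" "g' \<in> hom (FC C E) A' A''"
        and h: "h \<in> hom UFE B B'" "h' \<in> hom UFE B' B''"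
        and M: "M \<iota> \<iota>' g h" "M \<iota>' \<iota>'' g' h'" for A B \<iota> A' B' \<iota>' A'' B'' \<iota>'' g h g' h'
    proof -
      obtain \<alpha> where ge: "g = (A, \<alpha>, A')" and \<alpha>: "nat_trans C E A A' \<alpha>" using g unfolding FC_simps by blast
      obtain \<alpha>' where ge': "g' = (A', \<alpha>', A'')" and \<alpha>': "nat_trans C E A' A'' \<alpha>'" using g unfolding FC_simps by blast
      obtain \<sigma> where he: "h = (B, \<sigma>, B')" and \<sigma>: "nat_trans (UF C) E B B' \<sigma>" using h unfolding UFE_simps by blast
      obtain \<sigma>' where he': "h' = (B', \<sigma>', B'')" and \<sigma>': "nat_trans (UF C) E B' B'' \<sigma>'" using h unfolding UFE_simps by blast
      have "\<iota>'' (X, \<U>) \<bullet> (\<sigma>' (X, \<U>) \<bullet> \<sigma> (X, \<U>)) = (\<alpha>' X \<bullet> \<alpha> X) \<bullet> \<iota> (X, \<U>)"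
        if X: "X \<in> Obj C" and U: "\<U> \<in> beta C X" for X \<U>
      proof -
        have x: "(X, \<U>) \<in> Obj (UF C)" using X U by simp
        note a = nat_transD(1-3)[OF C.category E.category \<alpha> X] nat_transD(1-3)[OF C.category E.category \<alpha>' X]
        note s = nat_transD(1-3)[OF UF.category E.category \<sigma> x] nat_transD(1-3)[OF UF.category E.category \<sigma>' x]
        note i = represents_incl[OF r X U] represents_incl[OF r' X U] represents_incl[OF r'' X U]
        have m: "\<iota>' (X, \<U>) \<bullet> \<sigma> (X, \<U>) = \<alpha> X \<bullet> \<iota> (X, \<U>)"
          "\<iota>'' (X, \<U>) \<bullet> \<sigma>' (X, \<U>) = \<alpha>' X \<bullet> \<iota>' (X, \<U>)"
          using M X U unfolding M_def compatible_def ge ge' he he' by simp_all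
        have "\<iota>'' (X, \<U>) \<bullet> (\<sigma>' (X, \<U>) \<bullet> \<sigma> (X, \<U>)) = (\<alpha>' X \<bullet> \<iota>' (X, \<U>)) \<bullet> \<sigma> (X, \<U>)"
          by (rule E.ext2[OF m(2)]) (use i s in simp_all)
        also have "\<dots> = \<alpha>' X \<bullet> (\<alpha> X \<bullet> \<iota> (X, \<U>))" using a i s m(1) by simp
        also have "\<dots> = (\<alpha>' X \<bullet> \<alpha> X) \<bullet> \<iota> (X, \<U>)" using a i by simp
        finally show ?thesis .
      qed
      then show ?thesis unfolding ge ge' he he' FC_simps UFE_simps M_def compatible_def by simp
    qed
  qed
  then obtain \<Phi> \<Psi> x y where eqv: "equivalence (FC C E) UFE \<Phi> \<Psi>"
    and x: "\<forall>A\<in>Obj (FC C E). represents A (fobj \<Phi> A) (x A)"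
    and xM: "\<forall>g\<in>Arr (FC C E). M (x (src (FC C E) g)) (x (tgt (FC C E) g)) g (fmap \<Phi> g)"
    and y: "\<forall>B\<in>Obj UFE. represents (fobj \<Psi> B) B (y B)"
    and yM: "\<forall>h\<in>Arr UFE. M (y (src UFE h))
      (y (tgt UFE h)) (fmap \<Psi> h) h"
    by blast
  have ftr: "is_functor (FC C E) UFE \<Phi>" "is_functor UFE (FC C E) \<Psi>"
    using eqv unfolding equivalence_def by auto
  have "is_tilde_functor C E \<Phi>"
    unfolding is_tilde_functor_def
  \<comment> \<open>The witnesses of the span over functors on \<open>C\<close> are the inclusions
    of the intersections, and \<open>M\<close> is the required compatibility on arrows.\<close>
  proof (intro conjI exI[of _ x] ballI allI impI)
    show "is_functor (FC C E) UFE \<Phi>" by (rule ftr)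
    show "is_tilde C E A (fobj \<Phi> A) (x A)" if "A \<in> Obj (FC C E)" for A using x that represents_tilde by blast
    fix A A' \<alpha> \<sigma> z assume g: "(A, \<alpha>, A') \<in> Arr (FC C E) \<and> fmap \<Phi> (A, \<alpha>, A') = (fobj \<Phi> A, \<sigma>, fobj \<Phi> A')"
      and z: "z \<in> Obj (UF C)"
    have "compatible (x A) (x A') \<alpha> \<sigma>"
      using xM[rule_format, of "(A, \<alpha>, A')"] g unfolding M_def FC_simps(4,5) by simp
    then show "case z of (X, \<U>) \<Rightarrow> x A' (X, \<U>) \<bullet> \<sigma> (X, \<U>) = \<alpha> X \<bullet> x A (X, \<U>)"
      using z unfolding compatible_def by (cases z) simp
  qed
  moreover have "is_integral_functor C E \<Psi>"
    unfolding is_integral_functor_def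
  \<comment> \<open>The witnesses over functors on \<open>UF C\<close> are read as coprojections of
    the sums.\<close>
  proof (intro conjI exI[of _ "\<lambda>B Y \<V>. y B (Y, \<V>)"] ballI allI impI)
    show "is_functor UFE (FC C E) \<Psi>" by (rule ftr)
    show "is_integral C E B (fobj \<Psi> B) (\<lambda>Y \<V>. y B (Y, \<V>))" if "B \<in> Obj UFE" for B
      using y that represents_integral by blast
    fix B B' \<beta> \<sigma> Y \<V> assume h: "(B, \<beta>, B') \<in> Arr UFE \<and> fmap \<Psi> (B, \<beta>, B') = (fobj \<Psi> B, \<sigma>, fobj \<Psi> B')"
      and Y: "Y \<in> Obj C" "\<V> \<in> beta C Y"
    have "compatible (y B) (y B') \<sigma> \<beta>"
      using yM[rule_format, of "(B, \<beta>, B')"] h unfolding M_def UFE_simps(4,5) by simp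
    then show "\<sigma> Y \<bullet> y B (Y, \<V>) = y B' (Y, \<V>) \<bullet> \<beta> (Y, \<V>)" using Y unfolding compatible_def by simp
  qed
  ultimately show ?thesis using eqv by blast
qed

end

theorem theorem26:
  fixes U :: "'u itself"
    and C :: "('o, 'a) cat"
    and E :: "('p, 'b) cat"
  assumes "universe U"
    and "extensive C"
    and "\<And>X. X \<in> Obj C \<Longrightarrow> small U (summands C X)"
    and "grothendieck_topos U E"
    and "locally_connected U E"
  shows "\<exists>\<Phi> \<Psi>. equivalence (FC C E) (functor_cat (UF C) E) \<Phi> \<Psi> \<and>
           is_tilde_functor C E \<Phi> \<and> is_integral_functor C E \<Psi>"
proof -
  have "category C" using assms(2) unfolding extensive_def by blast
  moreover have "category E" using assms(4) unfolding grothendieck_topos_def by blast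
  ultimately interpret extensive_to_topos C E U
    by unfold_locales (use assms topos_stable_coproducts[OF assms(1,4)] in auto)
  show ?thesis by (rule equivalence_FC_UF)
qed

end
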